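(* The block-diagonal operator $\mathcal B=\operatorname{diag}(\mathcal B_{\boldsymbol u}^{-1},\mathcal B_{\boldsymbol v}^{-1},\mathcal B_{\boldsymbol p}^{-1})$ is a uniform norm-equivalent preconditioner for the operator $\mathcal A$, robust in all parameters: $\kappa(\mathcal B\mathcal A)=\mathcal O(1)$, i.e. there is a constant $C$ independent of the parameters $\lambda,R_i^{-1},\alpha_{p_i},\alpha_{ij}$ ($i,j=1,\dots,n$) and of the network scale $n$ such that $\kappa(\mathcal B\mathcal A)\le C$.
   Context: Domain and spaces: $\Omega\subset\mathbb R^d$, $d\in\{2,3\}$, is a bounded connected Lipschitz domain; $(\cdot,\cdot)$ is the $L^2(\Omega)$ inner product. $\boldsymbol\epsilon(\boldsymbol u)=\frac12(\nabla\boldsymbol u+(\nabla\boldsymbol u)^T)$. $n\ge1$ is an integer. $\boldsymbol U=H^1_0(\Omega)^d$; $\boldsymbol V=\boldsymbol V_1\times\dots\times\boldsymbol V_n$ with $\boldsymbol V_i=H_0(\operatorname{div},\Omega)$ (zero normal trace on $\partial\Omega$); $\boldsymbol P=P_1\times\dots\times P_n$ with $P_i=L^2_0(\Omega)$ (mean-zero $L^2$ functions); $X=\boldsymbol U\times\boldsymbol V\times\boldsymbol P$. $\operatorname{Div}\boldsymbol v=(\operatorname{div}\boldsymbol v_1,\dots,\operatorname{div}\boldsymbol v_n)^T$. Parameters: constants $\lambda>0$; $R_i^{-1}>0$, $\alpha_{p_i}\ge0$; $\alpha_{ij}=\frac{\tau\beta_{ij}}{\alpha_i\alpha_j}\ge0$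 ($i,j=1,\dots,n$) with $\tau>0$, $\alpha_i>0$, $\beta_{ij}=\beta_{ji}\ge0$ for $i\ne j$, $\beta_{ii}=\sum_{j\ne i}\beta_{ij}$; $R^{-1}=\max_iR_i^{-1}$, $\lambda_0=\max\{1,\lambda\}$. Matrices ($n\times n$): $\Lambda_1$ has diagonal entries $\alpha_{ii}$ and off-diagonal entries $-\alpha_{ij}$; $\Lambda_2=\operatorname{diag}(\alpha_{p_1},\dots,\alpha_{p_n})$; $\Lambda_3=R\,I$; $\Lambda_4$ has all entries $1/\lambda_0$; $\Lambda=\sum_{k=1}^4\Lambda_k=(\gamma_{ij})$, $\Lambda^{-1}=(\tilde\gamma_{ij})$. Operators: $\mathcal A:X\to X^*$ is the operator induced by the bilinear form $$\begin{aligned}\mathcal A((\boldsymbol u;\boldsymbol v;\boldsymbol p),(\boldsymbol w;\boldsymbol z;\boldsymbol q))=&(\boldsymbol\epsilon(\boldsymbol u),\boldsymbol\epsilon(\boldsymbol w))+\lambda(\operatorname{div}\boldsymbol u,\operatorname{div}\boldsymbol w)-\Big(\sum_ip_i,\operatorname{div}\boldsymbol w\Big)+\sum_i(R_i^{-1}\boldsymbol v_i,\boldsymbol z_i)-(\boldsymbol p,\operatorname{Div}\boldsymbol z)\\&-\Big(\operatorname{div}\boldsymbol u,\sum_iq_i\Big)-(\operatorname{Div}\boldsymbol v,\boldsymbol q)-((\Lambda_1+\Lambda_2)\boldsymbol p,\boldsymbol q).\end{aligned}$$ $\mathcal B_{\boldsymbol u}=-\operatorname{div}\boldsymbol\epsilon-\lambda\nabla\operatorname{div}:\boldsymbol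 U\to\boldsymbol U^*$; $\mathcal B_{\boldsymbol v}:\boldsymbol V\to\boldsymbol V^*$ is the $n\times n$ block operator $\operatorname{diag}(R_1^{-1}I,\dots,R_n^{-1}I)-(\tilde\gamma_{ij}\nabla\operatorname{div})_{i,j=1}^n$; $\mathcal B_{\boldsymbol p}=(\gamma_{ij}I)_{i,j=1}^n:\boldsymbol P\to\boldsymbol P^*$ (all understood weakly, i.e. $\langle\mathcal B_{\boldsymbol u}\boldsymbol u,\boldsymbol w\rangle=(\boldsymbol\epsilon(\boldsymbol u),\boldsymbol\epsilon(\boldsymbol w))+\lambda(\operatorname{div}\boldsymbol u,\operatorname{div}\boldsymbol w)$, $\langle\mathcal B_{\boldsymbol v}\boldsymbol v,\boldsymbol z\rangle=\sum_i(R_i^{-1}\boldsymbol v_i,\boldsymbol z_i)+(\Lambda^{-1}\operatorname{Div}\boldsymbol v,\operatorname{Div}\boldsymbol z)$, $\langle\mathcal B_{\boldsymbol p}\boldsymbol p,\boldsymbol q\rangle=(\Lambda\boldsymbol p,\boldsymbol q)$). Condition number: $\kappa(\mathcal B\mathcal A)=\|\mathcal B\mathcal A\|_{\mathcal L(X,X)}\,\|(\mathcal B\mathcal A)^{-1}\|_{\mathcal L(X,X)}$, where $X$ carries the norm given by $\|x\|_X^2=\langle\mathcal B^{-1}x,x\rangle$. *)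

theory Defs
  imports
    "HOL-Analysis.Analysis"
    "HOL-Library.Function_Algebras"
    "Jordan_Normal_Form.Gauss_Jordan_Elimination"
begin

no_notation vec_index (infixl \<open>$\<close> 100)

section \<open>The space of square integrable functions modulo equality almost everywhere\<close>

definition square_integrable :: "('a::euclidean_space \<Rightarrow> real) \<Rightarrow> bool" where
  "square_integrable f \<longleftrightarrow> f \<in> borel_measurable lborel \<and> integrable lborel (\<lambda>x. (f x)\<^sup>2)"

lemma square_integrable_mult:
  assumes "square_integrable f" "square_integrable g"
  shows "integrable lborel (\<lambda>x. f x * g x)"
proof (rule Bochner_Integration.integrable_bound)
  show "integrable lborel (\<lambda>x. (f x)\<^sup>2 + (g x)\<^sup>2)"
    using assms by (auto simp: square_integrable_def)
  show "(\<lambda>x. f x * g x) \<in> borel_measurable lborel"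
    using assms by (auto simp: square_integrable_def)
  show "AE x in lborel. norm (f x * g x) \<le> norm ((f x)\<^sup>2 + (g x)\<^sup>2)"
  proof (rule AE_I2)
    fix x
    have "0 \<le> (\<bar>f x\<bar> - \<bar>g x\<bar>)\<^sup>2" by simp
    then have "2 * (\<bar>f x\<bar> * \<bar>g x\<bar>) \<le> (f x)\<^sup>2 + (g x)\<^sup>2"
      by (simp add: power2_diff)
    moreover have "0 \<le> \<bar>f x\<bar> * \<bar>g x\<bar>" by simp
    ultimately have "\<bar>f x\<bar> * \<bar>g x\<bar> \<le> (f x)\<^sup>2 + (g x)\<^sup>2" by linarith
    then show "norm (f x * g x) \<le> norm ((f x)\<^sup>2 + (g x)\<^sup>2)"
      by (simp add: abs_mult)
  qed
qed

lemma square_integrable_zero: "square_integrable (\<lambda>x. 0)"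
  by (simp add: square_integrable_def)

lemma square_integrable_add:
  assumes "square_integrable f" "square_integrable g"
  shows "square_integrable (\<lambda>x. f x + g x)"
proof -
  have "integrable lborel (\<lambda>x. (f x)\<^sup>2 + (g x)\<^sup>2 + 2 * (f x * g x))"
    using assms square_integrable_mult[OF assms] by (auto simp: square_integrable_def)
  then show ?thesis
    using assms by (auto simp: square_integrable_def power2_sum mult.assoc)
qed

lemma square_integrable_scale:
  assumes "square_integrable f"
  shows "square_integrable (\<lambda>x. c * f x)"
  using assms by (auto simp: square_integrable_def power_mult_distrib)

lemma square_integrable_minus:
  assumes "square_integrable f"
  shows "square_integrable (\<lambda>x. - f x)"
  using square_integrable_scale[OF assms, of "-1"] by simp

lemma square_integrable_diff:
  assumes "square_integrable f" "square_integrable g"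
  shows "square_integrable (\<lambda>x. f x - g x)"
  using square_integrable_add[OF assms(1) square_integrable_minus[OF assms(2)]] by simp

definition L2_rel :: "('a::euclidean_space \<Rightarrow> real) \<Rightarrow> ('a \<Rightarrow> real) \<Rightarrow> bool" where
  "L2_rel f g \<longleftrightarrow> square_integrable f \<and> square_integrable g \<and> (AE x in lborel. f x = g x)"

quotient_type (overloaded) 'a L2 = "'a::euclidean_space \<Rightarrow> real" / partial: L2_rel
  morphisms rep_L2 L2_class
proof (rule part_equivpI)
  show "\<exists>f. L2_rel f f"
    by (rule exI[of _ "\<lambda>x. 0"]) (simp add: L2_rel_def square_integrable_zero)
  show "symp L2_rel"
    by (auto intro!: sympI simp: L2_rel_def)
  show "transp L2_rel"
    by (rule transpI) (auto simp: L2_rel_def elim: AE_mp)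
qed

instantiation L2 :: (euclidean_space) real_inner
begin

lift_definition zero_L2 :: "'a L2" is "\<lambda>x. 0"
  by (simp add: L2_rel_def square_integrable_zero)

lift_definition plus_L2 :: "'a L2 \<Rightarrow> 'a L2 \<Rightarrow> 'a L2" is "\<lambda>f g x. f x + g x"
  by (auto simp: L2_rel_def square_integrable_add elim: AE_mp)

lift_definition minus_L2 :: "'a L2 \<Rightarrow> 'a L2 \<Rightarrow> 'a L2" is "\<lambda>f g x. f x - g x"
  by (auto simp: L2_rel_def square_integrable_diff elim: AE_mp)

lift_definition uminus_L2 :: "'a L2 \<Rightarrow> 'a L2" is "\<lambda>f x. - f x"
  by (auto simp: L2_rel_def square_integrable_minus elim: AE_mp)

lift_definition scaleR_L2 :: "real \<Rightarrow> 'a L2 \<Rightarrow> 'a L2" is "\<lambda>c f x. c * f x"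
  by (auto simp: L2_rel_def square_integrable_scale elim: AE_mp)

lift_definition inner_L2 :: "'a L2 \<Rightarrow> 'a L2 \<Rightarrow> real" is "\<lambda>f g. \<integral>x. f x * g x \<partial>lborel"
proof -
  fix f f' g g' :: "'a \<Rightarrow> real"
  assume "L2_rel f f'" "L2_rel g g'"
  then show "(\<integral>x. f x * g x \<partial>lborel) = (\<integral>x. f' x * g' x \<partial>lborel)"
    by (intro integral_cong_AE) (auto simp: L2_rel_def square_integrable_def elim: AE_mp)
qed

definition norm_L2 :: "'a L2 \<Rightarrow> real" where
  "norm_L2 f = sqrt (inner f f)"

definition dist_L2 :: "'a L2 \<Rightarrow> 'a L2 \<Rightarrow> real" where
  "dist_L2 f g = norm (f - g)"

definition sgn_L2 :: "'a L2 \<Rightarrow> 'a L2" where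
  "sgn_L2 f = inverse (norm f) *\<^sub>R f"

definition uniformity_L2 :: "('a L2 \<times> 'a L2) filter" where
  "uniformity_L2 = (INF e\<in>{0<..}. principal {(x, y). dist x y < e})"

definition open_L2 :: "'a L2 set \<Rightarrow> bool" where
  "open_L2 U \<longleftrightarrow> (\<forall>x\<in>U. eventually (\<lambda>(x', y). x' = x \<longrightarrow> y \<in> U) uniformity)"

instance
proof
  fix a b :: real and f g h :: "'a L2" and U :: "'a L2 set"
  show "f + g + h = f + (g + h)"
    by transfer (auto simp: L2_rel_def square_integrable_add add.assoc)
  show "f + g = g + f"
    by transfer (auto simp: L2_rel_def square_integrable_add add.commute)
  show "0 + f = f"
    by transfer (auto simp: L2_rel_def)
  show "- f + f = 0"
    by transfer (auto simp: L2_rel_def square_integrable_zero)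
  show "f - g = f + - g"
    by transfer (auto simp: L2_rel_def square_integrable_diff)
  show "a *\<^sub>R (f + g) = a *\<^sub>R f + a *\<^sub>R g"
    by transfer (auto simp: L2_rel_def distrib_left
        intro!: square_integrable_add square_integrable_scale)
  show "(a + b) *\<^sub>R f = a *\<^sub>R f + b *\<^sub>R f"
    by transfer (auto simp: L2_rel_def distrib_right
        intro!: square_integrable_add square_integrable_scale)
  show "a *\<^sub>R b *\<^sub>R f = (a * b) *\<^sub>R f"
    by transfer (auto simp: L2_rel_def mult.assoc dest: square_integrable_scale)
  show "1 *\<^sub>R f = f"
    by transfer (auto simp: L2_rel_def)
  show "sgn f = inverse (norm f) *\<^sub>R f"
    by (simp add: sgn_L2_def)
  show "dist f g = norm (f - g)"
    by (simp add: dist_L2_def)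
  show "(uniformity :: ('a L2 \<times> 'a L2) filter) = (INF e\<in>{0<..}. principal {(x, y). dist x y < e})"
    by (rule uniformity_L2_def)
  show "open U = (\<forall>x\<in>U. \<forall>\<^sub>F (x', y) in uniformity. x' = x \<longrightarrow> y \<in> U)"
    by (rule open_L2_def)
  show "inner f g = inner g f"
    by transfer (simp add: mult.commute)
  show "inner (f + g) h = inner f h + inner g h"
    by transfer (simp add: L2_rel_def distrib_right square_integrable_mult)
  show "inner (a *\<^sub>R f) g = a * inner f g"
    by transfer (simp add: mult.assoc)
  show "0 \<le> inner f f"
    by transfer simp
  show "inner f f = 0 \<longleftrightarrow> f = 0"
  proof transfer
    fix f :: "'a \<Rightarrow> real"
    assume f: "L2_rel f f"
    then have "(\<integral>x. f x * f x \<partial>lborel) = 0 \<longleftrightarrow> (AE x in lborel. f x * f x = 0)"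
      by (intro integral_nonneg_eq_0_iff_AE square_integrable_mult) (auto simp: L2_rel_def)
    with f show "(\<integral>x. f x * f x \<partial>lborel) = 0 \<longleftrightarrow> L2_rel f (\<lambda>x. 0)"
      by (simp add: L2_rel_def square_integrable_zero)
  qed
  show "norm f = sqrt (inner f f)"
    by (rule norm_L2_def)
qed

end

text \<open>
  \<open>L2_on S\<close> is the space of square integrable functions on \<open>S\<close>, realised inside the functions on
  the whole space by extension by zero. On it, \<open>inner\<close> is the usual inner product over \<open>S\<close>.
\<close>

lift_definition vanishes_outside :: "'a::euclidean_space set \<Rightarrow> 'a L2 \<Rightarrow> bool"
  is "\<lambda>S f. AE x in lborel. x \<notin> S \<longrightarrow> f x = 0"
  by (auto simp: L2_rel_def elim: AE_mp)

lift_definition L2_integral :: "'a::euclidean_space set \<Rightarrow> 'a L2 \<Rightarrow> real"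
  is "\<lambda>S f. if S \<in> sets lborel then (LINT x:S|lborel. f x) else 0"
  by (auto simp: L2_rel_def square_integrable_def set_lebesgue_integral_def
      intro!: integral_cong_AE elim: AE_mp)

definition L2_on :: "'a::euclidean_space set \<Rightarrow> 'a L2 set" where
  "L2_on S = {f. vanishes_outside S f}"

definition L2_mean_zero :: "'a::euclidean_space set \<Rightarrow> 'a L2 set" where
  "L2_mean_zero S = {f \<in> L2_on S. L2_integral S f = 0}"

section \<open>Lipschitz domains, test functions and weak derivatives\<close>

definition lipschitz_domain :: "'a::euclidean_space set \<Rightarrow> bool" where
  "lipschitz_domain S \<longleftrightarrow> open S \<and> connected S \<and> bounded S \<and> S \<noteq> {} \<and>
     (\<forall>x\<in>frontier S. \<exists>r>0. \<exists>e \<phi> L. norm e = 1 \<and> L-lipschitz_on {y. inner y e = 0} \<phi> \<and>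
        S \<inter> ball x r = {y \<in> ball x r. \<phi> (y - inner y e *\<^sub>R e) < inner y e})"

definition partial_deriv :: "'d \<Rightarrow> (real^'d::finite \<Rightarrow> real) \<Rightarrow> real^'d \<Rightarrow> real" where
  "partial_deriv i f x = frechet_derivative f (at x) (axis i 1)"

primrec C_k :: "nat \<Rightarrow> (real^'d::finite \<Rightarrow> real) \<Rightarrow> bool" where
  "C_k 0 f \<longleftrightarrow> continuous_on UNIV f"
| "C_k (Suc k) f \<longleftrightarrow> (\<forall>x. f differentiable (at x)) \<and> (\<forall>i. C_k k (partial_deriv i f))"

definition test_functions :: "(real^'d::finite) set \<Rightarrow> (real^'d \<Rightarrow> real) set" where
  "test_functions S = {\<phi>. (\<forall>k. C_k k \<phi>) \<and> compact (closure {x. \<phi> x \<noteq> 0}) \<and>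
     closure {x. \<phi> x \<noteq> 0} \<subseteq> S}"

type_synonym 'd sfield = "(real^'d) L2"
type_synonym 'd vfield = "(real^'d) L2 ^ 'd"

definition has_weak_partial ::
  "(real^'d::finite) set \<Rightarrow> 'd \<Rightarrow> 'd sfield \<Rightarrow> 'd sfield \<Rightarrow> bool" where
  "has_weak_partial S i f g \<longleftrightarrow> g \<in> L2_on S \<and>
     (\<forall>\<phi>\<in>test_functions S.
        inner f (L2_class (partial_deriv i \<phi>)) = - inner g (L2_class \<phi>))"

definition weak_partial :: "(real^'d::finite) set \<Rightarrow> 'd \<Rightarrow> 'd sfield \<Rightarrow> 'd sfield" where
  "weak_partial S i f = (THE g. has_weak_partial S i f g)"

definition weak_grad :: "(real^'d::finite) set \<Rightarrow> 'd sfield \<Rightarrow> 'd vfield" where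
  "weak_grad S f = (\<chi> i. weak_partial S i f)"

definition has_weak_div ::
  "(real^'d::finite) set \<Rightarrow> 'd vfield \<Rightarrow> 'd sfield \<Rightarrow> bool" where
  "has_weak_div S v g \<longleftrightarrow> g \<in> L2_on S \<and>
     (\<forall>\<phi>\<in>test_functions S.
        inner v (\<chi> i. L2_class (partial_deriv i \<phi>)) = - inner g (L2_class \<phi>))"

definition weak_div :: "(real^'d::finite) set \<Rightarrow> 'd vfield \<Rightarrow> 'd sfield" where
  "weak_div S v = (THE g. has_weak_div S v g)"

text \<open>Symmetric gradient; \<open>inner\<close> of two such matrix fields is the integrated Frobenius product.\<close>

definition sym_grad :: "(real^'d::finite) set \<Rightarrow> 'd vfield \<Rightarrow> (real^'d) L2 ^ 'd ^ 'd" where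
  "sym_grad S u = (\<chi> i j. (1/2) *\<^sub>R (weak_partial S j (u $ i) + weak_partial S i (u $ j)))"

section \<open>The function spaces\<close>

definition H1 :: "(real^'d::finite) set \<Rightarrow> 'd sfield set" where
  "H1 S = {f \<in> L2_on S. \<forall>i. \<exists>g. has_weak_partial S i f g}"

definition H1_norm :: "(real^'d::finite) set \<Rightarrow> 'd sfield \<Rightarrow> real" where
  "H1_norm S f = sqrt ((norm f)\<^sup>2 + (norm (weak_grad S f))\<^sup>2)"

definition H1_0 :: "(real^'d::finite) set \<Rightarrow> 'd sfield set" where
  "H1_0 S = {f \<in> H1 S. \<forall>e>0. \<exists>\<phi>\<in>test_functions S. H1_norm S (f - L2_class \<phi>) < e}"

definition Hdiv :: "(real^'d::finite) set \<Rightarrow> 'd vfield set" where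
  "Hdiv S = {v. (\<forall>i. v $ i \<in> L2_on S) \<and> (\<exists>g. has_weak_div S v g)}"

text \<open>The normal trace of a field in \<open>Hdiv S\<close>, as a functional on \<open>H1 S\<close> (Green's formula).\<close>

definition normal_trace :: "(real^'d::finite) set \<Rightarrow> 'd vfield \<Rightarrow> 'd sfield \<Rightarrow> real" where
  "normal_trace S v q = inner v (weak_grad S q) + inner (weak_div S v) q"

definition Hdiv_0 :: "(real^'d::finite) set \<Rightarrow> 'd vfield set" where
  "Hdiv_0 S = {v \<in> Hdiv S. \<forall>q\<in>H1 S. normal_trace S v q = 0}"

instantiation "fun" :: (type, real_vector) real_vector
begin

definition scaleR_fun :: "real \<Rightarrow> ('a \<Rightarrow> 'b) \<Rightarrow> 'a \<Rightarrow> 'b" where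
  "scaleR_fun c f = (\<lambda>x. c *\<^sub>R f x)"

instance
  by standard (auto simp: scaleR_fun_def fun_eq_iff scaleR_add_right scaleR_add_left)

end

text \<open>Network components are indexed by \<open>0, \<dots>, n - 1\<close>; tuples are zero beyond that range.\<close>

type_synonym 'd xspace = "'d vfield \<times> (nat \<Rightarrow> 'd vfield) \<times> (nat \<Rightarrow> 'd sfield)"

definition U_space :: "(real^'d::finite) set \<Rightarrow> 'd vfield set" where
  "U_space S = {u. \<forall>i. u $ i \<in> H1_0 S}"

definition V_space :: "(real^'d::finite) set \<Rightarrow> nat \<Rightarrow> (nat \<Rightarrow> 'd vfield) set" where
  "V_space S n = {v. (\<forall>i<n. v i \<in> Hdiv_0 S) \<and> (\<forall>i\<ge>n. v i = 0)}"

definition P_space :: "(real^'d::finite) set \<Rightarrow> nat \<Rightarrow> (nat \<Rightarrow> 'd sfield) set" where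
  "P_space S n = {p. (\<forall>i<n. p i \<in> L2_mean_zero S) \<and> (\<forall>i\<ge>n. p i = 0)}"

definition X_space :: "(real^'d::finite) set \<Rightarrow> nat \<Rightarrow> 'd xspace set" where
  "X_space S n = U_space S \<times> V_space S n \<times> P_space S n"

definition U_norm :: "(real^'d::finite) set \<Rightarrow> 'd vfield \<Rightarrow> real" where
  "U_norm S u = sqrt (\<Sum>i\<in>UNIV. (H1_norm S (u $ i))\<^sup>2)"

definition V_norm :: "(real^'d::finite) set \<Rightarrow> nat \<Rightarrow> (nat \<Rightarrow> 'd vfield) \<Rightarrow> real" where
  "V_norm S n v = sqrt (\<Sum>i<n. (norm (v i))\<^sup>2 + (norm (weak_div S (v i)))\<^sup>2)"

definition P_norm :: "nat \<Rightarrow> (nat \<Rightarrow> 'd::finite sfield) \<Rightarrow> real" where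
  "P_norm n p = sqrt (\<Sum>i<n. (norm (p i))\<^sup>2)"

definition X_norm :: "(real^'d::finite) set \<Rightarrow> nat \<Rightarrow> 'd xspace \<Rightarrow> real" where
  "X_norm S n = (\<lambda>(u, v, p). sqrt ((U_norm S u)\<^sup>2 + (V_norm S n v)\<^sup>2 + (P_norm n p)\<^sup>2))"

text \<open>
  Topological dual of the subspace \<open>D\<close> with norm \<open>N\<close>. Functionals are extensional on \<open>D\<close>, so that
  equality in the dual is equality of functions.
\<close>

definition dual_space :: "'a::real_vector set \<Rightarrow> ('a \<Rightarrow> real) \<Rightarrow> ('a \<Rightarrow> real) set" where
  "dual_space D N = {F \<in> extensional D.
     (\<forall>x\<in>D. \<forall>y\<in>D. F (x + y) = F x + F y) \<and>
     (\<forall>c. \<forall>x\<in>D. F (c *\<^sub>R x) = c * F x) \<and>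
     (\<exists>K. \<forall>x\<in>D. \<bar>F x\<bar> \<le> K * N x)}"

abbreviation "U_dual S \<equiv> dual_space (U_space S) (U_norm S)"
abbreviation "V_dual S n \<equiv> dual_space (V_space S n) (V_norm S n)"
abbreviation "P_dual S n \<equiv> dual_space (P_space S n) (P_norm n)"
abbreviation "X_dual S n \<equiv> dual_space (X_space S n) (X_norm S n)"

section \<open>The parameter matrices\<close>

text \<open>
  \<open>Rinv\<close>, \<open>ap\<close> and \<open>a\<close> stand for the parameters $R_i^{-1}$, $\alpha_{p_i}$ and $\alpha_{ij}$, and
  \<open>l\<close> for $\lambda$.
\<close>

definition Lambda1 :: "nat \<Rightarrow> (nat \<Rightarrow> nat \<Rightarrow> real) \<Rightarrow> real mat" where
  "Lambda1 n a = mat n n (\<lambda>(i, j). if i = j then a i i else - a i j)"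

definition Lambda2 :: "nat \<Rightarrow> (nat \<Rightarrow> real) \<Rightarrow> real mat" where
  "Lambda2 n ap = mat n n (\<lambda>(i, j). if i = j then ap i else 0)"

definition R_const :: "nat \<Rightarrow> (nat \<Rightarrow> real) \<Rightarrow> real" where
  "R_const n Rinv = 1 / Max (Rinv ` {..<n})"

definition Lambda3 :: "nat \<Rightarrow> (nat \<Rightarrow> real) \<Rightarrow> real mat" where
  "Lambda3 n Rinv = R_const n Rinv \<cdot>\<^sub>m 1\<^sub>m n"

definition Lambda4 :: "nat \<Rightarrow> real \<Rightarrow> real mat" where
  "Lambda4 n l = mat n n (\<lambda>(i, j). 1 / max 1 l)"

definition Lambda ::
  "nat \<Rightarrow> real \<Rightarrow> (nat \<Rightarrow> real) \<Rightarrow> (nat \<Rightarrow> real) \<Rightarrow> (nat \<Rightarrow> nat \<Rightarrow> real) \<Rightarrow> real mat" where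
  "Lambda n l Rinv ap a = Lambda1 n a + Lambda2 n ap + Lambda3 n Rinv + Lambda4 n l"

definition Lambda_inv ::
  "nat \<Rightarrow> real \<Rightarrow> (nat \<Rightarrow> real) \<Rightarrow> (nat \<Rightarrow> real) \<Rightarrow> (nat \<Rightarrow> nat \<Rightarrow> real) \<Rightarrow> real mat" where
  "Lambda_inv n l Rinv ap a = the (mat_inverse (Lambda n l Rinv ap a))"

text \<open>\<open>mat_form n M p q\<close> is $(M p, q)$ for tuples of scalar fields.\<close>

definition mat_form ::
  "nat \<Rightarrow> real mat \<Rightarrow> (nat \<Rightarrow> 'd::finite sfield) \<Rightarrow> (nat \<Rightarrow> 'd sfield) \<Rightarrow> real" where
  "mat_form n M p q = (\<Sum>i<n. inner (\<Sum>j<n. (M $$ (i, j)) *\<^sub>R p j) (q i))"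

section \<open>The operators\<close>

definition A_form ::
  "(real^'d::finite) set \<Rightarrow> nat \<Rightarrow> real \<Rightarrow> (nat \<Rightarrow> real) \<Rightarrow> (nat \<Rightarrow> real) \<Rightarrow> (nat \<Rightarrow> nat \<Rightarrow> real)
    \<Rightarrow> 'd xspace \<Rightarrow> 'd xspace \<Rightarrow> real" where
  "A_form S n l Rinv ap a = (\<lambda>(u, v, p) (w, z, q).
     inner (sym_grad S u) (sym_grad S w) + l * inner (weak_div S u) (weak_div S w)
     - inner (\<Sum>i<n. p i) (weak_div S w)
     + (\<Sum>i<n. Rinv i * inner (v i) (z i)) - (\<Sum>i<n. inner (p i) (weak_div S (z i)))
     - inner (weak_div S u) (\<Sum>i<n. q i) - (\<Sum>i<n. inner (weak_div S (v i)) (q i))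
     - mat_form n (Lambda1 n a + Lambda2 n ap) p q)"

definition A_op ::
  "(real^'d::finite) set \<Rightarrow> nat \<Rightarrow> real \<Rightarrow> (nat \<Rightarrow> real) \<Rightarrow> (nat \<Rightarrow> real) \<Rightarrow> (nat \<Rightarrow> nat \<Rightarrow> real)
    \<Rightarrow> 'd xspace \<Rightarrow> 'd xspace \<Rightarrow> real" where
  "A_op S n l Rinv ap a x = (\<lambda>y\<in>X_space S n. A_form S n l Rinv ap a x y)"

definition B_u :: "(real^'d::finite) set \<Rightarrow> real \<Rightarrow> 'd vfield \<Rightarrow> 'd vfield \<Rightarrow> real" where
  "B_u S l u = (\<lambda>w\<in>U_space S.
     inner (sym_grad S u) (sym_grad S w) + l * inner (weak_div S u) (weak_div S w))"

definition B_v ::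
  "(real^'d::finite) set \<Rightarrow> nat \<Rightarrow> real \<Rightarrow> (nat \<Rightarrow> real) \<Rightarrow> (nat \<Rightarrow> real) \<Rightarrow> (nat \<Rightarrow> nat \<Rightarrow> real)
    \<Rightarrow> (nat \<Rightarrow> 'd vfield) \<Rightarrow> (nat \<Rightarrow> 'd vfield) \<Rightarrow> real" where
  "B_v S n l Rinv ap a v = (\<lambda>z\<in>V_space S n.
     (\<Sum>i<n. Rinv i * inner (v i) (z i)) +
     mat_form n (Lambda_inv n l Rinv ap a) (\<lambda>i. weak_div S (v i)) (\<lambda>i. weak_div S (z i)))"

definition B_p ::
  "(real^'d::finite) set \<Rightarrow> nat \<Rightarrow> real \<Rightarrow> (nat \<Rightarrow> real) \<Rightarrow> (nat \<Rightarrow> real) \<Rightarrow> (nat \<Rightarrow> nat \<Rightarrow> real)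
    \<Rightarrow> (nat \<Rightarrow> 'd sfield) \<Rightarrow> (nat \<Rightarrow> 'd sfield) \<Rightarrow> real" where
  "B_p S n l Rinv ap a p = (\<lambda>q\<in>P_space S n. mat_form n (Lambda n l Rinv ap a) p q)"

text \<open>
  The block-diagonal operator from the dual of \<open>X\<close> to \<open>X\<close>: a functional on the product is
  identified with the triple of its restrictions to the three factors.
\<close>

definition B_op ::
  "(real^'d::finite) set \<Rightarrow> nat \<Rightarrow> real \<Rightarrow> (nat \<Rightarrow> real) \<Rightarrow> (nat \<Rightarrow> real) \<Rightarrow> (nat \<Rightarrow> nat \<Rightarrow> real)
    \<Rightarrow> ('d xspace \<Rightarrow> real) \<Rightarrow> 'd xspace" where
  "B_op S n l Rinv ap a F =
     (inv_into (U_space S) (B_u S l) (\<lambda>w\<in>U_space S. F (w, 0, 0)),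
      inv_into (V_space S n) (B_v S n l Rinv ap a) (\<lambda>z\<in>V_space S n. F (0, z, 0)),
      inv_into (P_space S n) (B_p S n l Rinv ap a) (\<lambda>q\<in>P_space S n. F (0, 0, q)))"

definition BA_op ::
  "(real^'d::finite) set \<Rightarrow> nat \<Rightarrow> real \<Rightarrow> (nat \<Rightarrow> real) \<Rightarrow> (nat \<Rightarrow> real) \<Rightarrow> (nat \<Rightarrow> nat \<Rightarrow> real)
    \<Rightarrow> 'd xspace \<Rightarrow> 'd xspace" where
  "BA_op S n l Rinv ap a x = B_op S n l Rinv ap a (A_op S n l Rinv ap a x)"

definition B_norm ::
  "(real^'d::finite) set \<Rightarrow> nat \<Rightarrow> real \<Rightarrow> (nat \<Rightarrow> real) \<Rightarrow> (nat \<Rightarrow> real) \<Rightarrow> (nat \<Rightarrow> nat \<Rightarrow> real)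
    \<Rightarrow> 'd xspace \<Rightarrow> real" where
  "B_norm S n l Rinv ap a x = sqrt (inv_into (X_dual S n) (B_op S n l Rinv ap a) x x)"

section \<open>Condition number\<close>

text \<open>Norm of an operator on \<open>(D, N)\<close>; it is infinite for unbounded operators.\<close>

definition op_norm :: "'a set \<Rightarrow> ('a \<Rightarrow> real) \<Rightarrow> ('a \<Rightarrow> 'a) \<Rightarrow> ennreal" where
  "op_norm D N T = (SUP x\<in>D. ennreal (N (T x) / N x))"

definition condition_number :: "'a set \<Rightarrow> ('a \<Rightarrow> real) \<Rightarrow> ('a \<Rightarrow> 'a) \<Rightarrow> ennreal" where
  "condition_number D N T = op_norm D N T * op_norm D N (inv_into D T)"

end

(*
The heart of the matter is that div maps H^1_0(Omega)^d onto the mean-zero functions with a bounded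
right inverse, i.e. the Necas inequality ||p|| <= C ||grad p||_{H^-1} for mean-zero p.  For a test
function f, the difference between f and a mollification of f is the divergence of a telescoping sum
of smooth fields whose H^1 norm is bounded by ||f||: almost orthogonality of the dyadic pieces
replaces singular integrals.  Mollifying in a direction that points into the domain keeps supports
inside, so p is controlled near each boundary point by grad p and by p on a compact subset; on
compact subsets a mollification of p has a gradient bounded by that of p, and connectedness compares
the means.

Let |.|_B be the norm of the block-diagonal form.  Young's inequality gives
|A(x,x)| <= (d+4)|x|_B^2, which bounds the symmetric form A.  For the inf-sup condition test with
(delta u - w0, delta v - z0, -delta p - q0), where div w0 = (1/lambda_0) sum_i p_i, Div z0 = R p and
q0 = Lambda^{-1} Div v.  Here z0 may be taken in U^n, since U is contained in H_0(div).  Korn's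
inequality and ||div u||^2 <= d ||eps(u)||^2 make every constant depend on Omega only.  By Riesz, BA
is the symmetric operator that represents A in the inner product |.|_B, so the two bounds control BA
and its inverse.
*)

theory Submission
  imports Defs "Jordan_Normal_Form.Determinant"
begin

no_notation vec_index (infixl \<open>$\<close> 100)

section \<open>Smooth functions with compact support\<close>

text \<open>The telescoping argument dictates the shape of the mollifier. To be summed by almost
  orthogonality, every piece must be a convolution with two kernels of mean zero. Mollifying twice
  supplies two factors: under convolution a difference of squares is a difference times a sum. The
  difference is a divergence, and the derivative demanded by the H^1 norm falls on the sum, where it
  creates mean zero. The kernels whose divergence is the difference must have mean zero themselves,
  which forces the first moments of the mollifier to vanish, because a dilation multiplies them by
  q. Near the boundary the mollifier must also sit around a nonzero vector v. Only a mollifier that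
  changes sign can do both, with q so close to 1 that one dilation hardly moves the support.

  Completeness and dual spaces are insensitive to constants, so the equivalence of the block norms
  with the standard norms may degenerate with the parameters; only the bounds of A in the block norm
  may not. Hence inner products are forms on a carrier set, and several coexist on one
  space.\<close>

definition C_inf :: "(real^'d::finite \<Rightarrow> real) \<Rightarrow> bool" where
  "C_inf f \<longleftrightarrow> (\<forall>k. C_k k f)"

definition supp :: "('a::topological_space \<Rightarrow> real) \<Rightarrow> 'a set" where
  "supp f = closure {x. f x \<noteq> 0}"

lemma partial_deriv_eq: "(f has_derivative f') (at x) \<Longrightarrow> partial_deriv i f x = f' (axis i 1)"
  unfolding partial_deriv_def by (metis frechet_derivative_at)

lemma partial_deriv_add:
  "f differentiable (at x) \<Longrightarrow> g differentiable (at x) \<Longrightarrow>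
    partial_deriv i (\<lambda>x. f x + g x) x = partial_deriv i f x + partial_deriv i g x"
  unfolding differentiable_def
  by (auto simp: partial_deriv_eq partial_deriv_eq[OF has_derivative_add])

lemma partial_deriv_mult:
  "f differentiable (at x) \<Longrightarrow> g differentiable (at x) \<Longrightarrow>
    partial_deriv i (\<lambda>x. f x * g x) x = f x * partial_deriv i g x + partial_deriv i f x * g x"
  unfolding differentiable_def
  by (auto simp: partial_deriv_eq partial_deriv_eq[OF has_derivative_mult])

lemma partial_deriv_const' [simp]: "partial_deriv i (\<lambda>x. c) = (\<lambda>x. 0)"
  by (simp add: fun_eq_iff partial_deriv_eq[OF has_derivative_const])

lemma has_derivative_affine:
  fixes f :: "real^'d::finite \<Rightarrow> real"
  assumes "(f has_derivative f') (at (t + c *\<^sub>R x))"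
  shows "((\<lambda>x. f (t + c *\<^sub>R x)) has_derivative (\<lambda>h. c * f' h)) (at x)"
proof -
  have "((\<lambda>x. t + c *\<^sub>R x) has_derivative (\<lambda>h. c *\<^sub>R h)) (at x)"
    by (auto intro!: derivative_eq_intros)
  from has_derivative_compose[OF this assms]
  have "((\<lambda>x. f (t + c *\<^sub>R x)) has_derivative (\<lambda>h. f' (c *\<^sub>R h))) (at x)" .
  moreover have "f' (c *\<^sub>R h) = c * f' h" for h
    using assms has_derivative_bounded_linear linear_simps(5) by fastforce
  ultimately show ?thesis by simp
qed

lemma partial_deriv_affine:
  fixes f :: "real^'d::finite \<Rightarrow> real"
  assumes "f differentiable (at (t + c *\<^sub>R x))"
  shows "partial_deriv i (\<lambda>x. f (t + c *\<^sub>R x)) x = c * partial_deriv i f (t + c *\<^sub>R x)"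
  using assms unfolding differentiable_def
  by (auto simp: partial_deriv_eq partial_deriv_eq[OF has_derivative_affine])

lemma C_k_continuous: "C_k k f \<Longrightarrow> continuous_on UNIV f"
proof (cases k)
  case (Suc m)
  assume "C_k k f"
  then have "f differentiable_on UNIV"
    using Suc by (auto simp: differentiable_on_def)
  then show ?thesis by (rule differentiable_imp_continuous_on)
qed simp

lemma C_k_Suc_imp: "C_k (Suc k) f \<Longrightarrow> C_k k f"
proof (induction k arbitrary: f)
  case 0
  then show ?case using C_k_continuous[of "Suc 0" f] by auto
qed auto

text \<open>This fixed point form passes smoothness on to the partial derivatives without an order
  to keep track of.\<close>

lemma C_inf_unfold:
  "C_inf f \<longleftrightarrow> (\<forall>x. f differentiable (at x)) \<and> (\<forall>i. C_inf (partial_deriv i f))"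
  unfolding C_inf_def by (metis C_k.simps(2) C_k_Suc_imp)

lemma C_inf_differentiable: "C_inf f \<Longrightarrow> f differentiable (at x)"
  and C_inf_partial_deriv: "C_inf f \<Longrightarrow> C_inf (partial_deriv i f)"
  and C_inf_continuous: "C_inf f \<Longrightarrow> continuous_on S f"
  using C_inf_unfold C_inf_def C_k_continuous continuous_on_subset by blast+

lemma C_k_const: "C_k k (\<lambda>x. c)"
  by (induction k arbitrary: c) auto

lemma C_k_add: "C_k k f \<Longrightarrow> C_k k g \<Longrightarrow> C_k k (\<lambda>x. f x + g x)"
proof (induction k arbitrary: f g)
  case (Suc k)
  have "partial_deriv i (\<lambda>x. f x + g x) = (\<lambda>x. partial_deriv i f x + partial_deriv i g x)" for i
    using Suc by (auto simp: fun_eq_iff partial_deriv_add)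
  then show ?case using Suc by (auto intro: differentiable_add)
qed (auto intro: continuous_on_add)

lemma C_k_mult: "C_k k f \<Longrightarrow> C_k k g \<Longrightarrow> C_k k (\<lambda>x. f x * g x)"
proof (induction k arbitrary: f g)
  case (Suc k)
  have "partial_deriv i (\<lambda>x. f x * g x) = (\<lambda>x. f x * partial_deriv i g x + partial_deriv i f x * g x)" for i
    using Suc by (auto simp: fun_eq_iff partial_deriv_mult)
  moreover have "C_k k f" "C_k k g"
    using Suc.prems C_k_Suc_imp by blast+
  ultimately show ?case using Suc by (auto intro!: C_k_add)
qed (auto intro: continuous_on_mult)

lemma C_k_affine: "C_k k f \<Longrightarrow> C_k k (\<lambda>x. f (t + c *\<^sub>R x))"
proof (induction k arbitrary: f)
  case 0
  then show ?case by (auto intro!: continuous_intros continuous_on_compose2[of UNIV f])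
next
  case (Suc k)
  have "partial_deriv i (\<lambda>x. f (t + c *\<^sub>R x)) = (\<lambda>x. c * partial_deriv i f (t + c *\<^sub>R x))" for i
    using Suc by (auto simp: fun_eq_iff partial_deriv_affine)
  moreover have "(\<lambda>x. f (t + c *\<^sub>R x)) differentiable (at x)" for x
  proof -
    obtain f' where "(f has_derivative f') (at (t + c *\<^sub>R x))"
      using Suc.prems unfolding C_k.simps differentiable_def by blast
    then show ?thesis
      unfolding differentiable_def by (blast dest: has_derivative_affine)
  qed
  ultimately show ?case using Suc by (auto intro!: C_k_mult C_k_const)
qed

lemma C_inf_const: "C_inf (\<lambda>x. c)"
  and C_inf_add: "C_inf f \<Longrightarrow> C_inf g \<Longrightarrow> C_inf (\<lambda>x. f x + g x)"
  and C_inf_mult: "C_inf f \<Longrightarrow> C_inf g \<Longrightarrow> C_inf (\<lambda>x. f x * g x)"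
  and C_inf_affine: "C_inf f \<Longrightarrow> C_inf (\<lambda>x. f (t + c *\<^sub>R x))"
  by (auto simp: C_inf_def C_k_const C_k_add C_k_mult C_k_affine)

lemma C_inf_prod: "(\<And>i. i \<in> I \<Longrightarrow> C_inf (f i)) \<Longrightarrow> C_inf (\<lambda>x. \<Prod>i\<in>I. f i x)"
  by (induction I rule: infinite_finite_induct) (auto intro: C_inf_const C_inf_mult)

lemma has_derivative_component: "((\<lambda>x. x $ i) has_derivative (\<lambda>h. h $ i)) (at x)"
  by (rule bounded_linear_imp_has_derivative) (rule bounded_linear_vec_nth)

lemma partial_deriv_component: "partial_deriv i (\<lambda>x. x $ j) = (\<lambda>x. if i = j then 1 else 0)"
  by (auto simp: fun_eq_iff partial_deriv_eq[OF has_derivative_component] axis_def)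

lemma C_inf_component: "C_inf (\<lambda>x. x $ i)"
  by (subst C_inf_unfold)
    (use has_derivative_component in
      \<open>auto intro!: C_inf_const simp: partial_deriv_component differentiable_def\<close>)

lemma frechet_partial:
  fixes f :: "real^'d::finite \<Rightarrow> real"
  assumes "f differentiable (at x)"
  shows "(f has_derivative (\<lambda>h. \<Sum>i\<in>UNIV. h $ i * partial_deriv i f x)) (at x)"
proof -
  have d: "(f has_derivative frechet_derivative f (at x)) (at x)"
    using assms frechet_derivative_works by blast
  interpret bounded_linear "frechet_derivative f (at x)"
    using d by (rule has_derivative_bounded_linear)
  have "frechet_derivative f (at x) = (\<lambda>h. \<Sum>i\<in>UNIV. h $ i * partial_deriv i f x)"
  proof
    fix h :: "real^'d"
    have "h = (\<Sum>i\<in>UNIV. h $ i *\<^sub>R axis i 1)"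
      by (metis basis_expansion scalar_mult_eq_scaleR)
    then have "frechet_derivative f (at x) h = frechet_derivative f (at x) (\<Sum>i\<in>UNIV. h $ i *\<^sub>R axis i 1)"
      by simp
    also have "\<dots> = (\<Sum>i\<in>UNIV. h $ i * partial_deriv i f x)"
      by (simp add: sum scaleR partial_deriv_def)
    finally show "frechet_derivative f (at x) h = (\<Sum>i\<in>UNIV. h $ i * partial_deriv i f x)" .
  qed
  then show ?thesis using d by simp
qed

subsection \<open>Test functions\<close>

abbreviation tf :: "(real^'d::finite \<Rightarrow> real) set" where
  "tf \<equiv> test_functions UNIV"

lemma test_functions_iff: "f \<in> test_functions S \<longleftrightarrow> C_inf f \<and> compact (supp f) \<and> supp f \<subseteq> S"
  by (auto simp: test_functions_def C_inf_def supp_def)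

lemma tf_iff: "f \<in> tf \<longleftrightarrow> C_inf f \<and> compact (supp f)"
  by (auto simp: test_functions_iff)

lemma test_functions_mono: "f \<in> test_functions S \<Longrightarrow> S \<subseteq> T \<Longrightarrow> f \<in> test_functions T"
  by (auto simp: test_functions_iff)

lemma zero_outside_supp: "x \<notin> supp f \<Longrightarrow> f x = 0"
  using closure_subset[of "{x. f x \<noteq> 0}"] by (auto simp: supp_def)

lemma nonzero_add_supp: "f x + g x \<noteq> 0 \<Longrightarrow> x \<in> supp f \<or> x \<in> supp g"
  by (rule ccontr) (simp add: zero_outside_supp)

lemma supp_subset_closed: "closed K \<Longrightarrow> (\<And>x. f x \<noteq> 0 \<Longrightarrow> x \<in> K) \<Longrightarrow> supp f \<subseteq> K"
  unfolding supp_def by (rule closure_minimal) auto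

lemma compact_supp_I: "compact K \<Longrightarrow> (\<And>x. f x \<noteq> 0 \<Longrightarrow> x \<in> K) \<Longrightarrow> compact (supp f)"
  for f :: "'a::t2_space \<Rightarrow> real"
  by (metis closed_Int_compact compact_imp_closed inf.absorb_iff1 supp_def closed_closure supp_subset_closed)

lemma test_functionsI:
  assumes "C_inf f" "compact K" "K \<subseteq> S" "\<And>x. f x \<noteq> 0 \<Longrightarrow> x \<in> K"
  shows "f \<in> test_functions S"
  using assms compact_supp_I[of K f] supp_subset_closed[of K f] compact_imp_closed
  by (auto simp: test_functions_iff)

lemma closed_supp [simp]: "closed (supp f)" by (simp add: supp_def)

lemma partial_deriv_zero_outside:
  fixes f :: "real^'d::finite \<Rightarrow> real"
  assumes "x \<notin> supp f" shows "partial_deriv i f x = 0"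
proof -
  have "((\<lambda>x. 0) has_derivative (\<lambda>h. 0)) (at x)" by simp
  then have "(f has_derivative (\<lambda>h. 0)) (at x)"
    by (rule has_derivative_transform_within_open[where s="- supp f"])
      (use assms zero_outside_supp in \<open>auto simp: open_Compl\<close>)
  then show ?thesis by (simp add: partial_deriv_eq)
qed

lemma test_functions_partial_deriv: "f \<in> test_functions S \<Longrightarrow> partial_deriv i f \<in> test_functions S"
  by (rule test_functionsI[where K="supp f"])
    (auto simp: test_functions_iff C_inf_partial_deriv intro: ccontr dest: partial_deriv_zero_outside)

lemma test_functions_zero: "(\<lambda>x. 0) \<in> test_functions S"
  by (rule test_functionsI[where K="{}"]) (auto simp: C_inf_const)

lemma test_functions_add: "f \<in> test_functions S \<Longrightarrow> g \<in> test_functions S \<Longrightarrow> (\<lambda>x. f x + g x) \<in> test_functions S"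
  by (rule test_functionsI[where K="supp f \<union> supp g"])
    (auto simp: test_functions_iff C_inf_add intro: compact_Un dest: nonzero_add_supp)

lemma test_functions_mult: "f \<in> test_functions S \<Longrightarrow> C_inf g \<Longrightarrow> (\<lambda>x. g x * f x) \<in> test_functions S"
  by (rule test_functionsI[where K="supp f"])
    (auto simp: test_functions_iff C_inf_mult intro: ccontr dest: zero_outside_supp)

lemma test_functions_cmult: "f \<in> test_functions S \<Longrightarrow> (\<lambda>x. c * f x) \<in> test_functions S"
  by (intro test_functions_mult C_inf_const)

lemma test_functions_sum:
  "(\<And>i. i \<in> I \<Longrightarrow> f i \<in> test_functions S) \<Longrightarrow> (\<lambda>x. \<Sum>i\<in>I. f i x) \<in> test_functions S"
  by (induction I rule: infinite_finite_induct) (auto intro: test_functions_zero test_functions_add)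

lemma test_functions_affine:
  assumes "f \<in> tf" "c \<noteq> 0" shows "(\<lambda>x. f (t + c *\<^sub>R x)) \<in> tf"
proof (rule test_functionsI[where K="(\<lambda>y. (1/c) *\<^sub>R (y - t)) ` supp f"])
  show "compact ((\<lambda>y. (1 / c) *\<^sub>R (y - t)) ` supp f)"
    using assms by (intro compact_continuous_image continuous_intros) (auto simp: tf_iff)
  show "x \<in> (\<lambda>y. (1 / c) *\<^sub>R (y - t)) ` supp f" if "f (t + c *\<^sub>R x) \<noteq> 0" for x
    using that zero_outside_supp assms by (intro image_eqI[of _ _ "t + c *\<^sub>R x"]) auto
qed (use assms in \<open>auto simp: tf_iff C_inf_affine\<close>)

section \<open>Convolution\<close>

lemma lborel_integrable_affine:
  fixes f :: "'a::euclidean_space \<Rightarrow> real"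
  assumes "c \<noteq> 0" "integrable lborel f"
  shows "integrable lborel (\<lambda>x. f (t + c *\<^sub>R x))"
proof -
  have m: "f \<in> borel_measurable borel"
    using assms(2) by auto
  have "integrable (density (distr lborel borel (\<lambda>x. t + c *\<^sub>R x)) (\<lambda>_. ennreal (\<bar>c\<bar>^DIM('a)))) f"
    using assms lborel_affine[of c t] by simp
  then show ?thesis
    using assms(1) m by (simp add: integrable_density integrable_distr_eq)
qed

lemma lborel_integral_affine:
  fixes f :: "'a::euclidean_space \<Rightarrow> real"
  assumes c: "c \<noteq> 0"
  shows "(\<integral>x. f x \<partial>lborel) = \<bar>c\<bar>^DIM('a) * (\<integral>x. f (t + c *\<^sub>R x) \<partial>lborel)"
proof (cases "integrable lborel f")
  case True
  then have m: "f \<in> borel_measurable borel" by auto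
  have "(\<integral>x. f x \<partial>lborel)
      = (\<integral>x. f x \<partial>density (distr lborel borel (\<lambda>x. t + c *\<^sub>R x)) (\<lambda>_. ennreal (\<bar>c\<bar>^DIM('a))))"
    using lborel_affine[OF c, of t] by simp
  also have "\<dots> = \<bar>c\<bar>^DIM('a) * (\<integral>x. f (t + c *\<^sub>R x) \<partial>lborel)"
    using m c by (simp add: integral_density integral_distr)
  finally show ?thesis .
next
  \<comment> \<open>Both sides are 0 here: a Bochner integral that does not exist has the value 0,
    and the inverse affine map would carry integrability of the rescaled function back to
    \<open>f\<close>.\<close>
  case False
  have "\<not> integrable lborel (\<lambda>x. f (t + c *\<^sub>R x))"
  proof
    assume "integrable lborel (\<lambda>x. f (t + c *\<^sub>R x))"
    from lborel_integrable_affine[OF _ this, of "1/c" "- (1/c) *\<^sub>R t"] c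
    have "integrable lborel f" by (simp add: scaleR_right_diff_distrib)
    with False show False by simp
  qed
  then show ?thesis using False by (simp add: not_integrable_integral_eq)
qed

lemma lborel_integral_reflect:
  fixes f :: "'a::euclidean_space \<Rightarrow> real"
  shows "(\<integral>x. f (t - x) \<partial>lborel) = (\<integral>x. f x \<partial>lborel)"
  using lborel_integral_affine[of "-1" f t] by simp

lemma lborel_integral_translate:
  fixes f :: "'a::euclidean_space \<Rightarrow> real"
  shows "(\<integral>x. f (t + x) \<partial>lborel) = (\<integral>x. f x \<partial>lborel)"
  using lborel_integral_affine[of "1" f t] by simp

section \<open>Continuous functions with compact support\<close>

definition Cc :: "('a::euclidean_space \<Rightarrow> real) \<Rightarrow> bool" where
  "Cc f \<longleftrightarrow> continuous_on UNIV f \<and> compact (supp f)"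

lemma CcI: "continuous_on UNIV f \<Longrightarrow> compact K \<Longrightarrow> (\<And>x. f x \<noteq> 0 \<Longrightarrow> x \<in> K) \<Longrightarrow> Cc f"
  using compact_supp_I by (auto simp: Cc_def)

lemma tf_Cc: "f \<in> tf \<Longrightarrow> Cc f"
  by (simp add: Cc_def tf_iff C_inf_continuous)

lemma test_functions_tf: "f \<in> test_functions S \<Longrightarrow> f \<in> tf"
  by (simp add: test_functions_iff)

lemma test_functions_Cc: "f \<in> test_functions S \<Longrightarrow> Cc f"
  using tf_Cc test_functions_tf by blast

lemma Cc_measurable [measurable_dest]: "Cc f \<Longrightarrow> f \<in> borel_measurable borel"
  by (simp add: Cc_def borel_measurable_continuous_onI)

lemma Cc_integrable: "Cc f \<Longrightarrow> integrable lborel f"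
proof -
  assume f: "Cc f"
  then have "integrable lborel (\<lambda>x. indicator (supp f) x *\<^sub>R f x)"
    by (intro borel_integrable_compact) (auto simp: Cc_def intro: continuous_on_subset)
  moreover have "(\<lambda>x. indicator (supp f) x *\<^sub>R f x) = f"
    using zero_outside_supp by (auto simp: indicator_def fun_eq_iff)
  ultimately show ?thesis by simp
qed

lemma Cc_mult: "continuous_on UNIV g \<Longrightarrow> Cc f \<Longrightarrow> Cc (\<lambda>x. g x * f x)"
  by (rule CcI[where K="supp f"])
    (auto simp: Cc_def intro: continuous_on_mult, meson zero_outside_supp)

lemma Cc_mult2: "Cc f \<Longrightarrow> Cc g \<Longrightarrow> Cc (\<lambda>x. f x * g x)"
  by (rule Cc_mult) (auto simp: Cc_def)

lemma Cc_cmult: "Cc f \<Longrightarrow> Cc (\<lambda>x. c * f x)"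
  by (intro Cc_mult) auto

lemma Cc_abs: "Cc f \<Longrightarrow> Cc (\<lambda>x. \<bar>f x\<bar>)"
  by (rule CcI[where K="supp f"])
    (auto simp: Cc_def intro: continuous_on_rabs, meson zero_outside_supp)

lemma Cc_add: "Cc f \<Longrightarrow> Cc g \<Longrightarrow> Cc (\<lambda>x. f x + g x)"
  by (rule CcI[where K="supp f \<union> supp g"])
    (auto simp: Cc_def intro: continuous_on_add compact_Un dest: nonzero_add_supp)

lemma Cc_diff: "Cc f \<Longrightarrow> Cc g \<Longrightarrow> Cc (\<lambda>x. f x - g x)"
  using Cc_add[of f "\<lambda>x. (-1) * g x"] Cc_cmult[of g "-1"] by simp

lemma Cc_zero: "Cc (\<lambda>x. 0)"
  by (rule CcI[where K="{}"]) auto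

lemma Cc_sum: "(\<And>i. i \<in> I \<Longrightarrow> Cc (f i)) \<Longrightarrow> Cc (\<lambda>x. \<Sum>i\<in>I. f i x)"
  by (induction I rule: infinite_finite_induct) (auto intro: Cc_zero Cc_add)

lemma Cc_affine: assumes "Cc f" "c \<noteq> 0" shows "Cc (\<lambda>x. f (t + c *\<^sub>R x))"
proof (rule CcI[where K="(\<lambda>y. (1/c) *\<^sub>R (y - t)) ` supp f"])
  show "compact ((\<lambda>y. (1 / c) *\<^sub>R (y - t)) ` supp f)"
    using assms by (intro compact_continuous_image continuous_intros) (auto simp: Cc_def)
  show "x \<in> (\<lambda>y. (1 / c) *\<^sub>R (y - t)) ` supp f" if "f (t + c *\<^sub>R x) \<noteq> 0" for x
    using that zero_outside_supp assms by (intro image_eqI[of _ _ "t + c *\<^sub>R x"]) auto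
  show "continuous_on UNIV (\<lambda>x. f (t + c *\<^sub>R x))"
    using assms by (auto simp: Cc_def intro!: continuous_intros continuous_on_compose2[of UNIV f])
qed

lemma Cc_reflect: "Cc f \<Longrightarrow> Cc (\<lambda>x. f (t - x))"
  using Cc_affine[of f "-1" t] by simp

lemma Cc_translate: "Cc f \<Longrightarrow> Cc (\<lambda>x. f (t + x))"
  using Cc_affine[of f "1" t] by simp

lemma Cc_uminus: "Cc f \<Longrightarrow> Cc (\<lambda>x. f (- x))"
  using Cc_affine[of f "-1" 0] by simp

lemma Cc_bounded: assumes "Cc f" obtains B where "B > 0" "\<And>x. \<bar>f x\<bar> \<le> B"
proof -
  have "bounded (f ` supp f)"
    using assms by (auto simp: Cc_def intro!: compact_imp_bounded compact_continuous_image
      intro: continuous_on_subset)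
  then obtain B where "B > 0" "\<And>x. x \<in> supp f \<Longrightarrow> \<bar>f x\<bar> \<le> B"
    by (auto simp: bounded_pos)
  then show ?thesis
    using that[of B] zero_outside_supp by (metis abs_zero less_imp_le)
qed

text \<open>Heine-Cantor on the support fattened by 1. Of two points closer than 1, either one lies
  in \<open>supp f\<close>, and then both lie in the fattened compact set, or \<open>f\<close>
  vanishes at both.\<close>

lemma Cc_uniformly_continuous:
  assumes f: "Cc f" and "e > 0"
  obtains d where "d > 0" "\<And>x y. dist x y < d \<Longrightarrow> \<bar>f x - f y\<bar> < e"
proof -
  let ?K = "(\<lambda>(x, y). x + y) ` (supp f \<times> cball 0 1)"
  have "compact ?K"
    using f by (intro compact_continuous_image compact_Times)
      (auto simp: Cc_def case_prod_beta intro!: continuous_intros)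
  moreover have "continuous_on ?K f"
    using f continuous_on_subset by (auto simp: Cc_def)
  ultimately have "uniformly_continuous_on ?K f"
    using compact_uniformly_continuous by blast
  then obtain d where d: "d > 0" "\<And>x y. x \<in> ?K \<Longrightarrow> y \<in> ?K \<Longrightarrow> dist x y < d \<Longrightarrow> dist (f x) (f y) < e"
    using \<open>e > 0\<close> unfolding uniformly_continuous_on_def by metis
  have K: "x \<in> ?K" if "z \<in> supp f" "dist x z \<le> 1" for x z
    using that by (intro image_eqI[of _ _ "(z, x - z)"]) (auto simp: dist_norm norm_minus_commute)
  show ?thesis
  proof (rule that[of "min d 1"])
    show "min d 1 > 0" using d by simp
    fix x y :: 'a assume xy: "dist x y < min d 1"
    consider "x \<in> supp f" | "y \<in> supp f" | "x \<notin> supp f" "y \<notin> supp f" by blast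
    then show "\<bar>f x - f y\<bar> < e"
    proof cases
      case 1
      then show ?thesis using xy d(2)[of x y] K[of x x] K[of x y] by (auto simp: dist_real_def dist_commute)
    next
      case 2
      then show ?thesis using xy d(2)[of x y] K[of y x] K[of y y] by (auto simp: dist_real_def dist_commute)
    next
      case 3
      then show ?thesis using \<open>e > 0\<close> by (simp add: zero_outside_supp)
    qed
  qed
qed

section \<open>Convolutions and their derivatives\<close>

definition conv :: "('a::euclidean_space \<Rightarrow> real) \<Rightarrow> ('a \<Rightarrow> real) \<Rightarrow> 'a \<Rightarrow> real" where
  "conv f a x = (\<integral>y. f y * a (x - y) \<partial>lborel)"

lemma integrable_mult_bounded:
  fixes f g :: "'a \<Rightarrow> real"
  assumes "integrable M f" "g \<in> borel_measurable M" "\<And>x. \<bar>g x\<bar> \<le> B"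
  shows "integrable M (\<lambda>x. f x * g x)"
proof (rule Bochner_Integration.integrable_bound)
  show "integrable M (\<lambda>x. B * \<bar>f x\<bar>)" using assms by auto
  show "(\<lambda>x. f x * g x) \<in> borel_measurable M" using assms by auto
  show "AE x in M. norm (f x * g x) \<le> norm (B * \<bar>f x\<bar>)"
  proof (rule AE_I2)
    fix x
    have "\<bar>f x\<bar> * \<bar>g x\<bar> \<le> \<bar>f x\<bar> * B" by (intro mult_left_mono assms) auto
    moreover have "B \<ge> 0" using assms(3)[of x] by linarith
    ultimately show "norm (f x * g x) \<le> norm (B * \<bar>f x\<bar>)"
      by (simp add: abs_mult mult.commute)
  qed
qed

lemma integrable_mult_Cc:
  assumes "integrable lborel f" "Cc a" shows "integrable lborel (\<lambda>y. f y * a y)"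
proof -
  obtain B where "\<And>x. \<bar>a x\<bar> \<le> B" using Cc_bounded[OF assms(2)] by blast
  then show ?thesis
    using assms Cc_measurable[of a] by (intro integrable_mult_bounded) auto
qed

lemma conv_integrable:
  "integrable lborel f \<Longrightarrow> Cc a \<Longrightarrow> integrable lborel (\<lambda>y. f y * a (x - y))"
  by (intro integrable_mult_Cc Cc_reflect)

lemma abs_conv_le:
  assumes f: "integrable lborel f" and a: "Cc a" and B: "\<And>y. \<bar>a y\<bar> \<le> B"
  shows "\<bar>conv f a x\<bar> \<le> B * (\<integral>y. \<bar>f y\<bar> \<partial>lborel)"
proof -
  have "\<bar>conv f a x\<bar> \<le> (\<integral>y. \<bar>f y * a (x - y)\<bar> \<partial>lborel)"
    unfolding conv_def by (rule integral_abs_bound)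
  also have "\<dots> \<le> (\<integral>y. B * \<bar>f y\<bar> \<partial>lborel)"
    using integrable_abs[OF conv_integrable[OF f a]] f B
    by (intro integral_mono) (auto simp: abs_mult mult.commute[of B] intro!: mult_left_mono)
  finally show ?thesis by simp
qed

lemma conv_diff_right:
  assumes "integrable lborel f" "Cc a" "Cc b"
  shows "conv f (\<lambda>x. a x - b x) x = conv f a x - conv f b x"
  using conv_integrable[OF assms(1,2)] conv_integrable[OF assms(1,3)]
  by (simp add: conv_def right_diff_distrib)

lemma conv_commute: "conv f a = conv a f"
proof
  fix x show "conv f a x = conv a f x"
    using lborel_integral_reflect[of "\<lambda>y. f y * a (x - y)" x] by (simp add: conv_def mult.commute)
qed

lemma conv_translate: "conv f a (x + h) = conv f (\<lambda>z. a (z + h)) x"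
  by (simp add: conv_def algebra_simps)

text \<open>Shifting the argument of \<open>conv f a\<close> shifts \<open>a\<close>, so the modulus
  of continuity comes from the uniform continuity of \<open>a\<close>, and \<open>f\<close> enters
  through its L1 norm. Dividing by that norm plus 1 covers norm 0.\<close>

lemma continuous_conv:
  assumes f: "integrable lborel f" and a: "Cc a" shows "continuous_on UNIV (conv f a)"
  unfolding continuous_on_iff
proof (intro ballI allI impI)
  fix x :: 'a and e :: real assume "e > 0"
  let ?I = "(\<integral>y. \<bar>f y\<bar> \<partial>lborel)"
  have I: "?I \<ge> 0" by simp
  with \<open>e > 0\<close> have "e / (?I + 1) > 0" by (intro divide_pos_pos add_nonneg_pos) auto
  from Cc_uniformly_continuous[OF a this] obtain d where
    d: "d > 0" "\<And>x y. dist x y < d \<Longrightarrow> \<bar>a x - a y\<bar> < e / (?I + 1)" by metis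
  have "dist (conv f a x') (conv f a x) < e" if "dist x' x < d" for x'
  proof -
    let ?h = "x' - x"
    let ?b = "\<lambda>z. a (z + ?h) - a z"
    have ca: "Cc (\<lambda>z. a (z + ?h))" using Cc_translate[OF a, of ?h] by (simp add: add.commute)
    have "conv f a x' - conv f a x = conv f ?b x"
      using conv_translate[of f a x ?h] by (simp add: conv_diff_right[OF f ca a])
    moreover have "\<bar>conv f ?b x\<bar> \<le> e / (?I + 1) * ?I"
      using that d(2)
      by (intro abs_conv_le f Cc_diff ca a) (auto simp: dist_norm less_imp_le)
    moreover have "e / (?I + 1) * ?I < e"
      using I \<open>e > 0\<close> by (simp add: field_simps add_pos_nonneg)
    ultimately show ?thesis by (simp add: dist_real_def)
  qed
  then show "\<exists>d>0. \<forall>x'\<in>UNIV. dist x' x < d \<longrightarrow> dist (conv f a x') (conv f a x) < e"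
    using d(1) by blast
qed

text \<open>The increment falls on the smooth factor \<open>a\<close>, while \<open>f\<close> is
  merely integrable. The first order remainder of \<open>a\<close> is small uniformly in the base
  point, since the partial derivatives of \<open>a\<close> are uniformly continuous, and
  \<open>abs_conv_le\<close> integrates it.\<close>

lemma conv_has_derivative:
  fixes a :: "real^'d::finite \<Rightarrow> real"
  assumes f: "integrable lborel f" and a: "a \<in> tf"
  shows "(conv f a has_derivative (\<lambda>h. \<Sum>i\<in>UNIV. h $ i * conv f (partial_deriv i a) x)) (at x)"
proof -
  let ?I = "(\<integral>y. \<bar>f y\<bar> \<partial>lborel)"
  let ?D = "\<lambda>z h. \<Sum>i\<in>UNIV. h $ i * partial_deriv i a z"
  have I: "?I \<ge> 0" by simp
  have da: "Cc (partial_deriv i a)" for i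
    using a test_functions_partial_deriv tf_Cc by blast
  have bl: "bounded_linear (\<lambda>h. \<Sum>i\<in>UNIV. h $ i * conv f (partial_deriv i a) x)"
    by (intro bounded_linear_sum bounded_linear_mult_left[THEN bounded_linear_compose] bounded_linear_vec_nth)
  have "\<exists>d>0. \<forall>y. norm (y - x) < d \<longrightarrow>
      norm (conv f a y - conv f a x - (\<Sum>i\<in>UNIV. (y - x) $ i * conv f (partial_deriv i a) x)) \<le> e * norm (y - x)"
    if "e > 0" for e
  proof -
    define e' where "e' = e / (?I + 1) / CARD('d)"
    have e': "e' > 0" using that I unfolding e'_def by (intro divide_pos_pos add_nonneg_pos) auto
    have "\<exists>d>0. \<forall>x y. dist x y < d \<longrightarrow> \<bar>partial_deriv i a x - partial_deriv i a y\<bar> < e'" for i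
      using Cc_uniformly_continuous[OF da e'] by metis
    then obtain d where d: "\<And>i. d i > 0"
      "\<And>i x y. dist x y < d i \<Longrightarrow> \<bar>partial_deriv i a x - partial_deriv i a y\<bar> < e'" by metis
    define d0 where "d0 = Min (range d)"
    have d0: "d0 > 0" "\<And>i. d0 \<le> d i" by (auto simp: d0_def d)
    \<comment> \<open>Mean value inequality for \<open>a\<close> minus its linearisation at
      \<open>z\<close>: the derivative of this difference on \<open>cball z (norm h)\<close> is the
      oscillation of the gradient of \<open>a\<close>.\<close>
    have est: "\<bar>a (z + h) - a z - ?D z h\<bar> \<le> e' * CARD('d) * norm h" if "norm h < d0" for z h
    proof -
      let ?g = "\<lambda>w. a w - ?D z w"
      have dg: "(?g has_derivative (\<lambda>h. ?D w h - ?D z h)) (at w within cball z (norm h))" for w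
        using a by (intro has_derivative_diff has_derivative_at_withinI[OF frechet_partial]
          has_derivative_sum has_derivative_mult_left[OF has_derivative_at_withinI[OF has_derivative_component]])
          (auto simp: tf_iff C_inf_differentiable)
      have "onorm (\<lambda>h. ?D w h - ?D z h) \<le> e' * CARD('d)" if w: "w \<in> cball z (norm h)" for w
      proof (rule onorm_le)
        fix k :: "real^'d"
        have "\<bar>?D w k - ?D z k\<bar> \<le> (\<Sum>i\<in>UNIV. \<bar>k $ i * (partial_deriv i a w - partial_deriv i a z)\<bar>)"
          unfolding sum_subtractf[symmetric] right_diff_distrib[symmetric] by (rule sum_abs)
        also have "\<dots> \<le> (\<Sum>i\<in>(UNIV::'d set). norm k * e')"
        proof (rule sum_mono)
          fix i
          have "dist w z < d i" using w \<open>norm h < d0\<close> d0(2)[of i] by (auto simp: dist_commute)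
          from d(2)[OF this] have "\<bar>partial_deriv i a w - partial_deriv i a z\<bar> \<le> e'" by simp
          then show "\<bar>k $ i * (partial_deriv i a w - partial_deriv i a z)\<bar> \<le> norm k * e'"
            unfolding abs_mult by (intro mult_mono component_le_norm_cart) auto
        qed
        finally show "norm (?D w k - ?D z k) \<le> e' * CARD('d) * norm k" by (simp add: algebra_simps)
      qed
      then have "norm (?g (z + h) - ?g z) \<le> e' * CARD('d) * norm (z + h - z)"
        using dg by (intro differentiable_bound[OF convex_cball[of z "norm h"]]) (auto simp: dist_norm)
      moreover have "?D z (z + h) = ?D z z + ?D z h"
        by (simp add: sum.distrib[symmetric] algebra_simps)
      ultimately show ?thesis by simp
    qed
    have "norm (conv f a y - conv f a x - (\<Sum>i\<in>UNIV. (y - x) $ i * conv f (partial_deriv i a) x)) \<le> e * norm (y - x)"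
      if y: "norm (y - x) < d0" for y
    proof -
      let ?h = "y - x"
      let ?b = "\<lambda>z. a (z + ?h) - a z - ?D z ?h"
      have ca: "Cc (\<lambda>z. a (z + ?h))" "Cc a"
        using Cc_translate[of a ?h] a tf_Cc by (auto simp: add.commute)
      have cD: "Cc (\<lambda>z. ?D z ?h)" by (intro Cc_sum Cc_cmult da)
      have cs: "conv f (\<lambda>z. ?D z ?h) x = (\<Sum>i\<in>UNIV. ?h $ i * conv f (partial_deriv i a) x)"
        unfolding conv_def sum_distrib_left mult.left_commute[of "f _"]
        using conv_integrable[OF f da]
        by (subst Bochner_Integration.integral_sum) auto
      have "conv f a y = conv f (\<lambda>z. a (z + ?h)) x"
        using conv_translate[of f a x ?h] by simp
      then have "conv f a y - conv f a x - (\<Sum>i\<in>UNIV. ?h $ i * conv f (partial_deriv i a) x) = conv f ?b x"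
        by (simp only: conv_diff_right[OF f Cc_diff[OF ca] cD] conv_diff_right[OF f ca] cs)
      moreover have "\<bar>conv f ?b x\<bar> \<le> (e' * CARD('d) * norm ?h) * ?I"
        by (intro abs_conv_le f Cc_diff ca cD est y)
      moreover have "(e' * CARD('d) * norm ?h) * ?I \<le> e * norm ?h"
        using I that \<open>e > 0\<close> mult_left_mono[of ?I "?I + 1" "e * norm ?h"]
        by (simp add: e'_def field_simps add_pos_nonneg)
      ultimately show ?thesis by (simp only: real_norm_def)
    qed
    then show ?thesis using d0 by blast
  qed
  then show ?thesis
    unfolding has_derivative_within_alt using bl by auto
qed

lemma partial_deriv_conv:
  assumes "integrable lborel f" "a \<in> tf"
  shows "partial_deriv i (conv f a) = conv f (partial_deriv i a)"
proof
  fix x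
  have "partial_deriv i (conv f a) x = (\<Sum>j\<in>UNIV. axis i 1 $ j * conv f (partial_deriv j a) x)"
    by (rule partial_deriv_eq[OF conv_has_derivative[OF assms]])
  also have "\<dots> = (\<Sum>j\<in>UNIV. if i = j then conv f (partial_deriv j a) x else 0)"
    by (rule sum.cong) (auto simp: axis_def)
  finally show "partial_deriv i (conv f a) x = conv f (partial_deriv i a) x" by simp
qed

lemma C_inf_conv:
  assumes "integrable lborel f" "a \<in> tf" shows "C_inf (conv f a)"
  unfolding C_inf_def
proof
  fix k show "C_k k (conv f a)"
    using assms(2)
  proof (induction k arbitrary: a)
    case 0
    then show ?case using continuous_conv[OF assms(1) tf_Cc] by simp
  next
    case (Suc k)
    then show ?case
      using conv_has_derivative[OF assms(1) Suc.prems] partial_deriv_conv[OF assms(1) Suc.prems]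
      by (auto simp: differentiable_def test_functions_partial_deriv)
  qed
qed

text \<open>Pointwise form of the inclusion of the support of a convolution in the sum of the
  supports; it also tracks smaller sets than closed supports.\<close>

lemma conv_nonzeroD:
  assumes "conv f a x \<noteq> 0" obtains y z where "f y \<noteq> 0" "a z \<noteq> 0" "x = y + z"
proof -
  have "\<exists>y. f y * a (x - y) \<noteq> 0"
  proof (rule ccontr)
    assume "\<not> ?thesis"
    then have "(\<lambda>y. f y * a (x - y)) = (\<lambda>y. 0)" by auto
    then have "conv f a x = 0" unfolding conv_def by (metis Bochner_Integration.integral_zero)
    with assms show False by simp
  qed
  then show ?thesis using that by (metis add_diff_cancel_left' diff_add_cancel mult_eq_0_iff add.commute)
qed

lemma compact_plus: "compact A \<Longrightarrow> compact B \<Longrightarrow> compact {x + y |x y. x \<in> A \<and> y \<in> (B :: 'a::real_normed_vector set)}"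
  by (rule compact_sums)

lemma Cc_conv: assumes "Cc f" "Cc a" shows "Cc (conv f a)"
proof (rule CcI)
  show "continuous_on UNIV (conv f a)" using assms continuous_conv Cc_integrable by blast
  show "compact {y + z |y z. y \<in> supp f \<and> z \<in> supp a}"
    by (rule compact_plus) (use assms in \<open>auto simp: Cc_def\<close>)
  show "x \<in> {y + z |y z. y \<in> supp f \<and> z \<in> supp a}" if "conv f a x \<noteq> 0" for x
  proof -
    from that obtain y z where "f y \<noteq> 0" "a z \<noteq> 0" "x = y + z" by (rule conv_nonzeroD)
    then show ?thesis
      using zero_outside_supp[of y f] zero_outside_supp[of z a] by auto
  qed
qed

lemma tf_conv: assumes "Cc f" "a \<in> tf" shows "conv f a \<in> tf"
  using Cc_conv[OF assms(1) tf_Cc[OF assms(2)]] C_inf_conv[OF Cc_integrable[OF assms(1)] assms(2)]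
  by (auto simp: tf_iff Cc_def)

section \<open>The L2 seminorm, adjoints of convolutions and Young's inequality\<close>

definition n2 :: "('a::euclidean_space \<Rightarrow> real) \<Rightarrow> real" where
  "n2 f = sqrt (\<integral>x. (f x)\<^sup>2 \<partial>lborel)"

lemma n2_nonneg [simp]: "n2 f \<ge> 0"
  by (simp add: n2_def)

lemma n2_power2: "(n2 f)\<^sup>2 = (\<integral>x. f x * f x \<partial>lborel)"
  by (simp add: n2_def power2_eq_square)

lemma L2_rel_refl: "square_integrable f \<Longrightarrow> L2_rel f f"
  by (simp add: L2_rel_def)

lemma inner_L2_class:
  "square_integrable f \<Longrightarrow> square_integrable g \<Longrightarrow> inner (L2_class f) (L2_class g) = (\<integral>x. f x * g x \<partial>lborel)"
  by (simp add: inner_L2.abs_eq L2_rel_refl)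

lemma norm_L2_class: "square_integrable f \<Longrightarrow> norm (L2_class f) = n2 f"
  by (simp add: norm_eq_sqrt_inner inner_L2_class n2_def power2_eq_square)

lemma n2_Cauchy_Schwarz:
  assumes "square_integrable f" "square_integrable g"
  shows "\<bar>\<integral>x. f x * g x \<partial>lborel\<bar> \<le> n2 f * n2 g"
  using Cauchy_Schwarz_ineq2[of "L2_class f" "L2_class g"] assms
  by (simp add: inner_L2_class norm_L2_class)

lemma n2_triangle:
  assumes "square_integrable f" "square_integrable g"
  shows "n2 (\<lambda>x. f x + g x) \<le> n2 f + n2 g"
  using norm_triangle_ineq[of "L2_class f" "L2_class g"] assms
  by (simp add: plus_L2.abs_eq L2_rel_refl norm_L2_class square_integrable_add)

lemma n2_cmult: "n2 (\<lambda>x. c * f x) = \<bar>c\<bar> * n2 f"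
  by (simp add: n2_def power_mult_distrib real_sqrt_mult)

lemma Cc_square_integrable: "Cc f \<Longrightarrow> square_integrable f"
  using Cc_integrable[OF Cc_mult2[of f f]] Cc_measurable[of f]
  by (auto simp: square_integrable_def power2_eq_square)

lemma n2_CS_Cc: "Cc f \<Longrightarrow> Cc g \<Longrightarrow> \<bar>\<integral>x. f x * g x \<partial>lborel\<bar> \<le> n2 f * n2 g"
  by (intro n2_Cauchy_Schwarz Cc_square_integrable)

lemma Cc_Fubini:
  fixes F :: "'a::euclidean_space \<times> 'b::euclidean_space \<Rightarrow> real"
  assumes "Cc F"
  shows "(\<integral>x. (\<integral>y. F (x, y) \<partial>lborel) \<partial>lborel) = (\<integral>y. (\<integral>x. F (x, y) \<partial>lborel) \<partial>lborel)"
    and "integrable lborel (\<lambda>x. \<integral>y. F (x, y) \<partial>lborel)"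
proof -
  have "integrable (lborel \<Otimes>\<^sub>M lborel) (\<lambda>(x, y). F (x, y))"
    using Cc_integrable[OF assms] by (simp add: lborel_prod)
  from lborel_pair.Fubini_integral[OF this] lborel_pair.integrable_fst[OF this]
  show "(\<integral>x. (\<integral>y. F (x, y) \<partial>lborel) \<partial>lborel) = (\<integral>y. (\<integral>x. F (x, y) \<partial>lborel) \<partial>lborel)"
    "integrable lborel (\<lambda>x. \<integral>y. F (x, y) \<partial>lborel)" by simp_all
qed

lemma CcI_pair:
  assumes "continuous_on UNIV F" "compact A" "compact B" "\<And>x y. F (x, y) \<noteq> 0 \<Longrightarrow> x \<in> A \<and> y \<in> B"
  shows "Cc F"
  by (rule CcI[where K="A \<times> B"]) (use assms in \<open>auto intro: compact_Times\<close>)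

lemma Cc_continuous_compose: "Cc f \<Longrightarrow> continuous_on S g \<Longrightarrow> continuous_on S (\<lambda>x. f (g x))"
  by (rule continuous_on_compose2[of UNIV f]) (auto simp: Cc_def)

text \<open>Fubini for \<open>a y * (f (x - y) * g x)\<close>, which has compact support in the pair
  because \<open>a\<close> confines \<open>y\<close> and \<open>g\<close> confines
  \<open>x\<close>.\<close>

lemma conv_pairing:
  fixes a f g :: "'a::euclidean_space \<Rightarrow> real"
  assumes "Cc a" "Cc f" "Cc g"
  shows "(\<integral>x. conv a f x * g x \<partial>lborel) = (\<integral>y. a y * (\<integral>x. f (x - y) * g x \<partial>lborel) \<partial>lborel)" (is ?eq)
    and "integrable lborel (\<lambda>y. a y * (\<integral>x. f (x - y) * g x \<partial>lborel))" (is ?int)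
proof -
  let ?F = "\<lambda>(y, x). a y * (f (x - y) * g x)"
  have "continuous_on UNIV ?F"
    by (auto simp: case_prod_beta intro!: continuous_intros assms[THEN Cc_continuous_compose])
  then have F: "Cc ?F"
    by (rule CcI_pair[of _ "supp a" "supp g"])
      (use assms zero_outside_supp[of _ a] zero_outside_supp[of _ g] in \<open>auto simp: Cc_def\<close>)
  have "(\<integral>x. conv a f x * g x \<partial>lborel) = (\<integral>x. (\<integral>y. ?F (y, x) \<partial>lborel) \<partial>lborel)"
    by (simp add: conv_def mult.assoc flip: integral_mult_left_zero)
  also have "\<dots> = (\<integral>y. (\<integral>x. ?F (y, x) \<partial>lborel) \<partial>lborel)"
    using Cc_Fubini(1)[OF F] by simp
  finally show ?eq by simp
  show ?int using Cc_Fubini(2)[OF F] by simp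
qed

lemma conv_adjoint:
  fixes a f g :: "'a::euclidean_space \<Rightarrow> real"
  assumes "Cc a" "Cc f" "Cc g"
  shows "(\<integral>x. conv a f x * g x \<partial>lborel) = (\<integral>x. f x * conv (\<lambda>y. a (- y)) g x \<partial>lborel)"
proof -
  have "(\<integral>x. f x * conv (\<lambda>y. a (- y)) g x \<partial>lborel) = (\<integral>y. a (- y) * (\<integral>x. g (x - y) * f x \<partial>lborel) \<partial>lborel)"
    using conv_pairing(1)[OF Cc_uminus[OF assms(1)] assms(3,2)] by (simp add: mult.commute)
  also have "\<dots> = (\<integral>y. a y * (\<integral>x. g (x + y) * f x \<partial>lborel) \<partial>lborel)"
    using lborel_integral_reflect[of "\<lambda>y. a y * (\<integral>x. g (x + y) * f x \<partial>lborel)" 0] by simp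
  also have "\<dots> = (\<integral>y. a y * (\<integral>x. f (x - y) * g x \<partial>lborel) \<partial>lborel)"
  proof -
    have "(\<integral>x. g (x + y) * f x \<partial>lborel) = (\<integral>x. f (x - y) * g x \<partial>lborel)" for y
      using lborel_integral_translate[of "\<lambda>x. f (x - y) * g x" y] by (simp add: algebra_simps)
    then show ?thesis by simp
  qed
  finally show ?thesis using conv_pairing(1)[OF assms] by simp
qed

lemma n2_translate: "n2 (\<lambda>x. f (x - y)) = n2 f"
  using lborel_integral_translate[of "\<lambda>x. (f x)\<^sup>2" "- y"] by (simp add: n2_def)

text \<open>Duality replaces Minkowski's integral inequality: pair \<open>conv a f\<close> with
  itself, apply Cauchy-Schwarz to each translate of \<open>f\<close>, whose norm does not depend on
  the shift, and cancel one factor of the norm.\<close>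

lemma conv_Young:
  assumes a: "Cc a" and f: "Cc f"
  shows "n2 (conv a f) \<le> (\<integral>y. \<bar>a y\<bar> \<partial>lborel) * n2 f"
proof -
  let ?g = "conv a f"
  let ?A = "\<integral>y. \<bar>a y\<bar> \<partial>lborel"
  have g: "Cc ?g" using a f by (rule Cc_conv)
  have bd: "\<bar>\<integral>x. f (x - y) * ?g x \<partial>lborel\<bar> \<le> n2 f * n2 ?g" for y
    using n2_CS_Cc[OF _ g, of "\<lambda>x. f (x - y)"] Cc_translate[OF f, of "- y"] by (simp add: n2_translate)
  have "(n2 ?g)\<^sup>2 = (\<integral>y. a y * (\<integral>x. f (x - y) * ?g x \<partial>lborel) \<partial>lborel)"
    unfolding n2_power2 by (rule conv_pairing(1)[OF a f g])
  also have "\<dots> \<le> (\<integral>y. \<bar>a y\<bar> * (n2 f * n2 ?g) \<partial>lborel)"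
  proof (rule integral_mono)
    show "integrable lborel (\<lambda>y. a y * (\<integral>x. f (x - y) * ?g x \<partial>lborel))"
      by (rule conv_pairing(2)[OF a f g])
    show "integrable lborel (\<lambda>y. \<bar>a y\<bar> * (n2 f * n2 ?g))"
      using Cc_integrable[OF a] by auto
    show "a y * (\<integral>x. f (x - y) * ?g x \<partial>lborel) \<le> \<bar>a y\<bar> * (n2 f * n2 ?g)" for y
      by (rule order_trans[OF abs_ge_self], subst abs_mult, rule mult_left_mono[OF bd[of y]]) simp
  qed
  also have "\<dots> = ?A * n2 f * n2 ?g" by simp
  finally have "n2 ?g * n2 ?g \<le> (?A * n2 f) * n2 ?g" by (simp add: power2_eq_square)
  moreover have "0 \<le> ?A * n2 f" by (simp add: Bochner_Integration.integral_nonneg)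
  ultimately show ?thesis
    using mult_right_le_imp_le[of "n2 ?g" "n2 ?g" "?A * n2 f"] n2_nonneg[of ?g] by (cases "n2 ?g = 0") auto
qed

lemma conv_assoc:
  fixes a b f :: "'a::euclidean_space \<Rightarrow> real"
  assumes "Cc a" "Cc b" "Cc f"
  shows "conv a (conv b f) = conv (conv a b) f"
proof
  fix x
  let ?F = "\<lambda>(y, w). a y * (b (w - y) * f (x - w))"
  have "continuous_on UNIV ?F"
    by (auto simp: case_prod_beta intro!: continuous_intros assms[THEN Cc_continuous_compose])
  then have F: "Cc ?F"
    by (rule CcI_pair[of _ "supp a" "supp (\<lambda>w. f (x - w))"])
      (use assms Cc_reflect[OF assms(3), of x] zero_outside_supp[of _ a] zero_outside_supp[of _ "\<lambda>w. f (x - w)"] in \<open>auto simp: Cc_def\<close>)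
  have "conv b f (x - y) = (\<integral>w. b (w - y) * f (x - w) \<partial>lborel)" for y
    using lborel_integral_translate[of "\<lambda>z. b z * f (x - y - z)" "- y"] by (simp add: conv_def)
  then have "conv a (conv b f) x = (\<integral>y. (\<integral>w. ?F (y, w) \<partial>lborel) \<partial>lborel)"
    by (simp add: conv_def)
  also have "\<dots> = (\<integral>w. (\<integral>y. ?F (y, w) \<partial>lborel) \<partial>lborel)"
    by (rule Cc_Fubini(1)[OF F])
  also have "\<dots> = conv (conv a b) f x"
    by (simp add: conv_def mult.assoc flip: integral_mult_left_zero)
  finally show "conv a (conv b f) x = conv (conv a b) f x" .
qed

lemma conv_left_commute:
  "Cc a \<Longrightarrow> Cc b \<Longrightarrow> Cc f \<Longrightarrow> conv a (conv b f) = conv b (conv a f)"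
  by (simp add: conv_assoc conv_commute[of a b])

lemma conv_add_right:
  assumes "Cc f" "Cc a" "Cc b"
  shows "conv f (\<lambda>x. a x + b x) = (\<lambda>x. conv f a x + conv f b x)"
  using conv_integrable[OF Cc_integrable assms(2)] conv_integrable[OF Cc_integrable assms(3)] assms(1)
  by (simp add: conv_def distrib_left fun_eq_iff)

lemma conv_cmult_right: "conv f (\<lambda>x. c * a x) = (\<lambda>x. c * conv f a x)"
  by (simp add: conv_def fun_eq_iff mult.left_commute[of _ c])

lemma conv_cmult_left: "conv (\<lambda>x. c * f x) a = (\<lambda>x. c * conv f a x)"
  by (simp add: conv_commute[of _ a] conv_cmult_right)

lemma conv_sum_left:
  assumes "Cc a" "\<And>i. i \<in> I \<Longrightarrow> Cc (f i)"
  shows "conv (\<lambda>x. \<Sum>i\<in>I. f i x) a x = (\<Sum>i\<in>I. conv (f i) a x)"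
  using assms conv_integrable[OF Cc_integrable, of _ a]
  by (simp add: conv_def sum_distrib_right)

lemma conv_diff_left:
  assumes "Cc f" "Cc g" "Cc a"
  shows "conv (\<lambda>x. f x - g x) a x = conv f a x - conv g a x"
  using assms by (simp add: conv_commute[of _ a] conv_diff_right Cc_integrable)

section \<open>A discrete square function estimate\<close>

text \<open>Normalised so that integrals and L1 norms of kernels are preserved;
  \<open>dil (q ^ j) a\<close> is the kernel \<open>a\<close> at scale \<open>q ^ j\<close>.\<close>

definition dil :: "real \<Rightarrow> ('a::euclidean_space \<Rightarrow> real) \<Rightarrow> 'a \<Rightarrow> real" where
  "dil h a x = a ((1 / h) *\<^sub>R x) / h ^ DIM('a)"

lemma Cc_dil: "h > 0 \<Longrightarrow> Cc a \<Longrightarrow> Cc (dil h a)"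
  using Cc_cmult[OF Cc_affine[of a "1/h" 0], of "1 / h ^ DIM('a)"]
  by (simp add: dil_def[abs_def])

lemma dil_uminus: "dil h a (- x) = dil h (\<lambda>y. a (- y)) x"
  by (simp add: dil_def)

lemma integral_dil:
  fixes a :: "'a::euclidean_space \<Rightarrow> real"
  assumes "h > 0" shows "(\<integral>x. dil h a x \<partial>lborel) = (\<integral>x. a x \<partial>lborel)"
  using lborel_integral_affine[of h "dil h a" 0] assms by (simp add: dil_def)

lemma integral_abs_dil:
  fixes a :: "'a::euclidean_space \<Rightarrow> real"
  assumes "h > 0" shows "(\<integral>x. \<bar>dil h a x\<bar> \<partial>lborel) = (\<integral>x. \<bar>a x\<bar> \<partial>lborel)"
  using integral_dil[OF assms, of "\<lambda>x. \<bar>a x\<bar>"] assms by (simp add: dil_def abs_divide)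

lemma dil_support:
  assumes "h > 0" "\<And>x. R < norm x \<Longrightarrow> a x = 0" "h * R < norm x"
  shows "dil h a x = 0"
  using assms(2)[of "(1/h) *\<^sub>R x"] assms(1,3) by (simp add: dil_def field_simps)

lemma dil_Lipschitz:
  fixes a :: "'a::euclidean_space \<Rightarrow> real"
  assumes "h > 0" "\<And>x y. \<bar>a x - a y\<bar> \<le> L * norm (x - y)"
  shows "\<bar>dil h a x - dil h a y\<bar> \<le> L / h ^ Suc DIM('a) * norm (x - y)"
proof -
  have "\<bar>dil h a x - dil h a y\<bar> = \<bar>a ((1/h) *\<^sub>R x) - a ((1/h) *\<^sub>R y)\<bar> / h ^ DIM('a)"
    using assms(1) by (simp add: dil_def diff_divide_distrib[symmetric] abs_divide)
  also have "\<dots> \<le> (L * norm ((1/h) *\<^sub>R x - (1/h) *\<^sub>R y)) / h ^ DIM('a)"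
    using assms by (intro divide_right_mono) auto
  also have "norm ((1/h) *\<^sub>R x - (1/h) *\<^sub>R y) = norm (x - y) / h"
    using assms(1) by (simp add: scaleR_diff_right[symmetric] divide_inverse mult.commute)
  finally show ?thesis by (simp add: field_simps)
qed

section \<open>Kernels of mean zero against Lipschitz kernels\<close>

lemma integral_abs_le_ball:
  fixes g :: "'a::euclidean_space \<Rightarrow> real"
  assumes "Cc g" "\<And>x. \<bar>g x\<bar> \<le> B" "\<And>x. r < norm x \<Longrightarrow> g x = 0" "0 \<le> r"
  shows "(\<integral>x. \<bar>g x\<bar> \<partial>lborel) \<le> B * (2 * r) ^ DIM('a)"
proof -
  let ?C = "cbox (- r *\<^sub>R One) (r *\<^sub>R One :: 'a)"
  have B: "B \<ge> 0" using assms(2)[of 0] by linarith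
  have C: "x \<in> ?C" if "norm x \<le> r" for x
    using that Basis_le_norm[of _ x] by (force simp: mem_box abs_le_iff)
  have "(\<integral>x. \<bar>g x\<bar> \<partial>lborel) \<le> (\<integral>x. B * indicator ?C x \<partial>lborel)"
  proof (rule integral_mono)
    show "integrable lborel (\<lambda>x. \<bar>g x\<bar>)" using Cc_integrable[OF assms(1)] by simp
    show "integrable lborel (\<lambda>x. B * indicator ?C x)"
      by (intro integrable_mult_right integrable_real_indicator emeasure_bounded_finite bounded_cbox) auto
    show "\<bar>g x\<bar> \<le> B * indicator ?C x" for x
      using assms(2)[of x] assms(3)[of x] C[of x] B by (cases "norm x \<le> r") (auto simp: not_le)
  qed
  also have "\<dots> = B * (2 * r) ^ DIM('a)"
  proof -
    have "measure lborel ?C = (\<Prod>b\<in>(Basis :: 'a set). 2 * r)"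
      using \<open>0 \<le> r\<close> by (auto simp: measure_lborel_cbox_eq inner_add_left intro!: prod.cong)
    then show ?thesis by simp
  qed
  finally show ?thesis .
qed

text \<open>Mean zero of \<open>a\<close> allows \<open>k x\<close> to be subtracted inside the
  convolution, so the Lipschitz bound of \<open>k\<close> gains the factor \<open>r\<close>, the
  radius of the support of \<open>a\<close>. The result lives in the ball of radius
  \<open>r + s\<close>, which turns a supremum bound into an L1 bound.\<close>

lemma integral_abs_conv_le:
  fixes a k :: "'a::euclidean_space \<Rightarrow> real"
  assumes a: "Cc a" "(\<integral>x. a x \<partial>lborel) = 0" "\<And>x. r < norm x \<Longrightarrow> a x = 0" "0 \<le> r"
    and k: "Cc k" "\<And>x y. \<bar>k x - k y\<bar> \<le> L * norm (x - y)" "\<And>x. s < norm x \<Longrightarrow> k x = 0" "0 \<le> s"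
  shows "(\<integral>x. \<bar>conv a k x\<bar> \<partial>lborel) \<le> L * r * (\<integral>x. \<bar>a x\<bar> \<partial>lborel) * (2 * (r + s)) ^ DIM('a)"
proof (rule integral_abs_le_ball)
  show "Cc (conv a k)" using a k by (intro Cc_conv)
  show "0 \<le> r + s" using a k by simp
  show "conv a k x = 0" if "r + s < norm x" for x
  proof (rule ccontr)
    assume "conv a k x \<noteq> 0"
    then obtain y z where yz: "a y \<noteq> 0" "k z \<noteq> 0" "x = y + z" by (rule conv_nonzeroD)
    then have "norm y \<le> r" "norm z \<le> s" using a(3)[of y] k(3)[of z] by force+
    then show False using norm_triangle_ineq[of y z] yz that by simp
  qed
  show "\<bar>conv a k x\<bar> \<le> L * r * (\<integral>x. \<bar>a x\<bar> \<partial>lborel)" for x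
  proof -
    have "norm (One::'a) > 0" by simp
    then have "0 \<le> L" using order_trans[OF abs_ge_zero k(2)[of One 0]] by (simp add: zero_le_mult_iff)
    have i: "integrable lborel (\<lambda>y. a y * k (x - y))" "integrable lborel a"
      using a k by (auto intro: conv_integrable Cc_integrable)
    have "conv a k x = (\<integral>y. a y * (k (x - y) - k x) \<partial>lborel)"
      using i a(2) by (simp add: conv_def right_diff_distrib)
    also have "\<bar>\<dots>\<bar> \<le> (\<integral>y. \<bar>a y * (k (x - y) - k x)\<bar> \<partial>lborel)"
      by (rule integral_abs_bound)
    also have "\<dots> \<le> (\<integral>y. (L * r) * \<bar>a y\<bar> \<partial>lborel)"
    proof (rule integral_mono)
      show "integrable lborel (\<lambda>y. \<bar>a y * (k (x - y) - k x)\<bar>)"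
        using i by (auto simp: right_diff_distrib intro!: integrable_abs Bochner_Integration.integrable_diff)
      show "integrable lborel (\<lambda>y. (L * r) * \<bar>a y\<bar>)" using i by auto
      show "\<bar>a y * (k (x - y) - k x)\<bar> \<le> (L * r) * \<bar>a y\<bar>" for y
      proof (cases "norm y \<le> r")
        case True
        then have "\<bar>k (x - y) - k x\<bar> \<le> L * r"
          using k(2)[of "x - y" x] mult_left_mono[OF True \<open>0 \<le> L\<close>] by simp
        then show ?thesis by (simp add: abs_mult mult.commute[of _ "\<bar>a y\<bar>"] mult_left_mono)
      qed (use a(3) in auto)
    qed
    finally show ?thesis by simp
  qed
qed

text \<open>Two geometric series, one on either side of \<open>i\<close>.\<close>

lemma sum_power_dist_le:
  fixes q :: real assumes "0 < q" "q < 1"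
  shows "(\<Sum>j<J. q ^ (if i \<le> j then j - i else i - j)) \<le> 2 / (1 - q)" (is "sum ?f _ \<le> _")
proof -
  have geo: "(\<Sum>k<n. q ^ k) \<le> 1 / (1 - q)" for n :: nat
    using assms by (simp add: sum_gp_strict divide_right_mono)
  have "sum ?f {..<J} \<le> sum ?f ({..<i} \<union> {i..<i + J})"
    using assms by (intro sum_mono2) auto
  also have "\<dots> = sum ?f {..<i} + sum ?f {i..<i + J}"
    by (rule sum.union_disjoint) auto
  also have "sum ?f {i..<i + J} = (\<Sum>k<J. q ^ k)"
    using sum.shift_bounds_nat_ivl[of ?f 0 i J] by (simp add: add.commute lessThan_atLeast0)
  also have "sum ?f {..<i} = (\<Sum>j<i. q * q ^ (i - Suc j))"
    by (rule sum.cong) (auto simp: power_Suc[symmetric] Suc_diff_Suc simp del: power_Suc)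
  also have "\<dots> = q * (\<Sum>k<i. q ^ k)"
    by (simp add: sum_distrib_left[symmetric] sum.nat_diff_reindex)
  also have "\<dots> \<le> 1 * (1 / (1 - q))"
    using assms geo by (intro mult_mono) (auto intro: sum_nonneg)
  finally show ?thesis using geo[of J] by simp
qed

text \<open>Almost orthogonality in the manner of Cotlar and Stein. Let T_j be the convolution with
  the kernel at scale \<open>q ^ j\<close>, S the sum of the squares and G the sum of T_j* T_j f.
  Pairing with \<open>f\<close> gives S at most |f| |G|, and |G|^2 is at most a constant times S
  because T_i T_j* has norm of order q^|i-j|. Hence S is at most C |f|^2, whatever the number
  \<open>J\<close> of terms.\<close>

lemma square_function:
  fixes b :: "'a::euclidean_space \<Rightarrow> real"
  assumes b: "Cc b" "(\<integral>x. b x \<partial>lborel) = 0" "\<And>x y. \<bar>b x - b y\<bar> \<le> L * norm (x - y)"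
    and q: "0 < q" "q < 1"
  obtains C where "0 \<le> C" "\<And>J f. Cc f \<Longrightarrow> (\<Sum>j<J. (n2 (conv (dil (q ^ j) b) f))\<^sup>2) \<le> C * (n2 f)\<^sup>2"
proof -
  have "bounded (supp b)" using b(1) by (simp add: Cc_def compact_imp_bounded)
  then obtain R where R: "R > 0" "\<And>x. x \<in> supp b \<Longrightarrow> norm x \<le> R" by (auto simp: bounded_pos)
  then have bR: "\<And>x. R < norm x \<Longrightarrow> b x = 0" using zero_outside_supp[of _ b] by fastforce
  let ?D = "DIM('a)"
  let ?A = "\<integral>x. \<bar>b x\<bar> \<partial>lborel"
  define K where "K = L * R * ?A * (4 * R) ^ ?D"
  have "norm (One::'a) > 0" by simp
  then have L: "0 \<le> L" using order_trans[OF abs_ge_zero b(3)[of One 0]] by (simp add: zero_le_mult_iff)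
  have K: "K \<ge> 0" unfolding K_def using L R by (intro mult_nonneg_nonneg) (auto simp: Bochner_Integration.integral_nonneg)
  let ?b = "\<lambda>j. dil (q ^ j) b"
  let ?r = "\<lambda>j. dil (q ^ j) (\<lambda>y. b (- y))"
  have qj: "q ^ j > 0" for j using q by simp
  have Cb: "Cc (?b j)" "Cc (?r j)" for j
    using b(1) qj by (auto intro!: Cc_dil Cc_uminus)
  have refl: "(\<lambda>y. ?r j (- y)) = ?b j" "(\<lambda>y. ?b j (- y)) = ?r j" for j
    by (auto simp: dil_def)
  \<comment> \<open>\<open>t\<close> is the finer scale: its kernel supplies the mean zero, the
    coarser one the Lipschitz constant, of order s^-(d+1) in dimension d. The volume, of order s^d,
    leaves the gain \<open>t / s\<close>.\<close>
  have main: "(\<integral>x. \<bar>conv (dil t a) (dil s k) x\<bar> \<partial>lborel) \<le> K * (t / s)"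
    if ak: "Cc a" "Cc k" "(\<integral>x. a x \<partial>lborel) = 0" "\<And>x. R < norm x \<Longrightarrow> a x = 0"
      "\<And>x. R < norm x \<Longrightarrow> k x = 0" "\<And>x y. \<bar>k x - k y\<bar> \<le> L * norm (x - y)"
      "(\<integral>x. \<bar>a x\<bar> \<partial>lborel) = ?A" and ts: "0 < t" "t \<le> s" for a k :: "'a \<Rightarrow> real" and t s
  proof -
    have s: "s > 0" using ts by simp
    have "(\<integral>x. \<bar>conv (dil t a) (dil s k) x\<bar> \<partial>lborel)
      \<le> L / s ^ Suc ?D * (t * R) * (\<integral>x. \<bar>dil t a x\<bar> \<partial>lborel) * (2 * (t * R + s * R)) ^ ?D"
      using ak ts s R(1) dil_support[OF ts(1) ak(4)] dil_support[OF s ak(5)] dil_Lipschitz[OF s ak(6)]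
      by (intro integral_abs_conv_le) (auto intro: Cc_dil simp: integral_dil)
    also have "\<dots> \<le> L / s ^ Suc ?D * (t * R) * ?A * (4 * s * R) ^ ?D"
    proof -
      have "2 * (t * R + s * R) \<le> 4 * s * R" using ts R mult_right_mono[OF ts(2), of R] by (simp add: algebra_simps)
      then have "(2 * (t * R + s * R)) ^ ?D \<le> (4 * s * R) ^ ?D"
        using ts R s by (intro power_mono) auto
      then show ?thesis
        unfolding integral_abs_dil[OF ts(1)] ak(7)
        using L ts R s by (intro mult_left_mono mult_nonneg_nonneg)
          (auto simp: Bochner_Integration.integral_nonneg)
    qed
    also have "\<dots> = K * (t / s)"
      using s by (simp add: K_def power_mult_distrib field_simps)
    finally show ?thesis .
  qed
  \<comment> \<open>Convolution commutes, so whichever of the two kernels is the finer can play the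
    part of the one with mean zero.\<close>
  have ker: "(\<integral>x. \<bar>conv (?b i) (?r j) x\<bar> \<partial>lborel) \<le> K * q ^ (if i \<le> j then j - i else i - j)" for i j
  proof -
    have r: "Cc (\<lambda>y. b (- y))" "(\<integral>x. b (- x) \<partial>lborel) = 0" "\<And>x. R < norm x \<Longrightarrow> b (- x) = 0"
      "\<And>x y. \<bar>b (- x) - b (- y)\<bar> \<le> L * norm (x - y)" "(\<integral>x. \<bar>b (- x)\<bar> \<partial>lborel) = ?A"
      using Cc_uminus[OF b(1)] lborel_integral_reflect[of b 0] b(2) bR b(3)
        lborel_integral_reflect[of "\<lambda>x. \<bar>b x\<bar>" 0]
      by (auto, metis minus_diff_eq minus_diff_minus norm_minus_cancel)
    show ?thesis
    proof (cases "i \<le> j")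
      case True
      have "(\<integral>x. \<bar>conv (?r j) (?b i) x\<bar> \<partial>lborel) \<le> K * (q ^ j / q ^ i)"
        using q True by (intro main b r bR) (auto intro: power_decreasing)
      then show ?thesis using True q by (simp add: conv_commute[of "?r j"] power_diff)
    next
      case False
      have "(\<integral>x. \<bar>conv (?b i) (?r j) x\<bar> \<partial>lborel) \<le> K * (q ^ i / q ^ j)"
        using q False by (intro main b r bR) (auto intro: power_decreasing)
      then show ?thesis using False q by (simp add: power_diff)
    qed
  qed
  define C where "C = K * (2 / (1 - q))"
  have "(\<Sum>j<J. (n2 (conv (?b j) f))\<^sup>2) \<le> C * (n2 f)\<^sup>2" if f: "Cc f" for J f
  proof -
    let ?F = "\<lambda>j. conv (?b j) f"
    let ?N = "\<lambda>j. n2 (?F j)"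
    let ?S = "\<Sum>j<J. (?N j)\<^sup>2"
    let ?G = "\<lambda>x. \<Sum>j<J. conv (?r j) (?F j) x"
    let ?w = "\<lambda>i j. q ^ (if i \<le> j then j - i else i - j)"
    have F: "Cc (?F j)" for j by (rule Cc_conv[OF Cb(1) f])
    have rF: "Cc (conv (?r j) (?F j))" for j by (rule Cc_conv[OF Cb(2) F])
    have G: "Cc ?G" by (intro Cc_sum rF)
    have "?S = (\<Sum>j<J. \<integral>x. f x * conv (?r j) (?F j) x \<partial>lborel)"
      unfolding n2_power2 using conv_adjoint[OF Cb(1) f F] by (simp add: refl)
    also have "\<dots> = (\<integral>x. f x * ?G x \<partial>lborel)"
      unfolding sum_distrib_left
      by (rule Bochner_Integration.integral_sum[symmetric]) (intro Cc_integrable Cc_mult2 f rF)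
    also have "\<dots> \<le> n2 f * n2 ?G"
      using n2_CS_Cc[OF f G] by simp
    finally have S1: "?S \<le> n2 f * n2 ?G" .
    \<comment> \<open>Schur test: the weights \<open>?w\<close> are symmetric with bounded row sums,
      so splitting each \<open>?N i * ?N j\<close> by the arithmetic-geometric mean leaves a
      multiple of \<open>?S\<close>.\<close>
    have "(n2 ?G)\<^sup>2 = (\<Sum>i<J. \<Sum>j<J. \<integral>x. conv (?r i) (?F i) x * conv (?r j) (?F j) x \<partial>lborel)"
      unfolding n2_power2 sum_product
      using Cc_integrable[OF Cc_mult2[OF rF rF]] by (subst Bochner_Integration.integral_sum; simp)+
    also have "\<dots> \<le> (\<Sum>i<J. \<Sum>j<J. K * ?w i j * (((?N i)\<^sup>2 + (?N j)\<^sup>2) / 2))"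
    proof (intro sum_mono)
      fix i j
      have "(\<integral>x. conv (?r i) (?F i) x * conv (?r j) (?F j) x \<partial>lborel)
          = (\<integral>x. ?F i x * conv (?b i) (conv (?r j) (?F j)) x \<partial>lborel)"
        using conv_adjoint[OF Cb(2) F rF] by (simp add: refl)
      also have "\<dots> \<le> ?N i * n2 (conv (?b i) (conv (?r j) (?F j)))"
        using n2_CS_Cc[OF F Cc_conv[OF Cb(1) rF]] by (rule order_trans[OF abs_ge_self])
      also have "n2 (conv (?b i) (conv (?r j) (?F j))) \<le> (K * ?w i j) * ?N j"
        unfolding conv_assoc[OF Cb(1) Cb(2) F]
        by (rule order_trans[OF conv_Young[OF Cc_conv[OF Cb] F] mult_right_mono[OF ker]]) simp
      also have "?N i * ((K * ?w i j) * ?N j) = (K * ?w i j) * (?N i * ?N j)" by simp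
      also have "\<dots> \<le> (K * ?w i j) * (((?N i)\<^sup>2 + (?N j)\<^sup>2) / 2)"
        using K q sum_squares_bound[of "?N i" "?N j"] by (intro mult_left_mono mult_nonneg_nonneg) auto
      finally show "(\<integral>x. conv (?r i) (?F i) x * conv (?r j) (?F j) x \<partial>lborel)
        \<le> K * ?w i j * (((?N i)\<^sup>2 + (?N j)\<^sup>2) / 2)" by (simp add: mult_left_mono)
    qed
    also have "\<dots> = K / 2 * ((\<Sum>i<J. \<Sum>j<J. ?w i j * (?N i)\<^sup>2) + (\<Sum>i<J. \<Sum>j<J. ?w i j * (?N j)\<^sup>2))"
      by (simp add: sum_distrib_left sum.distrib[symmetric] algebra_simps add_divide_distrib)
    also have "(\<Sum>i<J. \<Sum>j<J. ?w i j * (?N j)\<^sup>2) = (\<Sum>i<J. \<Sum>j<J. ?w i j * (?N i)\<^sup>2)"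
      by (subst sum.swap) (auto intro!: sum.cong)
    also have "(\<Sum>i<J. \<Sum>j<J. ?w i j * (?N i)\<^sup>2) = (\<Sum>i<J. (?N i)\<^sup>2 * (\<Sum>j<J. ?w i j))"
      by (simp add: sum_distrib_left mult.commute)
    also have "\<dots> \<le> (\<Sum>i<J. (?N i)\<^sup>2 * (2 / (1 - q)))"
      by (intro sum_mono mult_left_mono sum_power_dist_le q) auto
    also have "K / 2 * ((\<Sum>i<J. (?N i)\<^sup>2 * (2 / (1 - q))) + (\<Sum>i<J. (?N i)\<^sup>2 * (2 / (1 - q)))) = C * ?S"
      unfolding sum_distrib_right[symmetric] C_def by simp
    finally have G2: "(n2 ?G)\<^sup>2 \<le> C * ?S" using K by (simp add: mult_left_mono)
    have S0: "?S \<ge> 0" by (simp add: sum_nonneg)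
    have "?S\<^sup>2 \<le> (n2 f * n2 ?G)\<^sup>2" using S1 S0 by (rule power_mono)
    also have "\<dots> \<le> (n2 f)\<^sup>2 * (C * ?S)"
      unfolding power_mult_distrib using G2 by (intro mult_left_mono) auto
    finally have "?S * ?S \<le> (C * (n2 f)\<^sup>2) * ?S" by (simp add: power2_eq_square mult.commute mult.left_commute)
    moreover have "0 \<le> C * (n2 f)\<^sup>2" using K q by (simp add: C_def)
    ultimately show ?thesis using S0 mult_right_le_imp_le[of ?S ?S "C * (n2 f)\<^sup>2"] by (cases "?S = 0") auto
  qed
  moreover have "0 \<le> C" using K q by (simp add: C_def)
  ultimately show ?thesis using that by blast
qed

section \<open>Smooth functions of one variable\<close>

primrec Dk :: "nat \<Rightarrow> (real \<Rightarrow> real) \<Rightarrow> bool" where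
  "Dk 0 f \<longleftrightarrow> continuous_on UNIV f"
| "Dk (Suc k) f \<longleftrightarrow> (\<exists>f'. (\<forall>x. (f has_real_derivative f' x) (at x)) \<and> Dk k f')"

lemma DERIV_imp_continuous_on:
  fixes f :: "real \<Rightarrow> real"
  assumes "\<And>x. (f has_real_derivative f' x) (at x)" shows "continuous_on S f"
  using assms by (intro continuous_at_imp_continuous_on ballI DERIV_isCont)

lemma Dk_continuous: "Dk k f \<Longrightarrow> continuous_on UNIV f"
  by (cases k) (auto intro: DERIV_imp_continuous_on)

lemma Dk_Suc_imp: "Dk (Suc k) f \<Longrightarrow> Dk k f"
proof (induction k arbitrary: f)
  case 0
  then show ?case using Dk_continuous by (metis Dk.simps(1))
qed (metis Dk.simps(2))

lemma Dk_add: "Dk k f \<Longrightarrow> Dk k g \<Longrightarrow> Dk k (\<lambda>x. f x + g x)"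
proof (induction k arbitrary: f g)
  case (Suc k)
  then obtain f' g' where d: "\<And>x. (f has_real_derivative f' x) (at x)" "Dk k f'"
    "\<And>x. (g has_real_derivative g' x) (at x)" "Dk k g'" by auto
  show ?case
    unfolding Dk.simps
    by (rule exI[of _ "\<lambda>x. f' x + g' x"]) (use d Suc.IH in \<open>auto intro!: derivative_eq_intros\<close>)
qed (auto intro: continuous_on_add)

lemma Dk_mult: "Dk k f \<Longrightarrow> Dk k g \<Longrightarrow> Dk k (\<lambda>x. f x * g x)"
proof (induction k arbitrary: f g)
  case (Suc k)
  then obtain f' g' where d: "\<And>x. (f has_real_derivative f' x) (at x)" "Dk k f'"
    "\<And>x. (g has_real_derivative g' x) (at x)" "Dk k g'" by auto
  moreover have "Dk k f" "Dk k g" using Suc.prems Dk_Suc_imp by blast+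
  ultimately show ?case
    unfolding Dk.simps
    by (intro exI[of _ "\<lambda>x. f' x * g x + g' x * f x"])
      (use Suc.IH in \<open>auto intro!: DERIV_mult Dk_add\<close>)
qed (auto intro: continuous_on_mult)

lemma Dk_const: "Dk k (\<lambda>x. c)"
  by (induction k arbitrary: c) (auto intro!: exI[of _ "\<lambda>x. 0"])

lemma Dk_affine: "Dk k f \<Longrightarrow> Dk k (\<lambda>x. f (c * x + t))"
proof (induction k arbitrary: f)
  case 0
  then show ?case by (auto intro!: continuous_intros continuous_on_compose2[of UNIV f])
next
  case (Suc k)
  then obtain f' where d: "\<And>x. (f has_real_derivative f' x) (at x)" "Dk k f'" by auto
  have "((\<lambda>x. f (c * x + t)) has_real_derivative c * f' (c * x + t)) (at x)" for x
  proof -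
    have "((\<lambda>x. c * x + t) has_real_derivative c) (at x)" by (auto intro!: derivative_eq_intros)
    from DERIV_chain2[OF d(1) this] show ?thesis by (simp add: mult.commute)
  qed
  moreover have "Dk k (\<lambda>x. c * f' (c * x + t))"
    by (intro Dk_mult Dk_const Suc.IH d)
  ultimately show ?case by (auto intro!: exI[of _ "\<lambda>x. c * f' (c * x + t)"])
qed

definition smooth1 :: "(real \<Rightarrow> real) \<Rightarrow> bool" where
  "smooth1 f \<longleftrightarrow> (\<forall>k. Dk k f)"

lemma smooth1_continuous: "smooth1 f \<Longrightarrow> continuous_on UNIV f"
  using Dk_continuous smooth1_def by blast

lemma smooth1_antiderivative:
  "(\<And>x. (F has_real_derivative f x) (at x)) \<Longrightarrow> smooth1 f \<Longrightarrow> smooth1 F"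
  unfolding smooth1_def by (metis Dk.simps(2) Dk_Suc_imp)

lemma smooth1_intros:
  shows smooth1_const: "smooth1 (\<lambda>x. c)"
    and smooth1_add: "smooth1 f \<Longrightarrow> smooth1 g \<Longrightarrow> smooth1 (\<lambda>x. f x + g x)"
    and smooth1_mult: "smooth1 f \<Longrightarrow> smooth1 g \<Longrightarrow> smooth1 (\<lambda>x. f x * g x)"
    and smooth1_affine: "smooth1 f \<Longrightarrow> smooth1 (\<lambda>x. f (c * x + t))"
  by (auto simp: smooth1_def Dk_const Dk_add Dk_mult Dk_affine)

lemma C_inf_smooth1_component:
  assumes "smooth1 g" shows "C_inf (\<lambda>x::real^'d::finite. g (x $ i))"
  unfolding C_inf_def
proof
  fix k
  have "Dk k g" using assms by (simp add: smooth1_def)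
  then show "C_k k (\<lambda>x::real^'d. g (x $ i))"
  proof (induction k arbitrary: g)
    case 0
    then show ?case by (auto intro!: continuous_intros continuous_on_compose2[of UNIV g])
  next
    case (Suc k)
    then obtain g' where g': "\<And>x. (g has_real_derivative g' x) (at x)" "Dk k g'" by auto
    have d: "((\<lambda>x::real^'d. g (x $ i)) has_derivative (\<lambda>h. h $ i * g' (x $ i))) (at x)" for x
    proof -
      have "(g has_derivative (\<lambda>h. g' (x $ i) * h)) (at (x $ i))"
        using g'(1)[of "x $ i"] by (simp add: has_field_derivative_def)
      from has_derivative_compose[OF has_derivative_component this]
      show ?thesis by (simp add: mult.commute)
    qed
    have "partial_deriv j (\<lambda>x::real^'d. g (x $ i)) = (\<lambda>x. (if i = j then 1 else 0) * g' (x $ i))" for j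
      by (rule ext, subst partial_deriv_eq[OF d]) (auto simp: axis_def)
    moreover have "C_k k (\<lambda>x::real^'d. (if i = j then 1 else 0) * g' (x $ i))" for j
      by (intro C_k_mult C_k_const Suc.IH g')
    ultimately show ?case using d by (auto simp: differentiable_def)
  qed
qed

section \<open>A function flat at the origin, and smooth bumps\<close>

definition flat :: "real poly \<Rightarrow> real \<Rightarrow> real" where
  "flat p x = (if x > 0 then poly p (1 / x) * exp (- (1 / x)) else 0)"

lemma poly_exp_tendsto_0: "((\<lambda>x::real. poly p x * exp (- x)) \<longlongrightarrow> 0) at_top"
proof -
  have "((\<lambda>x. \<Sum>i\<le>degree p. coeff p i * (x ^ i / exp x)) \<longlongrightarrow> (\<Sum>i\<le>degree p. coeff p i * 0)) at_top"
    by (intro tendsto_sum tendsto_mult tendsto_const tendsto_power_div_exp_0)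
  moreover have "(\<lambda>x. \<Sum>i\<le>degree p. coeff p i * (x ^ i / exp x)) = (\<lambda>x. poly p x * exp (- x))"
    by (simp add: fun_eq_iff poly_altdef sum_distrib_right exp_minus divide_inverse mult.assoc)
  ultimately show ?thesis by simp
qed

text \<open>Differentiation acts on the polynomials p in t = 1/x as p -> t^2 (p - p'). The family of
  all \<open>flat p\<close> is closed under it, so smoothness follows by induction with
  \<open>p\<close> arbitrary.\<close>

lemma flat_deriv: "(flat p has_real_derivative flat ([:0, 0, 1:] * (p - pderiv p)) x) (at x)"
proof -
  consider "x > 0" | "x < 0" | "x = 0" by linarith
  then show ?thesis
  proof cases
    case 1
    have a: "((\<lambda>x. 1 / x) has_real_derivative - (1 / x\<^sup>2)) (at x)"
      using 1 by (auto intro!: derivative_eq_intros simp: power2_eq_square)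
    have "((\<lambda>x. exp (- (1 / x))) has_real_derivative exp (- (1 / x)) * (1 / x\<^sup>2)) (at x)"
      using DERIV_chain2[OF DERIV_exp DERIV_minus[OF a]] by simp
    from DERIV_mult[OF DERIV_chain2[OF poly_DERIV a] this]
    have "((\<lambda>x. poly p (1 / x) * exp (- (1 / x))) has_real_derivative
        poly ([:0, 0, 1:] * (p - pderiv p)) (1 / x) * exp (- (1 / x))) (at x)"
      by (rule DERIV_cong) (use 1 in \<open>simp add: field_simps power2_eq_square\<close>)
    then have "((\<lambda>x. poly p (1 / x) * exp (- (1 / x))) has_real_derivative
        flat ([:0, 0, 1:] * (p - pderiv p)) x) (at x)"
      using 1 by (simp add: flat_def)
    then show ?thesis
      by (rule has_field_derivative_transform_within_open[where S="{0<..}"])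
        (use 1 in \<open>auto simp: flat_def\<close>)
  next
    case 2
    have "((\<lambda>x. 0) has_real_derivative flat ([:0, 0, 1:] * (p - pderiv p)) x) (at x)"
      using 2 by (simp add: flat_def)
    then show ?thesis
      by (rule has_field_derivative_transform_within_open[where S="{..<0}"])
        (use 2 in \<open>auto simp: flat_def\<close>)
  next
    case 3
    \<comment> \<open>At 0 the difference quotient from the right is of the same kind: dividing by
      \<open>h\<close> multiplies the polynomial by its variable, and the exponential wins.\<close>
    have "((\<lambda>h. poly ([:0, 1:] * p) (inverse h) * exp (- inverse h)) \<longlongrightarrow> 0) (at_right 0)"
      by (rule filterlim_compose[OF poly_exp_tendsto_0 filterlim_inverse_at_top_right])
    then have "((\<lambda>h. (flat p (0 + h) - flat p 0) / h) \<longlongrightarrow> 0) (at_right 0)"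
      by (rule Lim_transform_eventually)
        (auto simp: eventually_at_filter flat_def field_simps intro!: always_eventually)
    moreover have "((\<lambda>h. (flat p (0 + h) - flat p 0) / h) \<longlongrightarrow> 0) (at_left 0)"
      by (rule Lim_transform_eventually[OF tendsto_const])
        (auto simp: eventually_at_filter flat_def intro!: always_eventually)
    ultimately have "((\<lambda>h. (flat p (0 + h) - flat p 0) / h) \<longlongrightarrow> 0) (at 0)"
      by (simp add: filterlim_split_at)
    then show ?thesis using 3 by (simp add: DERIV_def flat_def)
  qed
qed

lemma smooth1_flat: "smooth1 (flat p)"
  unfolding smooth1_def
proof
  fix k show "Dk k (flat p)"
  proof (induction k arbitrary: p)
    case 0
    show ?case
      using DERIV_imp_continuous_on[OF flat_deriv] by simp
  next
    case (Suc k)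
    then show ?case using flat_deriv by auto
  qed
qed

lemma antiderivative_compact:
  fixes g :: "real \<Rightarrow> real"
  assumes g: "continuous_on UNIV g" "\<And>x. x \<le> l \<Longrightarrow> g x = 0" "\<And>x. u \<le> x \<Longrightarrow> g x = 0" "l \<le> u"
  obtains G where "\<And>x. (G has_real_derivative g x) (at x)" "\<And>x. x \<le> l \<Longrightarrow> G x = 0"
    "\<And>x. u \<le> x \<Longrightarrow> G x = (\<integral>x. g x \<partial>lborel)"
proof -
  \<comment> \<open>Starting at \<open>l - 1\<close> instead of \<open>l\<close> makes every
    \<open>x \<ge> l\<close> an interior point of \<open>{l - 1..x + 1}\<close>, so the derivative
    within that interval is a two-sided one.\<close>
  let ?G = "\<lambda>x. integral {l - 1..x} g"
  have z: "?G x = 0" if "x \<le> l" for x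
    using that g by (subst integral_cong[of _ _ "\<lambda>x. 0"]) auto
  have d: "(?G has_real_derivative g x) (at x)" for x
  proof (cases "x < l")
    case True
    have "((\<lambda>x. 0) has_real_derivative g x) (at x)" using True g by simp
    then show ?thesis
      by (rule has_field_derivative_transform_within_open[where S="{..<l}"]) (use True z in auto)
  next
    case False
    have "(?G has_real_derivative g x) (at x within {l - 1..x + 1})"
      using False g by (intro integral_has_real_derivative continuous_on_subset[OF g(1)]) auto
    then show ?thesis
      using False by (subst (asm) at_within_Icc_at) auto
  qed
  have "?G x = (\<integral>x. g x \<partial>lborel)" if "u \<le> x" for x
  proof -
    have "(\<integral>y. g y * indicat_real {l..x} y \<partial>lborel) = ?G x - ?G l"
      using d g that by (intro integral_FTC_Icc_real) (auto simp: continuous_on_eq_continuous_at)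
    moreover have "(\<lambda>y. g y * indicat_real {l..x} y) = g"
    proof
      fix y
      show "g y * indicat_real {l..x} y = g y"
        using g(2)[of y] g(3)[of y] that by (cases "y \<le> l"; cases "u \<le> y") auto
    qed
    ultimately show ?thesis using z[of l] by simp
  qed
  then show ?thesis using that[of ?G] d z by blast
qed

lemma bump1:
  obtains \<beta> where "smooth1 \<beta>" "\<And>x. x \<le> 0 \<Longrightarrow> \<beta> x = 0" "\<And>x. 1 \<le> x \<Longrightarrow> \<beta> x = 0" "\<And>x. 0 \<le> \<beta> x"
    "(\<integral>x. \<beta> x \<partial>lborel) = (1::real)"
proof -
  let ?b = "\<lambda>x. flat [:1:] x * flat [:1:] ((-1) * x + 1)"
  have s: "smooth1 ?b" by (intro smooth1_intros smooth1_flat)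
  have z: "\<And>x. x \<le> 0 \<Longrightarrow> ?b x = 0" "\<And>x. 1 \<le> x \<Longrightarrow> ?b x = 0" "\<And>x. 0 \<le> ?b x"
    by (auto simp: flat_def)
  have p: "0 < ?b x" if "0 < x" "x < 1" for x using that by (auto simp: flat_def)
  obtain G where G: "\<And>x. (G has_real_derivative ?b x) (at x)" "\<And>x. x \<le> 0 \<Longrightarrow> G x = 0"
    "\<And>x. 1 \<le> x \<Longrightarrow> G x = (\<integral>x. ?b x \<partial>lborel)"
    using antiderivative_compact[OF smooth1_continuous[OF s], of 0 1] z by auto
  \<comment> \<open>The mass is positive because the antiderivative increases strictly where the
    integrand is positive.\<close>
  have "G 0 < G 1"
    by (rule DERIV_pos_imp_increasing_open)
      (use G(1) p DERIV_imp_continuous_on[OF G(1)] in auto)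
  then have pos: "(\<integral>x. ?b x \<partial>lborel) > 0" using G by simp
  show ?thesis
  proof (rule that[of "\<lambda>x. (1 / (\<integral>x. ?b x \<partial>lborel)) * ?b x"])
    show "smooth1 (\<lambda>x. (1 / (\<integral>x. ?b x \<partial>lborel)) * ?b x)"
      by (rule smooth1_mult[OF smooth1_const s])
  qed (use z pos in auto)
qed

section \<open>Mollifiers with vanishing first moments\<close>

text \<open>With \<Theta> an antiderivative of \<open>\<theta>\<close>, \<open>A\<close> is
  \<Theta>(x/q) - \<Theta>(x), nonzero only near the two transition zones. Integration by parts
  gives it the integral (1 - q) m, where m is the first moment of \<open>\<theta>\<close>; so m has
  to be 0 although \<open>\<theta>\<close> sits near \<open>c\<close>. The bound on
  \<open>(1 - q) * \<bar>c\<bar>\<close> keeps the zone of the dilated function in the same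
  window.\<close>

lemma kernel1:
  fixes c \<epsilon> q :: real
  assumes e: "\<epsilon> > 0" and q: "0 < q" "q < 1" "(1 - q) * \<bar>c\<bar> \<le> \<epsilon> / 2"
  obtains \<theta> A where "smooth1 \<theta>" "smooth1 A"
    "\<And>x. (A has_real_derivative \<theta> (x / q) / q - \<theta> x) (at x)"
    "\<And>x. \<theta> x \<noteq> 0 \<Longrightarrow> \<bar>x - c\<bar> \<le> \<epsilon>" "\<And>x. \<theta> (x / q) \<noteq> 0 \<Longrightarrow> \<bar>x - c\<bar> \<le> \<epsilon>"
    "\<And>x. A x \<noteq> 0 \<Longrightarrow> \<bar>x - c\<bar> \<le> \<epsilon>"
    "(\<integral>x. \<theta> x \<partial>lborel) = 1" "(\<integral>x. A x \<partial>lborel) = 0"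
proof -
  obtain \<beta> where \<beta>: "smooth1 \<beta>" "\<And>x. x \<le> 0 \<Longrightarrow> \<beta> x = 0" "\<And>x. 1 \<le> x \<Longrightarrow> \<beta> x = 0" "\<And>x. 0 \<le> \<beta> x"
    "(\<integral>x. \<beta> x \<partial>lborel) = (1::real)" by (rule bump1) blast
  \<comment> \<open>A quarter of \<epsilon>: the bumps need \<open>d\<close> on either side of
    \<open>c\<close>, and the dilation by \<open>q\<close> may shift this zone by up to
    \<epsilon>/2.\<close>
  define d where "d = \<epsilon> / 4"
  have d: "d > 0" using e by (simp add: d_def)
  define m where "m = (\<integral>x. x * \<beta> x \<partial>lborel)"
  have cc\<beta>: "Cc \<beta>"
    by (rule CcI[of _ "{0..1}"]) (use \<beta> smooth1_continuous in \<open>auto simp: not_le intro: ccontr less_imp_le\<close>)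
  define B where "B t x = (1 / d) * \<beta> ((1 / d) * x + (- t / d))" for t x
  have B_smooth: "smooth1 (B t)" for t
    unfolding B_def[abs_def] by (intro smooth1_mult[OF smooth1_const] smooth1_affine \<beta>)
  have B_zero: "B t x = 0" if "x \<le> t \<or> t + d \<le> x" for t x
  proof -
    have "(1 / d) * x + (- t / d) = (x - t) / d" using d by (simp add: field_simps)
    moreover have "(x - t) / d \<le> 0 \<or> 1 \<le> (x - t) / d" using that d by (auto simp: field_simps)
    ultimately show ?thesis using \<beta>(2,3) by (auto simp: B_def)
  qed
  have B_Cc: "Cc (B t)" for t
    by (rule CcI[of _ "{t..t+d}"]) (use B_smooth B_zero smooth1_continuous in \<open>auto simp: not_le intro: ccontr less_imp_le\<close>)
  have B_arg: "B t (t + d * x) = (1 / d) * \<beta> x" for t x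
    using d by (simp add: B_def field_simps)
  have B_int: "(\<integral>x. B t x \<partial>lborel) = 1" for t
    using lborel_integral_affine[of d "B t" t] d \<beta>(5) by (simp add: B_arg)
  have B_mom: "(\<integral>x. x * B t x \<partial>lborel) = t + d * m" for t
  proof -
    have i: "integrable lborel \<beta>" "integrable lborel (\<lambda>x. x * \<beta> x)"
      by (auto intro!: Cc_integrable cc\<beta> Cc_mult)
    have "(\<integral>x. x * B t x \<partial>lborel) = d * (\<integral>x. (t + d * x) * ((1 / d) * \<beta> x) \<partial>lborel)"
      using lborel_integral_affine[of d "\<lambda>x. x * B t x" t] d by (simp add: B_arg)
    also have "(\<lambda>x. (t + d * x) * ((1 / d) * \<beta> x)) = (\<lambda>x. (t / d) * \<beta> x + x * \<beta> x)"
      using d by (auto simp: fun_eq_iff field_simps)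
    also have "(\<integral>x. (t / d) * \<beta> x + x * \<beta> x \<partial>lborel) = t / d + m"
      using i \<beta>(5) by (simp add: m_def)
    finally show ?thesis using d by (simp add: distrib_left)
  qed
  \<comment> \<open>two shifted bumps, weighted so that the mass is 1 and the first moment vanishes\<close>
  define a where "a = (c + d * m) / d"
  define \<theta> where "\<theta> x = a * B (c - d) x + (1 - a) * B c x" for x
  have \<theta>_smooth: "smooth1 \<theta>"
    unfolding \<theta>_def[abs_def] by (intro smooth1_intros B_smooth)
  have \<theta>_zero: "\<theta> x = 0" if "x \<le> c - d \<or> c + d \<le> x" for x
    using that B_zero[of x "c - d"] B_zero[of x c] d by (auto simp: \<theta>_def)
  have \<theta>_Cc: "Cc \<theta>" unfolding \<theta>_def[abs_def] by (intro Cc_add Cc_cmult B_Cc)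
  have \<theta>_int: "(\<integral>x. \<theta> x \<partial>lborel) = 1"
    using Cc_integrable[OF B_Cc] by (simp add: \<theta>_def B_int)
  have \<theta>_mom: "(\<integral>x. x * \<theta> x \<partial>lborel) = 0"
  proof -
    have i: "integrable lborel (\<lambda>x. x * B t x)" for t by (intro Cc_integrable Cc_mult B_Cc) auto
    have "(\<lambda>x. x * \<theta> x) = (\<lambda>x. a * (x * B (c - d) x) + (1 - a) * (x * B c x))"
      by (auto simp: \<theta>_def algebra_simps)
    then have "(\<integral>x. x * \<theta> x \<partial>lborel) = a * ((c - d) + d * m) + (1 - a) * (c + d * m)"
      using i by (simp add: B_mom)
    also have "\<dots> = c + d * m - a * d" by (simp add: algebra_simps)
    also have "\<dots> = 0" using d by (simp add: a_def)
    finally show ?thesis .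
  qed
  have \<theta>_nz: "\<bar>x - c\<bar> \<le> d" if "\<theta> x \<noteq> 0" for x
  proof -
    have "\<not> (x \<le> c - d \<or> c + d \<le> x)" using \<theta>_zero[of x] that by blast
    then show ?thesis by (auto simp: abs_le_iff)
  qed
  obtain \<Theta> where \<Theta>: "\<And>x. (\<Theta> has_real_derivative \<theta> x) (at x)" "\<And>x. x \<le> c - d \<Longrightarrow> \<Theta> x = 0"
    "\<And>x. c + d \<le> x \<Longrightarrow> \<Theta> x = 1"
    using antiderivative_compact[OF smooth1_continuous[OF \<theta>_smooth], of "c - d" "c + d"] \<theta>_zero d \<theta>_int
    by auto
  have \<Theta>_smooth: "smooth1 \<Theta>" using \<Theta>(1) \<theta>_smooth by (rule smooth1_antiderivative)
  define A where "A x = \<Theta> ((1/q) * x + 0) + (-1) * \<Theta> x" for x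
  have A_smooth: "smooth1 A"
    unfolding A_def[abs_def] by (intro smooth1_add smooth1_mult[OF smooth1_const] smooth1_affine \<Theta>_smooth)
  have A_deriv: "(A has_real_derivative \<theta> (x / q) / q - \<theta> x) (at x)" for x
  proof -
    have "((\<lambda>x. (1/q) * x + 0) has_real_derivative 1 / q) (at x)"
      using q by (auto intro!: derivative_eq_intros)
    from DERIV_chain2[OF \<Theta>(1) this]
    have "((\<lambda>x. \<Theta> ((1/q) * x + 0)) has_real_derivative \<theta> (x / q) / q) (at x)" by simp
    from DERIV_add[OF this DERIV_cmult[OF \<Theta>(1), of "-1"]] show ?thesis
      unfolding A_def[abs_def] by simp
  qed
  have lo: "x / q \<le> c - d" if "x < c - \<epsilon>" for x
  proof -
    have "(1 - q) * (c - d) \<le> (1 - q) * \<bar>c\<bar>" using q d by (intro mult_left_mono) auto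
    moreover have "q * (c - d) = (c - d) - (1 - q) * (c - d)" by (simp add: algebra_simps)
    moreover have "d = \<epsilon> / 4" by (simp add: d_def)
    ultimately have "x \<le> q * (c - d)" using that q(3) e by linarith
    then show ?thesis using q by (simp add: field_simps)
  qed
  have hi: "c + d \<le> x / q" if "c + \<epsilon> < x" for x
  proof -
    have "(1 - q) * (- c - d) \<le> (1 - q) * \<bar>c\<bar>" using q d by (intro mult_left_mono) auto
    moreover have "q * (c + d) = (c + d) + (1 - q) * (- c - d)" by (simp add: algebra_simps)
    moreover have "d = \<epsilon> / 4" by (simp add: d_def)
    ultimately have "q * (c + d) \<le> x" using that q(3) e by linarith
    then show ?thesis using q by (simp add: field_simps)
  qed
  \<comment> \<open>Outside the window \<open>x\<close> and \<open>x / q\<close> lie on the same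
    side of the transition zone, where \<Theta> is constantly 0 or constantly 1.\<close>
  have out: "\<theta> (x / q) = 0 \<and> A x = 0" if x: "\<not> \<bar>x - c\<bar> \<le> \<epsilon>" for x
  proof -
    from x consider "x < c - \<epsilon>" | "c + \<epsilon> < x" by linarith
    then show ?thesis
    proof cases
      case 1
      then have "x \<le> c - d" using e by (simp add: d_def)
      then show ?thesis using lo[OF 1] by (simp add: \<theta>_zero A_def \<Theta>)
    next
      case 2
      then have "c + d \<le> x" using e by (simp add: d_def)
      then show ?thesis using hi[OF 2] by (simp add: \<theta>_zero A_def \<Theta>)
    qed
  qed
  have A_Cc: "Cc A"
    by (rule CcI[of _ "cball c \<epsilon>"])
      (use A_smooth out smooth1_continuous in \<open>auto simp: dist_real_def abs_minus_commute\<close>)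
  have "(\<integral>x. A x \<partial>lborel) = 0"
  proof -
    let ?l = "c - \<epsilon> - 1" and ?u = "c + \<epsilon> + 1"
    \<comment> \<open>\<open>?g\<close> is the derivative of \<open>x * A x\<close>, so its integral
      vanishes; the dilated and the undilated first moment are both 0, and only the integral of
      \<open>A\<close> remains.\<close>
    let ?g = "\<lambda>x. A x + x * (\<theta> (x / q) / q - \<theta> x)"
    have q': "Cc (\<lambda>x. \<theta> (x / q))"
      using Cc_affine[OF \<theta>_Cc, of "1/q" 0] q by simp
    have ig: "integrable lborel A" "integrable lborel (\<lambda>x. x * (\<theta> (x / q)))" "integrable lborel (\<lambda>x. x * \<theta> x)"
      by (auto intro!: Cc_integrable A_Cc Cc_mult q' \<theta>_Cc)
    have "(\<integral>x. ?g x * indicat_real {?l..?u} x \<partial>lborel) = ?u * A ?u - ?l * A ?l"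
    proof (rule integral_FTC_Icc_real)
      show "((\<lambda>x. x * A x) has_real_derivative ?g x) (at x)" for x
        by (rule DERIV_cong[OF DERIV_mult[OF DERIV_ident A_deriv]]) (simp add: mult.commute)
      have "continuous_on UNIV ?g"
        using smooth1_continuous[OF A_smooth] q' \<theta>_Cc q by (auto simp: Cc_def intro!: continuous_intros)
      then show "isCont ?g x" for x by (simp add: continuous_on_eq_continuous_at)
    qed (use e in simp)
    also have "\<dots> = 0" using out[of ?u] out[of ?l] e by simp
    also have "(\<lambda>x. ?g x * indicat_real {?l..?u} x) = ?g"
    proof
      fix x show "?g x * indicat_real {?l..?u} x = ?g x"
      proof (cases "x \<in> {?l..?u}")
        case False
        then have "\<not> \<bar>x - c\<bar> \<le> \<epsilon>" by (auto simp: abs_le_iff)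
        moreover from this have "\<theta> x = 0" using \<theta>_nz[of x] e by (auto simp: d_def)
        ultimately show ?thesis using out[of x] by simp
      qed simp
    qed
    finally have "(\<integral>x. ?g x \<partial>lborel) = 0" .
    moreover have "?g = (\<lambda>x. A x + (1/q) * (x * \<theta> (x / q)) - x * \<theta> x)"
      by (auto simp: algebra_simps)
    ultimately have "(\<integral>x. A x \<partial>lborel) + (1/q) * (\<integral>x. x * \<theta> (x / q) \<partial>lborel) = 0"
      using ig \<theta>_mom by simp
    moreover have "(\<integral>x. x * \<theta> (x / q) \<partial>lborel) = 0"
      using lborel_integral_affine[of q "\<lambda>x. x * \<theta> (x / q)" 0] q \<theta>_mom by (simp add: mult.assoc)
    ultimately show ?thesis by simp
  qed
  moreover have "\<bar>x - c\<bar> \<le> \<epsilon>" if "\<theta> x \<noteq> 0" for x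
    using \<theta>_nz[OF that] e by (simp add: d_def)
  moreover have "\<bar>x - c\<bar> \<le> \<epsilon>" if "\<theta> (x / q) \<noteq> 0" for x using out[of x] that by blast
  moreover have "\<bar>x - c\<bar> \<le> \<epsilon>" if "A x \<noteq> 0" for x using out[of x] that by blast
  ultimately show ?thesis
    by (intro that[of \<theta> A] \<theta>_smooth A_smooth A_deriv \<theta>_int)
qed

text \<open>Lebesgue measure on \<open>real^'d\<close> is the image of a product measure indexed by
  \<open>Basis\<close>; the work is to relabel coordinates by axis vectors.\<close>

lemma integral_prod_components:
  fixes g :: "'d::finite \<Rightarrow> real \<Rightarrow> real"
  assumes "\<And>i. integrable lborel (g i)"
  shows "(\<integral>x. (\<Prod>i\<in>UNIV. g i ((x :: real^'d) $ i)) \<partial>lborel) = (\<Prod>i\<in>UNIV. \<integral>t. g i t \<partial>lborel)"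
proof -
  let ?ax = "\<lambda>i::'d. axis i (1::real)"
  have B: "(Basis :: (real^'d) set) = range ?ax" by (auto simp: Basis_vec_def)
  have inj: "inj ?ax" by (auto simp: inj_on_def axis_eq_axis)
  interpret product_sigma_finite "\<lambda>_::real^'d. lborel :: real measure" by standard
  have m: "g i \<in> borel_measurable borel" for i using assms[of i] by auto
  have meas: "(\<lambda>x::real^'d. \<Prod>i\<in>UNIV. g i (x $ i)) \<in> borel_measurable borel"
  proof (intro borel_measurable_prod)
    fix i
    have "(\<lambda>x::real^'d. x $ i) \<in> borel_measurable borel"
      by (intro borel_measurable_continuous_onI continuous_intros)
    then show "(\<lambda>x::real^'d. g i (x $ i)) \<in> borel_measurable borel"
      using measurable_compose m by blast
  qed
  have comp: "(\<Sum>b\<in>Basis. f b *\<^sub>R b) $ i = f (?ax i)" for f and i :: 'd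
  proof -
    have "(\<Sum>b\<in>Basis. f b *\<^sub>R b) $ i = (\<Sum>j\<in>UNIV. f (?ax j) * ?ax j $ i)"
      unfolding B by (subst sum.reindex[OF inj]) simp
    also have "\<dots> = (\<Sum>j\<in>UNIV. if j = i then f (?ax j) else 0)"
      by (intro sum.cong refl) (simp add: axis_def)
    finally have "(\<Sum>b\<in>Basis. f b *\<^sub>R b) $ i = (\<Sum>j\<in>UNIV. if j = i then f (?ax j) else 0)" .
    then show ?thesis by simp
  qed
  have "(\<integral>x. (\<Prod>i\<in>UNIV. g i ((x :: real^'d) $ i)) \<partial>lborel)
      = integral\<^sup>L (Pi\<^sub>M (Basis::(real^'d) set) (\<lambda>_. lborel)) (\<lambda>f. \<Prod>i\<in>UNIV. g i ((\<Sum>b\<in>Basis. f b *\<^sub>R b) $ i))"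
    by (subst lborel_eq, subst integral_distr) (use meas in auto)
  also have "\<dots> = integral\<^sup>L (Pi\<^sub>M (Basis::(real^'d) set) (\<lambda>_. lborel)) (\<lambda>f. \<Prod>b\<in>Basis. g (the_inv ?ax b) (f b))"
    unfolding comp unfolding B by (subst prod.reindex[OF inj]) (simp add: the_inv_f_f[OF inj])
  also have "\<dots> = (\<Prod>b\<in>(Basis::(real^'d) set). \<integral>t. g (the_inv ?ax b) t \<partial>lborel)"
    by (rule product_integral_prod) (auto intro: assms)
  also have "\<dots> = (\<Prod>i\<in>UNIV. \<integral>t. g i t \<partial>lborel)"
    unfolding B by (subst prod.reindex[OF inj]) (simp add: the_inv_f_f[OF inj])
  finally show ?thesis .
qed

text \<open>Exchange the factors one at a time; \<open>s i l\<close> records whether factor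
  \<open>l\<close> is taken from \<open>a\<close> or from \<open>b\<close> while factor
  \<open>i\<close> is being exchanged. The record is chosen before \<open>a\<close> and
  \<open>b\<close>, because it defines functions, and the values at each point are inserted for
  \<open>a\<close> and \<open>b\<close> only later.\<close>

lemma prod_telescope:
  assumes "finite I"
  shows "\<exists>s. \<forall>a b :: 'i \<Rightarrow> real. (\<Prod>i\<in>I. a i) - (\<Prod>i\<in>I. b i)
      = (\<Sum>i\<in>I. (a i - b i) * (\<Prod>l\<in>I - {i}. if s i l then a l else b l))"
    using assms
  proof (induction I)
    case (insert k I)
    then obtain s where s: "\<And>a b :: 'i \<Rightarrow> real. (\<Prod>i\<in>I. a i) - (\<Prod>i\<in>I. b i)
      = (\<Sum>i\<in>I. (a i - b i) * (\<Prod>l\<in>I - {i}. if s i l then a l else b l))" by blast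
    define s' where "s' i l = (if i = k then True else if l = k then False else s i l)" for i l
    have "(\<Prod>i\<in>insert k I. a i) - (\<Prod>i\<in>insert k I. b i)
      = (\<Sum>i\<in>insert k I. (a i - b i) * (\<Prod>l\<in>insert k I - {i}. if s' i l then a l else b l))"
      for a b :: "'i \<Rightarrow> real"
    proof -
      have 1: "(\<Prod>l\<in>insert k I - {k}. if s' k l then a l else b l) = (\<Prod>i\<in>I. a i)"
        using insert.hyps by (intro prod.cong) (auto simp: s'_def)
      have 2: "(\<Prod>l\<in>insert k I - {i}. if s' i l then a l else b l)
          = b k * (\<Prod>l\<in>I - {i}. if s i l then a l else b l)" if "i \<in> I" for i
      proof -
        have ik: "i \<noteq> k" using that insert.hyps by auto
        then have "insert k I - {i} = insert k (I - {i})" by auto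
        moreover have "(\<Prod>l\<in>I - {i}. if s' i l then a l else b l) = (\<Prod>l\<in>I - {i}. if s i l then a l else b l)"
          using insert.hyps ik by (intro prod.cong) (auto simp: s'_def)
        ultimately show ?thesis using insert.hyps ik by (simp add: s'_def)
      qed
      have "(\<Prod>i\<in>insert k I. a i) - (\<Prod>i\<in>insert k I. b i)
          = (a k - b k) * (\<Prod>i\<in>I. a i) + b k * ((\<Prod>i\<in>I. a i) - (\<Prod>i\<in>I. b i))"
        using insert.hyps by (simp add: algebra_simps)
      also have "b k * ((\<Prod>i\<in>I. a i) - (\<Prod>i\<in>I. b i))
          = (\<Sum>i\<in>I. (a i - b i) * (\<Prod>l\<in>insert k I - {i}. if s' i l then a l else b l))"
        unfolding s by (simp add: sum_distrib_left 2 mult.left_commute)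
      finally show ?thesis using insert.hyps 1 by simp
    qed
    then show ?case by blast
  qed simp

text \<open>Reduces partial derivatives of products of one-variable functions to calculus in one
  variable.\<close>

lemma partial_deriv_eq_line:
  assumes "f differentiable (at x)" "((\<lambda>t. f (x + t *\<^sub>R axis i 1)) has_real_derivative D) (at 0)"
  shows "partial_deriv i f x = D"
proof -
  obtain f' where f': "(f has_derivative f') (at x)" using assms(1) by (auto simp: differentiable_def)
  have "((\<lambda>t::real. x + t *\<^sub>R axis i 1) has_derivative (\<lambda>t. t *\<^sub>R axis i 1)) (at 0)"
    by (auto intro!: derivative_eq_intros)
  from has_derivative_compose[OF this, of f f'] f'
  have "((\<lambda>t. f (x + t *\<^sub>R axis i 1)) has_derivative (\<lambda>t. f' (t *\<^sub>R axis i 1))) (at 0)" by simp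
  moreover have "(\<lambda>t. f' (t *\<^sub>R axis i 1)) = (*) (f' (axis i 1))"
    using has_derivative_bounded_linear[OF f'] by (simp add: linear_simps fun_eq_iff mult.commute)
  ultimately have "((\<lambda>t. f (x + t *\<^sub>R axis i 1)) has_real_derivative f' (axis i 1)) (at 0)"
    by (simp add: has_field_derivative_def)
  from DERIV_unique[OF this assms(2)] show ?thesis using partial_deriv_eq[OF f'] by simp
qed

lemma dil_tf: "h > 0 \<Longrightarrow> a \<in> tf \<Longrightarrow> dil h a \<in> tf"
  using test_functions_cmult[OF test_functions_affine[of a "1/h" 0], of "1 / h ^ DIM(real^'d)"]
  by (simp add: dil_def[abs_def])

lemma tfI_cbox:
  fixes f :: "real^'d::finite \<Rightarrow> real"
  assumes "C_inf f" "\<And>x l. f x \<noteq> 0 \<Longrightarrow> \<bar>x $ l - v $ l\<bar> \<le> \<epsilon>"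
  shows "f \<in> tf"
proof (rule test_functionsI)
  show "x \<in> cbox (\<chi> l. v $ l - \<epsilon>) (\<chi> l. v $ l + \<epsilon>)" if "f x \<noteq> 0" for x
    using assms(2)[OF that] by (auto simp: mem_box_cart abs_le_iff algebra_simps)
qed (use assms in auto)

text \<open>A tensor product of one-dimensional kernels, one for each component of \<open>v\<close>.
  The difference of the products \<open>dil q \<rho>\<close> and \<open>\<rho>\<close> telescopes
  into summands with one factor that is itself a difference; replacing that factor by its
  antiderivative \<open>A\<close> exhibits the summand as a partial derivative. Each
  \<open>\<kappa> i\<close> has mean zero because its factor \<open>A i\<close> has.\<close>

lemma kernel:
  fixes v :: "real^'d::finite" and \<epsilon> :: real
  assumes e: "\<epsilon> > 0"
  obtains \<rho> q \<kappa> where "0 < q" "q < 1" "\<rho> \<in> tf" "\<And>i. \<kappa> i \<in> tf"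
    "(\<integral>x. \<rho> x \<partial>lborel) = 1" "\<And>i. (\<integral>x. \<kappa> i x \<partial>lborel) = 0"
    "\<And>x. (\<Sum>i\<in>UNIV. partial_deriv i (\<kappa> i) x) = dil q \<rho> x - \<rho> x"
    "\<And>x l. \<rho> x \<noteq> 0 \<Longrightarrow> \<bar>x $ l - v $ l\<bar> \<le> \<epsilon>"
    "\<And>x l. dil q \<rho> x \<noteq> 0 \<Longrightarrow> \<bar>x $ l - v $ l\<bar> \<le> \<epsilon>"
    "\<And>x l i. \<kappa> i x \<noteq> 0 \<Longrightarrow> \<bar>x $ l - v $ l\<bar> \<le> \<epsilon>"
proof -
  \<comment> \<open>Chosen so that (1 - q) |v_l| is at most \<epsilon>/2 for every component, as
    \<open>kernel1\<close> requires; the minimum with 1/2 keeps \<open>q\<close> positive.\<close>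
  define w where "w = \<epsilon> / (2 * (1 + norm v))"
  define q where "q = 1 - min (1/2) w"
  have w: "w > 0" using e by (auto simp: w_def add_pos_nonneg)
  have q: "0 < q" "q < 1" using w by (auto simp: q_def)
  have qv: "(1 - q) * \<bar>v $ l\<bar> \<le> \<epsilon> / 2" for l
  proof -
    have "(1 - q) * \<bar>v $ l\<bar> \<le> w * (1 + norm v)"
      using component_le_norm_cart[of v l] w by (intro mult_mono) (auto simp: q_def)
    also have "\<dots> = \<epsilon> / 2"
      using norm_ge_zero[of v] by (simp add: w_def field_simps add_nonneg_eq_0_iff)
    finally show ?thesis .
  qed
  have "\<exists>\<theta> A. smooth1 \<theta> \<and> smooth1 A \<and>
    (\<forall>x. (A has_real_derivative \<theta> (x / q) / q - \<theta> x) (at x)) \<and>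
    (\<forall>x. \<theta> x \<noteq> 0 \<longrightarrow> \<bar>x - v $ l\<bar> \<le> \<epsilon>) \<and> (\<forall>x. \<theta> (x / q) \<noteq> 0 \<longrightarrow> \<bar>x - v $ l\<bar> \<le> \<epsilon>) \<and>
    (\<forall>x. A x \<noteq> 0 \<longrightarrow> \<bar>x - v $ l\<bar> \<le> \<epsilon>) \<and>
    (\<integral>x. \<theta> x \<partial>lborel) = 1 \<and> (\<integral>x. A x \<partial>lborel) = 0" for l
    by (rule kernel1[OF e q qv[of l]]) blast
  then obtain \<theta> A where \<theta>: "\<And>l. smooth1 (\<theta> l)" "\<And>l. smooth1 (A l)"
    "\<And>l x. (A l has_real_derivative \<theta> l (x / q) / q - \<theta> l x) (at x)"
    "\<And>l x. \<theta> l x \<noteq> 0 \<Longrightarrow> \<bar>x - v $ l\<bar> \<le> \<epsilon>" "\<And>l x. \<theta> l (x / q) \<noteq> 0 \<Longrightarrow> \<bar>x - v $ l\<bar> \<le> \<epsilon>"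
    "\<And>l x. A l x \<noteq> 0 \<Longrightarrow> \<bar>x - v $ l\<bar> \<le> \<epsilon>"
    "\<And>l. (\<integral>x. \<theta> l x \<partial>lborel) = 1" "\<And>l. (\<integral>x. A l x \<partial>lborel) = 0" by metis
  define \<theta>q where "\<theta>q l x = (1 / q) * \<theta> l ((1 / q) * x + 0)" for l x
  have \<theta>q_smooth: "smooth1 (\<theta>q l)" for l
    unfolding \<theta>q_def[abs_def] by (intro smooth1_mult[OF smooth1_const] smooth1_affine \<theta>)
  obtain s :: "'d \<Rightarrow> 'd \<Rightarrow> bool" where s: "\<And>a b :: 'd \<Rightarrow> real. (\<Prod>i\<in>UNIV. a i) - (\<Prod>i\<in>UNIV. b i)
      = (\<Sum>i\<in>UNIV. (a i - b i) * (\<Prod>l\<in>UNIV - {i}. if s i l then a l else b l))"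
    using prod_telescope[OF finite[of "UNIV :: 'd set"]] by blast
  define G where "G i l = (if l = i then A i else if s i l then \<theta>q l else \<theta> l)" for i l
  define \<rho> :: "real^'d \<Rightarrow> real" where "\<rho> x = (\<Prod>l\<in>UNIV. \<theta> l (x $ l))" for x
  define \<kappa> :: "'d \<Rightarrow> real^'d \<Rightarrow> real" where "\<kappa> i x = (\<Prod>l\<in>UNIV. G i l (x $ l))" for i x
  have G_smooth: "smooth1 (G i l)" for i l using \<theta> \<theta>q_smooth by (simp add: G_def)
  have G_supp: "\<bar>x - v $ l\<bar> \<le> \<epsilon>" if "G i l x \<noteq> 0" for i l x
    using that \<theta>(4-6)[of l x] by (auto simp: G_def \<theta>q_def split: if_splits)
  have smooth1_Cc: "Cc g" if "smooth1 g" "\<And>x. g x \<noteq> 0 \<Longrightarrow> \<bar>x - c\<bar> \<le> \<epsilon>" for g c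
    by (rule CcI[of _ "cball c \<epsilon>"])
      (use that smooth1_continuous in \<open>auto simp: dist_real_def abs_minus_commute\<close>)
  have \<rho>_supp: "\<bar>x $ l - v $ l\<bar> \<le> \<epsilon>" if "\<rho> x \<noteq> 0" for x l
    using that \<theta>(4)[of l "x $ l"] by (auto simp: \<rho>_def)
  have \<kappa>_supp: "\<bar>x $ l - v $ l\<bar> \<le> \<epsilon>" if "\<kappa> i x \<noteq> 0" for x l i
    using that G_supp[of i l "x $ l"] by (auto simp: \<kappa>_def)
  have \<rho>q: "dil q \<rho> x = (\<Prod>l\<in>UNIV. \<theta>q l (x $ l))" for x
    using q by (simp add: dil_def \<rho>_def \<theta>q_def prod_dividef)
  have \<rho>q_supp: "\<bar>x $ l - v $ l\<bar> \<le> \<epsilon>" if "dil q \<rho> x \<noteq> 0" for x l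
    using that \<theta>(5)[of l "x $ l"] unfolding \<rho>q by (auto simp: \<theta>q_def)
  have \<rho>_tf: "\<rho> \<in> tf"
    using \<rho>_supp by (intro tfI_cbox[of _ v \<epsilon>])
      (auto simp: \<rho>_def[abs_def] intro!: C_inf_prod C_inf_smooth1_component \<theta>)
  have \<kappa>_tf: "\<kappa> i \<in> tf" for i
    using \<kappa>_supp by (intro tfI_cbox[of _ v \<epsilon>])
      (auto simp: \<kappa>_def[abs_def] intro!: C_inf_prod C_inf_smooth1_component G_smooth)
  have "(\<integral>x. \<rho> x \<partial>lborel) = (\<Prod>l\<in>UNIV. \<integral>t. \<theta> l t \<partial>lborel)"
    unfolding \<rho>_def by (intro integral_prod_components Cc_integrable smooth1_Cc[of _ "v $ _"] \<theta>(1,4))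
  then have \<rho>_int: "(\<integral>x. \<rho> x \<partial>lborel) = 1" by (simp add: \<theta>)
  have \<kappa>_int: "(\<integral>x. \<kappa> i x \<partial>lborel) = 0" for i
  proof -
    have "(\<integral>x. \<kappa> i x \<partial>lborel) = (\<Prod>l\<in>UNIV. \<integral>t. G i l t \<partial>lborel)"
      unfolding \<kappa>_def by (intro integral_prod_components Cc_integrable smooth1_Cc[of _ "v $ _"] G_smooth G_supp)
    also have "\<dots> = 0" by (rule prod_zero) (auto intro!: exI[of _ i] simp: G_def \<theta>)
    finally show ?thesis .
  qed
  have pd: "partial_deriv i (\<kappa> i) x = (\<theta>q i (x $ i) - \<theta> i (x $ i))
      * (\<Prod>l\<in>UNIV - {i}. if s i l then \<theta>q l (x $ l) else \<theta> l (x $ l))" for i x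
  proof (rule partial_deriv_eq_line)
    show "\<kappa> i differentiable (at x)" using \<kappa>_tf[of i] by (simp add: tf_iff C_inf_differentiable)
    let ?h = "\<Prod>l\<in>UNIV - {i}. if s i l then \<theta>q l (x $ l) else \<theta> l (x $ l)"
    have "\<kappa> i (x + t *\<^sub>R axis i 1) = A i (x $ i + t) * ?h" for t
    proof -
      have "\<kappa> i (x + t *\<^sub>R axis i 1) = G i i ((x + t *\<^sub>R axis i 1) $ i)
          * (\<Prod>l\<in>UNIV - {i}. G i l ((x + t *\<^sub>R axis i 1) $ l))"
        unfolding \<kappa>_def by (rule prod.remove) auto
      also have "(\<Prod>l\<in>UNIV - {i}. G i l ((x + t *\<^sub>R axis i 1) $ l)) = ?h"
        by (intro prod.cong refl) (auto simp: G_def axis_def)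
      finally show ?thesis by (simp add: G_def axis_def)
    qed
    moreover have "((\<lambda>t. A i (x $ i + t) * ?h) has_real_derivative (\<theta>q i (x $ i) - \<theta> i (x $ i)) * ?h) (at 0)"
      using \<theta>(3)[of i "x $ i"] DERIV_shift[of "A i" _ 0 "x $ i"]
      by (intro DERIV_cmult_right) (simp add: \<theta>q_def add.commute)
    ultimately show "((\<lambda>t. \<kappa> i (x + t *\<^sub>R axis i 1)) has_real_derivative (\<theta>q i (x $ i) - \<theta> i (x $ i)) * ?h) (at 0)"
      by simp
  qed
  have "(\<Sum>i\<in>UNIV. partial_deriv i (\<kappa> i) x) = dil q \<rho> x - \<rho> x" for x
    unfolding pd \<rho>q \<rho>_def s[of "\<lambda>l. \<theta>q l (x $ l)" "\<lambda>l. \<theta> l (x $ l)"] ..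
  then show ?thesis
    using that[of q \<rho> \<kappa>] q \<rho>_tf \<kappa>_tf \<rho>_int \<kappa>_int \<rho>_supp \<rho>q_supp \<kappa>_supp by blast
qed

section \<open>A right inverse of the divergence, up to smoothing\<close>

lemma tf_Lipschitz:
  fixes a :: "real^'d::finite \<Rightarrow> real"
  assumes "a \<in> tf"
  obtains L where "\<And>x y. \<bar>a x - a y\<bar> \<le> L * norm (x - y)"
proof -
  have "\<exists>B. \<forall>x. \<bar>partial_deriv i a x\<bar> \<le> B" for i
    using Cc_bounded[OF test_functions_Cc[OF test_functions_partial_deriv[OF assms]]] by metis
  then obtain B where B: "\<And>i x. \<bar>partial_deriv i a x\<bar> \<le> B i" by metis
  have "onorm (\<lambda>h. \<Sum>i\<in>UNIV. h $ i * partial_deriv i a x) \<le> (\<Sum>i\<in>UNIV. B i)" for x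
  proof (rule onorm_le)
    fix k :: "real^'d"
    have "\<bar>\<Sum>i\<in>UNIV. k $ i * partial_deriv i a x\<bar> \<le> (\<Sum>i\<in>UNIV. \<bar>k $ i * partial_deriv i a x\<bar>)"
      by (rule sum_abs)
    also have "\<dots> \<le> (\<Sum>i\<in>UNIV. norm k * B i)"
      unfolding abs_mult by (intro sum_mono mult_mono component_le_norm_cart B) auto
    finally show "norm (\<Sum>i\<in>UNIV. k $ i * partial_deriv i a x) \<le> (\<Sum>i\<in>UNIV. B i) * norm k"
      by (simp add: sum_distrib_left mult.commute)
  qed
  moreover have "(a has_derivative (\<lambda>h. \<Sum>i\<in>UNIV. h $ i * partial_deriv i a x)) (at x within UNIV)" for x
    using assms by (intro frechet_partial C_inf_differentiable) (simp add: tf_iff)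
  ultimately have "norm (a x - a y) \<le> (\<Sum>i\<in>UNIV. B i) * norm (x - y)" for x y
    by (intro differentiable_bound[OF convex_UNIV]) auto
  then show ?thesis by (intro that[of "\<Sum>i\<in>UNIV. B i"]) (simp add: real_norm_def)
qed

lemma Cc_zero_outside_ball:
  assumes "Cc f" obtains R where "R > 0" "\<And>x. R < norm x \<Longrightarrow> f x = 0"
proof -
  have "bounded (supp f)" using assms by (simp add: Cc_def compact_imp_bounded)
  then obtain R where R: "R > 0" "\<And>x. x \<in> supp f \<Longrightarrow> norm x \<le> R" by (auto simp: bounded_pos)
  then have "f x = 0" if "R < norm x" for x
    using that zero_outside_supp[of x f] R(2)[of x] by fastforce
  then show ?thesis using R that by blast
qed

text \<open>Convolve with the indicator of a ball that contains the reflected support together with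
  all its shifts by less than 1. The result is constant near 0, and its derivative there is the
  integral of the derivative of \<open>f\<close>.\<close>

lemma integral_partial_deriv:
  fixes f :: "real^'d::finite \<Rightarrow> real"
  assumes f: "f \<in> tf" shows "(\<integral>x. partial_deriv i f x \<partial>lborel) = 0"
proof -
  obtain R where R: "R > 0" "\<And>x. R < norm x \<Longrightarrow> f x = 0"
    by (rule Cc_zero_outside_ball[OF tf_Cc[OF f]]) blast
  have R': "partial_deriv i f x = 0" if "R < norm x" for x
    using supp_subset_closed[of "cball 0 R" f] R that
    by (intro partial_deriv_zero_outside) (force simp: not_le[symmetric])
  let ?g = "indicat_real (cball (0::real^'d) (R + 1))"
  have g: "integrable lborel ?g"
    by (intro integrable_real_indicator emeasure_bounded_finite) auto
  have full: "conv ?g a x = (\<integral>y. a y \<partial>lborel)"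
    if "norm x < 1" "\<And>x. R < norm x \<Longrightarrow> a x = 0" for a x
  proof -
    have "?g y * a (x - y) = a (x - y)" for y
    proof (cases "norm y \<le> R + 1")
      case False
      then have "R < norm (x - y)" using that(1) norm_triangle_ineq2[of y x] by (simp add: norm_minus_commute)
      then show ?thesis using that(2) by simp
    qed simp
    then have "conv ?g a x = (\<integral>y. a (x - y) \<partial>lborel)" by (simp only: conv_def)
    then show ?thesis by (simp add: lborel_integral_reflect)
  qed
  have "((\<lambda>x. (\<integral>y. f y \<partial>lborel)) has_derivative (\<lambda>h. 0)) (at (0::real^'d))" by simp
  then have "(conv ?g f has_derivative (\<lambda>h. 0)) (at 0)"
    by (rule has_derivative_transform_within_open[where s="ball 0 1"]) (use full[OF _ R(2)] in auto)
  then have "0 = partial_deriv i (conv ?g f) 0" by (simp add: partial_deriv_eq)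
  also have "\<dots> = conv ?g (partial_deriv i f) 0" by (simp add: partial_deriv_conv[OF g f])
  also have "\<dots> = (\<integral>x. partial_deriv i f x \<partial>lborel)" by (rule full) (use R' in auto)
  finally show ?thesis by simp
qed

lemma integral_by_parts_tf:
  assumes f: "f \<in> tf" and g: "C_inf g"
  shows "(\<integral>x. partial_deriv i f x * g x \<partial>lborel) = - (\<integral>x. f x * partial_deriv i g x \<partial>lborel)"
proof -
  have cf: "Cc f" "Cc (partial_deriv i f)"
    using f test_functions_partial_deriv tf_Cc by blast+
  have "Cc (\<lambda>x. g x * partial_deriv i f x)" "Cc (\<lambda>x. partial_deriv i g x * f x)"
    using cf g C_inf_partial_deriv C_inf_continuous by (blast intro: Cc_mult)+
  then have i: "integrable lborel (\<lambda>x. g x * partial_deriv i f x)" "integrable lborel (\<lambda>x. partial_deriv i g x * f x)"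
    by (auto intro: Cc_integrable)
  have "0 = (\<integral>x. partial_deriv i (\<lambda>x. g x * f x) x \<partial>lborel)"
    using integral_partial_deriv[OF test_functions_mult[OF f g]] by simp
  also have "\<dots> = (\<integral>x. g x * partial_deriv i f x + partial_deriv i g x * f x \<partial>lborel)"
    using f g by (simp add: partial_deriv_mult C_inf_differentiable tf_iff)
  finally show ?thesis using i by (simp add: mult.commute)
qed

text \<open>Uniform continuity makes the error uniformly small, and all errors live in the ball of
  radius \<open>R + R'\<close> because the scales are at most 1; so smallness in the supremum norm
  gives smallness in L2.\<close>

lemma approx_identity:
  fixes a f :: "'a::euclidean_space \<Rightarrow> real"
  assumes a: "Cc a" "(\<integral>x. a x \<partial>lborel) = 1" and f: "Cc f" and q: "0 < q" "q < 1"
  shows "(\<lambda>j. n2 (\<lambda>x. conv (dil (q ^ j) a) f x - f x)) \<longlonglongrightarrow> 0"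
proof (rule LIMSEQ_I)
  fix r :: real assume "r > 0"
  obtain R where R: "R > 0" "\<And>x. R < norm x \<Longrightarrow> a x = 0" by (rule Cc_zero_outside_ball[OF a(1)]) blast
  obtain R' where R': "R' > 0" "\<And>x. R' < norm x \<Longrightarrow> f x = 0" by (rule Cc_zero_outside_ball[OF f]) blast
  let ?A = "\<integral>y. \<bar>a y\<bar> \<partial>lborel"
  let ?V = "(2 * (R + R')) ^ DIM('a)"
  have A: "?A \<ge> 0" by simp
  \<comment> \<open>\<open>1 + ?A\<close> and \<open>1 + ?V\<close> keep the denominator positive;
    the L2 error comes out as at most \<open>r / 2\<close>.\<close>
  define e where "e = r / (2 * (1 + ?A) * (1 + ?V))"
  have V: "?V \<ge> 0" using R R' by simp
  have e: "e > 0" unfolding e_def using \<open>r > 0\<close> A V by (intro divide_pos_pos mult_pos_pos add_pos_nonneg) auto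
  obtain d where d: "d > 0" "\<And>x y. dist x y < d \<Longrightarrow> \<bar>f x - f y\<bar> < e"
    by (rule Cc_uniformly_continuous[OF f e]) blast
  have "(\<lambda>j. q ^ j * R) \<longlonglongrightarrow> 0 * R"
    by (intro tendsto_mult tendsto_const LIMSEQ_realpow_zero) (use q in auto)
  then have "eventually (\<lambda>j. q ^ j * R < d) sequentially"
    using d by (intro order_tendstoD) auto
  then obtain N where N: "\<And>j. j \<ge> N \<Longrightarrow> q ^ j * R < d" by (auto simp: eventually_sequentially)
  have "norm (n2 (\<lambda>x. conv (dil (q ^ j) a) f x - f x) - 0) < r" if j: "j \<ge> N" for j
  proof -
    let ?h = "q ^ j"
    let ?b = "dil ?h a"
    let ?g = "\<lambda>x. conv ?b f x - f x"
    have h: "?h > 0" "?h \<le> 1" using q by (auto simp: power_le_one)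
    have b: "Cc ?b" "(\<integral>x. ?b x \<partial>lborel) = 1" "(\<integral>x. \<bar>?b x\<bar> \<partial>lborel) = ?A"
      using a h by (auto intro: Cc_dil simp: integral_dil integral_abs_dil)
    have b0: "?b y = 0" if "?h * R < norm y" for y using dil_support[OF h(1) R(2) that] by simp
    have g: "Cc ?g" by (intro Cc_diff Cc_conv b f)
    have bd: "\<bar>?g x\<bar> \<le> e * ?A" for x
    proof -
      have i: "integrable lborel (\<lambda>y. ?b y * f (x - y))" "integrable lborel ?b"
        using b f by (auto intro: conv_integrable Cc_integrable)
      have "?g x = (\<integral>y. ?b y * (f (x - y) - f x) \<partial>lborel)"
        using i b by (simp add: conv_def right_diff_distrib)
      also have "\<bar>\<dots>\<bar> \<le> (\<integral>y. \<bar>?b y * (f (x - y) - f x)\<bar> \<partial>lborel)" by (rule integral_abs_bound)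
      also have "\<dots> \<le> (\<integral>y. e * \<bar>?b y\<bar> \<partial>lborel)"
      proof (rule integral_mono)
        show "integrable lborel (\<lambda>y. \<bar>?b y * (f (x - y) - f x)\<bar>)"
          using i by (auto simp: right_diff_distrib intro!: integrable_abs Bochner_Integration.integrable_diff)
        show "integrable lborel (\<lambda>y. e * \<bar>?b y\<bar>)" using i by auto
        show "\<bar>?b y * (f (x - y) - f x)\<bar> \<le> e * \<bar>?b y\<bar>" for y
        proof (cases "norm y \<le> ?h * R")
          case True
          then have "\<bar>f (x - y) - f x\<bar> \<le> e"
            using d(2)[of "x - y" x] N[OF j] by (simp add: dist_norm less_imp_le)
          then show ?thesis by (simp add: abs_mult mult.commute[of _ "\<bar>?b y\<bar>"] mult_left_mono)
        qed (use b0 in auto)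
      qed
      finally show ?thesis using b by simp
    qed
    have g0: "?g x = 0" if "R + R' < norm x" for x
    proof -
      have "conv ?b f x = 0"
      proof (rule ccontr)
        assume "conv ?b f x \<noteq> 0"
        then obtain y z where yz: "?b y \<noteq> 0" "f z \<noteq> 0" "x = y + z" by (rule conv_nonzeroD)
        then have "norm y \<le> ?h * R" "norm z \<le> R'" using b0[of y] R'(2)[of z] by force+
        moreover have "?h * R \<le> R" using h R by simp
        ultimately show False using norm_triangle_ineq[of y z] yz that by simp
      qed
      then show ?thesis using R'(2)[of x] R that by simp
    qed
    have "(n2 ?g)\<^sup>2 \<le> (\<integral>x. (e * ?A) * \<bar>?g x\<bar> \<partial>lborel)"
      unfolding n2_power2
    proof (rule integral_mono)
      show "integrable lborel (\<lambda>x. ?g x * ?g x)" by (intro Cc_integrable Cc_mult2 g)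
      show "integrable lborel (\<lambda>x. (e * ?A) * \<bar>?g x\<bar>)" by (intro Cc_integrable Cc_cmult Cc_abs g)
      show "?g x * ?g x \<le> (e * ?A) * \<bar>?g x\<bar>" for x
        using mult_right_mono[OF bd[of x], of "\<bar>?g x\<bar>"] by (simp add: abs_mult_self_eq)
    qed
    also have "\<dots> \<le> (e * ?A) * (e * ?A * ?V)"
      unfolding integral_mult_right_zero by (rule mult_left_mono[OF integral_abs_le_ball[OF g bd g0]]) (use e A R R' in auto)
    also have "\<dots> \<le> (e * (1 + ?A) * (1 + ?V))\<^sup>2"
    proof -
      have "e * ?A \<le> e * (1 + ?A) * (1 + ?V)"
        using e A V mult_mono[of "e * ?A" "e * (1 + ?A)" 1 "1 + ?V"] by simp
      moreover have "e * ?A * ?V \<le> e * (1 + ?A) * (1 + ?V)"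
        using e A V by (intro mult_mono) auto
      ultimately show ?thesis unfolding power2_eq_square using e A V by (rule_tac mult_mono) auto
    qed
    also have "e * (1 + ?A) * (1 + ?V) = r / 2"
      using A V by (simp add: e_def field_simps add_nonneg_eq_0_iff)
    finally have "n2 ?g \<le> r / 2"
      using \<open>r > 0\<close> by (intro power2_le_imp_le[of "n2 ?g"]) auto
    then show ?thesis using \<open>r > 0\<close> by simp
  qed
  then show "\<exists>N. \<forall>j\<ge>N. norm (n2 (\<lambda>x. conv (dil (q ^ j) a) f x - f x) - 0) < r" by blast
qed

text \<open>Paired with itself, the sum \<open>?G\<close> becomes a sum of pairings of
  \<open>conv (dil (q ^ j) b) f\<close> with the convolution of \<open>?G\<close> by the reflected
  kernel of \<open>a\<close>. Cauchy-Schwarz in \<open>j\<close> and one square function estimate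
  for each factor give a bound independent of \<open>J\<close>. This takes the place of a theorem on
  singular integrals.\<close>

lemma singular_sum_bound:
  fixes a b :: "real^'d::finite \<Rightarrow> real"
  assumes a: "a \<in> tf" "(\<integral>x. a x \<partial>lborel) = 0" and b: "b \<in> tf" "(\<integral>x. b x \<partial>lborel) = 0"
    and q: "0 < q" "q < 1"
  obtains C where "0 \<le> C"
    "\<And>J f. Cc f \<Longrightarrow> n2 (\<lambda>x. \<Sum>j<J. conv (dil (q ^ j) a) (conv (dil (q ^ j) b) f) x) \<le> C * n2 f"
proof -
  let ?r = "\<lambda>y. a (- y)"
  have ra: "?r \<in> tf" using test_functions_affine[OF a(1), of "-1" 0] by simp
  have ra0: "(\<integral>x. ?r x \<partial>lborel) = 0" using lborel_integral_reflect[of a 0] a(2) by simp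
  obtain L1 where "\<And>x y. \<bar>?r x - ?r y\<bar> \<le> L1 * norm (x - y)" by (rule tf_Lipschitz[OF ra]) blast
  then obtain C1 where C1: "0 \<le> C1" "\<And>J f. Cc f \<Longrightarrow> (\<Sum>j<J. (n2 (conv (dil (q ^ j) ?r) f))\<^sup>2) \<le> C1 * (n2 f)\<^sup>2"
    using square_function[OF tf_Cc[OF ra] ra0 _ q] by metis
  obtain L2 where "\<And>x y. \<bar>b x - b y\<bar> \<le> L2 * norm (x - y)" by (rule tf_Lipschitz[OF b(1)]) blast
  then obtain C2 where C2: "0 \<le> C2" "\<And>J f. Cc f \<Longrightarrow> (\<Sum>j<J. (n2 (conv (dil (q ^ j) b) f))\<^sup>2) \<le> C2 * (n2 f)\<^sup>2"
    using square_function[OF tf_Cc[OF b(1)] b(2) _ q] by metis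
  have qj: "q ^ j > 0" for j using q by simp
  have "n2 (\<lambda>x. \<Sum>j<J. conv (dil (q ^ j) a) (conv (dil (q ^ j) b) f) x) \<le> sqrt (C2 * C1) * n2 f"
    if f: "Cc f" for J f
  proof -
    let ?a = "\<lambda>j. dil (q ^ j) a" and ?b = "\<lambda>j. dil (q ^ j) b" and ?s = "\<lambda>j. dil (q ^ j) ?r"
    let ?G = "\<lambda>x. \<Sum>j<J. conv (?a j) (conv (?b j) f) x"
    have c: "Cc (?a j)" "Cc (?b j)" "Cc (?s j)" for j
      by (intro Cc_dil tf_Cc qj a b ra)+
    have cb: "Cc (conv (?b j) f)" for j by (intro Cc_conv c f)
    have ca: "Cc (conv (?a j) (conv (?b j) f))" for j by (intro Cc_conv c cb)
    have G: "Cc ?G" by (intro Cc_sum ca)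
    have cs: "Cc (conv (?s j) ?G)" for j by (intro Cc_conv c G)
    have "(n2 ?G)\<^sup>2 = (\<Sum>j<J. \<integral>x. conv (?a j) (conv (?b j) f) x * ?G x \<partial>lborel)"
      unfolding n2_power2 sum_distrib_right
      by (rule Bochner_Integration.integral_sum) (intro Cc_integrable Cc_mult2 ca G)
    also have "\<dots> = (\<Sum>j<J. \<integral>x. conv (?b j) f x * conv (?s j) ?G x \<partial>lborel)"
      using conv_adjoint[OF c(1) cb G] by (simp add: dil_uminus)
    also have "\<dots> \<le> (\<Sum>j<J. n2 (conv (?b j) f) * n2 (conv (?s j) ?G))"
      by (intro sum_mono order_trans[OF abs_ge_self n2_CS_Cc] cb cs)
    also have "\<dots> \<le> sqrt (\<Sum>j<J. (n2 (conv (?b j) f))\<^sup>2) * sqrt (\<Sum>j<J. (n2 (conv (?s j) ?G))\<^sup>2)"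
      using L2_set_mult_ineq[of "\<lambda>j. n2 (conv (?b j) f)" "\<lambda>j. n2 (conv (?s j) ?G)" "{..<J}"]
      by (simp add: L2_set_def)
    also have "\<dots> \<le> sqrt (C2 * (n2 f)\<^sup>2) * sqrt (C1 * (n2 ?G)\<^sup>2)"
      by (intro mult_mono real_sqrt_le_mono C1 C2 f G) (auto simp: sum_nonneg C2(1))
    also have "\<dots> = (sqrt (C2 * C1) * n2 f) * n2 ?G"
      by (simp add: real_sqrt_mult)
    finally have "n2 ?G * n2 ?G \<le> (sqrt (C2 * C1) * n2 f) * n2 ?G" by (simp add: power2_eq_square)
    moreover have "0 \<le> sqrt (C2 * C1) * n2 f" using C1 C2 by simp
    ultimately show ?thesis
      using mult_right_le_imp_le[of "n2 ?G" "n2 ?G" "sqrt (C2 * C1) * n2 f"] n2_nonneg[of ?G]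
      by (cases "n2 ?G = 0") auto
  qed
  then show ?thesis using that[of "sqrt (C2 * C1)"] C1 C2 by simp
qed

section \<open>Test fields and the dual norm of the gradient\<close>

definition test_fields :: "(real^'d::finite) set \<Rightarrow> ('d \<Rightarrow> real^'d \<Rightarrow> real) set" where
  "test_fields S = {w. \<forall>i. w i \<in> test_functions S}"

definition fdiv :: "('d::finite \<Rightarrow> real^'d \<Rightarrow> real) \<Rightarrow> real^'d \<Rightarrow> real" where
  "fdiv w x = (\<Sum>i\<in>UNIV. partial_deriv i (w i) x)"

definition grad_norm :: "('d::finite \<Rightarrow> real^'d \<Rightarrow> real) \<Rightarrow> real" where
  "grad_norm w = sqrt (\<Sum>i\<in>UNIV. \<Sum>j\<in>UNIV. (n2 (partial_deriv j (w i)))\<^sup>2)"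

text \<open>\<open>grad_bound S p M\<close>: the norm of the gradient of \<open>p\<close> in the dual of $H^1_0(S)^d$ is at most \<open>M\<close>.\<close>

definition grad_bound :: "(real^'d::finite) set \<Rightarrow> (real^'d \<Rightarrow> real) \<Rightarrow> real \<Rightarrow> bool" where
  "grad_bound S p M \<longleftrightarrow> (\<forall>w\<in>test_fields S. \<bar>\<integral>x. p x * fdiv w x \<partial>lborel\<bar> \<le> M * grad_norm w)"

lemma grad_norm_nonneg [simp]: "grad_norm w \<ge> 0"
  by (simp add: grad_norm_def sum_nonneg)

lemma fdiv_tf: "w \<in> test_fields S \<Longrightarrow> fdiv w \<in> test_functions S"
  unfolding fdiv_def[abs_def] test_fields_def
  by (intro test_functions_sum test_functions_partial_deriv) auto

lemma grad_norm_le: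
  fixes B :: real
  assumes "\<And>i j. n2 (partial_deriv j (w i)) \<le> B" "B \<ge> 0"
  shows "grad_norm (w :: 'd::finite \<Rightarrow> _) \<le> CARD('d) * B"
proof -
  have "(\<Sum>i\<in>UNIV. \<Sum>j\<in>UNIV. (n2 (partial_deriv j (w i)))\<^sup>2) \<le> (\<Sum>i\<in>(UNIV::'d set). \<Sum>j\<in>(UNIV::'d set). B\<^sup>2)"
    by (intro sum_mono power_mono assms) auto
  also have "\<dots> = (CARD('d) * B)\<^sup>2" by (simp add: power2_eq_square)
  finally show ?thesis unfolding grad_norm_def using assms(2) by (intro real_le_lsqrt) auto
qed

lemma partial_deriv_dil:
  fixes a :: "real^'d::finite \<Rightarrow> real"
  assumes "h > 0" "a \<in> tf"
  shows "partial_deriv i (dil h a) x = (1 / h) * dil h (partial_deriv i a) x"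
proof -
  have "a differentiable (at ((1 / h) *\<^sub>R x))" using assms by (simp add: tf_iff C_inf_differentiable)
  then have d: "(\<lambda>x. a ((1 / h) *\<^sub>R x)) differentiable (at x)"
    "partial_deriv i (\<lambda>x. a ((1 / h) *\<^sub>R x)) x = (1 / h) * partial_deriv i a ((1 / h) *\<^sub>R x)"
    using partial_deriv_affine[of a 0 "1/h" x i] has_derivative_affine[of a _ 0 "1/h" x]
    by (auto simp: differentiable_def)
  have "partial_deriv i (\<lambda>x. (1 / h ^ DIM(real^'d)) * a ((1 / h) *\<^sub>R x)) x
      = (1 / h ^ DIM(real^'d)) * ((1 / h) * partial_deriv i a ((1 / h) *\<^sub>R x))"
    using d by (subst partial_deriv_mult) auto
  then show ?thesis by (simp add: dil_def[abs_def])
qed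

lemma partial_deriv_conv_left:
  assumes "a \<in> tf" "Cc f" shows "partial_deriv i (conv a f) = conv (partial_deriv i a) f"
  using partial_deriv_conv[OF Cc_integrable[OF assms(2)] assms(1), of i]
  by (simp add: conv_commute[of a] conv_commute[of "partial_deriv i a"])

lemma partial_deriv_sum:
  assumes "\<And>j. j \<in> I \<Longrightarrow> f j differentiable (at x)"
  shows "partial_deriv i (\<lambda>x. \<Sum>j\<in>I. f j x) x = (\<Sum>j\<in>I. partial_deriv i (f j) x)
    \<and> (\<lambda>x. \<Sum>j\<in>I. f j x) differentiable (at x)"
  using assms by (induction I rule: infinite_finite_induct) (auto simp: partial_deriv_add differentiable_add)

lemma tf_differentiable: "f \<in> tf \<Longrightarrow> f differentiable (at x)"
  by (simp add: tf_iff C_inf_differentiable)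

lemma partial_deriv_cmult:
  "f differentiable (at x) \<Longrightarrow> partial_deriv i (\<lambda>x. c * f x) x = c * partial_deriv i f x"
  by (subst partial_deriv_mult) auto

text \<open>
  Fields \<open>U\<close> with divergence \<open>\<rho>\<^sub>J * \<rho>\<^sub>J * f - \<rho> * \<rho> * f\<close>, where \<open>\<rho>\<^sub>j\<close> is the mollifier \<open>\<rho>\<close> at scale
  \<open>q ^ j\<close>: a telescoping sum. As \<open>\<rho>\<close> is concentrated near \<open>v\<close>, the support only moves towards \<open>v\<close>.
\<close>

lemma mollifier_field:
  fixes v :: "real^'d::finite" and \<epsilon> :: real
  assumes e: "\<epsilon> > 0"
  obtains \<rho> q C where "0 < q" "q < 1" "\<rho> \<in> tf" "(\<integral>x. \<rho> x \<partial>lborel) = 1" "0 \<le> C"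
    "\<And>x l. \<rho> x \<noteq> 0 \<Longrightarrow> \<bar>x $ l - v $ l\<bar> \<le> \<epsilon>"
    "\<And>f J. f \<in> tf \<Longrightarrow> \<exists>U. (\<forall>i. U i \<in> tf) \<and>
      (\<forall>x. fdiv U x = conv (dil (q ^ J) \<rho>) (conv (dil (q ^ J) \<rho>) f) x - conv \<rho> (conv \<rho> f) x) \<and>
      (\<forall>i l. n2 (partial_deriv l (U i)) \<le> C * n2 f) \<and>
      (\<forall>i x. U i x \<noteq> 0 \<longrightarrow> (\<exists>j<J. \<exists>y t1 t2. f y \<noteq> 0 \<and> x = y + (q ^ j) *\<^sub>R (t1 + t2) \<and>
         (\<forall>l. \<bar>t1 $ l - v $ l\<bar> \<le> \<epsilon>) \<and> (\<forall>l. \<bar>t2 $ l - v $ l\<bar> \<le> \<epsilon>)))"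
proof -
  obtain \<rho> q \<kappa> where q: "0 < q" "q < 1" and \<rho>: "\<rho> \<in> tf" "(\<integral>x. \<rho> x \<partial>lborel) = 1" and \<kappa>: "\<And>i. \<kappa> i \<in> tf"
    "\<And>i. (\<integral>x. \<kappa> i x \<partial>lborel) = 0"
    and div: "\<And>x. (\<Sum>i\<in>UNIV. partial_deriv i (\<kappa> i) x) = dil q \<rho> x - \<rho> x"
    and sup: "\<And>x l. \<rho> x \<noteq> 0 \<Longrightarrow> \<bar>x $ l - v $ l\<bar> \<le> \<epsilon>"
      "\<And>x l. dil q \<rho> x \<noteq> 0 \<Longrightarrow> \<bar>x $ l - v $ l\<bar> \<le> \<epsilon>"
      "\<And>x l i. \<kappa> i x \<noteq> 0 \<Longrightarrow> \<bar>x $ l - v $ l\<bar> \<le> \<epsilon>"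
    by (rule kernel[OF e, of v]) blast
  have qj: "q ^ j > 0" for j using q by simp
  have \<rho>q: "dil q \<rho> \<in> tf" using dil_tf q \<rho> by blast
  \<comment> \<open>Under convolution the difference of the squares of \<open>dil q \<rho>\<close>
    and \<open>\<rho>\<close> is their difference times their sum. The difference is the divergence
    of \<open>\<kappa>\<close>; \<open>s\<close> is the sum.\<close>
  define s where "s x = dil q \<rho> x + \<rho> x" for x
  have s: "s \<in> tf" unfolding s_def[abs_def] by (intro test_functions_add \<rho>q \<rho>)
  \<comment> \<open>The H^1 bound differentiates the field, and that derivative is put on
    \<open>s\<close>: a partial derivative of a test function has mean zero, as
    \<open>singular_sum_bound\<close> demands of its second kernel.\<close>
  define m where "m l = partial_deriv l s" for l
  have m: "m l \<in> tf" "(\<integral>x. m l x \<partial>lborel) = 0" for l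
    using s test_functions_partial_deriv integral_partial_deriv by (auto simp: m_def)
  define Q where "Q i l C \<longleftrightarrow> 0 \<le> C \<and> (\<forall>J f. Cc f \<longrightarrow>
      n2 (\<lambda>x. \<Sum>j<J. conv (dil (q ^ j) (\<kappa> i)) (conv (dil (q ^ j) (m l)) f) x) \<le> C * n2 f)" for i l C
  have "\<exists>C. Q i l C" for i l
    unfolding Q_def by (rule singular_sum_bound[OF \<kappa>[of i] m[of l] q]) blast
  then have Q: "Q i l (SOME C. Q i l C)" for i l by (rule someI_ex)
  define C0 where "C0 i l = (SOME C. Q i l C)" for i l
  have "Q i l (C0 i l)" for i l unfolding C0_def by (rule Q)
  then have C0: "\<And>i l. 0 \<le> C0 i l" "\<And>i l J f. Cc f \<Longrightarrow>
      n2 (\<lambda>x. \<Sum>j<J. conv (dil (q ^ j) (\<kappa> i)) (conv (dil (q ^ j) (m l)) f) x) \<le> C0 i l * n2 f"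
    unfolding Q_def by blast+
  define C where "C = (\<Sum>i\<in>UNIV. \<Sum>l\<in>UNIV. C0 i l)"
  have C: "0 \<le> C" "C0 i l \<le> C" for i l
  proof -
    show "0 \<le> C" unfolding C_def by (intro sum_nonneg C0)
    have "C0 i l \<le> (\<Sum>l\<in>UNIV. C0 i l)" by (rule member_le_sum) (auto intro: C0)
    also have "\<dots> \<le> C" unfolding C_def
      by (rule member_le_sum[of i UNIV "\<lambda>i. \<Sum>l\<in>UNIV. C0 i l"]) (auto intro: sum_nonneg C0)
    finally show "C0 i l \<le> C" .
  qed
  have dil_Suc: "dil (q ^ Suc j) \<rho> = dil (q ^ j) (dil q \<rho>)" for j
    by (simp add: dil_def fun_eq_iff power_mult_distrib mult.commute)
  have main: "\<exists>U. (\<forall>i. U i \<in> tf) \<and>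
      (\<forall>x. fdiv U x = conv (dil (q ^ J) \<rho>) (conv (dil (q ^ J) \<rho>) f) x - conv \<rho> (conv \<rho> f) x) \<and>
      (\<forall>i l. n2 (partial_deriv l (U i)) \<le> C * n2 f) \<and>
      (\<forall>i x. U i x \<noteq> 0 \<longrightarrow> (\<exists>j<J. \<exists>y t1 t2. f y \<noteq> 0 \<and> x = y + (q ^ j) *\<^sub>R (t1 + t2) \<and>
         (\<forall>l. \<bar>t1 $ l - v $ l\<bar> \<le> \<epsilon>) \<and> (\<forall>l. \<bar>t2 $ l - v $ l\<bar> \<le> \<epsilon>)))" if f: "f \<in> tf" for f J
  proof -
    let ?P = "\<lambda>j. dil (q ^ j) \<rho>"
    let ?g = "\<lambda>j. conv (dil (q ^ j) s) f"
    let ?k = "\<lambda>j i. dil (q ^ j) (\<kappa> i)"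
    \<comment> \<open>The weight \<open>q ^ j\<close> cancels the factor \<open>1 / q ^ j\<close>
      that a derivative produces on a kernel at scale \<open>q ^ j\<close>.\<close>
    define U where "U i x = (\<Sum>j<J. q ^ j * conv (?k j i) (?g j) x)" for i x
    have cf: "Cc f" using f by (rule tf_Cc)
    have P: "?P j \<in> tf" "Cc (?P j)" for j using dil_tf[OF qj \<rho>(1)] tf_Cc by blast+
    have k: "?k j i \<in> tf" "Cc (?k j i)" for j i using dil_tf[OF qj \<kappa>(1)] tf_Cc by blast+
    have ds: "dil (q ^ j) s \<in> tf" for j using dil_tf[OF qj s] .
    have g: "?g j \<in> tf" "Cc (?g j)" for j using tf_conv[OF tf_Cc[OF ds] f] tf_Cc by blast+
    have kg: "conv (?k j i) (?g j) \<in> tf" for j i using tf_conv[OF k(2) g(1)] .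
    have U: "U i \<in> tf" for i
      unfolding U_def[abs_def] by (intro test_functions_sum test_functions_cmult kg)
    have pdU: "partial_deriv l (U i) x = (\<Sum>j<J. q ^ j * partial_deriv l (conv (?k j i) (?g j)) x)" for l i x
      unfolding U_def[abs_def]
      using partial_deriv_sum[of "{..<J}" "\<lambda>j x. q ^ j * conv (?k j i) (?g j) x" x l]
        tf_differentiable[OF test_functions_cmult[OF kg]] tf_differentiable[OF kg]
      by (simp add: partial_deriv_cmult)
    have PP: "conv (?P i) f \<in> tf" "Cc (conv (?P i) f)" for i using tf_conv[OF P(2) f] tf_Cc by blast+
    have fd: "fdiv U x = conv (?P J) (conv (?P J) f) x - conv \<rho> (conv \<rho> f) x" for x
    proof -
      have "(\<Sum>i\<in>UNIV. q ^ j * partial_deriv i (conv (?k j i) (?g j)) x)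
          = conv (?P (Suc j)) (conv (?P (Suc j)) f) x - conv (?P j) (conv (?P j) f) x" for j
      proof -
        have eq: "(\<lambda>y. (q ^ j) * partial_deriv i (?k j i) y) = dil (q ^ j) (partial_deriv i (\<kappa> i))" for i
          using partial_deriv_dil[OF qj \<kappa>(1)] q by (simp add: fun_eq_iff)
        have gj: "?g j = (\<lambda>x. conv (?P (Suc j)) f x + conv (?P j) f x)"
        proof -
          have "dil (q ^ j) s = (\<lambda>x. ?P (Suc j) x + ?P j x)"
            unfolding dil_Suc by (simp add: dil_def s_def fun_eq_iff add_divide_distrib)
          then show ?thesis
            using conv_add_right[OF cf P(2) P(2)] by (simp add: conv_commute[of _ f] del: power_Suc)
        qed
        have "(\<Sum>i\<in>UNIV. q ^ j * partial_deriv i (conv (?k j i) (?g j)) x)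
            = (\<Sum>i\<in>UNIV. conv (dil (q ^ j) (partial_deriv i (\<kappa> i))) (?g j) x)"
          unfolding partial_deriv_conv_left[OF k(1) g(2)] eq[symmetric] conv_cmult_left ..
        also have "\<dots> = conv (\<lambda>y. \<Sum>i\<in>UNIV. dil (q ^ j) (partial_deriv i (\<kappa> i)) y) (?g j) x"
          using dil_tf[OF qj test_functions_partial_deriv[OF \<kappa>(1)]] g(2)
          by (intro conv_sum_left[symmetric]) (auto intro: tf_Cc)
        also have "(\<lambda>y. \<Sum>i\<in>UNIV. dil (q ^ j) (partial_deriv i (\<kappa> i)) y) = (\<lambda>y. ?P (Suc j) y - ?P j y)"
          unfolding dil_Suc using div by (simp add: dil_def fun_eq_iff sum_divide_distrib[symmetric] diff_divide_distrib)
        also have "conv \<dots> (?g j) x = conv (?P (Suc j)) (?g j) x - conv (?P j) (?g j) x"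
          by (rule conv_diff_left[OF P(2) P(2) g(2)])
        also have "\<dots> = conv (?P (Suc j)) (conv (?P (Suc j)) f) x + conv (?P (Suc j)) (conv (?P j) f) x
            - (conv (?P j) (conv (?P (Suc j)) f) x + conv (?P j) (conv (?P j) f) x)"
          unfolding gj by (simp only: conv_add_right[OF P(2) PP(2) PP(2)])
        \<comment> \<open>The mixed products of neighbouring scales cancel because convolutions
          commute.\<close>
        finally show ?thesis
          using conv_left_commute[OF P(2)[of j] P(2)[of "Suc j"] cf] by (simp del: power_Suc)
      qed
      then have "fdiv U x = (\<Sum>j<J. conv (?P (Suc j)) (conv (?P (Suc j)) f) x - conv (?P j) (conv (?P j) f) x)"
        unfolding fdiv_def pdU by (subst sum.swap) simp
      then show ?thesis
        using sum_lessThan_telescope[of "\<lambda>j. conv (?P j) (conv (?P j) f) x" J]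
        by (simp add: dil_def[abs_def] del: power_Suc)
    qed
    have bd: "n2 (partial_deriv l (U i)) \<le> C * n2 f" for i l
    proof -
      \<comment> \<open>For the divergence the derivative fell on \<open>\<kappa>\<close>; for the
        bound it falls on \<open>s\<close>, so that both kernels keep mean zero.\<close>
      have "q ^ j * partial_deriv l (conv (?k j i) (?g j)) x
          = conv (?k j i) (conv (dil (q ^ j) (m l)) f) x" for j x
      proof -
        have eq: "(\<lambda>y. (q ^ j) * partial_deriv l (dil (q ^ j) s) y) = dil (q ^ j) (m l)"
          using partial_deriv_dil[OF qj s] q by (simp add: fun_eq_iff m_def)
        show ?thesis
          unfolding partial_deriv_conv[OF Cc_integrable[OF k(2)] g(1)] partial_deriv_conv_left[OF ds cf]
            eq[symmetric] conv_cmult_left conv_cmult_right ..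
      qed
      then have "partial_deriv l (U i) = (\<lambda>x. \<Sum>j<J. conv (?k j i) (conv (dil (q ^ j) (m l)) f) x)"
        by (simp add: pdU fun_eq_iff)
      then have "n2 (partial_deriv l (U i)) \<le> C0 i l * n2 f" using C0(2)[OF cf] by simp
      also have "\<dots> \<le> C * n2 f" by (intro mult_right_mono C) simp
      finally show ?thesis .
    qed
    \<comment> \<open>A point of the support comes from one with \<open>f y \<noteq> 0\<close> by
      two shifts at the same scale, \<open>t1\<close> from \<open>\<kappa>\<close> and
      \<open>t2\<close> from \<open>s\<close>.\<close>
    have supU: "\<exists>j<J. \<exists>y t1 t2. f y \<noteq> 0 \<and> x = y + (q ^ j) *\<^sub>R (t1 + t2) \<and>
         (\<forall>l. \<bar>t1 $ l - v $ l\<bar> \<le> \<epsilon>) \<and> (\<forall>l. \<bar>t2 $ l - v $ l\<bar> \<le> \<epsilon>)" if nz: "U i x \<noteq> 0" for i x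
    proof -
      obtain j where j: "j < J" "conv (?k j i) (?g j) x \<noteq> 0"
        using nz unfolding U_def by (metis (no_types, lifting) lessThan_iff mult_zero_right sum.neutral)
      from j(2) obtain z1 z2 where z: "?k j i z1 \<noteq> 0" "?g j z2 \<noteq> 0" "x = z1 + z2" by (rule conv_nonzeroD)
      from z(2) obtain z3 y where z': "dil (q ^ j) s z3 \<noteq> 0" "f y \<noteq> 0" "z2 = z3 + y" by (rule conv_nonzeroD)
      let ?t1 = "(1 / q ^ j) *\<^sub>R z1" and ?t2 = "(1 / q ^ j) *\<^sub>R z3"
      have "\<kappa> i ?t1 \<noteq> 0" using z(1) by (auto simp: dil_def)
      then have t1: "\<bar>?t1 $ l - v $ l\<bar> \<le> \<epsilon>" for l by (rule sup(3))
      have "s ?t2 \<noteq> 0" using z'(1) by (auto simp: dil_def)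
      then have "dil q \<rho> ?t2 \<noteq> 0 \<or> \<rho> ?t2 \<noteq> 0" by (auto simp: s_def)
      then have t2: "\<bar>?t2 $ l - v $ l\<bar> \<le> \<epsilon>" for l using sup(1,2)[of ?t2 l] by blast
      have "x = y + (q ^ j) *\<^sub>R (?t1 + ?t2)"
        using z(3) z'(3) q by (simp add: scaleR_add_right)
      then show ?thesis using j(1) z'(2) t1 t2 by blast
    qed
    show ?thesis using U fd bd supU by blast
  qed
  show ?thesis by (rule that[OF q \<rho> C(1) sup(1) main])
qed

text \<open>The hypothesis on supports: \<open>S\<close> contains \<open>supp f\<close> moved along the box around \<open>2 v\<close>.\<close>

lemma mollify_estimate:
  fixes v :: "real^'d::finite" and \<epsilon> :: real
  assumes e: "\<epsilon> > 0"
  obtains \<rho> C where "\<rho> \<in> tf" "(\<integral>x. \<rho> x \<partial>lborel) = 1" "0 \<le> C"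
    "\<And>x l. \<rho> x \<noteq> 0 \<Longrightarrow> \<bar>x $ l - v $ l\<bar> \<le> \<epsilon>"
    "\<And>S p M f. square_integrable p \<Longrightarrow> grad_bound S p M \<Longrightarrow> 0 \<le> M \<Longrightarrow> f \<in> tf \<Longrightarrow>
      (\<And>h y t1 t2. 0 < h \<Longrightarrow> h \<le> 1 \<Longrightarrow> y \<in> supp f \<Longrightarrow> (\<forall>l. \<bar>t1 $ l - v $ l\<bar> \<le> \<epsilon>) \<Longrightarrow>
         (\<forall>l. \<bar>t2 $ l - v $ l\<bar> \<le> \<epsilon>) \<Longrightarrow> y + h *\<^sub>R (t1 + t2) \<in> S) \<Longrightarrow>
      \<bar>(\<integral>x. p x * f x \<partial>lborel) - (\<integral>x. p x * conv \<rho> (conv \<rho> f) x \<partial>lborel)\<bar> \<le> C * M * n2 f"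
proof -
  obtain \<rho> q C where q: "0 < q" "q < 1" and \<rho>: "\<rho> \<in> tf" "(\<integral>x. \<rho> x \<partial>lborel) = 1" and C: "0 \<le> C"
    and sup: "\<And>x l. \<rho> x \<noteq> 0 \<Longrightarrow> \<bar>x $ l - v $ l\<bar> \<le> \<epsilon>" and
    main: "\<And>f J. f \<in> tf \<Longrightarrow> \<exists>U. (\<forall>i. U i \<in> tf) \<and>
      (\<forall>x. fdiv U x = conv (dil (q ^ J) \<rho>) (conv (dil (q ^ J) \<rho>) f) x - conv \<rho> (conv \<rho> f) x) \<and>
      (\<forall>i l. n2 (partial_deriv l (U i)) \<le> C * n2 f) \<and>
      (\<forall>i x. U i x \<noteq> 0 \<longrightarrow> (\<exists>j<J. \<exists>y t1 t2. f y \<noteq> 0 \<and> x = y + (q ^ j) *\<^sub>R (t1 + t2) \<and>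
         (\<forall>l. \<bar>t1 $ l - v $ l\<bar> \<le> \<epsilon>) \<and> (\<forall>l. \<bar>t2 $ l - v $ l\<bar> \<le> \<epsilon>)))"
    by (rule mollifier_field[OF e, of v]) blast
  have "\<bar>(\<integral>x. p x * f x \<partial>lborel) - (\<integral>x. p x * conv \<rho> (conv \<rho> f) x \<partial>lborel)\<bar> \<le> CARD('d) * C * M * n2 f"
    if p: "square_integrable p" and gb: "grad_bound S p M" "0 \<le> M" and f: "f \<in> tf" and
      S: "\<And>h y t1 t2. 0 < h \<Longrightarrow> h \<le> 1 \<Longrightarrow> y \<in> supp f \<Longrightarrow> (\<forall>l. \<bar>t1 $ l - v $ l\<bar> \<le> \<epsilon>) \<Longrightarrow>
         (\<forall>l. \<bar>t2 $ l - v $ l\<bar> \<le> \<epsilon>) \<Longrightarrow> y + h *\<^sub>R (t1 + t2) \<in> S" for S p M f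
  proof -
    let ?P = "\<lambda>j. dil (q ^ j) \<rho>"
    let ?B = "cbox (\<chi> l. v $ l - \<epsilon>) (\<chi> l. v $ l + \<epsilon>)"
    have B: "t \<in> ?B \<longleftrightarrow> (\<forall>l. \<bar>t $ l - v $ l\<bar> \<le> \<epsilon>)" for t
      by (auto simp: mem_box_cart abs_le_iff algebra_simps)
    have cf: "Cc f" using f by (rule tf_Cc)
    have P: "Cc (?P j)" for j using tf_Cc[OF dil_tf[OF _ \<rho>(1)]] q by simp
    have cr: "Cc \<rho>" using \<rho> tf_Cc by blast
    let ?I = "\<integral>x. p x * conv \<rho> (conv \<rho> f) x \<partial>lborel"
    let ?f = "\<lambda>J. conv (?P J) (conv (?P J) f)"
    have cfJ: "Cc (?f J)" for J by (intro Cc_conv P cf)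
    have ip: "integrable lborel (\<lambda>x. p x * g x)" if "Cc g" for g
      using square_integrable_mult[OF p Cc_square_integrable[OF that]] .
    have step: "\<bar>(\<integral>x. p x * ?f J x \<partial>lborel) - ?I\<bar> \<le> CARD('d) * C * M * n2 f" for J
    proof -
      obtain U where U: "\<And>i. U i \<in> tf" "\<And>x. fdiv U x = ?f J x - conv \<rho> (conv \<rho> f) x"
        "\<And>i l. n2 (partial_deriv l (U i)) \<le> C * n2 f"
        "\<And>i x. U i x \<noteq> 0 \<Longrightarrow> (\<exists>j<J. \<exists>y t1 t2. f y \<noteq> 0 \<and> x = y + (q ^ j) *\<^sub>R (t1 + t2) \<and>
         (\<forall>l. \<bar>t1 $ l - v $ l\<bar> \<le> \<epsilon>) \<and> (\<forall>l. \<bar>t2 $ l - v $ l\<bar> \<le> \<epsilon>))"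
        using main[OF f, of J] by blast
      \<comment> \<open>What the support of \<open>f\<close> sweeps out at the finitely many scales
        in use; the hypothesis on supports places it in \<open>S\<close>.\<close>
      define K where "K = (\<Union>j<J. (\<lambda>(y, t1, t2). y + (q ^ j) *\<^sub>R (t1 + t2)) ` (supp f \<times> ?B \<times> ?B))"
      have K: "compact K" unfolding K_def
        using cf by (intro compact_UN finite_lessThan ballI compact_continuous_image compact_Times compact_cbox)
          (auto simp: Cc_def case_prod_beta intro!: continuous_intros)
      have "K \<subseteq> S" unfolding K_def using S q B by (auto simp: power_le_one)
      moreover have "x \<in> K" if nz: "U i x \<noteq> 0" for i x
      proof -
        obtain j y t1 t2 where "j < J" "f y \<noteq> 0" "x = y + (q ^ j) *\<^sub>R (t1 + t2)" "t1 \<in> ?B" "t2 \<in> ?B"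
          using U(4)[OF nz] B by blast
        moreover from this have "y \<in> supp f" using zero_outside_supp by blast
        ultimately show ?thesis unfolding K_def by (auto intro!: bexI[of _ j] image_eqI[of _ _ "(y, t1, t2)"])
      qed
      ultimately have "U i \<in> test_functions S" for i
        using U(1)[of i] K by (intro test_functionsI) (auto simp: tf_iff)
      then have UT: "U \<in> test_fields S" by (simp add: test_fields_def)
      have "(\<integral>x. p x * ?f J x \<partial>lborel) - ?I = (\<integral>x. p x * fdiv U x \<partial>lborel)"
        unfolding U(2) right_diff_distrib
        by (rule Bochner_Integration.integral_diff[symmetric]) (intro ip Cc_conv P cf cr)+
      also have "\<bar>\<dots>\<bar> \<le> M * grad_norm U" using gb(1) UT by (auto simp: grad_bound_def)
      also have "\<dots> \<le> M * (CARD('d) * (C * n2 f))"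
        using U(3) C gb(2) by (intro mult_left_mono grad_norm_le) auto
      finally show ?thesis by (simp add: mult.commute mult.left_commute)
    qed
    \<comment> \<open>The bounds are uniform in \<open>J\<close>, so the limit may be taken. The
      error of two convolutions is the convolution of the error of one plus that error, whence the
      factor \<open>?A + 1\<close>.\<close>
    have "(\<lambda>J. (\<integral>x. p x * ?f J x \<partial>lborel)) \<longlonglongrightarrow> (\<integral>x. p x * f x \<partial>lborel)"
    proof (rule LIM_zero_cancel, rule Lim_null_comparison)
      let ?A = "\<integral>x. \<bar>\<rho> x\<bar> \<partial>lborel"
      let ?e = "\<lambda>J. n2 (\<lambda>x. conv (?P J) f x - f x)"
      show "(\<lambda>J. n2 p * ((?A + 1) * ?e J)) \<longlonglongrightarrow> 0"
        by (intro tendsto_mult_right_zero approx_identity cr \<rho>(2) cf q)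
      show "eventually (\<lambda>J. norm ((\<integral>x. p x * ?f J x \<partial>lborel) - (\<integral>x. p x * f x \<partial>lborel)) \<le> n2 p * ((?A + 1) * ?e J)) sequentially"
      proof (intro always_eventually allI)
        fix J
        let ?d = "\<lambda>x. conv (?P J) f x - f x"
        have d: "Cc ?d" by (intro Cc_diff Cc_conv P cf)
        have eq: "(\<lambda>x. ?f J x - f x) = (\<lambda>x. conv (?P J) ?d x + ?d x)"
          using conv_diff_right[OF Cc_integrable[OF P[of J]] Cc_conv[OF P cf] cf] by (simp add: fun_eq_iff)
        have "(\<integral>x. p x * ?f J x \<partial>lborel) - (\<integral>x. p x * f x \<partial>lborel) = (\<integral>x. p x * (?f J x - f x) \<partial>lborel)"
          unfolding right_diff_distrib
          by (rule Bochner_Integration.integral_diff[symmetric]) (intro ip cfJ cf)+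
        also have "\<bar>\<dots>\<bar> \<le> n2 p * n2 (\<lambda>x. ?f J x - f x)"
          by (intro n2_Cauchy_Schwarz p Cc_square_integrable Cc_diff cfJ cf)
        also have "\<dots> \<le> n2 p * ((?A + 1) * ?e J)"
        proof (rule mult_left_mono)
          have "n2 (\<lambda>x. ?f J x - f x) \<le> n2 (conv (?P J) ?d) + n2 ?d"
            unfolding eq by (intro n2_triangle Cc_square_integrable Cc_conv P d)
          also have "n2 (conv (?P J) ?d) \<le> ?A * n2 ?d"
            using conv_Young[OF P d, of J] q by (simp add: integral_abs_dil)
          finally show "n2 (\<lambda>x. ?f J x - f x) \<le> (?A + 1) * ?e J" by (simp add: algebra_simps)
        qed simp
        finally show "norm ((\<integral>x. p x * ?f J x \<partial>lborel) - (\<integral>x. p x * f x \<partial>lborel)) \<le> n2 p * ((?A + 1) * ?e J)"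
          by simp
      qed
    qed
    then have "(\<lambda>J. \<bar>(\<integral>x. p x * ?f J x \<partial>lborel) - ?I\<bar>) \<longlonglongrightarrow> \<bar>(\<integral>x. p x * f x \<partial>lborel) - ?I\<bar>"
      by (intro tendsto_intros)
    then show ?thesis by (rule LIMSEQ_le_const2) (use step in blast)
  qed
  then show ?thesis using C by (intro that[OF \<rho> _ sup, of "CARD('d) * C"]) auto
qed

section \<open>Test functions determine square integrable functions\<close>

text \<open>In contrast with \<open>kernel\<close>, the sign matters here and the moments do not: a
  nonnegative mollifier keeps mollified indicators between 0 and 1.\<close>

lemma nonneg_bump:
  fixes \<epsilon> :: real assumes "\<epsilon> > 0"
  obtains \<rho> :: "real^'d::finite \<Rightarrow> real" where "\<rho> \<in> tf" "\<And>x. 0 \<le> \<rho> x" "(\<integral>x. \<rho> x \<partial>lborel) = 1"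
    "\<And>x. \<rho> x \<noteq> 0 \<Longrightarrow> norm x \<le> \<epsilon>"
proof -
  obtain \<beta> where \<beta>: "smooth1 \<beta>" "\<And>x. x \<le> 0 \<Longrightarrow> \<beta> x = 0" "\<And>x. 1 \<le> x \<Longrightarrow> \<beta> x = 0" "\<And>x. 0 \<le> \<beta> x"
    "(\<integral>x. \<beta> x \<partial>lborel) = (1::real)" by (rule bump1) blast
  have \<beta>01: "0 \<le> x \<and> x \<le> 1" if "\<beta> x \<noteq> 0" for x
    using \<beta>(2)[of x] \<beta>(3)[of x] that by force
  have c\<beta>: "Cc \<beta>" by (rule CcI[of _ "{0..1}"]) (use \<beta>01 smooth1_continuous[OF \<beta>(1)] in auto)
  define r :: "real^'d \<Rightarrow> real" where "r x = (\<Prod>l\<in>UNIV. \<beta> (x $ l))" for x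
  have r1: "0 \<le> x $ l \<and> x $ l \<le> 1" if "r x \<noteq> 0" for x l
    using that \<beta>01[of "x $ l"] by (auto simp: r_def)
  have rt: "r \<in> tf"
  proof (rule tfI_cbox[of _ 0 1])
    show "C_inf r" unfolding r_def[abs_def] by (intro C_inf_prod C_inf_smooth1_component \<beta>)
    show "\<bar>x $ l - 0 $ l\<bar> \<le> 1" if "r x \<noteq> 0" for x l using r1[OF that, of l] by simp
  qed
  have rn: "norm x \<le> CARD('d)" if "r x \<noteq> 0" for x
  proof -
    have "norm x \<le> (\<Sum>l\<in>UNIV. \<bar>x $ l\<bar>)" by (rule norm_le_l1_cart)
    also have "\<dots> \<le> (\<Sum>l\<in>(UNIV::'d set). 1)" using r1[OF that] by (intro sum_mono) auto
    finally show ?thesis by simp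
  qed
  have ri: "(\<integral>x. r x \<partial>lborel) = 1"
    unfolding r_def using integral_prod_components[of "\<lambda>_. \<beta>"] Cc_integrable[OF c\<beta>] \<beta>(5) by simp
  define h where "h = \<epsilon> / CARD('d)"
  have h: "h > 0" using assms by (simp add: h_def)
  show ?thesis
  proof (rule that[of "dil h r"])
    show "dil h r \<in> tf" using dil_tf h rt by blast
    show "0 \<le> dil h r x" for x using h \<beta> by (simp add: dil_def r_def prod_nonneg)
    show "(\<integral>x. dil h r x \<partial>lborel) = 1" using integral_dil[OF h, of r] ri by simp
    show "norm x \<le> \<epsilon>" if "dil h r x \<noteq> 0" for x
      using rn[of "(1 / h) *\<^sub>R x"] that h by (auto simp: dil_def h_def field_simps)
  qed
qed

text \<open>Mollify the indicator of the \<open>d\<close>-neighbourhood of \<open>K\<close> with a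
  bump of radius \<open>d\<close>; the support then stays within \<open>2 * d\<close> of
  \<open>K\<close>, and \<open>d\<close> is a third of the margin of \<open>K\<close> in
  \<open>U\<close>.\<close>

lemma smooth_cutoff:
  fixes K U :: "(real^'d::finite) set"
  assumes K: "compact K" and U: "open U" "K \<subseteq> U"
  obtains f where "f \<in> test_functions U" "\<And>x. 0 \<le> f x" "\<And>x. f x \<le> 1" "\<And>x. x \<in> K \<Longrightarrow> f x = 1"
proof -
  obtain \<delta> where \<delta>: "\<delta> > 0" "(\<Union>x\<in>K. ball x \<delta>) \<subseteq> U"
    by (rule compact_subset_open_imp_ball_epsilon_subset[OF K U])
  define d where "d = \<delta> / 3"
  have d: "d > 0" using \<delta> by (simp add: d_def)
  define N where "N e = {x + y |x y. x \<in> K \<and> y \<in> cball (0::real^'d) e}" for e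
  have N: "compact (N e)" for e unfolding N_def by (rule compact_plus[OF K compact_cball])
  obtain \<rho> :: "real^'d \<Rightarrow> real" where \<rho>: "\<rho> \<in> tf" "\<And>x. 0 \<le> \<rho> x" "(\<integral>x. \<rho> x \<partial>lborel) = 1"
    "\<And>x. \<rho> x \<noteq> 0 \<Longrightarrow> norm x \<le> d" by (rule nonneg_bump[OF d]) blast
  let ?g = "indicat_real (N d)"
  have g: "integrable lborel ?g"
    using N[of d] by (intro integrable_real_indicator emeasure_compact_finite) (auto intro: borel_compact)
  let ?f = "conv ?g \<rho>"
  have \<rho>x: "integrable lborel (\<lambda>y. \<rho> (x - y))" "(\<integral>y. \<rho> (x - y) \<partial>lborel) = 1" for x
    using Cc_integrable[OF Cc_reflect[OF tf_Cc[OF \<rho>(1)]]] \<rho>(3) by (auto simp: lborel_integral_reflect)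
  have i: "integrable lborel (\<lambda>y. ?g y * \<rho> (x - y))" for x by (rule conv_integrable[OF g tf_Cc[OF \<rho>(1)]])
  show ?thesis
  proof (rule that[of ?f])
    show "?f \<in> test_functions U"
    proof (rule test_functionsI[of _ "N (2 * d)"])
      show "C_inf ?f" by (rule C_inf_conv[OF g \<rho>(1)])
      show "compact (N (2 * d))" by (rule N)
      have "x + y \<in> ball x \<delta>" if "norm y \<le> 2 * d" for x y :: "real^'d"
        using that \<delta> by (simp add: dist_norm d_def)
      then show "N (2 * d) \<subseteq> U" unfolding N_def using \<delta>(2) by (auto simp: subset_iff)
      show "x \<in> N (2 * d)" if nz: "?f x \<noteq> 0" for x
      proof -
        from nz obtain y z where yz: "?g y \<noteq> 0" "\<rho> z \<noteq> 0" "x = y + z" by (rule conv_nonzeroD)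
        then obtain k w where "k \<in> K" "norm w \<le> d" "y = k + w"
          by (auto simp: N_def indicator_def split: if_splits)
        then have "k \<in> K" "norm (w + z) \<le> 2 * d" "x = k + (w + z)"
          using \<rho>(4)[OF yz(2)] yz(3) norm_triangle_ineq[of w z] by auto
        then show ?thesis unfolding N_def by auto
      qed
    qed
    show "0 \<le> ?f x" for x unfolding conv_def using \<rho>(2) by (intro Bochner_Integration.integral_nonneg) auto
    show "?f x \<le> 1" for x
    proof -
      have "?f x \<le> (\<integral>y. \<rho> (x - y) \<partial>lborel)" unfolding conv_def
        by (rule integral_mono[OF i \<rho>x(1)]) (use \<rho>(2) in \<open>auto simp: indicator_def\<close>)
      then show ?thesis by (simp add: \<rho>x)
    qed
    show "?f x = 1" if x: "x \<in> K" for x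
    proof -
      have "?g y * \<rho> (x - y) = \<rho> (x - y)" for y
      proof (cases "\<rho> (x - y) = 0")
        case False
        have "y = x + (y - x)" "norm (y - x) \<le> d" using \<rho>(4)[OF False] by (auto simp: norm_minus_commute)
        then have "y \<in> N d" unfolding N_def using x by (intro CollectI exI[of _ x] exI[of _ "y - x"]) auto
        then show ?thesis by simp
      qed simp
      then have "?f x = (\<integral>y. \<rho> (x - y) \<partial>lborel)" by (simp only: conv_def)
      then show ?thesis by (simp add: \<rho>x)
    qed
  qed
qed

text \<open>Outer regularity squeezes a smooth cutoff between \<open>K\<close> and an open set of
  nearly the same measure; the cutoff is orthogonal to \<open>h\<close> and close to the indicator
  in L2.\<close>

lemma integral_compact_zero:
  fixes h :: "real^'d::finite \<Rightarrow> real"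
  assumes h: "square_integrable h" and B: "open B" "K \<subseteq> B" "compact K"
    and orth: "\<And>f. f \<in> test_functions B \<Longrightarrow> (\<integral>x. h x * f x \<partial>lborel) = 0"
  shows "(\<integral>x. h x * indicat_real K x \<partial>lborel) = 0"
proof -
  let ?I = "\<integral>x. h x * indicat_real K x \<partial>lborel"
  have Kb: "K \<in> sets borel" using B by (simp add: borel_compact)
  have sqi: "square_integrable (indicat_real K)"
    using B Kb by (auto simp: square_integrable_def power2_eq_square indicator_inter_arith[symmetric]
      intro!: integrable_real_indicator emeasure_compact_finite)
  have bd: "\<bar>?I\<bar> \<le> n2 h * e" if e: "e > 0" for e
  proof -
    have "0 < e\<^sup>2" using e by simp
    then obtain V where V: "open V" "K \<subseteq> V" "emeasure lborel (V - K) < ennreal (e\<^sup>2)"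
      by (rule outer_regular_lborel[OF Kb])
    have VB: "open (V \<inter> B)" "K \<subseteq> V \<inter> B" using V B by auto
    obtain f where f: "f \<in> test_functions (V \<inter> B)" "\<And>x. 0 \<le> f x" "\<And>x. f x \<le> 1" "\<And>x. x \<in> K \<Longrightarrow> f x = 1"
      by (rule smooth_cutoff[OF B(3) VB]) blast
    have cf: "Cc f" using f test_functions_Cc by blast
    let ?d = "\<lambda>x. indicat_real K x - f x"
    have sqd: "square_integrable ?d" by (rule square_integrable_diff[OF sqi Cc_square_integrable[OF cf]])
    have Vb: "V - K \<in> sets lborel" using V Kb by auto
    have fin: "emeasure lborel (V - K) < \<infinity>" using V(3) by (auto intro: less_trans)
    have "(n2 ?d)\<^sup>2 \<le> (\<integral>x. indicat_real (V - K) x \<partial>lborel)"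
      unfolding n2_power2
    proof (rule integral_mono)
      show "integrable lborel (\<lambda>x. ?d x * ?d x)" by (rule square_integrable_mult[OF sqd sqd])
      show "integrable lborel (indicat_real (V - K))" using Vb fin by (intro integrable_real_indicator) auto
      show "?d x * ?d x \<le> indicat_real (V - K) x" for x
      proof (cases "x \<in> K")
        case False
        have "f x = 0" if "x \<notin> V" using that f(1) zero_outside_supp[of x f] by (auto simp: test_functions_iff)
        moreover have "f x * f x \<le> 1 * 1" using f by (intro mult_mono) auto
        ultimately show ?thesis using False by (auto simp: indicator_def)
      qed (use f in auto)
    qed
    also have "\<dots> \<le> e\<^sup>2"
      using V(3) Vb by (simp add: measure_def enn2real_leI less_imp_le)
    finally have d: "n2 ?d \<le> e" using e by (intro power2_le_imp_le[of "n2 ?d" e]) auto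
    have "(\<integral>x. h x * f x \<partial>lborel) = 0" using orth f(1) test_functions_mono by blast
    moreover have "integrable lborel (\<lambda>x. h x * indicat_real K x)" "integrable lborel (\<lambda>x. h x * f x)"
      using square_integrable_mult[OF h] sqi Cc_square_integrable[OF cf] by blast+
    ultimately have "?I = (\<integral>x. h x * ?d x \<partial>lborel)" by (simp add: right_diff_distrib)
    also have "\<bar>\<dots>\<bar> \<le> n2 h * n2 ?d" by (rule n2_Cauchy_Schwarz[OF h sqd])
    also have "\<dots> \<le> n2 h * e" by (intro mult_left_mono d) simp
    finally show ?thesis .
  qed
  have "\<bar>?I\<bar> \<le> 0"
  proof (rule field_le_epsilon)
    fix e :: real assume "e > 0"
    have n: "n2 h + 1 > 0" using n2_nonneg[of h] by linarith
    then have "\<bar>?I\<bar> \<le> n2 h * (e / (n2 h + 1))" using \<open>e > 0\<close> by (intro bd divide_pos_pos)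
    also have "\<dots> \<le> e" using n \<open>e > 0\<close> by (simp add: field_simps)
    finally show "\<bar>?I\<bar> \<le> 0 + e" by simp
  qed
  then show ?thesis by simp
qed

text \<open>The fundamental lemma of the calculus of variations. If \<open>h\<close> exceeded some e
  > 0 on a set of positive measure, inner regularity would give a compact subset of positive
  measure, over which \<open>h\<close> would have integral 0 and be larger than e.\<close>

lemma AE_zero_if_orthogonal:
  fixes h :: "real^'d::finite \<Rightarrow> real"
  assumes h: "square_integrable h" and B: "open B"
    and orth: "\<And>f. f \<in> test_functions B \<Longrightarrow> (\<integral>x. h x * f x \<partial>lborel) = 0"
  shows "AE x in lborel. x \<in> B \<longrightarrow> h x = 0"
proof -
  have no: "emeasure lborel ({x \<in> B. g x > e} \<inter> cball 0 R) = 0"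
    if g: "square_integrable g" "\<And>f. f \<in> test_functions B \<Longrightarrow> (\<integral>x. g x * f x \<partial>lborel) = 0" and e: "e > 0"
    for g e R
  proof (rule ccontr)
    let ?A = "{x \<in> B. g x > e} \<inter> cball 0 R"
    assume nz: "emeasure lborel ?A \<noteq> 0"
    have gm: "g \<in> borel_measurable borel" using g by (simp add: square_integrable_def)
    have "{x \<in> space borel. g x > e} \<in> sets borel" using gm by measurable
    moreover have "?A = B \<inter> {x \<in> space borel. g x > e} \<inter> cball 0 R" by auto
    ultimately have A: "?A \<in> sets borel" using B by auto
    have Afin: "emeasure lborel ?A < \<infinity>" by (intro emeasure_bounded_finite) (auto intro: bounded_subset[OF bounded_cball])
    define m where "m = measure lborel ?A"
    have m: "emeasure lborel ?A = ennreal m" "m > 0"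
      using nz Afin emeasure_eq_ennreal_measure[of lborel ?A] by (auto simp: m_def top.not_eq_extremum zero_less_measure_iff)
    have Al: "?A \<in> sets lebesgue" using A by (intro sets_completionI_sets) simp
    \<comment> \<open>Losing less than the full measure \<open>m\<close> leaves \<open>T\<close> a
      positive measure; the intersection with a ball makes it compact.\<close>
    obtain T where T: "closed T" "T \<subseteq> ?A" "emeasure lebesgue (?A - T) < ennreal m"
      by (rule sets_lebesgue_inner_closed[OF Al m(2)])
    have Tb: "T \<in> sets borel" using T by (simp add: borel_closed)
    have cT: "compact T" using T by (metis bounded_cball bounded_subset compact_eq_bounded_closed inf.bounded_iff)
    have AT: "emeasure lborel (?A - T) < ennreal m"
      using T(3) A Tb by simp
    have "emeasure lborel T \<noteq> 0"
    proof
      assume "emeasure lborel T = 0"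
      moreover have "emeasure lborel ?A \<le> emeasure lborel (?A - T) + emeasure lborel T"
        using emeasure_subadditive[of "?A - T" lborel T] A Tb T(2) emeasure_mono[of ?A "?A - T \<union> T" lborel]
        by (auto intro: order_trans)
      ultimately show False using AT m by simp
    qed
    moreover have "emeasure lborel T < \<infinity>" using cT by (rule emeasure_compact_finite)
    ultimately have mT: "measure lborel T > 0"
      using emeasure_eq_ennreal_measure[of lborel T] by (cases "measure lborel T = 0") (auto simp: zero_less_measure_iff less_top)
    have sqi: "integrable lborel (indicat_real T)"
      using Tb \<open>emeasure lborel T < \<infinity>\<close> by (intro integrable_real_indicator) auto
    have "e * measure lborel T = (\<integral>x. e * indicat_real T x \<partial>lborel)" using Tb by simp
    also have "\<dots> \<le> (\<integral>x. g x * indicat_real T x \<partial>lborel)"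
    proof (rule integral_mono)
      show "integrable lborel (\<lambda>x. e * indicat_real T x)" using sqi by simp
      show "integrable lborel (\<lambda>x. g x * indicat_real T x)"
        using square_integrable_mult[OF g(1), of "indicat_real T"] sqi Tb
        by (auto simp: square_integrable_def power2_eq_square indicator_inter_arith[symmetric])
      show "e * indicat_real T x \<le> g x * indicat_real T x" for x
        using T(2) by (auto simp: indicator_def)
    qed
    also have "\<dots> = 0"
    proof (rule integral_compact_zero[OF g(1) B _ cT])
      show "T \<subseteq> B" using T(2) by auto
    qed (rule g(2))
    finally show False using e mT by (simp add: mult_le_0_iff)
  qed
  \<comment> \<open>The set where \<open>g\<close> is positive is a countable union of bounded sets
    as in \<open>no\<close>; the set where \<open>h\<close> is negative is reached through
    \<open>- h\<close>.\<close>
  have AE1: "AE x in lborel. \<forall>n. \<not> (x \<in> B \<and> g x > 1 / Suc n \<and> norm x \<le> Suc n)"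
    if g: "square_integrable g" "\<And>f. f \<in> test_functions B \<Longrightarrow> (\<integral>x. g x * f x \<partial>lborel) = 0" for g
    unfolding AE_all_countable
  proof
    fix n
    let ?A = "{x \<in> B. g x > 1 / Suc n} \<inter> cball 0 (Suc n)"
    have "g \<in> borel_measurable borel" using g by (simp add: square_integrable_def)
    then have "{x \<in> space borel. g x > 1 / Suc n} \<in> sets borel" by measurable
    moreover have "?A = B \<inter> {x \<in> space borel. g x > 1 / Suc n} \<inter> cball 0 (Suc n)" by auto
    ultimately have A: "?A \<in> sets lborel" using B by auto
    have "emeasure lborel ?A = 0" by (rule no[OF g(1)]) (auto intro: g(2))
    then have "?A \<in> null_sets lborel" using A by (intro null_setsI) auto
    then show "AE x in lborel. \<not> (x \<in> B \<and> g x > 1 / Suc n \<and> norm x \<le> Suc n)"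
      using AE_iff_null_sets[OF A] by (auto elim: AE_mp)
  qed
  have h': "square_integrable (\<lambda>x. - h x)" "\<And>f. f \<in> test_functions B \<Longrightarrow> (\<integral>x. - h x * f x \<partial>lborel) = 0"
    using square_integrable_minus[OF h] orth by auto
  have a1: "AE x in lborel. \<forall>n. \<not> (x \<in> B \<and> h x > 1 / Suc n \<and> norm x \<le> Suc n)"
    by (rule AE1[OF h]) (rule orth)
  have a2: "AE x in lborel. \<forall>n. \<not> (x \<in> B \<and> - h x > 1 / Suc n \<and> norm x \<le> Suc n)"
    by (rule AE1[OF h'(1)]) (rule h'(2))
  show ?thesis
    using a1 a2
  proof eventually_elim
    fix x
    assume a: "\<forall>n. \<not> (x \<in> B \<and> h x > 1 / Suc n \<and> norm x \<le> Suc n)"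
      "\<forall>n. \<not> (x \<in> B \<and> - h x > 1 / Suc n \<and> norm x \<le> Suc n)"
    show "x \<in> B \<longrightarrow> h x = 0"
    proof (rule ccontr)
      assume "\<not> ?thesis"
      then have xB: "x \<in> B" "\<bar>h x\<bar> > 0" by auto
      obtain n where n: "norm x + 1 / \<bar>h x\<bar> < real n" using reals_Archimedean2 by blast
      moreover have "0 \<le> 1 / \<bar>h x\<bar>" "0 \<le> norm x" by auto
      ultimately have "1 / \<bar>h x\<bar> < Suc n" "norm x \<le> Suc n" by linarith+
      moreover from this(1) have "1 / Suc n < \<bar>h x\<bar>" using xB by (simp add: field_simps)
      ultimately show False using a xB by (cases "h x \<ge> 0") auto
    qed
  qed
qed

section \<open>Completeness of the space of square integrable functions\<close>

lemma square_integrable_rep_L2: "square_integrable (rep_L2 x)"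
  using Quotient3_rep_reflp[OF Quotient3_L2, of x] by (simp add: L2_rel_def)

lemma L2_class_rep_L2: "L2_class (rep_L2 x) = x"
  by (rule Quotient3_abs_rep[OF Quotient3_L2])

lemma L2_class_eq_iff:
  "square_integrable f \<Longrightarrow> square_integrable g \<Longrightarrow> L2_class f = L2_class g \<longleftrightarrow> (AE x in lborel. f x = g x)"
  using Quotient3_rel[OF Quotient3_L2, of f g] by (auto simp: L2_rel_def)

lemma L2_class_diff:
  "square_integrable f \<Longrightarrow> square_integrable g \<Longrightarrow> L2_class f - L2_class g = L2_class (\<lambda>x. f x - g x)"
  by (simp add: minus_L2.abs_eq L2_rel_refl)

lemma L2_class_add:
  "square_integrable f \<Longrightarrow> square_integrable g \<Longrightarrow> L2_class f + L2_class g = L2_class (\<lambda>x. f x + g x)"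
  by (simp add: plus_L2.abs_eq L2_rel_refl)

lemma L2_class_scaleR:
  "square_integrable f \<Longrightarrow> c *\<^sub>R L2_class f = L2_class (\<lambda>x. c * f x)"
  by (simp add: scaleR_L2.abs_eq L2_rel_refl)

lemma L2_class_sum:
  "(\<And>i. i \<in> I \<Longrightarrow> square_integrable (f i)) \<Longrightarrow>
    (\<Sum>i\<in>I. L2_class (f i)) = L2_class (\<lambda>x. \<Sum>i\<in>I. f i x) \<and> square_integrable (\<lambda>x. \<Sum>i\<in>I. f i x)"
  by (induction I rule: infinite_finite_induct)
    (auto simp: zero_L2.abs_eq square_integrable_zero L2_class_add square_integrable_add)

lemma nn_integral_square:
  "square_integrable f \<Longrightarrow> (\<integral>\<^sup>+x. ennreal ((f x)\<^sup>2) \<partial>lborel) = ennreal ((n2 f)\<^sup>2)"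
  by (subst nn_integral_eq_integral) (auto simp: square_integrable_def n2_def)

lemma square_integrable_nn:
  assumes "f \<in> borel_measurable borel" "(\<integral>\<^sup>+x. ennreal ((f x)\<^sup>2) \<partial>lborel) \<le> ennreal (c\<^sup>2)" "0 \<le> c"
  shows "square_integrable f" "n2 f \<le> c"
proof -
  have "integrable lborel (\<lambda>x. (f x)\<^sup>2)"
    using assms by (intro integrableI_bounded) (auto intro: le_less_trans)
  then show sq: "square_integrable f" using assms(1) by (simp add: square_integrable_def)
  have "ennreal ((n2 f)\<^sup>2) \<le> ennreal (c\<^sup>2)" using assms(2) nn_integral_square[OF sq] by simp
  then have "(n2 f)\<^sup>2 \<le> c\<^sup>2" by (subst (asm) ennreal_le_iff) auto
  then show "n2 f \<le> c" using assms(3) by (rule power2_le_imp_le)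
qed

text \<open>The argument of Riesz and Fischer: with geometrically small increments, the sum of their
  absolute values is finite almost everywhere by monotone convergence, so the representatives
  converge pointwise; Fatou's lemma bounds the distance of the limit from each term.\<close>

lemma L2_fast_Cauchy_converges:
  fixes X :: "nat \<Rightarrow> 'a::euclidean_space L2"
  assumes X: "\<And>k. norm (X (Suc k) - X k) \<le> (1/2) ^ k"
  obtains x where "X \<longlonglongrightarrow> x"
proof -
  define f where "f k = rep_L2 (X k)" for k
  have f: "square_integrable (f k)" "X k = L2_class (f k)" for k
    by (simp_all add: f_def square_integrable_rep_L2 L2_class_rep_L2)
  have [measurable]: "f k \<in> borel_measurable borel" for k using f(1)[of k] by (simp add: square_integrable_def)
  define d where "d k x = \<bar>f (Suc k) x - f k x\<bar>" for k x
  have [measurable]: "d k \<in> borel_measurable borel" for k unfolding d_def[abs_def] by measurable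
  have d_sq: "square_integrable (d k)" for k
    using square_integrable_diff[OF f(1) f(1), of "Suc k" k] by (simp add: square_integrable_def d_def)
  have "n2 (d k) \<le> (1/2) ^ k" for k
  proof -
    have "n2 (d k) = norm (X (Suc k) - X k)"
      using norm_L2_class[OF square_integrable_diff[OF f(1) f(1), of "Suc k" k]]
      by (simp add: f(2) L2_class_diff[OF f(1) f(1)] n2_def d_def)
    then show ?thesis using X by simp
  qed
  then have dk: "norm (L2_class (d k)) \<le> (1/2) ^ k" for k using d_sq by (simp add: norm_L2_class)
  define D where "D m x = (\<Sum>k<m. d k x)" for m x
  have D: "square_integrable (D m)" "n2 (D m) \<le> 2" for m
  proof -
    have s: "(\<Sum>k<m. L2_class (d k)) = L2_class (D m)" "square_integrable (D m)"
      using L2_class_sum[of "{..<m}" d] d_sq by (simp_all add: D_def[abs_def])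
    then show "square_integrable (D m)" by simp
    have "n2 (D m) = norm (\<Sum>k<m. L2_class (d k))" using s by (simp add: norm_L2_class)
    also have "\<dots> \<le> (\<Sum>k<m. (1/2::real) ^ k)" using dk by (intro order_trans[OF norm_sum] sum_mono)
    also have "\<dots> \<le> 2" by (simp add: sum_gp_strict)
    finally show "n2 (D m) \<le> 2" .
  qed
  have D_mono: "D m x \<le> D (Suc m) x" "0 \<le> D m x" for m x by (auto simp: D_def d_def sum_nonneg)
  have [measurable]: "D m \<in> borel_measurable borel" for m using D(1)[of m] by (simp add: square_integrable_def)
  have "(\<integral>\<^sup>+x. (SUP m. ennreal ((D m x)\<^sup>2)) \<partial>lborel) = (SUP m. \<integral>\<^sup>+x. ennreal ((D m x)\<^sup>2) \<partial>lborel)"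
  proof (rule nn_integral_monotone_convergence_SUP)
    show "incseq (\<lambda>m x. ennreal ((D m x)\<^sup>2))"
      using D_mono by (intro incseq_SucI le_funI ennreal_leI power_mono) auto
  qed measurable
  also have "\<dots> \<le> ennreal (2\<^sup>2)"
    unfolding nn_integral_square[OF D(1)] by (intro SUP_least ennreal_leI power_mono D) simp
  finally have "(\<integral>\<^sup>+x. (SUP m. ennreal ((D m x)\<^sup>2)) \<partial>lborel) \<noteq> \<infinity>"
    by (auto simp: top_unique)
  then have "AE x in lborel. (SUP m. ennreal ((D m x)\<^sup>2)) \<noteq> \<infinity>"
    by (intro nn_integral_noteq_infinite) auto
  then have conv: "AE x in lborel. convergent (\<lambda>k. f k x)"
  proof eventually_elim
    fix x assume "(SUP m. ennreal ((D m x)\<^sup>2)) \<noteq> \<infinity>"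
    then obtain c where c: "(SUP m. ennreal ((D m x)\<^sup>2)) = ennreal c" "0 \<le> c"
      by (cases "SUP m. ennreal ((D m x)\<^sup>2)") auto
    have "D m x \<le> sqrt c" for m
    proof -
      have "ennreal ((D m x)\<^sup>2) \<le> ennreal c" unfolding c(1)[symmetric] by (rule SUP_upper) simp
      then have "(D m x)\<^sup>2 \<le> c" using c(2) by simp
      then show ?thesis by (rule real_le_rsqrt)
    qed
    then have "summable (\<lambda>k. d k x)"
      by (intro summableI_nonneg_bounded[of _ "sqrt c"]) (auto simp: D_def d_def)
    then have "summable (\<lambda>k. f (Suc k) x - f k x)"
      unfolding d_def by (rule summable_rabs_cancel)
    then have "convergent (\<lambda>m. \<Sum>k<m. f (Suc k) x - f k x)" by (simp add: summable_iff_convergent)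
    then have "convergent (\<lambda>m. (f m x - f 0 x))" by (simp add: sum_lessThan_telescope[of "\<lambda>k. f k x"])
    then show "convergent (\<lambda>k. f k x)" using convergent_add_const_right_iff[of "\<lambda>k. f k x" "- f 0 x"] by simp
  qed
  define g where "g x = lim (\<lambda>k. f k x)" for x
  have gm [measurable]: "g \<in> borel_measurable borel" unfolding g_def[abs_def] by measurable
  have tail: "norm (X m - X k) \<le> 2 * (1/2) ^ k" if "k \<le> m" for k m
  proof -
    have "norm (X (k + j) - X k) \<le> 2 * (1/2) ^ k - 2 * (1/2) ^ (k + j)" for j
    proof (induction j)
      case (Suc j)
      have "norm (X (k + Suc j) - X k) \<le> norm (X (Suc (k + j)) - X (k + j)) + norm (X (k + j) - X k)"
        using norm_triangle_ineq[of "X (Suc (k + j)) - X (k + j)" "X (k + j) - X k"] by simp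
      then show ?case using Suc X[of "k + j"] by simp
    qed simp
    from this[of "m - k"] have "norm (X m - X k) \<le> 2 * (1/2) ^ k - 2 * (1/2) ^ m" using that by simp
    moreover have "0 \<le> (1/2::real) ^ m" by simp
    ultimately show ?thesis by linarith
  qed
  have est: "square_integrable (\<lambda>x. g x - f k x) \<and> n2 (\<lambda>x. g x - f k x) \<le> 2 * (1/2) ^ k" for k
  proof -
    have "(\<integral>\<^sup>+x. ennreal ((g x - f k x)\<^sup>2) \<partial>lborel) \<le> (\<integral>\<^sup>+x. liminf (\<lambda>m. ennreal ((f m x - f k x)\<^sup>2)) \<partial>lborel)"
    proof (rule nn_integral_mono_AE)
      show "AE x in lborel. ennreal ((g x - f k x)\<^sup>2) \<le> liminf (\<lambda>m. ennreal ((f m x - f k x)\<^sup>2))"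
        using conv
      proof eventually_elim
        fix x assume "convergent (\<lambda>k. f k x)"
        then have "(\<lambda>k. f k x) \<longlonglongrightarrow> g x" by (simp add: g_def convergent_LIMSEQ_iff)
        then have "(\<lambda>m. ennreal ((f m x - f k x)\<^sup>2)) \<longlonglongrightarrow> ennreal ((g x - f k x)\<^sup>2)"
          by (intro tendsto_intros)
        then have "liminf (\<lambda>m. ennreal ((f m x - f k x)\<^sup>2)) = ennreal ((g x - f k x)\<^sup>2)"
          by (intro lim_imp_Liminf) auto
        then show "ennreal ((g x - f k x)\<^sup>2) \<le> liminf (\<lambda>m. ennreal ((f m x - f k x)\<^sup>2))" by simp
      qed
    qed
    also have "\<dots> \<le> liminf (\<lambda>m. \<integral>\<^sup>+x. ennreal ((f m x - f k x)\<^sup>2) \<partial>lborel)"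
      by (intro nn_integral_liminf) measurable
    also have "\<dots> \<le> limsup (\<lambda>m. \<integral>\<^sup>+x. ennreal ((f m x - f k x)\<^sup>2) \<partial>lborel)"
      by (rule Liminf_le_Limsup) simp
    also have "\<dots> \<le> ennreal ((2 * (1/2) ^ k)\<^sup>2)"
    proof (rule Limsup_bounded)
      have "(\<integral>\<^sup>+x. ennreal ((f m x - f k x)\<^sup>2) \<partial>lborel) \<le> ennreal ((2 * (1/2) ^ k)\<^sup>2)" if "k \<le> m" for m
        using tail[OF that] norm_L2_class[OF square_integrable_diff[OF f(1) f(1), of m k]]
        unfolding nn_integral_square[OF square_integrable_diff[OF f(1) f(1)]] f(2) L2_class_diff[OF f(1) f(1)]
        by (intro ennreal_leI power_mono) auto
      then show "eventually (\<lambda>m. (\<integral>\<^sup>+x. ennreal ((f m x - f k x)\<^sup>2) \<partial>lborel) \<le> ennreal ((2 * (1/2) ^ k)\<^sup>2)) sequentially"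
        by (auto simp: eventually_sequentially)
    qed
    finally show ?thesis using square_integrable_nn[of "\<lambda>x. g x - f k x" "2 * (1/2) ^ k"] by auto
  qed
  have g: "square_integrable g"
    using square_integrable_add[OF conjunct1[OF est[of 0]] f(1)[of 0]] by simp
  have "X \<longlonglongrightarrow> L2_class g"
  proof (rule LIM_zero_cancel, rule Lim_null_comparison)
    show "(\<lambda>k. 2 * (1/2::real) ^ k) \<longlonglongrightarrow> 0"
      by (intro tendsto_mult_right_zero LIMSEQ_realpow_zero) auto
    have "norm (X k - L2_class g) \<le> 2 * (1/2) ^ k" for k
      using est[of k] norm_L2_class[of "\<lambda>x. g x - f k x"] L2_class_diff[OF g f(1)[of k]]
      by (simp add: f(2) norm_minus_commute)
    then show "eventually (\<lambda>k. norm (X k - L2_class g) \<le> 2 * (1/2) ^ k) sequentially" by simp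
  qed
  then show ?thesis by (rule that)
qed

instance L2 :: (euclidean_space) complete_space
proof
  fix X :: "nat \<Rightarrow> 'a L2" assume X: "Cauchy X"
  have "\<exists>N. \<forall>m\<ge>N. \<forall>n\<ge>N. norm (X m - X n) < (1/2) ^ k" for k :: nat
    using X by (intro CauchyD) auto
  then obtain N where N: "\<And>k m n. N k \<le> m \<Longrightarrow> N k \<le> n \<Longrightarrow> norm (X m - X n) < (1/2) ^ k" by metis
  \<comment> \<open>Summing \<open>Suc (N j)\<close> makes the subsequence strictly increasing and
    at least \<open>N k\<close> at the same time.\<close>
  define r where "r k = (\<Sum>j\<le>k. Suc (N j))" for k
  have r: "strict_mono r" "N k \<le> r k" for k
    unfolding r_def strict_mono_Suc_iff using member_le_sum[of k "{..k}" "\<lambda>j. Suc (N j)"]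
    by auto
  have "norm (X (r (Suc k)) - X (r k)) \<le> (1/2) ^ k" for k
    using N[of k "r (Suc k)" "r k"] r(2)[of k] strict_monoD[OF r(1), of k "Suc k"] by (simp add: less_imp_le)
  then obtain x where "(\<lambda>k. X (r k)) \<longlonglongrightarrow> x"
    using L2_fast_Cauchy_converges[of "\<lambda>k. X (r k)"] by blast
  then show "convergent X"
    using X r(1) Cauchy_converges_subseq[of X r x] by (auto simp: convergent_def comp_def)
qed

section \<open>Complete symmetric bilinear forms\<close>

lemma le_if_square_le: "x * x \<le> y * x \<Longrightarrow> 0 \<le> x \<Longrightarrow> 0 \<le> y \<Longrightarrow> x \<le> y" for x y :: real
  by (cases "x = 0") (auto dest: mult_right_le_imp_le)

text \<open>An inner product on a carrier set rather than on a type, because one space carries its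
  standard inner product and several that depend on parameters. The laws are confined to
  \<open>D\<close>: outside it the weak derivatives inside the forms are uncontrolled. Completeness
  is stated through the form itself.\<close>

locale hilbert_form =
  fixes D :: "'a::real_vector set" and b :: "'a \<Rightarrow> 'a \<Rightarrow> real"
  assumes subspace: "subspace D"
    and add_left: "\<And>x y z. x \<in> D \<Longrightarrow> y \<in> D \<Longrightarrow> z \<in> D \<Longrightarrow> b (x + y) z = b x z + b y z"
    and scale_left: "\<And>c x z. x \<in> D \<Longrightarrow> z \<in> D \<Longrightarrow> b (c *\<^sub>R x) z = c * b x z"
    and sym: "\<And>x y. x \<in> D \<Longrightarrow> y \<in> D \<Longrightarrow> b x y = b y x"
    and pos: "\<And>x. x \<in> D \<Longrightarrow> x \<noteq> 0 \<Longrightarrow> b x x > 0"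
    and complete: "\<And>X. (\<And>n. X n \<in> D) \<Longrightarrow>
      (\<And>e. e > 0 \<Longrightarrow> \<exists>N. \<forall>m\<ge>N. \<forall>n\<ge>N. b (X m - X n) (X m - X n) < e) \<Longrightarrow>
      \<exists>x\<in>D. (\<lambda>n. b (X n - x) (X n - x)) \<longlonglongrightarrow> 0"
begin

lemma D_zero: "0 \<in> D" and D_add: "x \<in> D \<Longrightarrow> y \<in> D \<Longrightarrow> x + y \<in> D"
  and D_scale: "x \<in> D \<Longrightarrow> c *\<^sub>R x \<in> D" and D_diff: "x \<in> D \<Longrightarrow> y \<in> D \<Longrightarrow> x - y \<in> D"
  using subspace by (auto simp: subspace_0 subspace_add subspace_scale subspace_diff)

lemma add_right: "x \<in> D \<Longrightarrow> y \<in> D \<Longrightarrow> z \<in> D \<Longrightarrow> b z (x + y) = b z x + b z y"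
  by (simp add: sym[of z] add_left D_add)

lemma scale_right: "x \<in> D \<Longrightarrow> z \<in> D \<Longrightarrow> b z (c *\<^sub>R x) = c * b z x"
  by (simp add: sym[of z] scale_left D_scale)

lemma diff_left: "x \<in> D \<Longrightarrow> y \<in> D \<Longrightarrow> z \<in> D \<Longrightarrow> b (x - y) z = b x z - b y z"
  using add_left[of x "(-1) *\<^sub>R y" z] scale_left[of y z "-1"] D_scale[of y "-1"] by simp

lemma diff_right: "x \<in> D \<Longrightarrow> y \<in> D \<Longrightarrow> z \<in> D \<Longrightarrow> b z (x - y) = b z x - b z y"
  by (simp add: sym[of z] diff_left D_diff)

lemma zero_left: "z \<in> D \<Longrightarrow> b 0 z = 0"
  using scale_left[of 0 z 0] D_zero by simp

lemma nonneg: "x \<in> D \<Longrightarrow> 0 \<le> b x x"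
  using pos[of x] zero_left[OF D_zero] by (cases "x = 0") auto

lemma quadratic:
  assumes "x \<in> D" "y \<in> D"
  shows "b (x + t *\<^sub>R y) (x + t *\<^sub>R y) = b x x + 2 * t * b x y + t\<^sup>2 * b y y"
  using assms sym[of y x]
  by (simp add: add_left add_right scale_left scale_right D_add D_scale power2_eq_square algebra_simps)

lemma Cauchy_Schwarz:
  assumes "x \<in> D" "y \<in> D" shows "\<bar>b x y\<bar> \<le> sqrt (b x x) * sqrt (b y y)"
proof (cases "y = 0")
  case True
  then show ?thesis using assms zero_left[of x] sym[of x y] D_zero nonneg[of x] nonneg[OF D_zero] by simp
next
  case False
  then have y: "b y y > 0" using assms pos by blast
  define t where "t = - b x y / b y y"
  have "0 \<le> b (x + t *\<^sub>R y) (x + t *\<^sub>R y)" using assms by (intro nonneg D_add D_scale)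
  also have "\<dots> = b x x - (b x y)\<^sup>2 / b y y"
    using y unfolding quadratic[OF assms] by (simp add: t_def field_simps power2_eq_square)
  finally have "(b x y)\<^sup>2 \<le> b x x * b y y" using y by (simp add: field_simps)
  then have "sqrt ((b x y)\<^sup>2) \<le> sqrt (b x x * b y y)" by (rule real_sqrt_le_mono)
  then show ?thesis by (simp add: real_sqrt_mult)
qed

lemma eq_if_eq_left:
  assumes "x \<in> D" "y \<in> D" "\<And>z. z \<in> D \<Longrightarrow> b x z = b y z" shows "x = y"
proof (rule ccontr)
  assume "x \<noteq> y"
  then have "b (x - y) (x - y) > 0" using assms pos[of "x - y"] D_diff by simp
  moreover have "b (x - y) (x - y) = 0" using assms D_diff[of x y] by (simp add: diff_left)
  ultimately show False by simp
qed

text \<open>Minimise the energy \<open>b x x - 2 * F x\<close>. It is bounded below by the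
  continuity of \<open>F\<close>; the parallelogram law makes a minimising sequence Cauchy, and its
  limit satisfies the first order condition, which is the representation.\<close>

lemma Riesz:
  assumes F_add: "\<And>x y. x \<in> D \<Longrightarrow> y \<in> D \<Longrightarrow> F (x + y) = F x + F y"
    and F_scale: "\<And>c x. x \<in> D \<Longrightarrow> F (c *\<^sub>R x) = c * F x"
    and F_bound: "\<And>x. x \<in> D \<Longrightarrow> \<bar>F x\<bar> \<le> K * sqrt (b x x)"
  obtains y where "y \<in> D" "\<And>x. x \<in> D \<Longrightarrow> F x = b y x"
proof -
  define J where "J x = b x x - 2 * F x" for x
  have lower: "J x \<ge> - K\<^sup>2" if "x \<in> D" for x
  proof -
    have "F x \<le> K * sqrt (b x x)" using F_bound[OF that] by simp
    moreover have "0 \<le> (sqrt (b x x) - K)\<^sup>2" by simp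
    then have "2 * (K * sqrt (b x x)) \<le> b x x + K\<^sup>2"
      using nonneg[OF that] by (simp add: power2_diff algebra_simps)
    ultimately show ?thesis by (simp add: J_def)
  qed
  define m where "m = Inf (J ` D)"
  have bdd: "bdd_below (J ` D)" using lower by (auto simp: bdd_below_def)
  have m_le: "m \<le> J x" if "x \<in> D" for x unfolding m_def using that bdd by (intro cInf_lower) auto
  have "\<exists>x\<in>D. J x < m + 1 / real (Suc n)" for n
  proof -
    have "J ` D \<noteq> {}" using D_zero by auto
    then have "\<exists>y\<in>J ` D. y < m + 1 / real (Suc n)"
      unfolding m_def by (intro cInf_lessD) auto
    then show ?thesis by auto
  qed
  then obtain X where X: "\<And>n. X n \<in> D" "\<And>n. J (X n) < m + 1 / real (Suc n)" by metis
  have J_quad: "J (x + t *\<^sub>R z) = J x + 2 * t * (b x z - F z) + t\<^sup>2 * b z z" if "x \<in> D" "z \<in> D" for x z t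
    using that by (simp add: J_def quadratic F_add F_scale D_scale algebra_simps)
  have par: "b (x - y) (x - y) \<le> 2 * (J x - m) + 2 * (J y - m)" if xy: "x \<in> D" "y \<in> D" for x y
  proof -
    let ?z = "(1/2) *\<^sub>R (x + y)"
    have z: "?z \<in> D" using xy by (intro D_scale D_add)
    have "b (x - y) (x - y) = 2 * J x + 2 * J y - 4 * J ?z"
      using xy sym[of y x]
      by (simp add: J_def scale_left scale_right add_left add_right diff_left diff_right F_add F_scale D_add D_diff D_scale field_simps)
    then show ?thesis using m_le[OF z] by simp
  qed
  have "\<exists>N. \<forall>k\<ge>N. \<forall>n\<ge>N. b (X k - X n) (X k - X n) < e" if e: "e > 0" for e
  proof -
    obtain N where N: "1 / real (Suc N) < e / 4" using e reals_Archimedean[of "e / 4"] by (auto simp: inverse_eq_divide)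
    have Jn: "J (X n) - m < e / 4" if "n \<ge> N" for n
    proof -
      have "1 / real (Suc n) \<le> 1 / real (Suc N)" using that by (simp add: field_simps)
      then show ?thesis using X(2)[of n] N by linarith
    qed
    have "b (X k - X n) (X k - X n) < e" if "k \<ge> N" "n \<ge> N" for k n
      proof -
      have "b (X k - X n) (X k - X n) \<le> 2 * (J (X k) - m) + 2 * (J (X n) - m)"
        by (rule par[OF X(1) X(1)])
      also have "\<dots> < 2 * (e / 4) + 2 * (e / 4)"
        using Jn[OF that(1)] Jn[OF that(2)] by (intro add_strict_mono mult_strict_left_mono) auto
      finally show ?thesis by simp
    qed
    then show ?thesis by blast
  qed
  from complete[OF X(1) this] obtain y where y: "y \<in> D" "(\<lambda>n. b (X n - y) (X n - y)) \<longlonglongrightarrow> 0" by blast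
  have "F z = b y z" if z: "z \<in> D" for z
  proof -
    have lim: "(\<lambda>n. b (X n) z) \<longlonglongrightarrow> b y z"
    proof (rule LIM_zero_cancel, rule Lim_null_comparison)
      have "(\<lambda>n. sqrt (b (X n - y) (X n - y))) \<longlonglongrightarrow> sqrt 0" by (intro tendsto_real_sqrt y)
      then show "(\<lambda>n. sqrt (b (X n - y) (X n - y)) * sqrt (b z z)) \<longlonglongrightarrow> 0"
        by (intro tendsto_mult_left_zero) simp
      show "eventually (\<lambda>n. norm (b (X n) z - b y z) \<le> sqrt (b (X n - y) (X n - y)) * sqrt (b z z)) sequentially"
        using Cauchy_Schwarz[OF D_diff[OF X(1) y(1)] z] by (simp add: diff_left X y z)
    qed
    define r where "r = b y z - F z"
    have ge: "0 \<le> 2 * t * r + t\<^sup>2 * b z z" for t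
    proof -
      have "(\<lambda>n. 1 / real (Suc n) + 2 * t * (b (X n) z - F z) + t\<^sup>2 * b z z) \<longlonglongrightarrow> 0 + 2 * t * r + t\<^sup>2 * b z z"
        unfolding r_def by (intro tendsto_intros lim LIMSEQ_Suc[OF lim_1_over_n])
      moreover have "0 \<le> 1 / real (Suc n) + 2 * t * (b (X n) z - F z) + t\<^sup>2 * b z z" for n
        using m_le[OF D_add[OF X(1)[of n] D_scale[OF z, of t]]] J_quad[OF X(1)[of n] z, of t] X(2)[of n] by simp
      ultimately show ?thesis by (intro LIMSEQ_le_const[of _ _ 0]) auto
    qed
    define c where "c = b z z"
    have c: "c \<ge> 0" using nonneg z by (simp add: c_def)
    \<comment> \<open>The minimising step would be - r / c; the denominator \<open>c + 1\<close>
      also serves for c = 0 and still produces a negative multiple of r^2.\<close>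
    have "0 \<le> 2 * (- r / (c + 1)) * r + (- r / (c + 1))\<^sup>2 * c" using ge[of "- r / (c + 1)"] by (simp add: c_def)
    also have "\<dots> = - (r\<^sup>2 * (c + 2)) / (c + 1)\<^sup>2"
      using c by (simp add: power_divide field_simps power2_eq_square add_nonneg_eq_0_iff)
    finally have "r\<^sup>2 * (c + 2) \<le> 0" using c by (simp add: divide_le_0_iff zero_le_divide_iff)
    then have "r = 0" using c by (simp add: mult_le_0_iff)
    then show ?thesis by (simp add: r_def)
  qed
  then show ?thesis using that y by blast
qed

text \<open>Completeness depends only on the equivalence class of the form: Cauchy sequences pass
  from \<open>b'\<close> to \<open>b\<close> by the lower bound, limits back by the upper
  one.\<close>

lemma equivalent_form:
  assumes add': "\<And>x y z. x \<in> D \<Longrightarrow> y \<in> D \<Longrightarrow> z \<in> D \<Longrightarrow> b' (x + y) z = b' x z + b' y z"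
    and scale': "\<And>c x z. x \<in> D \<Longrightarrow> z \<in> D \<Longrightarrow> b' (c *\<^sub>R x) z = c * b' x z"
    and sym': "\<And>x y. x \<in> D \<Longrightarrow> y \<in> D \<Longrightarrow> b' x y = b' y x"
    and c: "c > 0" "\<And>x. x \<in> D \<Longrightarrow> c * b x x \<le> b' x x"
    and C: "\<And>x. x \<in> D \<Longrightarrow> b' x x \<le> C * b x x"
  shows "hilbert_form D b'"
proof
  fix X :: "nat \<Rightarrow> 'a"
  assume X: "\<And>n. X n \<in> D" "\<And>e. e > 0 \<Longrightarrow> \<exists>N. \<forall>m\<ge>N. \<forall>n\<ge>N. b' (X m - X n) (X m - X n) < e"
  have "\<exists>N. \<forall>m\<ge>N. \<forall>n\<ge>N. b (X m - X n) (X m - X n) < e" if e: "e > 0" for e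
  proof -
    have "c * e > 0" using c(1) e by simp
    then obtain N where N: "\<And>m n. m \<ge> N \<Longrightarrow> n \<ge> N \<Longrightarrow> b' (X m - X n) (X m - X n) < c * e" using X(2) by blast
    have "b (X m - X n) (X m - X n) < e" if "m \<ge> N" "n \<ge> N" for m n
    proof -
      have "c * b (X m - X n) (X m - X n) < c * e"
        using c(2)[OF D_diff[OF X(1) X(1)], of m n] N[OF that] by linarith
      then show ?thesis using c(1) by simp
    qed
    then show ?thesis by blast
  qed
  from complete[OF X(1) this] obtain x where x: "x \<in> D" "(\<lambda>n. b (X n - x) (X n - x)) \<longlonglongrightarrow> 0" by blast
  have "(\<lambda>n. b' (X n - x) (X n - x)) \<longlonglongrightarrow> 0"
  proof (rule Lim_null_comparison)
    show "(\<lambda>n. C * b (X n - x) (X n - x)) \<longlonglongrightarrow> 0" by (intro tendsto_mult_right_zero x)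
    have "0 \<le> b' (X n - x) (X n - x)" for n
      by (rule order_trans[OF _ c(2)[OF D_diff[OF X(1) x(1)]]])
        (use c(1) nonneg[OF D_diff[OF X(1) x(1)]] in simp)
    then show "eventually (\<lambda>n. norm (b' (X n - x) (X n - x)) \<le> C * b (X n - x) (X n - x)) sequentially"
      using C[OF D_diff[OF X(1) x(1)]] by simp
  qed
  then show "\<exists>x\<in>D. (\<lambda>n. b' (X n - x) (X n - x)) \<longlonglongrightarrow> 0" using x by blast
next
  fix x assume x: "x \<in> D" "x \<noteq> 0"
  show "b' x x > 0" by (rule less_le_trans[OF _ c(2)[OF x(1)]]) (use c(1) pos[OF x] in simp)
qed (use subspace assms in auto)

text \<open>\<open>b (T x) (T y)\<close> is again a complete inner product, so Riesz represents the
  functional z -> b y (T z) by some \<open>x\<close>. By symmetry of \<open>T\<close> this says that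
  \<open>T (T x - y)\<close> is orthogonal to everything, and the lower bound makes \<open>T\<close>
  injective.\<close>

lemma symmetric_surj:
  assumes T: "\<And>x. x \<in> D \<Longrightarrow> T x \<in> D"
    and sym': "\<And>x y. x \<in> D \<Longrightarrow> y \<in> D \<Longrightarrow> b (T x) y = b x (T y)"
    and c: "c > 0" "\<And>x. x \<in> D \<Longrightarrow> c * b x x \<le> b (T x) (T x)"
    and C: "\<And>x. x \<in> D \<Longrightarrow> b (T x) (T x) \<le> C * b x x"
    and y: "y \<in> D"
  obtains x where "x \<in> D" "T x = y"
proof -
  have T_add: "T (u + v) = T u + T v" if "u \<in> D" "v \<in> D" for u v
    by (rule eq_if_eq_left) (use that in \<open>auto simp: sym' add_left T D_add\<close>)
  have T_scale: "T (r *\<^sub>R u) = r *\<^sub>R T u" if "u \<in> D" for u r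
    by (rule eq_if_eq_left) (use that in \<open>auto simp: sym' scale_left T D_scale\<close>)
  let ?b = "\<lambda>u v. b (T u) (T v)"
  interpret T: hilbert_form D ?b
  proof (rule equivalent_form)
    show "c > 0" by (rule c)
    show "c * b x x \<le> b (T x) (T x)" "b (T x) (T x) \<le> C * b x x" if "x \<in> D" for x
      using c(2)[OF that] C[OF that] .
  qed (auto simp: T_add T_scale add_left scale_left T intro: sym[OF T T])
  obtain x where x: "x \<in> D" "\<And>z. z \<in> D \<Longrightarrow> b y (T z) = ?b x z"
  proof (rule T.Riesz)
    show "b y (T (u + v)) = b y (T u) + b y (T v)" if "u \<in> D" "v \<in> D" for u v
      using that y by (simp add: T_add add_right T)
    show "b y (T (r *\<^sub>R u)) = r * b y (T u)" if "u \<in> D" for u r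
      using that y by (simp add: T_scale scale_right T)
    show "\<bar>b y (T u)\<bar> \<le> sqrt (b y y) * sqrt (b (T u) (T u))" if "u \<in> D" for u
      using Cauchy_Schwarz[OF y T[OF that]] .
  qed blast
  have d: "T x - y \<in> D" using x y T D_diff by blast
  have "b (T (T x - y)) z = b 0 z" if "z \<in> D" for z
    using x that y d T by (simp add: sym' diff_left zero_left)
  then have "T (T x - y) = 0" using T[OF d] D_zero by (intro eq_if_eq_left) auto
  then have "c * b (T x - y) (T x - y) \<le> 0" using c(2)[OF d] zero_left[OF D_zero] by simp
  then have "T x - y = 0" using pos[OF d] c(1) by (auto simp: mult_le_0_iff)
  then show ?thesis using that x by simp
qed

end

text \<open>The closed range theorem. \<open>G\<close> is the adjoint of \<open>B\<close>, and the
  inf-sup condition says that \<open>b (G p) (G q)\<close> is an inner product equivalent to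
  \<open>e\<close>. If \<open>p\<close> represents \<open>g\<close> in it, then \<open>G p\<close>
  solves the equation, and the inf-sup bound at \<open>p\<close> gives the bound on the
  solution.\<close>

lemma surj_if_inf_sup:
  assumes "hilbert_form D b" "hilbert_form E e"
    and B: "\<And>w. w \<in> D \<Longrightarrow> B w \<in> E"
    and B_add: "\<And>v w. v \<in> D \<Longrightarrow> w \<in> D \<Longrightarrow> B (v + w) = B v + B w"
    and B_scale: "\<And>r w. w \<in> D \<Longrightarrow> B (r *\<^sub>R w) = r *\<^sub>R B w"
    and B_bound: "\<And>w. w \<in> D \<Longrightarrow> sqrt (e (B w) (B w)) \<le> K * sqrt (b w w)" and K: "0 \<le> K"
    and inf_sup: "\<And>p M. p \<in> E \<Longrightarrow> 0 \<le> M \<Longrightarrow> (\<And>w. w \<in> D \<Longrightarrow> \<bar>e p (B w)\<bar> \<le> M * sqrt (b w w)) \<Longrightarrow> sqrt (e p p) \<le> C * M"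
    and g: "g \<in> E"
  obtains w where "w \<in> D" "B w = g" "sqrt (b w w) \<le> C * sqrt (e g g)"
proof -
  interpret D: hilbert_form D b by fact
  interpret E: hilbert_form E e by fact
  have "\<exists>y. y \<in> D \<and> (\<forall>w\<in>D. e p (B w) = b y w)" if p: "p \<in> E" for p
  proof -
    have bd: "\<bar>e p (B w)\<bar> \<le> (sqrt (e p p) * K) * sqrt (b w w)" if "w \<in> D" for w
      using E.Cauchy_Schwarz[OF p B[OF that]] mult_left_mono[OF B_bound[OF that], of "sqrt (e p p)"] E.nonneg[OF p]
      by (simp add: mult.assoc)
    show ?thesis
      by (rule D.Riesz[of "\<lambda>w. e p (B w)" "sqrt (e p p) * K"])
        (use p bd in \<open>auto simp: B_add B_scale E.add_right E.scale_right B\<close>)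
  qed
  then obtain G where G: "\<And>p. p \<in> E \<Longrightarrow> G p \<in> D" "\<And>p w. p \<in> E \<Longrightarrow> w \<in> D \<Longrightarrow> b (G p) w = e p (B w)" by metis
  have G_add: "G (p + q) = G p + G q" if "p \<in> E" "q \<in> E" for p q
    by (rule D.eq_if_eq_left) (use that in \<open>auto intro!: G D.D_add E.D_add simp: G(2) D.add_left E.add_left B E.D_add G(1)\<close>)
  have G_scale: "G (r *\<^sub>R p) = r *\<^sub>R G p" if "p \<in> E" for p r
    by (rule D.eq_if_eq_left) (use that in \<open>auto intro!: G D.D_scale E.D_scale simp: G(2) D.scale_left E.scale_left B E.D_scale G(1)\<close>)
  let ?b = "\<lambda>p q. b (G p) (G q)"
  have low: "sqrt (e p p) \<le> C * sqrt (?b p p)" if p: "p \<in> E" for p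
    using D.Cauchy_Schwarz[OF G(1)[OF p]] D.nonneg[OF G(1)[OF p]] by (intro inf_sup[OF p]) (auto simp: G(2)[OF p, symmetric])
  have up: "sqrt (?b p p) \<le> K * sqrt (e p p)" if p: "p \<in> E" for p
  proof -
    have n: "0 \<le> ?b p p" "0 \<le> e p p" using D.nonneg[OF G(1)[OF p]] E.nonneg[OF p] by auto
    have "sqrt (?b p p) * sqrt (?b p p) = e p (B (G p))" using n G(2)[OF p G(1)[OF p]] by simp
    also have "\<dots> \<le> sqrt (e p p) * sqrt (e (B (G p)) (B (G p)))"
      using E.Cauchy_Schwarz[OF p B[OF G(1)[OF p]]] by simp
    also have "\<dots> \<le> sqrt (e p p) * (K * sqrt (?b p p))"
      using B_bound[OF G(1)[OF p]] n by (intro mult_left_mono) auto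
    finally have "sqrt (?b p p) * sqrt (?b p p) \<le> (K * sqrt (e p p)) * sqrt (?b p p)" by (simp add: algebra_simps)
    then show ?thesis by (rule le_if_square_le) (use n K in auto)
  qed
  have sq: "x \<le> k\<^sup>2 * y" if "sqrt x \<le> k * sqrt y" "0 \<le> x" "0 \<le> y" for x y k :: real
    using power_mono[OF that(1), of 2] that by (simp add: power_mult_distrib)
  interpret G: hilbert_form E ?b
  proof (rule E.equivalent_form)
    \<comment> \<open>The summand 1 avoids division by zero when \<open>C = 0\<close>.\<close>
    let ?c = "1 / (C\<^sup>2 + 1)"
    show "?c > 0" by (simp add: add_nonneg_pos)
    then have "C\<^sup>2 + 1 > 0" by simp
    show "?c * e p p \<le> ?b p p" if p: "p \<in> E" for p
    proof -
      have "e p p \<le> C\<^sup>2 * ?b p p" by (rule sq[OF low[OF p]]) (use p in \<open>auto intro: E.nonneg D.nonneg G\<close>)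
      also have "\<dots> \<le> (C\<^sup>2 + 1) * ?b p p" using D.nonneg[OF G(1)[OF p]] by (intro mult_right_mono) auto
      finally show ?thesis using \<open>C\<^sup>2 + 1 > 0\<close> by (simp add: pos_divide_le_eq mult.commute)
    qed
    show "?b p p \<le> K\<^sup>2 * e p p" if p: "p \<in> E" for p
      by (rule sq[OF up[OF p]]) (use p in \<open>auto intro: E.nonneg D.nonneg G\<close>)
  qed (auto simp: G_add G_scale D.add_left D.scale_left G(1) intro: D.sym[OF G(1) G(1)])
  obtain p where p: "p \<in> E" "\<And>q. q \<in> E \<Longrightarrow> e g q = ?b p q"
  proof (rule G.Riesz)
    show "e g (q + r) = e g q + e g r" if "q \<in> E" "r \<in> E" for q r using that g by (simp add: E.add_right)
    show "e g (r *\<^sub>R q) = r * e g q" if "q \<in> E" for q r using that g by (simp add: E.scale_right)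
    show "\<bar>e g q\<bar> \<le> (sqrt (e g g) * C) * sqrt (b (G q) (G q))" if "q \<in> E" for q
      using E.Cauchy_Schwarz[OF g that] mult_left_mono[OF low[OF that], of "sqrt (e g g)"] E.nonneg[OF g]
      by (simp add: mult.assoc)
  qed blast
  let ?w = "G p"
  have w: "?w \<in> D" using G p by blast
  have "B ?w = g"
  proof (rule E.eq_if_eq_left)
    show "e (B ?w) q = e g q" if q: "q \<in> E" for q
    proof -
      have "e (B ?w) q = e q (B ?w)" using B[OF w] q by (rule E.sym)
      also have "\<dots> = b (G q) ?w" using G(2)[OF q w] by simp
      also have "\<dots> = e g q" using p(2)[OF q] D.sym[OF G(1)[OF q] w] by simp
      finally show ?thesis .
    qed
  qed (use B w g in auto)
  moreover have "sqrt (b ?w ?w) \<le> C * sqrt (e g g)"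
  proof -
    have n: "0 \<le> b ?w ?w" "0 \<le> e g g" "0 \<le> e p p"
      using D.nonneg[OF w] E.nonneg[OF g] E.nonneg[OF p(1)] by auto
    have "sqrt (b ?w ?w) * sqrt (b ?w ?w) = e g p" using p(2)[OF p(1)] n by simp
    also have "\<dots> \<le> sqrt (e g g) * sqrt (e p p)" using E.Cauchy_Schwarz[OF g p(1)] by simp
    also have "\<dots> \<le> sqrt (e g g) * (C * sqrt (b ?w ?w))" using low[OF p(1)] n by (intro mult_left_mono) auto
    finally have *: "sqrt (b ?w ?w) * sqrt (b ?w ?w) \<le> (C * sqrt (e g g)) * sqrt (b ?w ?w)" by (simp add: algebra_simps)
    \<comment> \<open>\<open>inf_sup\<close> at p = 0 with M = 1 shows that \<open>C\<close> is not
      negative.\<close>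
    have "sqrt (e 0 0) \<le> C * 1"
      by (rule inf_sup) (use E.zero_left E.D_zero B D.nonneg in auto)
    then have "0 \<le> C" using E.zero_left[OF E.D_zero] by simp
    with * show ?thesis by (intro le_if_square_le[OF *]) (use n in auto)
  qed
  ultimately show ?thesis using that w by blast
qed

section \<open>L2 norms by duality with test functions\<close>

lemma hilbert_form_inner:
  fixes D :: "'a::{real_inner, complete_space} set"
  assumes "subspace D" "closed D"
  shows "hilbert_form D inner"
proof
  fix X :: "nat \<Rightarrow> 'a"
  assume X: "\<And>n. X n \<in> D" "\<And>e. e > 0 \<Longrightarrow> \<exists>N. \<forall>m\<ge>N. \<forall>n\<ge>N. inner (X m - X n) (X m - X n) < e"
  have "Cauchy X"
  proof (rule CauchyI)
    fix e :: real assume e: "e > 0"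
    then obtain N where N: "\<And>m n. m \<ge> N \<Longrightarrow> n \<ge> N \<Longrightarrow> inner (X m - X n) (X m - X n) < e\<^sup>2"
      using X(2)[of "e\<^sup>2"] by auto
    have "norm (X m - X n) < e" if "m \<ge> N" "n \<ge> N" for m n
      using N[OF that] e by (simp add: power2_norm_eq_inner[symmetric] power_less_imp_less_base)
    then show "\<exists>N. \<forall>m\<ge>N. \<forall>n\<ge>N. norm (X m - X n) < e" by blast
  qed
  then obtain x where x: "X \<longlonglongrightarrow> x" using Cauchy_convergent convergent_def by blast
  then have "x \<in> D" using assms(2) X(1) closed_sequentially by blast
  moreover have "(\<lambda>n. inner (X n - x) (X n - x)) \<longlonglongrightarrow> inner (x - x) (x - x)"
    by (intro tendsto_intros x)
  ultimately show "\<exists>x\<in>D. (\<lambda>n. inner (X n - x) (X n - x)) \<longlonglongrightarrow> 0" by auto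
next
  show "inner x y = inner y x" for x y :: 'a by (rule inner_commute)
  show "inner (x + y) z = inner x z + inner y z" "inner (c *\<^sub>R x) z = c * inner x z" for x y z :: 'a and c
    by (simp_all add: inner_add_left)
  show "0 < inner x x" if "x \<noteq> 0" for x :: 'a using that by simp
qed (rule assms(1))

lemma subspace_closure:
  fixes S :: "'a::real_normed_vector set"
  assumes "subspace S" shows "subspace (closure S)"
  unfolding subspace_def
proof (intro conjI ballI allI)
  show "0 \<in> closure S" by (rule subsetD[OF closure_subset subspace_0[OF assms]])
  fix x y and c :: real assume x: "x \<in> closure S"
  obtain X where X: "\<And>n. X n \<in> S" "X \<longlonglongrightarrow> x" using x closure_sequential by blast
  show "c *\<^sub>R x \<in> closure S"
    unfolding closure_sequential
    by (rule exI[of _ "\<lambda>n. c *\<^sub>R X n"]) (auto intro!: tendsto_intros X subspace_scale[OF assms])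
  assume y: "y \<in> closure S"
  obtain Y where Y: "\<And>n. Y n \<in> S" "Y \<longlonglongrightarrow> y" using y closure_sequential by blast
  show "x + y \<in> closure S"
    unfolding closure_sequential
    by (rule exI[of _ "\<lambda>n. X n + Y n"]) (auto intro!: tendsto_intros X Y subspace_add[OF assms])
qed

lemma square_integrable_indicator_mult:
  assumes "square_integrable f" "A \<in> sets borel" shows "square_integrable (\<lambda>x. indicat_real A x * f x)"
    and "n2 (\<lambda>x. indicat_real A x * f x) \<le> n2 f"
proof -
  have m: "f \<in> borel_measurable borel" "integrable lborel (\<lambda>x. (f x)\<^sup>2)"
    using assms by (auto simp: square_integrable_def)
  have "integrable lborel (\<lambda>x. indicat_real A x *\<^sub>R (f x)\<^sup>2)"
    using m assms(2) by (intro integrable_mult_indicator) auto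
  moreover have "(\<lambda>x. indicat_real A x *\<^sub>R (f x)\<^sup>2) = (\<lambda>x. (indicat_real A x * f x)\<^sup>2)"
    by (auto simp: indicator_def)
  ultimately have i: "integrable lborel (\<lambda>x. (indicat_real A x * f x)\<^sup>2)" by simp
  then show "square_integrable (\<lambda>x. indicat_real A x * f x)"
    using m assms(2) by (simp add: square_integrable_def)
  show "n2 (\<lambda>x. indicat_real A x * f x) \<le> n2 f"
    unfolding n2_def
    by (intro real_sqrt_le_mono integral_mono i m) (auto simp: indicator_def)
qed

lemma n2_cong_AE:
  assumes "AE x in lborel. f x = g x" "f \<in> borel_measurable borel" "g \<in> borel_measurable borel"
  shows "n2 f = n2 g"
  unfolding n2_def using assms by (intro arg_cong[of _ _ sqrt] integral_cong_AE) (auto elim: AE_mp)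

text \<open>Riesz on the L2 closure of the test functions of \<open>B\<close> represents the pairing
  with \<open>h\<close> by an element \<open>y\<close> of norm at most \<open>K\<close>. The
  difference h - y is orthogonal to all these test functions, hence zero on
  \<open>B\<close>.\<close>

lemma n2_le_if_test_bound:
  fixes h :: "real^'d::finite \<Rightarrow> real"
  assumes h: "square_integrable h" and B: "open B" and K: "0 \<le> K"
    and bound: "\<And>f. f \<in> test_functions B \<Longrightarrow> \<bar>\<integral>x. h x * f x \<partial>lborel\<bar> \<le> K * n2 f"
  shows "n2 (\<lambda>x. indicat_real B x * h x) \<le> K"
proof -
  let ?T = "L2_class ` test_functions B"
  let ?D = "closure ?T"
  let ?h = "L2_class h"
  have sq: "square_integrable f" if "f \<in> test_functions B" for f
    using that test_functions_Cc Cc_square_integrable by blast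
  have "subspace ?T"
    unfolding subspace_def
    using sq by (auto simp: zero_L2.abs_eq L2_class_add L2_class_scaleR
        intro!: imageI test_functions_zero test_functions_add test_functions_cmult)
  then have sD: "subspace ?D" by (rule subspace_closure)
  interpret hilbert_form ?D inner by (rule hilbert_form_inner[OF sD]) simp
  have bT: "\<bar>inner ?h u\<bar> \<le> K * norm u" if "u \<in> ?D" for u
  proof -
    have "closed {u. \<bar>inner ?h u\<bar> \<le> K * norm u}"
      by (intro closed_Collect_le continuous_intros)
    moreover have "?T \<subseteq> {u. \<bar>inner ?h u\<bar> \<le> K * norm u}"
      using bound sq h by (auto simp: inner_L2_class norm_L2_class)
    ultimately show ?thesis using that closure_minimal by blast
  qed
  obtain y where y: "y \<in> ?D" "\<And>u. u \<in> ?D \<Longrightarrow> inner ?h u = inner y u"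
  proof (rule Riesz[of "inner ?h" K])
    show "\<bar>inner ?h u\<bar> \<le> K * sqrt (inner u u)" if "u \<in> ?D" for u
      using bT[OF that] by (simp add: norm_eq_sqrt_inner)
  qed (auto simp: inner_add_right)
  have "norm y * norm y \<le> K * norm y"
    using bT[OF y(1)] y(2)[OF y(1)] by (simp add: power2_norm_eq_inner[symmetric] power2_eq_square)
  then have ny: "norm y \<le> K" by (rule le_if_square_le) (use K in auto)
  define g where "g = rep_L2 y"
  have g: "square_integrable g" "L2_class g = y"
    by (simp_all add: g_def square_integrable_rep_L2 L2_class_rep_L2)
  have "AE x in lborel. x \<in> B \<longrightarrow> h x - g x = 0"
  proof (rule AE_zero_if_orthogonal[OF square_integrable_diff[OF h g(1)] B])
    fix f assume f: "f \<in> test_functions B"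
    have "inner ?h (L2_class f) = inner y (L2_class f)"
      using f closure_subset[of ?T] by (intro y(2)) auto
    then have "(\<integral>x. h x * f x \<partial>lborel) = (\<integral>x. g x * f x \<partial>lborel)"
      by (simp only: g(2)[symmetric] inner_L2_class[OF h sq[OF f]] inner_L2_class[OF g(1) sq[OF f]])
    then show "(\<integral>x. (h x - g x) * f x \<partial>lborel) = 0"
      using square_integrable_mult[OF h sq[OF f]] square_integrable_mult[OF g(1) sq[OF f]]
      by (simp add: left_diff_distrib)
  qed
  then have "AE x in lborel. indicat_real B x * h x = indicat_real B x * g x"
    by eventually_elim (auto simp: indicator_def)
  then have "n2 (\<lambda>x. indicat_real B x * h x) = n2 (\<lambda>x. indicat_real B x * g x)"
    using h g B by (intro n2_cong_AE) (auto simp: square_integrable_def)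
  also have "\<dots> \<le> n2 g" using g B by (intro square_integrable_indicator_mult) auto
  also have "\<dots> \<le> K" using ny norm_L2_class[OF g(1)] g(2) by simp
  finally show ?thesis .
qed

section \<open>Local estimates by the gradient\<close>

definition set_n2 :: "'a::euclidean_space set \<Rightarrow> ('a \<Rightarrow> real) \<Rightarrow> real" where
  "set_n2 A p = n2 (\<lambda>x. indicat_real A x * p x)"

lemma test_functions_nonzero: "f \<in> test_functions S \<Longrightarrow> f x \<noteq> 0 \<Longrightarrow> x \<in> S"
  unfolding test_functions_iff using zero_outside_supp[of x f] by blast

text \<open>Variant of \<open>conv_adjoint\<close> for a \<open>p\<close> that is not continuous,
  such as a truncated L2 function; absolute convergence comes from convolving absolute
  values.\<close>

lemma conv_adjoint_integrable:
  fixes p a u :: "'a::euclidean_space \<Rightarrow> real"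
  assumes p: "integrable lborel p" and a: "Cc a" and u: "Cc u"
  shows "(\<integral>x. p x * conv a u x \<partial>lborel) = (\<integral>z. conv p (\<lambda>y. a (- y)) z * u z \<partial>lborel)"
proof -
  have [measurable]: "p \<in> borel_measurable borel" "a \<in> borel_measurable borel" "u \<in> borel_measurable borel"
    using p a u by (auto intro: Cc_measurable)
  let ?F = "\<lambda>(x, z). p x * (a (x - z) * u z)"
  have conv_eq: "conv a u x = (\<integral>z. a (x - z) * u z \<partial>lborel)" for x
    by (subst conv_commute) (simp add: conv_def mult.commute)
  have i1: "integrable lborel (\<lambda>z. a (x - z) * u z)" for x
    by (intro Cc_integrable Cc_mult2 Cc_reflect a u)
  have int: "integrable (lborel \<Otimes>\<^sub>M lborel) ?F"
  proof (rule lborel_pair.Fubini_integrable)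
    show "?F \<in> borel_measurable (lborel \<Otimes>\<^sub>M lborel)" by measurable
    have "(\<integral>z. norm (?F (x, z)) \<partial>lborel) = \<bar>p x\<bar> * conv (\<lambda>y. \<bar>a y\<bar>) (\<lambda>y. \<bar>u y\<bar>) x" for x
      by (subst conv_commute) (simp add: conv_def abs_mult mult.commute)
    then show "integrable lborel (\<lambda>x. \<integral>z. norm (?F (x, z)) \<partial>lborel)"
      using integrable_mult_Cc[OF integrable_abs[OF p] Cc_conv[OF Cc_abs[OF a] Cc_abs[OF u]]] by simp
    show "AE x in lborel. integrable lborel (\<lambda>z. ?F (x, z))"
      using i1 by auto
  qed
  have "(\<integral>x. p x * conv a u x \<partial>lborel) = (\<integral>x. \<integral>z. ?F (x, z) \<partial>lborel \<partial>lborel)"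
    by (simp add: conv_eq)
  also have "\<dots> = (\<integral>z. \<integral>x. ?F (x, z) \<partial>lborel \<partial>lborel)"
    using lborel_pair.Fubini_integral[of "\<lambda>x z. ?F (x, z)"] int by simp
  also have "\<dots> = (\<integral>z. conv p (\<lambda>y. a (- y)) z * u z \<partial>lborel)"
    by (simp add: conv_def mult.assoc[symmetric])
  finally show ?thesis .
qed

lemma integral_conv:
  fixes a f :: "'a::euclidean_space \<Rightarrow> real"
  assumes "Cc a" "Cc f" shows "(\<integral>x. conv a f x \<partial>lborel) = (\<integral>x. a x \<partial>lborel) * (\<integral>x. f x \<partial>lborel)"
proof -
  let ?F = "\<lambda>(y, x). a y * f (x - y)"
  have "continuous_on UNIV ?F"
    by (auto simp: case_prod_beta intro!: continuous_intros assms[THEN Cc_continuous_compose])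
  then have F: "Cc ?F"
  proof (rule CcI_pair)
    show "compact (supp a)" "compact {y + z |y z. y \<in> supp a \<and> z \<in> supp f}"
      using compact_plus[of "supp a" "supp f"] assms by (auto simp: Cc_def)
    fix y x assume "?F (y, x) \<noteq> 0"
    then have "y \<in> supp a" "x - y \<in> supp f" using zero_outside_supp by fastforce+
    then show "y \<in> supp a \<and> x \<in> {y + z |y z. y \<in> supp a \<and> z \<in> supp f}"
      by (intro conjI CollectI exI[of _ y] exI[of _ "x - y"]) auto
  qed
  have "(\<integral>x. conv a f x \<partial>lborel) = (\<integral>y. \<integral>x. a y * f (x - y) \<partial>lborel \<partial>lborel)"
    using Cc_Fubini(1)[OF F] by (simp add: conv_def)
  also have "\<dots> = (\<integral>y. a y * (\<integral>x. f x \<partial>lborel) \<partial>lborel)"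
  proof -
    have "(\<integral>x. f (x - y) \<partial>lborel) = (\<integral>x. f x \<partial>lborel)" for y
      using lborel_integral_translate[of f "- y"] by simp
    then show ?thesis by simp
  qed
  finally show ?thesis by simp
qed

lemma norm_le_CARD:
  fixes t v :: "real^'d::finite" and \<epsilon> :: real
  assumes "\<And>l. \<bar>t $ l - v $ l\<bar> \<le> \<epsilon>" shows "norm (t - v) \<le> CARD('d) * \<epsilon>"
proof -
  have "norm (t - v) \<le> (\<Sum>l\<in>UNIV. \<bar>(t - v) $ l\<bar>)" by (rule norm_le_l1_cart)
  also have "\<dots> \<le> (\<Sum>l\<in>(UNIV::'d set). \<epsilon>)" using assms by (intro sum_mono) auto
  finally show ?thesis by simp
qed

lemma square_integrable_indicator:
  assumes "A \<in> sets borel" "bounded A" shows "square_integrable (indicat_real A)"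
proof -
  have "(\<lambda>x. (indicat_real A x)\<^sup>2) = indicat_real A" by (auto simp: indicator_def)
  then show ?thesis
    using assms by (auto simp: square_integrable_def intro!: integrable_real_indicator emeasure_bounded_finite)
qed

lemma integral_abs_le_n2:
  assumes "square_integrable u" "A \<in> sets borel" "bounded A" "\<And>x. u x \<noteq> 0 \<Longrightarrow> x \<in> A"
  shows "(\<integral>x. \<bar>u x\<bar> \<partial>lborel) \<le> n2 (indicat_real A) * n2 u" "integrable lborel u"
proof -
  have su: "square_integrable (\<lambda>x. \<bar>u x\<bar>)" "n2 (\<lambda>x. \<bar>u x\<bar>) = n2 u"
    using assms(1) by (auto simp: square_integrable_def n2_def)
  have "(\<lambda>x. indicat_real A x * \<bar>u x\<bar>) = (\<lambda>x. \<bar>u x\<bar>)" "(\<lambda>x. indicat_real A x * u x) = u"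
    using assms(4) by (auto simp: indicator_def fun_eq_iff)
  with n2_Cauchy_Schwarz[OF square_integrable_indicator[OF assms(2,3)] su(1)]
    square_integrable_mult[OF square_integrable_indicator[OF assms(2,3)] assms(1)] su(2)
  show "(\<integral>x. \<bar>u x\<bar> \<partial>lborel) \<le> n2 (indicat_real A) * n2 u" "integrable lborel u" by auto
qed

text \<open>Away from the boundary the mollifier may be centred at 0.
  \<open>mollify_estimate\<close> compares \<open>p\<close> with its double mollification, and one
  of the two mollifications can be moved onto \<open>p\<close>, giving a smooth
  \<open>?\<Phi>\<close>. Its partial derivatives are pairings of \<open>p\<close> with divergences
  of translated test fields, so \<open>?\<Phi>\<close> is nearly equal to its value \<open>c\<close>
  at the centre.\<close>

lemma interior_oscillation:
  fixes S :: "(real^'d::finite) set"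
  assumes S: "open S" "x0 \<in> S"
  obtains r C where "r > 0" "0 \<le> C" "ball x0 r \<subseteq> S"
    "\<And>p M. square_integrable p \<Longrightarrow> 0 \<le> M \<Longrightarrow> grad_bound S p M \<Longrightarrow>
      \<exists>c. set_n2 (ball x0 r) (\<lambda>x. p x - c) \<le> C * M"
proof -
  obtain \<delta> where \<delta>: "\<delta> > 0" "ball x0 \<delta> \<subseteq> S" using S by (auto simp: open_contains_ball)
  \<comment> \<open>Vectors of the \<epsilon>-box have length at most \<delta>/8, and the radii add
    up inside the ball of radius \<delta>: test functions live within \<delta>/2, one mollification
    reaches 5\<delta>/8, two reach 3\<delta>/4, and derivatives of \<open>?\<Phi>\<close> up to
    3\<delta>/4 take one further \<delta>/8.\<close>
  define \<epsilon> where "\<epsilon> = \<delta> / (8 * CARD('d))"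
  have e: "\<epsilon> > 0" using \<delta> by (simp add: \<epsilon>_def)
  obtain \<rho> :: "real^'d \<Rightarrow> real" and C1 where \<rho>: "\<rho> \<in> tf" "(\<integral>x. \<rho> x \<partial>lborel) = 1" "0 \<le> C1"
    "\<And>x l. \<rho> x \<noteq> 0 \<Longrightarrow> \<bar>x $ l - 0 $ l\<bar> \<le> \<epsilon>"
    and est: "\<And>S p M f. square_integrable p \<Longrightarrow> grad_bound S p M \<Longrightarrow> 0 \<le> M \<Longrightarrow> f \<in> tf \<Longrightarrow>
      (\<And>h y t1 t2. 0 < h \<Longrightarrow> h \<le> 1 \<Longrightarrow> y \<in> supp f \<Longrightarrow> (\<forall>l. \<bar>t1 $ l - 0 $ l\<bar> \<le> \<epsilon>) \<Longrightarrow>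
         (\<forall>l. \<bar>t2 $ l - 0 $ l\<bar> \<le> \<epsilon>) \<Longrightarrow> y + h *\<^sub>R (t1 + t2) \<in> S) \<Longrightarrow>
      \<bar>(\<integral>x. p x * f x \<partial>lborel) - (\<integral>x. p x * conv \<rho> (conv \<rho> f) x \<partial>lborel)\<bar> \<le> C1 * M * n2 f"
    by (rule mollify_estimate[OF e, of 0]) blast
  have small: "norm t \<le> \<delta> / 8" if "\<And>l. \<bar>t $ l - 0 $ l\<bar> \<le> \<epsilon>" for t :: "real^'d"
    using norm_le_CARD[of t 0 \<epsilon>] that by (simp add: \<epsilon>_def)
  have \<rho>n: "norm y \<le> \<delta> / 8" if "\<rho> y \<noteq> 0" for y by (rule small) (rule \<rho>(4)[OF that])
  define r where "r = \<delta> / 2"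
  let ?B = "ball x0 \<delta>"
  define V where "V = n2 (indicat_real ?B)"
  define A where "A = (\<integral>x. \<bar>\<rho> x\<bar> \<partial>lborel)"
  define G where "G = (\<Sum>j\<in>UNIV. n2 (partial_deriv j \<rho>))"
  have nn: "V \<ge> 0" "A \<ge> 0" "G \<ge> 0" by (auto simp: V_def A_def G_def sum_nonneg)
  define C where "C = C1 + CARD('d) * (CARD('d) * G) * \<delta> * V * A"
  have C: "C \<ge> 0" unfolding C_def using nn \<delta> \<rho>(3) by (intro add_nonneg_nonneg mult_nonneg_nonneg) auto
  have c\<rho>: "Cc \<rho>" using \<rho>(1) by (rule tf_Cc)
  let ?r = "\<lambda>y. \<rho> (- y)"
  have rt: "?r \<in> tf" using test_functions_affine[OF \<rho>(1), of "-1" 0] by simp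
  have main: "\<exists>c. set_n2 (ball x0 r) (\<lambda>x. p x - c) \<le> C * M"
    if p: "square_integrable p" and M: "0 \<le> M" and gb: "grad_bound S p M" for p M
  proof -
    \<comment> \<open>Truncation makes \<open>p\<close> integrable; the kernels paired with it below
      stay inside \<open>?B\<close>, so no integral changes.\<close>
    let ?p = "\<lambda>x. indicat_real ?B x * p x"
    have ip: "integrable lborel ?p" by (intro square_integrable_mult square_integrable_indicator p) auto
    let ?\<Phi> = "conv ?p ?r"
    let ?L = "M * (CARD('d) * G)"
    have der: "\<bar>partial_deriv i ?\<Phi> z\<bar> \<le> ?L" if z: "z \<in> ball x0 (3/4 * \<delta>)" for i z
    proof -
      have inB: "x \<in> ?B" if "norm (x - z) \<le> \<delta> / 8" for x
        using z that dist_triangle[of x0 x z] \<delta>(1) by (simp add: dist_norm norm_minus_commute)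
      \<comment> \<open>The \<open>i\<close>-th unit vector times a translate of the mollifier;
        pairing \<open>p\<close> with its divergence yields minus the \<open>i\<close>-th derivative
        of \<open>?\<Phi>\<close> at \<open>z\<close>.\<close>
      define w where "w l x = (if l = i then \<rho> (- z + 1 *\<^sub>R x) else 0)" for l x
      have wt: "(\<lambda>x. \<rho> (- z + 1 *\<^sub>R x)) \<in> tf" by (rule test_functions_affine[OF \<rho>(1)]) simp
      have dw: "partial_deriv j (\<lambda>x. \<rho> (- z + 1 *\<^sub>R x)) x = partial_deriv j \<rho> (x - z)" for j x
        using partial_deriv_affine[of \<rho> "- z" 1 x j] tf_differentiable[OF \<rho>(1)] by (simp add: algebra_simps)
      have "(\<lambda>x. \<rho> (- z + 1 *\<^sub>R x)) \<in> test_functions S"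
      proof (rule test_functionsI[of _ "cball z (\<delta> / 8)"])
        show "cball z (\<delta> / 8) \<subseteq> S" using inB \<delta>(2) by (auto simp: dist_norm norm_minus_commute subset_iff)
        show "x \<in> cball z (\<delta> / 8)" if "\<rho> (- z + 1 *\<^sub>R x) \<noteq> 0" for x
          using \<rho>n[OF that] by (simp add: dist_norm norm_minus_commute)
      qed (use wt in \<open>auto simp: tf_iff\<close>)
      moreover have wl: "w l = (if l = i then (\<lambda>x. \<rho> (- z + 1 *\<^sub>R x)) else (\<lambda>x. 0))" for l
        by (auto simp: w_def fun_eq_iff)
      ultimately have "w \<in> test_fields S"
        by (simp add: test_fields_def wl test_functions_zero)
      then have "\<bar>\<integral>x. p x * fdiv w x \<partial>lborel\<bar> \<le> M * grad_norm w" using gb by (simp add: grad_bound_def)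
      also have "\<dots> \<le> M * (CARD('d) * G)"
      proof (intro mult_left_mono grad_norm_le M nn)
        fix l j
        have Gj: "n2 (partial_deriv j \<rho>) \<le> G" unfolding G_def by (rule member_le_sum) auto
        have "partial_deriv j (w l) = (if l = i then (\<lambda>x. partial_deriv j \<rho> (x - z)) else (\<lambda>x. 0))"
          using dw by (auto simp: wl fun_eq_iff)
        then show "n2 (partial_deriv j (w l)) \<le> G"
          using Gj nn by (auto simp: n2_translate) (simp add: n2_def)
      qed
      also have "(\<integral>x. p x * fdiv w x \<partial>lborel) = - partial_deriv i ?\<Phi> z"
      proof -
        have fd: "fdiv w x = partial_deriv i \<rho> (x - z)" for x
        proof -
          have "fdiv w x = (\<Sum>l\<in>UNIV. if l = i then partial_deriv i \<rho> (x - z) else 0)"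
            unfolding fdiv_def by (rule sum.cong) (use dw in \<open>auto simp: wl\<close>)
          then show ?thesis by simp
        qed
        have "partial_deriv i ?r y = - partial_deriv i \<rho> (- y)" for y
          using partial_deriv_affine[of \<rho> 0 "-1" y i] tf_differentiable[OF \<rho>(1)] by simp
        then have "partial_deriv i ?\<Phi> z = (\<integral>x. ?p x * - partial_deriv i \<rho> (x - z) \<partial>lborel)"
          by (simp add: partial_deriv_conv[OF ip rt] conv_def)
        also have "\<dots> = (\<integral>x. - (p x * fdiv w x) \<partial>lborel)"
        proof (rule Bochner_Integration.integral_cong[OF refl])
          fix x
          show "?p x * - partial_deriv i \<rho> (x - z) = - (p x * fdiv w x)"
          proof (cases "x \<in> ?B")
            case False
            then have "\<not> norm (x - z) \<le> \<delta> / 8" using inB by blast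
            moreover have "supp \<rho> \<subseteq> cball 0 (\<delta> / 8)" by (rule supp_subset_closed) (use \<rho>n in auto)
            ultimately have "x - z \<notin> supp \<rho>" by auto
            then show ?thesis by (simp add: fd partial_deriv_zero_outside)
          qed (simp add: fd)
        qed
        finally show ?thesis by simp
      qed
      finally show ?thesis by simp
    qed
    have osc: "\<bar>?\<Phi> z - ?\<Phi> x0\<bar> \<le> CARD('d) * ?L * \<delta>" if z: "z \<in> ball x0 (3/4 * \<delta>)" for z
    proof -
      have "onorm (\<lambda>h. \<Sum>i\<in>UNIV. h $ i * partial_deriv i ?\<Phi> x) \<le> CARD('d) * ?L" if x: "x \<in> ball x0 (3/4 * \<delta>)" for x
      proof (rule onorm_le)
        fix k :: "real^'d"
        have "\<bar>\<Sum>i\<in>UNIV. k $ i * partial_deriv i ?\<Phi> x\<bar> \<le> (\<Sum>i\<in>UNIV. \<bar>k $ i * partial_deriv i ?\<Phi> x\<bar>)"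
          by (rule sum_abs)
        also have "\<dots> \<le> (\<Sum>i\<in>(UNIV::'d set). norm k * ?L)"
          unfolding abs_mult by (intro sum_mono mult_mono component_le_norm_cart der[OF x]) auto
        finally show "norm (\<Sum>i\<in>UNIV. k $ i * partial_deriv i ?\<Phi> x) \<le> CARD('d) * ?L * norm k"
          by (simp add: mult.commute mult.left_commute)
      qed
      moreover have "(?\<Phi> has_derivative (\<lambda>h. \<Sum>i\<in>UNIV. h $ i * partial_deriv i ?\<Phi> x)) (at x within ball x0 (3/4 * \<delta>))" for x
        by (rule has_derivative_at_withinI[OF frechet_partial]) (intro C_inf_differentiable C_inf_conv ip rt)
      ultimately have "norm (?\<Phi> z - ?\<Phi> x0) \<le> CARD('d) * ?L * norm (z - x0)"
        using z \<delta> by (intro differentiable_bound[OF convex_ball[of x0 "3/4 * \<delta>"]]) auto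
      also have "\<dots> \<le> CARD('d) * ?L * \<delta>"
        using z \<delta> nn M by (intro mult_left_mono) (auto simp: dist_norm norm_minus_commute)
      finally show ?thesis by simp
    qed
    define c where "c = ?\<Phi> x0"
    have key: "\<bar>\<integral>x. (indicat_real ?B x * (p x - c)) * f x \<partial>lborel\<bar> \<le> C * M * n2 f"
      if f: "f \<in> test_functions (ball x0 r)" for f
    proof -
      have ft: "f \<in> tf" "Cc f" using f test_functions_tf test_functions_Cc by blast+
      have fs: "x \<in> ball x0 r" if "f x \<noteq> 0" for x
        by (rule test_functions_nonzero[OF f that])
      let ?u = "conv \<rho> f"
      have u: "Cc ?u" by (intro Cc_conv c\<rho> ft)
      have us: "x \<in> ball x0 (5/8 * \<delta>)" if "?u x \<noteq> 0" for x
      proof -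
        from that obtain y z where "\<rho> y \<noteq> 0" "f z \<noteq> 0" "x = y + z" by (rule conv_nonzeroD)
        then show ?thesis using \<rho>n[of y] fs[of z] norm_triangle_ineq4[of "x0 - z" y] \<delta>(1)
          by (simp add: r_def dist_norm algebra_simps)
      qed
      have us2: "x \<in> ?B" if "conv \<rho> ?u x \<noteq> 0" for x
      proof -
        from that obtain y z where "\<rho> y \<noteq> 0" "?u z \<noteq> 0" "x = y + z" by (rule conv_nonzeroD)
        then show ?thesis using \<rho>n[of y] us[of z] norm_triangle_ineq4[of "x0 - z" y] \<delta>(1)
          by (simp add: dist_norm algebra_simps)
      qed
      have e1: "\<bar>(\<integral>x. p x * f x \<partial>lborel) - (\<integral>x. p x * conv \<rho> ?u x \<partial>lborel)\<bar> \<le> C1 * M * n2 f"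
      proof (rule est[OF p gb M ft(1)])
        fix h :: real and y t1 t2 :: "real^'d"
        assume h: "0 < h" "h \<le> 1" and y: "y \<in> supp f" and t: "\<forall>l. \<bar>t1 $ l - 0 $ l\<bar> \<le> \<epsilon>" "\<forall>l. \<bar>t2 $ l - 0 $ l\<bar> \<le> \<epsilon>"
        have yb: "y \<in> ball x0 r" using f y by (auto simp: test_functions_iff)
        have "norm (t1 + t2) \<le> \<delta> / 4" using small[of t1] small[of t2] t norm_triangle_ineq[of t1 t2] by simp
        then have "norm (h *\<^sub>R (t1 + t2)) \<le> 1 * (\<delta> / 4)" using h unfolding norm_scaleR by (intro mult_mono) auto
        then have "y + h *\<^sub>R (t1 + t2) \<in> ?B"
          using yb norm_triangle_ineq4[of "x0 - y" "h *\<^sub>R (t1 + t2)"] \<delta>(1)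
          by (simp add: r_def dist_norm algebra_simps)
        then show "y + h *\<^sub>R (t1 + t2) \<in> S" using \<delta>(2) by blast
      qed
      have "(\<integral>x. p x * conv \<rho> ?u x \<partial>lborel) = (\<integral>x. ?p x * conv \<rho> ?u x \<partial>lborel)"
        using us2 by (intro Bochner_Integration.integral_cong refl) (auto simp: indicator_def)
      also have "\<dots> = (\<integral>z. ?\<Phi> z * ?u z \<partial>lborel)" by (rule conv_adjoint_integrable[OF ip c\<rho> u])
      finally have e2: "(\<integral>x. p x * conv \<rho> ?u x \<partial>lborel) = (\<integral>z. ?\<Phi> z * ?u z \<partial>lborel)" .
      have iu: "integrable lborel ?u" "integrable lborel (\<lambda>z. ?\<Phi> z * ?u z)"
        using u C_inf_continuous[OF C_inf_conv[OF ip rt]] by (auto intro!: Cc_integrable Cc_mult)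
      have "(\<integral>z. ?\<Phi> z * ?u z \<partial>lborel) - c * (\<integral>x. f x \<partial>lborel) = (\<integral>z. (?\<Phi> z - c) * ?u z \<partial>lborel)"
        using integral_conv[OF c\<rho> ft(2)] \<rho>(2) iu by (simp add: left_diff_distrib)
      also have "\<bar>\<dots>\<bar> \<le> (\<integral>z. \<bar>(?\<Phi> z - c) * ?u z\<bar> \<partial>lborel)" by (rule integral_abs_bound)
      also have "\<dots> \<le> (\<integral>z. (CARD('d) * ?L * \<delta>) * \<bar>?u z\<bar> \<partial>lborel)"
      proof (rule integral_mono)
        show "integrable lborel (\<lambda>z. \<bar>(?\<Phi> z - c) * ?u z\<bar>)"
          using iu by (auto simp: left_diff_distrib intro!: integrable_abs Bochner_Integration.integrable_diff)
        show "integrable lborel (\<lambda>z. (CARD('d) * ?L * \<delta>) * \<bar>?u z\<bar>)"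
          by (intro integrable_mult_right integrable_abs iu)
        show "\<bar>(?\<Phi> z - c) * ?u z\<bar> \<le> (CARD('d) * ?L * \<delta>) * \<bar>?u z\<bar>" for z
        proof (cases "?u z = 0")
          case False
          then have "z \<in> ball x0 (3/4 * \<delta>)" using us[OF False] \<delta>(1) by simp
          then show ?thesis unfolding abs_mult c_def by (intro mult_right_mono osc) auto
        qed simp
      qed
      also have "\<dots> \<le> (CARD('d) * ?L * \<delta>) * (V * (A * n2 f))"
      proof -
        have "(\<integral>z. \<bar>?u z\<bar> \<partial>lborel) \<le> V * n2 ?u" unfolding V_def
          by (rule integral_abs_le_n2) (use u us \<delta> in \<open>force intro: Cc_square_integrable\<close>)+
        also have "\<dots> \<le> V * (A * n2 f)" unfolding A_def by (intro mult_left_mono conv_Young c\<rho> ft nn)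
        finally show ?thesis using nn M \<delta> by (simp add: mult_left_mono)
      qed
      finally have e3: "\<bar>(\<integral>z. ?\<Phi> z * ?u z \<partial>lborel) - c * (\<integral>x. f x \<partial>lborel)\<bar>
          \<le> (CARD('d) * ?L * \<delta>) * (V * (A * n2 f))" .
      have "(\<integral>x. (indicat_real ?B x * (p x - c)) * f x \<partial>lborel) = (\<integral>x. p x * f x - c * f x \<partial>lborel)"
      proof (intro Bochner_Integration.integral_cong refl)
        fix x
        show "(indicat_real ?B x * (p x - c)) * f x = p x * f x - c * f x"
          using fs[of x] \<delta>(1) by (cases "f x = 0") (auto simp: r_def algebra_simps)
      qed
      also have "\<dots> = (\<integral>x. p x * f x \<partial>lborel) - c * (\<integral>x. f x \<partial>lborel)"
        using square_integrable_mult[OF p Cc_square_integrable[OF ft(2)]] Cc_integrable[OF ft(2)] by simp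
      finally have "\<bar>\<integral>x. (indicat_real ?B x * (p x - c)) * f x \<partial>lborel\<bar>
          \<le> C1 * M * n2 f + (CARD('d) * ?L * \<delta>) * (V * (A * n2 f))"
        using e1 e2 e3 by linarith
      also have "\<dots> = C * M * n2 f" by (simp add: C_def algebra_simps)
      finally show ?thesis .
    qed
    have sq: "square_integrable (\<lambda>x. indicat_real ?B x * (p x - c))"
    proof -
      have "square_integrable (\<lambda>x. indicat_real ?B x * p x - c * indicat_real ?B x)"
        by (intro square_integrable_diff square_integrable_scale square_integrable_indicator square_integrable_indicator_mult p) auto
      then show ?thesis by (simp add: algebra_simps)
    qed
    have "n2 (\<lambda>x. indicat_real (ball x0 r) x * (indicat_real ?B x * (p x - c))) \<le> C * M"
      by (rule n2_le_if_test_bound[OF sq _ _ key]) (use C M in auto)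
    moreover have "(\<lambda>x. indicat_real (ball x0 r) x * (indicat_real ?B x * (p x - c))) = (\<lambda>x. indicat_real (ball x0 r) x * (p x - c))"
      using \<delta> by (auto simp: indicator_def r_def fun_eq_iff)
    ultimately show ?thesis unfolding set_n2_def by auto
  qed
  show ?thesis
    by (rule that[of r C, OF _ C _ main]) (use \<delta> in \<open>auto simp: r_def subset_iff\<close>)
qed

text \<open>In the Lipschitz chart, shifts by vectors of the cone
  \<open>L * norm (P t) < inner t e\<close> carry the closure of a patch into \<open>S\<close>. With
  the mollifier centred on the axis of this cone, the fields of \<open>mollify_estimate\<close> are
  admissible, and the doubly mollified test function sees \<open>p\<close> only on a compact subset
  \<open>K\<close> of \<open>S\<close>.\<close>

lemma boundary_estimate:
  fixes S :: "(real^'d::finite) set" and \<phi> :: "real^'d \<Rightarrow> real"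
  assumes r: "r > 0" and S: "open S" and e: "norm e = 1"
    and L: "L-lipschitz_on {y. inner y e = 0} \<phi>"
    and chart: "S \<inter> ball x0 r = {y \<in> ball x0 r. \<phi> (y - inner y e *\<^sub>R e) < inner y e}"
  obtains s K C where "s > 0" "compact K" "K \<subseteq> S" "0 \<le> C"
    "\<And>p M. square_integrable p \<Longrightarrow> 0 \<le> M \<Longrightarrow> grad_bound S p M \<Longrightarrow>
      set_n2 (S \<inter> ball x0 s) p \<le> C * (M + set_n2 K p)"
proof -
  define P where "P y = y - inner y e *\<^sub>R e" for y :: "real^'d"
  have ee: "inner e e = 1" using e by (simp add: norm_eq_1)
  have P0: "inner (P y) e = 0" for y by (simp add: P_def inner_diff_left ee)
  have P_add: "P (y + z) = P y + P z" for y z by (simp add: P_def inner_add_left algebra_simps)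
  have P_scale: "P (c *\<^sub>R z) = c *\<^sub>R P z" for c z by (simp add: P_def algebra_simps)
  have L0: "L \<ge> 0" using L by (rule lipschitz_on_nonneg)
  have \<phi>: "\<bar>\<phi> (P y) - \<phi> (P z)\<bar> \<le> L * norm (P y - P z)" for y z
    using lipschitz_onD[OF L, of "P y" "P z"] P0 by (simp add: dist_norm)
  \<comment> \<open>Two shifts of length at most \<open>2 * \<tau>\<close> add up to at most r/4, so
    they cannot leave the chart from the ball of half its radius. \<open>\<eta>\<close> is the error
    allowed around \<open>\<tau> *\<^sub>R e\<close> within the cone, which narrows as
    \<open>L\<close> grows.\<close>
  define \<tau> where "\<tau> = r / 16"
  define \<eta> where "\<eta> = \<tau> / (4 * (L + 1))"
  define \<epsilon> where "\<epsilon> = \<eta> / CARD('d)"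
  have pos: "\<tau> > 0" "\<eta> > 0" "\<epsilon> > 0" using r L0 by (auto simp: \<tau>_def \<eta>_def \<epsilon>_def)
  have \<eta>\<tau>: "\<eta> \<le> \<tau> / 4" using pos L0 by (simp add: \<eta>_def field_simps)
  have L\<eta>: "L * (2 * \<eta>) < \<tau> - \<eta>"
  proof -
    have "(L + 1) * \<eta> = \<tau> / 4" using L0 by (simp add: \<eta>_def field_simps add_nonneg_eq_0_iff)
    then show ?thesis using pos by (simp add: algebra_simps)
  qed
  let ?v = "\<tau> *\<^sub>R e"
  have cone: "L * norm (P t) < inner t e \<and> norm t \<le> 2 * \<tau>" if t: "\<And>l. \<bar>t $ l - ?v $ l\<bar> \<le> \<epsilon>" for t
  proof -
    have tv: "norm (t - ?v) \<le> \<eta>" using norm_le_CARD[of t ?v \<epsilon>] t by (simp add: \<epsilon>_def)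
    have in1: "\<bar>inner (t - ?v) e\<bar> \<le> \<eta>" using Cauchy_Schwarz_ineq2[of "t - ?v" e] e tv by simp
    then have ie: "inner t e \<ge> \<tau> - \<eta>" by (simp add: inner_diff_left ee abs_le_iff)
    have "P t = (t - ?v) - inner (t - ?v) e *\<^sub>R e" by (simp add: P_def inner_diff_left ee algebra_simps)
    then have "norm (P t) \<le> norm (t - ?v) + norm (inner (t - ?v) e *\<^sub>R e)" by (metis norm_triangle_ineq4)
    then have "norm (P t) \<le> 2 * \<eta>" using tv in1 e by simp
    then have "L * norm (P t) \<le> L * (2 * \<eta>)" by (intro mult_left_mono L0)
    moreover have "norm t \<le> norm (t - ?v) + norm ?v" using norm_triangle_ineq[of "t - ?v" ?v] by simp
    ultimately show ?thesis using ie L\<eta> tv e pos \<eta>\<tau> by simp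
  qed
  obtain \<rho> :: "real^'d \<Rightarrow> real" and C1 where \<rho>: "\<rho> \<in> tf" "(\<integral>x. \<rho> x \<partial>lborel) = 1" "0 \<le> C1"
    "\<And>x l. \<rho> x \<noteq> 0 \<Longrightarrow> \<bar>x $ l - ?v $ l\<bar> \<le> \<epsilon>"
    and est: "\<And>S p M f. square_integrable p \<Longrightarrow> grad_bound S p M \<Longrightarrow> 0 \<le> M \<Longrightarrow> f \<in> tf \<Longrightarrow>
      (\<And>h y t1 t2. 0 < h \<Longrightarrow> h \<le> 1 \<Longrightarrow> y \<in> supp f \<Longrightarrow> (\<forall>l. \<bar>t1 $ l - ?v $ l\<bar> \<le> \<epsilon>) \<Longrightarrow>
         (\<forall>l. \<bar>t2 $ l - ?v $ l\<bar> \<le> \<epsilon>) \<Longrightarrow> y + h *\<^sub>R (t1 + t2) \<in> S) \<Longrightarrow>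
      \<bar>(\<integral>x. p x * f x \<partial>lborel) - (\<integral>x. p x * conv \<rho> (conv \<rho> f) x \<partial>lborel)\<bar> \<le> C1 * M * n2 f"
    by (rule mollify_estimate[OF pos(3), of ?v]) blast
  have move: "y + h *\<^sub>R (t1 + t2) \<in> S"
    if h: "0 < h" "h \<le> 1" and y: "dist x0 y \<le> r / 2" "\<phi> (P y) \<le> inner y e"
      and t: "\<And>l. \<bar>t1 $ l - ?v $ l\<bar> \<le> \<epsilon>" "\<And>l. \<bar>t2 $ l - ?v $ l\<bar> \<le> \<epsilon>" for h y t1 t2
  proof -
    let ?z = "y + h *\<^sub>R (t1 + t2)"
    have n: "norm (t1 + t2) \<le> r / 4"
      using cone[OF t(1)] cone[OF t(2)] norm_triangle_ineq[of t1 t2] by (simp add: \<tau>_def)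
    have "norm (h *\<^sub>R (t1 + t2)) \<le> 1 * (r / 4)" using h n unfolding norm_scaleR by (intro mult_mono) auto
    then have zb: "?z \<in> ball x0 r"
      using y(1) r norm_triangle_ineq4[of "x0 - y" "h *\<^sub>R (t1 + t2)"] by (simp add: dist_norm algebra_simps)
    have "L * norm (P (t1 + t2)) \<le> L * (norm (P t1) + norm (P t2))"
      unfolding P_add by (intro mult_left_mono norm_triangle_ineq L0)
    also have "\<dots> < inner (t1 + t2) e"
      using cone[OF t(1)] cone[OF t(2)] by (simp add: inner_add_left distrib_left)
    finally have c: "L * norm (P (t1 + t2)) < inner (t1 + t2) e" .
    have "\<phi> (P ?z) - \<phi> (P y) \<le> L * norm (P ?z - P y)" using \<phi>[of ?z y] by simp
    also have "P ?z - P y = h *\<^sub>R P (t1 + t2)" by (simp add: P_add P_scale)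
    also have "L * norm (h *\<^sub>R P (t1 + t2)) = h * (L * norm (P (t1 + t2)))" using h by simp
    also have "\<dots> < h * inner (t1 + t2) e" using c h by simp
    finally have "\<phi> (P ?z) < inner ?z e" using y(2) by (simp add: inner_add_left)
    then have "?z \<in> S \<inter> ball x0 r" unfolding chart using zb by (simp add: P_def)
    then show ?thesis by blast
  qed
  let ?W = "S \<inter> ball x0 (r / 2)"
  \<comment> \<open>In the closure the chart inequality holds only weakly. The strict cone condition
    in \<open>move\<close> restores strictness, so the shifted closure is a compact subset of the
    open set \<open>S\<close>.\<close>
  have cl: "dist x0 y \<le> r / 2 \<and> \<phi> (P y) \<le> inner y e" if "y \<in> closure ?W" for y
  proof -
    have "continuous_on UNIV (\<lambda>y. \<phi> (P y))"
    proof (rule continuous_on_compose2[OF lipschitz_on_continuous_on[OF L]])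
      show "continuous_on UNIV P" unfolding P_def by (intro continuous_intros)
    qed (use P0 in auto)
    then have c1: "closed {y. \<phi> (P y) \<le> inner y e}" by (intro closed_Collect_le continuous_intros)
    have c2: "closed (cball x0 (r / 2))" by simp
    have "?W \<subseteq> cball x0 (r / 2) \<inter> {y. \<phi> (P y) \<le> inner y e}"
    proof
      fix y assume y: "y \<in> ?W"
      then have "y \<in> S \<inter> ball x0 r" using r by auto
      then show "y \<in> cball x0 (r / 2) \<inter> {y. \<phi> (P y) \<le> inner y e}" using y unfolding chart P_def by auto
    qed
    then have "closure ?W \<subseteq> cball x0 (r / 2) \<inter> {y. \<phi> (P y) \<le> inner y e}"
      by (rule closure_minimal) (intro closed_Int c1 c2)
    then show ?thesis using that by auto
  qed
  let ?Bx = "cbox (\<chi> l. ?v $ l - \<epsilon>) (\<chi> l. ?v $ l + \<epsilon>)"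
  have Bx: "t \<in> ?Bx \<longleftrightarrow> (\<forall>l. \<bar>t $ l - ?v $ l\<bar> \<le> \<epsilon>)" for t
    by (auto simp: mem_box_cart abs_le_iff algebra_simps)
  \<comment> \<open>The full shift h = 1 is the scale of the double mollification that remains after
    telescoping.\<close>
  define K where "K = (\<lambda>(y, t1, t2). y + 1 *\<^sub>R (t1 + t2)) ` (closure ?W \<times> ?Bx \<times> ?Bx)"
  have Kc: "compact K" unfolding K_def
    by (intro compact_continuous_image compact_Times compact_cbox)
      (auto simp: case_prod_beta intro!: continuous_intros bounded_Int)
  have KS: "K \<subseteq> S" unfolding K_def using move[of 1] cl Bx by auto
  have Kb: "K \<in> sets borel" using Kc by (simp add: borel_compact)
  define A where "A = (\<integral>x. \<bar>\<rho> x\<bar> \<partial>lborel)"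
  have A: "A \<ge> 0" by (simp add: A_def)
  define C where "C = C1 + A * A"
  have C: "C \<ge> 0" using A \<rho>(3) by (simp add: C_def)
  have c\<rho>: "Cc \<rho>" using \<rho>(1) by (rule tf_Cc)
  have main: "set_n2 ?W p \<le> C * (M + set_n2 K p)"
    if p: "square_integrable p" and M: "0 \<le> M" and gb: "grad_bound S p M" for p M
    unfolding set_n2_def[of ?W]
  proof (rule n2_le_if_test_bound[OF p])
    show "open ?W" using S by auto
    have sK: "set_n2 K p \<ge> 0" by (simp add: set_n2_def)
    show "0 \<le> C * (M + set_n2 K p)" using C M sK by simp
    fix f assume f: "f \<in> test_functions ?W"
    have ft: "f \<in> tf" "Cc f" "supp f \<subseteq> ?W" using f test_functions_tf test_functions_Cc by (auto simp: test_functions_iff)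
    have e1: "\<bar>(\<integral>x. p x * f x \<partial>lborel) - (\<integral>x. p x * conv \<rho> (conv \<rho> f) x \<partial>lborel)\<bar> \<le> C1 * M * n2 f"
    proof (rule est[OF p gb M ft(1)])
      fix h :: real and y t1 t2 :: "real^'d"
      assume h: "0 < h" "h \<le> 1" and y: "y \<in> supp f" and t: "\<forall>l. \<bar>t1 $ l - ?v $ l\<bar> \<le> \<epsilon>" "\<forall>l. \<bar>t2 $ l - ?v $ l\<bar> \<le> \<epsilon>"
      have "y \<in> closure ?W" by (rule subsetD[OF closure_subset subsetD[OF ft(3) y]])
      then show "y + h *\<^sub>R (t1 + t2) \<in> S" using cl t by (intro move h) auto
    qed
    let ?u = "conv \<rho> (conv \<rho> f)"
    have u: "Cc ?u" by (intro Cc_conv c\<rho> ft)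
    have uK: "x \<in> K" if "?u x \<noteq> 0" for x
    proof -
      from that obtain t1 z where 1: "\<rho> t1 \<noteq> 0" "conv \<rho> f z \<noteq> 0" "x = t1 + z" by (rule conv_nonzeroD)
      from 1(2) obtain t2 y where 2: "\<rho> t2 \<noteq> 0" "f y \<noteq> 0" "z = t2 + y" by (rule conv_nonzeroD)
      have "y \<in> closure ?W" by (rule subsetD[OF closure_subset test_functions_nonzero[OF f 2(2)]])
      moreover have "t1 \<in> ?Bx" "t2 \<in> ?Bx" unfolding Bx using \<rho>(4) 1 2 by auto
      ultimately show ?thesis unfolding K_def using 1(3) 2(3)
        by (intro image_eqI[of _ _ "(y, t1, t2)"]) auto
    qed
    have "(\<integral>x. p x * ?u x \<partial>lborel) = (\<integral>x. (indicat_real K x * p x) * ?u x \<partial>lborel)"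
      using uK by (intro Bochner_Integration.integral_cong refl) (auto simp: indicator_def)
    also have "\<bar>\<dots>\<bar> \<le> set_n2 K p * n2 ?u"
      unfolding set_n2_def
      by (intro n2_Cauchy_Schwarz square_integrable_indicator_mult p Kb Cc_square_integrable u)
    also have "\<dots> \<le> set_n2 K p * (A * (A * n2 f))"
    proof (rule mult_left_mono[OF _ sK])
      have "n2 ?u \<le> A * n2 (conv \<rho> f)" unfolding A_def by (intro conv_Young Cc_conv c\<rho> ft)
      also have "\<dots> \<le> A * (A * n2 f)" using A by (intro mult_left_mono) (auto simp: A_def intro!: conv_Young c\<rho> ft)
      finally show "n2 ?u \<le> A * (A * n2 f)" .
    qed
    finally have "\<bar>\<integral>x. p x * f x \<partial>lborel\<bar> \<le> C1 * M * n2 f + set_n2 K p * (A * (A * n2 f))"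
      using e1 by linarith
    also have "\<dots> \<le> C * (M + set_n2 K p) * n2 f"
    proof -
      have "0 \<le> C1 * set_n2 K p * n2 f" "0 \<le> A * A * M * n2 f" using \<rho>(3) sK A M by auto
      then show ?thesis by (simp add: C_def algebra_simps)
    qed
    finally show "\<bar>\<integral>x. p x * f x \<partial>lborel\<bar> \<le> C * (M + set_n2 K p) * n2 f" .
  qed
  show ?thesis by (rule that[OF _ Kc KS C main]) (use r in auto)
qed

section \<open>Patching local estimates together\<close>

lemma set_n2_mono:
  assumes "square_integrable p" "A \<in> sets borel" "B \<in> sets borel" "A \<subseteq> B"
  shows "set_n2 A p \<le> set_n2 B p"
proof -
  have "(\<lambda>x. indicat_real A x * p x) = (\<lambda>x. indicat_real A x * (indicat_real B x * p x))"
    using assms(4) by (auto simp: indicator_def fun_eq_iff)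
  then show ?thesis unfolding set_n2_def
    using square_integrable_indicator_mult(2)[OF square_integrable_indicator_mult(1)[OF assms(1,3)] assms(2)] by simp
qed

lemma set_n2_Un:
  assumes "square_integrable p" "A \<in> sets borel" "B \<in> sets borel"
  shows "set_n2 (A \<union> B) p \<le> set_n2 A p + set_n2 B p"
proof -
  have eq: "(\<lambda>x. indicat_real (A \<union> B) x * p x) = (\<lambda>x. indicat_real A x * p x + indicat_real (B - A) x * p x)"
    by (auto simp: indicator_def fun_eq_iff)
  have "set_n2 (A \<union> B) p \<le> set_n2 A p + set_n2 (B - A) p"
    unfolding set_n2_def eq
    by (intro n2_triangle square_integrable_indicator_mult assms) (use assms in auto)
  also have "set_n2 (B - A) p \<le> set_n2 B p" using assms by (intro set_n2_mono) auto
  finally show ?thesis by simp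
qed

definition oscillation_bound :: "(real^'d::finite) set \<Rightarrow> (real^'d) set \<Rightarrow> bool" where
  "oscillation_bound S A \<longleftrightarrow> (\<exists>C\<ge>0. \<forall>p M. square_integrable p \<longrightarrow> 0 \<le> M \<longrightarrow> grad_bound S p M \<longrightarrow>
      (\<exists>c. set_n2 A (\<lambda>x. p x - c) \<le> C * M))"

lemma square_integrable_on_diff_const:
  assumes "square_integrable p" "A \<in> sets borel" "bounded A"
  shows "square_integrable (\<lambda>x. indicat_real A x * (p x - c))"
proof -
  have "square_integrable (\<lambda>x. indicat_real A x * p x - c * indicat_real A x)"
    by (intro square_integrable_diff square_integrable_scale square_integrable_indicator square_integrable_indicator_mult assms)
  then show ?thesis by (simp add: algebra_simps)
qed

lemma set_n2_restrict: "A \<subseteq> B \<Longrightarrow> set_n2 A (\<lambda>x. indicat_real B x * p x) = set_n2 A p"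
  unfolding set_n2_def by (intro arg_cong[of _ _ n2]) (auto simp: indicator_def fun_eq_iff)

lemma set_n2_const: "A \<in> sets borel \<Longrightarrow> bounded A \<Longrightarrow> set_n2 A (\<lambda>x. c) = \<bar>c\<bar> * n2 (indicat_real A)"
  unfolding set_n2_def using n2_cmult[of c "indicat_real A"] by (simp add: mult.commute)

lemma oscillation_bound_mono:
  assumes "oscillation_bound S B" "A \<subseteq> B" "A \<in> sets borel" "B \<in> sets borel" "bounded B"
  shows "oscillation_bound S A"
proof -
  have "set_n2 A (\<lambda>x. p x - c) \<le> set_n2 B (\<lambda>x. p x - c)" if "square_integrable p" for p c
    using set_n2_mono[OF square_integrable_on_diff_const[OF that assms(4,5)] assms(3,4,2), of c]
    by (simp add: set_n2_restrict assms(2))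
  then show ?thesis using assms(1) unfolding oscillation_bound_def by (meson order_trans)
qed

text \<open>The two approximating constants differ by little, because on the overlap, which has
  positive measure, both approximate the same \<open>p\<close>.\<close>

lemma oscillation_bound_Un:
  assumes A: "oscillation_bound S A" "A \<in> sets borel" "bounded A"
    and B: "oscillation_bound S B" "B \<in> sets borel" "bounded B"
    and O: "open O'" "O' \<noteq> {}" "O' \<subseteq> A \<inter> B"
  shows "oscillation_bound S (A \<union> B)"
proof -
  obtain CA where CA: "0 \<le> CA" "\<And>p M. square_integrable p \<Longrightarrow> 0 \<le> M \<Longrightarrow> grad_bound S p M \<Longrightarrow>
    \<exists>c. set_n2 A (\<lambda>x. p x - c) \<le> CA * M" using A(1) unfolding oscillation_bound_def by blast
  obtain CB where CB: "0 \<le> CB" "\<And>p M. square_integrable p \<Longrightarrow> 0 \<le> M \<Longrightarrow> grad_bound S p M \<Longrightarrow>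
    \<exists>c. set_n2 B (\<lambda>x. p x - c) \<le> CB * M" using B(1) unfolding oscillation_bound_def by blast
  have Ob: "O' \<in> sets borel" "bounded O'" using O A(3) by (auto intro: bounded_subset)
  define \<omega> where "\<omega> = n2 (indicat_real O')"
  have \<omega>: "\<omega> > 0"
  proof -
    have "emeasure lborel O' \<noteq> 0"
      using O(1,2) open_not_negligible[of O'] Ob(1) by (simp add: negligible_iff_null_sets null_sets_def)
    moreover have "emeasure lborel O' < \<infinity>" using Ob by (intro emeasure_bounded_finite)
    ultimately have "measure lborel O' > 0" by (simp add: measure_def enn2real_positive_iff zero_less_iff_neq_zero)
    moreover have "(\<lambda>x. (indicat_real O' x)\<^sup>2) = indicat_real O'" by (auto simp: indicator_def)
    ultimately show ?thesis using Ob(1) by (simp add: \<omega>_def n2_def)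
  qed
  define D where "D = n2 (indicat_real B)"
  define C where "C = CA + CB + (CA + CB) / \<omega> * D"
  have D: "D \<ge> 0" by (simp add: D_def)
  have C: "C \<ge> 0" unfolding C_def using CA(1) CB(1) \<omega> D by auto
  have "\<exists>c. set_n2 (A \<union> B) (\<lambda>x. p x - c) \<le> C * M"
    if p: "square_integrable p" and M: "0 \<le> M" "grad_bound S p M" for p M
  proof -
    obtain a where a: "set_n2 A (\<lambda>x. p x - a) \<le> CA * M" using CA(2)[OF p M] by blast
    obtain b where b: "set_n2 B (\<lambda>x. p x - b) \<le> CB * M" using CB(2)[OF p M] by blast
    let ?E = "A \<union> B"
    have E: "?E \<in> sets borel" "bounded ?E" using A B by auto
    define pa where "pa x = indicat_real ?E x * (p x - a)" for x
    define pb where "pb x = indicat_real ?E x * (p x - b)" for x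
    have sq: "square_integrable pa" "square_integrable pb"
      unfolding pa_def pb_def by (intro square_integrable_on_diff_const p E)+
    have pa: "set_n2 X pa = set_n2 X (\<lambda>x. p x - a)" and pb: "set_n2 X pb = set_n2 X (\<lambda>x. p x - b)" if "X \<subseteq> ?E" for X
      unfolding pa_def pb_def by (intro set_n2_restrict that)+
    have "\<bar>b - a\<bar> * \<omega> = set_n2 O' (\<lambda>x. b - a)" using Ob by (simp add: set_n2_const \<omega>_def)
    also have "\<dots> = n2 (\<lambda>x. indicat_real O' x * pa x + (-1) * (indicat_real O' x * pb x))"
      unfolding set_n2_def using O(3)
      by (intro arg_cong[of _ _ n2]) (auto simp: pa_def pb_def fun_eq_iff indicator_def)
    also have "\<dots> \<le> set_n2 O' pa + n2 (\<lambda>x. (-1) * (indicat_real O' x * pb x))"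
      unfolding set_n2_def
      by (intro n2_triangle square_integrable_scale square_integrable_indicator_mult sq Ob)
    also have "\<dots> = set_n2 O' pa + set_n2 O' pb" unfolding n2_cmult set_n2_def by simp
    also have "\<dots> \<le> set_n2 A pa + set_n2 B pb"
      using O(3) A B Ob by (intro add_mono set_n2_mono sq) auto
    also have "\<dots> \<le> (CA + CB) * M" using a b by (simp add: pa pb algebra_simps)
    finally have ba: "\<bar>b - a\<bar> \<le> (CA + CB) / \<omega> * M" using \<omega> by (simp add: field_simps)
    have "set_n2 B pa \<le> set_n2 B pb + set_n2 B (\<lambda>x. b - a)"
    proof -
      have "set_n2 B pa = n2 (\<lambda>x. indicat_real B x * pb x + indicat_real B x * (b - a))"
        unfolding set_n2_def by (intro arg_cong[of _ _ n2]) (auto simp: pa_def pb_def fun_eq_iff indicator_def)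
      also have "\<dots> \<le> set_n2 B pb + set_n2 B (\<lambda>x. b - a)"
        unfolding set_n2_def
        using square_integrable_scale[OF square_integrable_indicator[OF B(2,3)], of "b - a"]
        by (intro n2_triangle square_integrable_indicator_mult(1)[OF sq(2) B(2)]) (simp add: mult.commute)
      finally show ?thesis .
    qed
    also have "set_n2 B (\<lambda>x. b - a) = \<bar>b - a\<bar> * D" using B by (simp add: set_n2_const D_def)
    also have "\<bar>b - a\<bar> * D \<le> ((CA + CB) / \<omega> * M) * D" by (intro mult_right_mono ba D)
    finally have "set_n2 B pa \<le> CB * M + ((CA + CB) / \<omega> * M) * D" using b by (simp add: pb)
    moreover have "set_n2 ?E pa \<le> set_n2 A pa + set_n2 B pa" using A B by (intro set_n2_Un sq) auto
    moreover have "set_n2 A pa \<le> CA * M" using a by (simp add: pa)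
    ultimately have "set_n2 ?E pa \<le> C * M" by (simp add: C_def algebra_simps)
    then show ?thesis using pa[of ?E] by auto
  qed
  then show ?thesis using C unfolding oscillation_bound_def by blast
qed

text \<open>The points joined to \<open>x0\<close> by a good set form a set that is open and closed
  in \<open>S\<close>, hence all of \<open>S\<close>; compactness reduces \<open>K\<close> to
  finitely many good sets.\<close>

lemma oscillation_bound_compact:
  fixes S :: "(real^'d::finite) set"
  assumes S: "open S" "connected S" and K: "compact K" "K \<subseteq> S"
  shows "oscillation_bound S K"
proof (cases "K = {}")
  case True
  have "set_n2 {} (\<lambda>x. p x - c) \<le> 0 * M" for p :: "real^'d \<Rightarrow> real" and c M :: real
    by (simp add: set_n2_def n2_def)
  then show ?thesis unfolding oscillation_bound_def True by blast
next
  case False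
  then obtain x0 where x0: "x0 \<in> S" using K by blast
  define G where "G A \<longleftrightarrow> A \<in> sets borel \<and> bounded A \<and> oscillation_bound S A" for A
  have loc: "\<exists>r>0. G (ball x r) \<and> ball x r \<subseteq> S" if x: "x \<in> S" for x
  proof -
    obtain r C where r: "r > 0" "0 \<le> C" "ball x r \<subseteq> S"
      "\<And>p M. square_integrable p \<Longrightarrow> 0 \<le> M \<Longrightarrow> grad_bound S p M \<Longrightarrow>
        \<exists>c. set_n2 (ball x r) (\<lambda>x. p x - c) \<le> C * M"
      by (rule interior_oscillation[OF S(1) x]) blast
    have "oscillation_bound S (ball x r)" unfolding oscillation_bound_def using r(2,4) by blast
    then show ?thesis using r by (auto simp: G_def)
  qed
  have GU: "G (A \<union> B)" if "G A" "G B" "z \<in> interior A" "z \<in> interior B" for A B z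
    unfolding G_def
    using that oscillation_bound_Un[of S A B "interior A \<inter> interior B"] interior_subset[of A] interior_subset[of B]
    by (auto simp: G_def)
  \<comment> \<open>Requiring \<open>x0\<close> in the interior of every good set makes any two of
    them overlap near \<open>x0\<close>, so that their finite union at the end is good.\<close>
  define W where "W = {x \<in> S. \<exists>A. G A \<and> x0 \<in> interior A \<and> x \<in> interior A}"
  have x0W: "x0 \<in> W"
  proof -
    obtain r where "r > 0" "G (ball x0 r)" using loc[OF x0] by blast
    then show ?thesis using x0 by (auto simp: W_def intro!: exI[of _ "ball x0 r"])
  qed
  have "open W"
  proof -
    have "\<exists>T. open T \<and> x \<in> T \<and> T \<subseteq> W" if xW: "x \<in> W" for x
    proof -
      obtain A where A: "G A" "x0 \<in> interior A" "x \<in> interior A" "x \<in> S" using xW by (auto simp: W_def)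
      then have "S \<inter> interior A \<subseteq> W" by (auto simp: W_def)
      then show ?thesis using A S(1) by (intro exI[of _ "S \<inter> interior A"]) auto
    qed
    then show ?thesis by (subst open_subopen) blast
  qed
  moreover have "open (S - W)"
  proof -
    have "\<exists>T. open T \<and> x \<in> T \<and> T \<subseteq> S - W" if xW: "x \<in> S - W" for x
    proof -
      obtain r where r: "r > 0" "G (ball x r)" "ball x r \<subseteq> S" using loc xW by blast
      have "y \<notin> W" if y: "y \<in> ball x r" for y
      proof
        assume "y \<in> W"
        then obtain A where A: "G A" "x0 \<in> interior A" "y \<in> interior A" by (auto simp: W_def)
        have "G (A \<union> ball x r)" using GU[OF A(1) r(2) A(3)] y by simp
        moreover have "x0 \<in> interior (A \<union> ball x r)" "x \<in> interior (A \<union> ball x r)"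
          using A(2) r(1) interior_mono[of A "A \<union> ball x r"] interior_mono[of "ball x r" "A \<union> ball x r"] by auto
        ultimately have "x \<in> W" using xW by (auto simp: W_def)
        then show False using xW by blast
      qed
      then show ?thesis using r by (intro exI[of _ "ball x r"]) auto
    qed
    then show ?thesis by (subst open_subopen) blast
  qed
  ultimately have "W \<inter> S = {} \<or> (S - W) \<inter> S = {}"
    by (intro connectedD[OF S(2)]) auto
  then have WS: "S \<subseteq> W" using x0W x0 by blast
  then have "\<exists>A. G A \<and> x0 \<in> interior A \<and> x \<in> interior A" if "x \<in> K" for x
    using K(2) that by (auto simp: W_def subset_iff)
  then obtain A where A: "\<And>x. x \<in> K \<Longrightarrow> G (A x) \<and> x0 \<in> interior (A x) \<and> x \<in> interior (A x)" by metis
  have "K \<subseteq> (\<Union>x\<in>K. interior (A x))" using A by blast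
  then obtain T where T: "T \<subseteq> K" "finite T" "K \<subseteq> (\<Union>x\<in>T. interior (A x))"
    using compactE_image[OF K(1), of K "\<lambda>x. interior (A x)"] by blast
  have "T \<noteq> {}" using T(3) False by auto
  have "G (\<Union>x\<in>T. A x) \<and> x0 \<in> interior (\<Union>x\<in>T. A x)"
    using T(2) \<open>T \<noteq> {}\<close> T(1)
  proof (induction T rule: finite_ne_induct)
    case (singleton x)
    then show ?case using A by simp
  next
    case (insert x T)
    then have IH: "G (\<Union>x\<in>T. A x)" "x0 \<in> interior (\<Union>x\<in>T. A x)" and Ax: "G (A x)" "x0 \<in> interior (A x)"
      using A by auto
    have "G (A x \<union> (\<Union>x\<in>T. A x))" by (rule GU[OF Ax(1) IH(1) Ax(2) IH(2)])
    moreover have "x0 \<in> interior (A x \<union> (\<Union>x\<in>T. A x))"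
      using Ax(2) interior_mono[of "A x" "A x \<union> (\<Union>x\<in>T. A x)"] by auto
    ultimately show ?case by simp
  qed
  moreover have "K \<subseteq> (\<Union>x\<in>T. A x)"
  proof -
    have "(\<Union>x\<in>T. interior (A x)) \<subseteq> (\<Union>x\<in>T. A x)" by (intro UN_mono order_refl interior_subset)
    then show ?thesis using T(3) by (rule order_trans[rotated])
  qed
  ultimately show ?thesis
    using K(1) by (intro oscillation_bound_mono[of S "\<Union>x\<in>T. A x" K]) (auto simp: G_def borel_compact)
qed

lemma set_n2_nonneg [simp]: "0 \<le> set_n2 A p" by (simp add: set_n2_def)

lemma set_n2_UN:
  assumes "finite T" "square_integrable p" "\<And>x. x \<in> T \<Longrightarrow> B x \<in> sets borel"
  shows "set_n2 (\<Union>x\<in>T. B x) p \<le> (\<Sum>x\<in>T. set_n2 (B x) p)"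
  using assms(1,3)
proof (induction T rule: finite_induct)
  case empty
  then show ?case by (simp add: set_n2_def n2_def)
next
  case (insert y T)
  have "set_n2 (\<Union>x\<in>insert y T. B x) p \<le> set_n2 (B y) p + set_n2 (\<Union>x\<in>T. B x) p"
  proof -
    have "(\<Union>x\<in>T. B x) \<in> sets borel" using insert by (intro sets.finite_UN) auto
    then show ?thesis using set_n2_Un[OF assms(2), of "B y" "\<Union>x\<in>T. B x"] insert by simp
  qed
  then show ?case using insert by simp
qed

theorem Necas_inequality:
  fixes S :: "(real^'d::finite) set"
  assumes S: "lipschitz_domain S"
  obtains C where "0 \<le> C" "\<And>p M. square_integrable p \<Longrightarrow> 0 \<le> M \<Longrightarrow> grad_bound S p M \<Longrightarrow>
    (\<integral>x. indicat_real S x * p x \<partial>lborel) = 0 \<Longrightarrow> set_n2 S p \<le> C * M"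
proof -
  have So: "open S" "connected S" "bounded S" and Sb: "S \<in> sets borel"
    using S by (auto simp: lipschitz_domain_def)
  define R where "R x s K C \<longleftrightarrow> s > 0 \<and> compact K \<and> K \<subseteq> S \<and> 0 \<le> C \<and>
      (\<forall>p M. square_integrable p \<longrightarrow> 0 \<le> M \<longrightarrow> grad_bound S p M \<longrightarrow> set_n2 (S \<inter> ball x s) p \<le> C * (M + set_n2 K p))" for x s K C
  have "\<exists>s K C. R x s K C" if x: "x \<in> frontier S" for x
  proof -
    obtain r e \<phi> L where r: "r > 0" "norm e = 1" "L-lipschitz_on {y. inner y e = 0} \<phi>"
      "S \<inter> ball x r = {y \<in> ball x r. \<phi> (y - inner y e *\<^sub>R e) < inner y e}"
      using S x unfolding lipschitz_domain_def by blast
    obtain s K C where "s > 0" "compact K" "K \<subseteq> S" "0 \<le> C"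
      "\<And>p M. square_integrable p \<Longrightarrow> 0 \<le> M \<Longrightarrow> grad_bound S p M \<Longrightarrow>
        set_n2 (S \<inter> ball x s) p \<le> C * (M + set_n2 K p)"
      by (rule boundary_estimate[OF r(1) So(1) r(2,3,4)]) blast
    then have "R x s K C" unfolding R_def by blast
    then show ?thesis by blast
  qed
  then obtain s K C where R: "\<And>x. x \<in> frontier S \<Longrightarrow> R x (s x) (K x) (C x)" by metis
  have "compact (frontier S)" using So(3) by (simp add: compact_frontier_bounded)
  moreover have "frontier S \<subseteq> (\<Union>x\<in>frontier S. ball x (s x))"
    using R by (force simp: R_def)
  ultimately obtain T where T: "T \<subseteq> frontier S" "finite T" "frontier S \<subseteq> (\<Union>x\<in>T. ball x (s x))"
    using compactE_image[of "frontier S" "frontier S" "\<lambda>x. ball x (s x)"] by blast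
  have RT: "s x > 0" "compact (K x)" "K x \<subseteq> S" "0 \<le> C x"
    "\<And>p M. square_integrable p \<Longrightarrow> 0 \<le> M \<Longrightarrow> grad_bound S p M \<Longrightarrow> set_n2 (S \<inter> ball x (s x)) p \<le> C x * (M + set_n2 (K x) p)"
    if "x \<in> T" for x
    using R[of x] T(1) that unfolding R_def by blast+
  define K0 where "K0 = closure S - (\<Union>x\<in>T. ball x (s x))"
  have K0: "compact K0" "K0 \<subseteq> S"
  proof -
    have "compact (closure S)" using So(3) by (simp add: compact_closure)
    then show "compact K0" unfolding K0_def by (intro compact_diff) auto
    have "closure S \<subseteq> S \<union> frontier S" using interior_subset[of S] by (auto simp: frontier_def)
    then show "K0 \<subseteq> S" using T(3) unfolding K0_def by blast
  qed
  \<comment> \<open>One compact set for the core and for all \<open>K x\<close>, so that a single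
    constant \<open>c\<close> serves every patch.\<close>
  define KK where "KK = K0 \<union> (\<Union>x\<in>T. K x)"
  have KK: "compact KK" "KK \<subseteq> S"
    unfolding KK_def using K0 RT(2,3) T(2) by (auto intro!: compact_Un compact_UN)
  obtain CK where CK: "0 \<le> CK" "\<And>p M. square_integrable p \<Longrightarrow> 0 \<le> M \<Longrightarrow> grad_bound S p M \<Longrightarrow>
    \<exists>c. set_n2 KK (\<lambda>x. p x - c) \<le> CK * M"
    using oscillation_bound_compact[OF So(1,2) KK] unfolding oscillation_bound_def by blast
  define CC where "CC = CK + (\<Sum>x\<in>T. C x * (1 + CK))"
  have CC: "0 \<le> CC" unfolding CC_def using CK(1) RT(4) by (intro add_nonneg_nonneg sum_nonneg mult_nonneg_nonneg) auto
  have "set_n2 S p \<le> CC * M" if p: "square_integrable p" and M: "0 \<le> M" and gb: "grad_bound S p M"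
    and mean: "(\<integral>x. indicat_real S x * p x \<partial>lborel) = 0" for p M
  proof -
    obtain c where c: "set_n2 KK (\<lambda>x. p x - c) \<le> CK * M" using CK(2)[OF p M gb] by blast
    define pc where "pc x = indicat_real S x * (p x - c)" for x
    have pc: "square_integrable pc" unfolding pc_def by (rule square_integrable_on_diff_const[OF p Sb So(3)])
    have pcK: "set_n2 A pc = set_n2 A (\<lambda>x. p x - c)" if "A \<subseteq> S" for A
      unfolding pc_def by (rule set_n2_restrict[OF that])
    have KKb: "KK \<in> sets borel" "\<And>x. x \<in> T \<Longrightarrow> K x \<in> sets borel" "K0 \<in> sets borel"
      using KK(1) RT(2) K0(1) by (auto intro: borel_compact)
    \<comment> \<open>Constants are invisible to the gradient, as divergences of test fields
      integrate to 0; so the patches may be estimated for \<open>p - c\<close> in place of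
      \<open>p\<close>.\<close>
    have gbc: "grad_bound S pc M"
      unfolding grad_bound_def
    proof
      fix w :: "'d \<Rightarrow> real^'d \<Rightarrow> real" assume w: "w \<in> test_fields S"
      have fw: "fdiv w \<in> test_functions S" using w by (rule fdiv_tf)
      have cfw: "Cc (fdiv w)" using fw by (rule test_functions_Cc)
      have "(\<integral>x. fdiv w x \<partial>lborel) = (\<Sum>i\<in>UNIV. \<integral>x. partial_deriv i (w i) x \<partial>lborel)"
        unfolding fdiv_def using w
        by (intro Bochner_Integration.integral_sum Cc_integrable test_functions_Cc[of _ S] test_functions_partial_deriv)
          (auto simp: test_fields_def)
      also have "\<dots> = 0"
        using w by (intro sum.neutral ballI integral_partial_deriv test_functions_tf[of _ S]) (auto simp: test_fields_def)
      finally have z: "(\<integral>x. fdiv w x \<partial>lborel) = 0" .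
      have "(\<integral>x. pc x * fdiv w x \<partial>lborel) = (\<integral>x. p x * fdiv w x - c * fdiv w x \<partial>lborel)"
        using test_functions_nonzero[OF fw]
        by (intro Bochner_Integration.integral_cong refl) (auto simp: pc_def indicator_def algebra_simps)
      also have "\<dots> = (\<integral>x. p x * fdiv w x \<partial>lborel)"
        using square_integrable_mult[OF p Cc_square_integrable[OF cfw]] Cc_integrable[OF cfw] z by simp
      finally show "\<bar>\<integral>x. pc x * fdiv w x \<partial>lborel\<bar> \<le> M * grad_norm w"
        using gb w by (simp add: grad_bound_def)
    qed
    have Kbd: "set_n2 A pc \<le> CK * M" if "A \<subseteq> KK" "A \<in> sets borel" for A
      using set_n2_mono[OF pc that(2) KKb(1) that(1)] c pcK[OF KK(2)] by simp
    have "S \<subseteq> K0 \<union> (\<Union>x\<in>T. S \<inter> ball x (s x))"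
      unfolding K0_def using closure_subset[of S] by auto
    moreover have UNb: "(\<Union>x\<in>T. S \<inter> ball x (s x)) \<in> sets borel"
      using Sb T(2) by (intro sets.finite_UN) auto
    ultimately have "set_n2 S pc \<le> set_n2 (K0 \<union> (\<Union>x\<in>T. S \<inter> ball x (s x))) pc"
      by (intro set_n2_mono pc Sb sets.Un KKb(3))
    also have "\<dots> \<le> set_n2 K0 pc + set_n2 (\<Union>x\<in>T. S \<inter> ball x (s x)) pc"
      by (intro set_n2_Un pc KKb(3) UNb)
    also have "\<dots> \<le> set_n2 K0 pc + (\<Sum>x\<in>T. set_n2 (S \<inter> ball x (s x)) pc)"
      using Sb T(2) by (intro add_left_mono set_n2_UN pc) auto
    also have "\<dots> \<le> CK * M + (\<Sum>x\<in>T. C x * (M + CK * M))"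
    proof (intro add_mono sum_mono)
      show "set_n2 K0 pc \<le> CK * M" using KKb by (intro Kbd) (auto simp: KK_def)
      fix x assume x: "x \<in> T"
      have "set_n2 (S \<inter> ball x (s x)) pc \<le> C x * (M + set_n2 (K x) pc)" by (rule RT(5)[OF x pc M gbc])
      also have "\<dots> \<le> C x * (M + CK * M)"
        using x KKb by (intro mult_left_mono add_left_mono Kbd RT(4)) (auto simp: KK_def)
      finally show "set_n2 (S \<inter> ball x (s x)) pc \<le> C x * (M + CK * M)" .
    qed
    also have "\<dots> = CC * M"
      unfolding CC_def distrib_right sum_distrib_right by (simp add: algebra_simps)
    finally have bd: "set_n2 S pc \<le> CC * M" .
    \<comment> \<open>Mean zero makes \<open>p\<close> orthogonal to constants on \<open>S\<close>,
      so its norm there is at most that of \<open>p - c\<close>.\<close>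
    let ?q = "\<lambda>x. indicat_real S x * p x"
    have q: "square_integrable ?q" by (intro square_integrable_indicator_mult p Sb)
    have iq: "integrable lborel ?q"
      by (intro square_integrable_mult square_integrable_indicator p Sb So)
    have "(n2 ?q)\<^sup>2 = (\<integral>x. pc x * ?q x + c * ?q x \<partial>lborel)"
      unfolding n2_power2
      by (intro Bochner_Integration.integral_cong refl) (auto simp: pc_def indicator_def algebra_simps)
    also have "\<dots> = (\<integral>x. pc x * ?q x \<partial>lborel)"
      using square_integrable_mult[OF pc q] iq mean by simp
    also have "\<dots> \<le> n2 pc * n2 ?q" using n2_Cauchy_Schwarz[OF pc q] by simp
    finally have "n2 ?q * n2 ?q \<le> n2 pc * n2 ?q" by (simp add: power2_eq_square)
    then have "n2 ?q \<le> n2 pc" by (rule le_if_square_le) auto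
    moreover have "n2 pc = set_n2 S pc"
      unfolding set_n2_def by (intro arg_cong[of _ _ n2]) (auto simp: pc_def indicator_def fun_eq_iff)
    ultimately show ?thesis using bd by (simp add: set_n2_def)
  qed
  then show ?thesis using that CC by blast
qed

section \<open>Weak derivatives\<close>

lemma L2_on_iff_rep: "f \<in> L2_on S \<longleftrightarrow> (AE x in lborel. x \<notin> S \<longrightarrow> rep_L2 f x = 0)"
  using vanishes_outside.abs_eq[OF L2_rel_refl[OF square_integrable_rep_L2], of S f]
  by (simp add: L2_on_def L2_class_rep_L2)

lemma L2_class_in_L2_on: "square_integrable f \<Longrightarrow> (\<And>x. f x \<noteq> 0 \<Longrightarrow> x \<in> S) \<Longrightarrow> L2_class f \<in> L2_on S"
  using vanishes_outside.abs_eq[OF L2_rel_refl, of f S] by (auto simp: L2_on_def)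

text \<open>Written as an orthogonal complement, \<open>L2_on S\<close> is visibly a closed
  subspace.\<close>

lemma L2_on_iff_orthogonal:
  assumes S: "S \<in> sets borel"
  shows "f \<in> L2_on S \<longleftrightarrow> (\<forall>h \<in> L2_on (- S). inner f h = 0)"
proof
  assume f: "f \<in> L2_on S"
  show "\<forall>h \<in> L2_on (- S). inner f h = 0"
  proof
    fix h assume h: "h \<in> L2_on (- S)"
    have "inner f h = (\<integral>x. rep_L2 f x * rep_L2 h x \<partial>lborel)"
      using inner_L2_class[OF square_integrable_rep_L2 square_integrable_rep_L2, of f h] by (simp add: L2_class_rep_L2)
    also have "\<dots> = 0"
    proof (rule integral_eq_zero_AE)
      show "AE x in lborel. rep_L2 f x * rep_L2 h x = 0"
        using f[unfolded L2_on_iff_rep] h[unfolded L2_on_iff_rep] by eventually_elim auto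
    qed
    finally show "inner f h = 0" by simp
  qed
next
  assume orth: "\<forall>h \<in> L2_on (- S). inner f h = 0"
  let ?f = "rep_L2 f"
  let ?h = "\<lambda>x. indicat_real (- S) x * ?f x"
  have Sc: "- S \<in> sets borel" using S by auto
  have sq: "square_integrable ?h" by (intro square_integrable_indicator_mult square_integrable_rep_L2 Sc)
  have "L2_class ?h \<in> L2_on (- S)" by (rule L2_class_in_L2_on[OF sq]) (auto simp: indicator_def split: if_splits)
  then have "0 = inner (L2_class ?f) (L2_class ?h)" using orth by (simp add: L2_class_rep_L2)
  also have "\<dots> = (\<integral>x. ?h x * ?h x \<partial>lborel)"
    unfolding inner_L2_class[OF square_integrable_rep_L2 sq]
    by (intro Bochner_Integration.integral_cong refl) (auto simp: indicator_def)
  also have "\<dots> = (n2 ?h)\<^sup>2" by (simp only: n2_power2)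
  finally have "norm (L2_class ?h) = 0" using norm_L2_class[OF sq] by simp
  then have "L2_class ?h = L2_class (\<lambda>x. 0)" by (simp add: zero_L2.abs_eq)
  then have "AE x in lborel. ?h x = 0" using L2_class_eq_iff[OF sq square_integrable_zero] by simp
  then show "f \<in> L2_on S" unfolding L2_on_iff_rep by eventually_elim (auto simp: indicator_def)
qed

lemma subspace_L2_on: "S \<in> sets borel \<Longrightarrow> subspace (L2_on S)"
  by (auto simp: subspace_def L2_on_iff_orthogonal inner_add_left)

lemma closed_L2_on: "S \<in> sets borel \<Longrightarrow> closed (L2_on S)"
proof -
  assume S: "S \<in> sets borel"
  have "L2_on S = (\<Inter>h\<in>L2_on (- S). {f. inner f h = 0})" using L2_on_iff_orthogonal[OF S] by auto
  then show ?thesis by (auto intro!: closed_INT closed_Collect_eq continuous_intros)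
qed

lemma L2_on_eq_if_test_eq:
  fixes S :: "(real^'d::finite) set"
  assumes S: "open S" and fg: "f \<in> L2_on S" "g \<in> L2_on S"
    and eq: "\<And>\<phi>. \<phi> \<in> test_functions S \<Longrightarrow> inner f (L2_class \<phi>) = inner g (L2_class \<phi>)"
  shows "f = g"
proof -
  let ?f = "rep_L2 f" and ?g = "rep_L2 g"
  have sq: "square_integrable ?f" "square_integrable ?g" by (simp_all add: square_integrable_rep_L2)
  have "AE x in lborel. x \<in> S \<longrightarrow> ?f x - ?g x = 0"
  proof (rule AE_zero_if_orthogonal[OF square_integrable_diff[OF sq] S])
    fix \<phi> assume \<phi>: "\<phi> \<in> test_functions S"
    have s\<phi>: "square_integrable \<phi>" by (rule Cc_square_integrable[OF test_functions_Cc[OF \<phi>]])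
    have "inner (L2_class ?f) (L2_class \<phi>) = inner (L2_class ?g) (L2_class \<phi>)"
      using eq[OF \<phi>] by (simp only: L2_class_rep_L2)
    then have "(\<integral>x. ?f x * \<phi> x \<partial>lborel) = (\<integral>x. ?g x * \<phi> x \<partial>lborel)"
      by (simp only: inner_L2_class[OF sq(1) s\<phi>] inner_L2_class[OF sq(2) s\<phi>])
    then show "(\<integral>x. (?f x - ?g x) * \<phi> x \<partial>lborel) = 0"
      using square_integrable_mult[OF sq(1) s\<phi>] square_integrable_mult[OF sq(2) s\<phi>]
      by (simp add: left_diff_distrib)
  qed
  with fg[unfolded L2_on_iff_rep] have "AE x in lborel. ?f x = ?g x"
    by eventually_elim auto
  then have "L2_class ?f = L2_class ?g" using L2_class_eq_iff[OF sq] by simp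
  then show ?thesis by (simp only: L2_class_rep_L2)
qed

lemma square_integrable_test: "\<phi> \<in> test_functions S \<Longrightarrow> square_integrable \<phi>"
  by (rule Cc_square_integrable[OF test_functions_Cc])

lemma inner_test:
  "\<phi> \<in> test_functions S \<Longrightarrow> \<psi> \<in> test_functions S \<Longrightarrow>
    inner (L2_class \<phi>) (L2_class \<psi>) = (\<integral>x. \<phi> x * \<psi> x \<partial>lborel)"
  by (intro inner_L2_class square_integrable_test)

lemma L2_class_test_in_L2_on: "\<phi> \<in> test_functions S \<Longrightarrow> L2_class \<phi> \<in> L2_on S"
  by (intro L2_class_in_L2_on square_integrable_test test_functions_nonzero)

section \<open>Uniqueness, linearity and closedness of weak derivatives\<close>

lemma has_weak_partial_unique:
  assumes "open S" "has_weak_partial S i f g" "has_weak_partial S i f h" shows "g = h"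
  using assms by (intro L2_on_eq_if_test_eq[OF assms(1)]) (auto simp: has_weak_partial_def)

lemma weak_partial_eq: "open S \<Longrightarrow> has_weak_partial S i f g \<Longrightarrow> weak_partial S i f = g"
  unfolding weak_partial_def by (rule the_equality) (auto intro: has_weak_partial_unique)

lemma has_weak_div_unique:
  assumes "open S" "has_weak_div S v g" "has_weak_div S v h" shows "g = h"
  using assms by (intro L2_on_eq_if_test_eq[OF assms(1)]) (auto simp: has_weak_div_def)

lemma weak_div_eq: "open S \<Longrightarrow> has_weak_div S v g \<Longrightarrow> weak_div S v = g"
  unfolding weak_div_def by (rule the_equality) (auto intro: has_weak_div_unique)

lemma has_weak_partial_add:
  "open S \<Longrightarrow> has_weak_partial S i f g \<Longrightarrow> has_weak_partial S i f' g' \<Longrightarrow> has_weak_partial S i (f + f') (g + g')"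
  using subspace_add[OF subspace_L2_on, of S] by (auto simp: has_weak_partial_def inner_add_left)

lemma has_weak_partial_scaleR:
  "open S \<Longrightarrow> has_weak_partial S i f g \<Longrightarrow> has_weak_partial S i (c *\<^sub>R f) (c *\<^sub>R g)"
  using subspace_scale[OF subspace_L2_on, of S] by (auto simp: has_weak_partial_def)

lemma has_weak_div_add:
  "open S \<Longrightarrow> has_weak_div S f g \<Longrightarrow> has_weak_div S f' g' \<Longrightarrow> has_weak_div S (f + f') (g + g')"
  using subspace_add[OF subspace_L2_on, of S] by (auto simp: has_weak_div_def inner_add_left)

lemma has_weak_div_scaleR:
  "open S \<Longrightarrow> has_weak_div S f g \<Longrightarrow> has_weak_div S (c *\<^sub>R f) (c *\<^sub>R g)"
  using subspace_scale[OF subspace_L2_on, of S] by (auto simp: has_weak_div_def)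

lemma has_weak_partial_limit:
  assumes S: "open S" and fg: "\<And>n. has_weak_partial S i (f n) (g n)" and "f \<longlonglongrightarrow> f'" "g \<longlonglongrightarrow> g'"
  shows "has_weak_partial S i f' g'"
  unfolding has_weak_partial_def
proof (intro conjI ballI)
  show "g' \<in> L2_on S"
    using closed_sequentially[OF closed_L2_on, of S g g'] fg assms(4) S by (auto simp: has_weak_partial_def)
  fix \<phi> assume \<phi>: "\<phi> \<in> test_functions S"
  have "(\<lambda>n. inner (f n) (L2_class (partial_deriv i \<phi>))) \<longlonglongrightarrow> inner f' (L2_class (partial_deriv i \<phi>))"
    by (intro tendsto_intros assms)
  moreover have "(\<lambda>n. - inner (g n) (L2_class \<phi>)) \<longlonglongrightarrow> - inner g' (L2_class \<phi>)"
    by (intro tendsto_intros assms)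
  moreover have "(\<lambda>n. inner (f n) (L2_class (partial_deriv i \<phi>))) = (\<lambda>n. - inner (g n) (L2_class \<phi>))"
    using fg \<phi> by (auto simp: has_weak_partial_def)
  ultimately show "inner f' (L2_class (partial_deriv i \<phi>)) = - inner g' (L2_class \<phi>)"
    using LIMSEQ_unique by metis
qed

lemma has_weak_div_limit:
  assumes S: "open S" and fg: "\<And>n. has_weak_div S (f n) (g n)" and "f \<longlonglongrightarrow> f'" "g \<longlonglongrightarrow> g'"
  shows "has_weak_div S f' g'"
  unfolding has_weak_div_def
proof (intro conjI ballI)
  show "g' \<in> L2_on S"
    using closed_sequentially[OF closed_L2_on, of S g g'] fg assms(4) S by (auto simp: has_weak_div_def)
  fix \<phi> assume \<phi>: "\<phi> \<in> test_functions S"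
  let ?d = "\<chi> i. L2_class (partial_deriv i \<phi>)"
  have "(\<lambda>n. inner (f n) ?d) \<longlonglongrightarrow> inner f' ?d"
    by (intro tendsto_inner tendsto_const assms)
  moreover have "(\<lambda>n. - inner (g n) (L2_class \<phi>)) \<longlonglongrightarrow> - inner g' (L2_class \<phi>)"
    by (intro tendsto_intros assms)
  moreover have "(\<lambda>n. inner (f n) ?d) = (\<lambda>n. - inner (g n) (L2_class \<phi>))"
    using fg \<phi> by (auto simp: has_weak_div_def)
  ultimately show "inner f' ?d = - inner g' (L2_class \<phi>)"
    using LIMSEQ_unique by metis
qed

lemma has_weak_partial_test:
  assumes \<phi>: "\<phi> \<in> test_functions S"
  shows "has_weak_partial S i (L2_class \<phi>) (L2_class (partial_deriv i \<phi>))"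
  unfolding has_weak_partial_def
proof (intro conjI ballI)
  show "L2_class (partial_deriv i \<phi>) \<in> L2_on S"
    by (intro L2_class_test_in_L2_on test_functions_partial_deriv \<phi>)
  fix \<psi> assume \<psi>: "\<psi> \<in> test_functions S"
  show "inner (L2_class \<phi>) (L2_class (partial_deriv i \<psi>)) = - inner (L2_class (partial_deriv i \<phi>)) (L2_class \<psi>)"
    unfolding inner_test[OF \<phi> test_functions_partial_deriv[OF \<psi>]] inner_test[OF test_functions_partial_deriv[OF \<phi>] \<psi>]
    using integral_by_parts_tf[of \<phi> \<psi> i] \<phi> \<psi> by (simp add: test_functions_iff)
qed

text \<open>For open \<open>S\<close>, its closure in the product space is the graph of the weak
  gradient over \<open>H1_0 S\<close>; linearity and completeness of that space are read off from
  it.\<close>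

definition test_graph :: "(real^'d::finite) set \<Rightarrow> ('d sfield \<times> 'd vfield) set" where
  "test_graph S = (\<lambda>\<phi>. (L2_class \<phi>, \<chi> i. L2_class (partial_deriv i \<phi>))) ` test_functions S"

lemma weak_grad_test:
  "open S \<Longrightarrow> \<phi> \<in> test_functions S \<Longrightarrow> weak_grad S (L2_class \<phi>) = (\<chi> i. L2_class (partial_deriv i \<phi>))"
  unfolding weak_grad_def using weak_partial_eq[OF _ has_weak_partial_test, of S \<phi>]
  by (simp add: Finite_Cartesian_Product.vec_eq_iff)

lemma H1_weak_partial: "open S \<Longrightarrow> f \<in> H1 S \<Longrightarrow> has_weak_partial S i f (weak_partial S i f)"
  unfolding H1_def using weak_partial_eq by blast

lemma test_in_H1: "\<phi> \<in> test_functions S \<Longrightarrow> L2_class \<phi> \<in> H1 S"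
  unfolding H1_def using has_weak_partial_test L2_class_test_in_L2_on by blast

lemma H1_norm_eq: "H1_norm S f = norm (f, weak_grad S f)"
  by (simp add: H1_norm_def norm_Pair)

lemma weak_grad_linear:
  assumes S: "open S" and "f \<in> H1 S" "g \<in> H1 S"
  shows "weak_grad S (f + g) = weak_grad S f + weak_grad S g"
    "weak_grad S (c *\<^sub>R f) = c *\<^sub>R weak_grad S f"
    "weak_grad S (f - g) = weak_grad S f - weak_grad S g"
proof -
  note h = H1_weak_partial[OF S]
  show "weak_grad S (f + g) = weak_grad S f + weak_grad S g"
    using weak_partial_eq[OF S has_weak_partial_add[OF S h h]] assms by (simp add: weak_grad_def Finite_Cartesian_Product.vec_eq_iff)
  show "weak_grad S (c *\<^sub>R f) = c *\<^sub>R weak_grad S f"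
    using weak_partial_eq[OF S has_weak_partial_scaleR[OF S h]] assms by (simp add: weak_grad_def Finite_Cartesian_Product.vec_eq_iff)
  have "has_weak_partial S i (f - g) (weak_partial S i f - weak_partial S i g)" for i
    using has_weak_partial_add[OF S h[OF assms(2)] has_weak_partial_scaleR[OF S h[OF assms(3)], where c="-1"], of i] by simp
  then show "weak_grad S (f - g) = weak_grad S f - weak_grad S g"
    using weak_partial_eq[OF S] by (simp add: weak_grad_def Finite_Cartesian_Product.vec_eq_iff)
qed

lemma closure_test_graph:
  assumes S: "open S" and fg: "(f, g) \<in> closure (test_graph S)"
  shows "f \<in> H1 S \<and> weak_grad S f = g"
proof -
  obtain X where X: "\<And>n. X n \<in> test_graph S" "X \<longlonglongrightarrow> (f, g)" using fg closure_sequential by blast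
  have lim: "(\<lambda>n. fst (X n)) \<longlonglongrightarrow> f" "(\<lambda>n. snd (X n) $ i) \<longlonglongrightarrow> g $ i" for i
    using tendsto_fst[OF X(2)] tendsto_vec_nth[OF tendsto_snd[OF X(2)]] by auto
  have w: "has_weak_partial S i (fst (X n)) (snd (X n) $ i)" and inL: "fst (X n) \<in> L2_on S" for n i
    using X(1)[of n] by (auto simp: test_graph_def has_weak_partial_test L2_class_test_in_L2_on)
  have wp: "has_weak_partial S i f (g $ i)" for i
    by (rule has_weak_partial_limit[OF S w lim])
  have "f \<in> L2_on S" using closed_sequentially[OF closed_L2_on inL lim(1)] S by simp
  then show ?thesis
    using wp weak_partial_eq[OF S wp] unfolding H1_def weak_grad_def by (auto simp: Finite_Cartesian_Product.vec_eq_iff)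
qed

lemma H1_0_iff:
  assumes S: "open S"
  shows "f \<in> H1_0 S \<longleftrightarrow> (f, weak_grad S f) \<in> closure (test_graph S)"
proof -
  have eq: "H1_norm S (f - L2_class \<phi>) = dist (L2_class \<phi>, \<chi> i. L2_class (partial_deriv i \<phi>)) (f, weak_grad S f)"
    if "f \<in> H1 S" "\<phi> \<in> test_functions S" for \<phi>
    using that weak_grad_linear(3)[OF S that(1) test_in_H1[OF that(2)]] weak_grad_test[OF S that(2)]
    by (simp add: H1_norm_eq dist_norm norm_Pair norm_minus_commute)
  show ?thesis
  proof
    assume f: "f \<in> H1_0 S"
    then have H: "f \<in> H1 S" by (simp add: H1_0_def)
    show "(f, weak_grad S f) \<in> closure (test_graph S)"
      unfolding closure_approachable test_graph_def using f eq[OF H] by (auto simp: H1_0_def)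
  next
    assume c: "(f, weak_grad S f) \<in> closure (test_graph S)"
    then have H: "f \<in> H1 S" using closure_test_graph[OF S] by blast
    show "f \<in> H1_0 S"
      using c eq[OF H] H unfolding closure_approachable test_graph_def by (auto simp: H1_0_def)
  qed
qed

lemma subspace_test_graph: "subspace (test_graph S)"
proof -
  have sq: "square_integrable \<phi>" "square_integrable (partial_deriv i \<phi>)" if "\<phi> \<in> test_functions S" for i \<phi>
    using that test_functions_partial_deriv square_integrable_test by blast+
  have d: "\<phi> differentiable (at x)" if "\<phi> \<in> test_functions S" for \<phi> x
    using that test_functions_tf tf_differentiable by blast
  show ?thesis
    unfolding subspace_def
  proof (intro conjI ballI allI)
    show "0 \<in> test_graph S" unfolding test_graph_def
      by (rule image_eqI[of _ _ "\<lambda>x. 0"]) (auto simp: test_functions_zero zero_prod_def zero_L2.abs_eq Finite_Cartesian_Product.vec_eq_iff)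
    show "x + y \<in> test_graph S" if xy: "x \<in> test_graph S" "y \<in> test_graph S" for x y
    proof -
      obtain \<phi> \<psi> where p: "\<phi> \<in> test_functions S" "\<psi> \<in> test_functions S"
        "x = (L2_class \<phi>, \<chi> i. L2_class (partial_deriv i \<phi>))" "y = (L2_class \<psi>, \<chi> i. L2_class (partial_deriv i \<psi>))"
        using xy unfolding test_graph_def by blast
      have "partial_deriv i (\<lambda>x. \<phi> x + \<psi> x) = (\<lambda>x. partial_deriv i \<phi> x + partial_deriv i \<psi> x)" for i
        using partial_deriv_add[OF d[OF p(1)] d[OF p(2)]] by auto
      then have "x + y = (L2_class (\<lambda>x. \<phi> x + \<psi> x), \<chi> i. L2_class (partial_deriv i (\<lambda>x. \<phi> x + \<psi> x)))"
        using p sq[OF p(1)] sq[OF p(2)] by (simp add: L2_class_add Finite_Cartesian_Product.vec_eq_iff)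
      then show ?thesis using test_functions_add[OF p(1,2)] by (auto simp: test_graph_def)
    qed
    show "c *\<^sub>R x \<in> test_graph S" if xc: "x \<in> test_graph S" for c x
    proof -
      obtain \<phi> where p: "\<phi> \<in> test_functions S" "x = (L2_class \<phi>, \<chi> i. L2_class (partial_deriv i \<phi>))"
        using xc unfolding test_graph_def by blast
      have "partial_deriv i (\<lambda>x. c * \<phi> x) = (\<lambda>x. c * partial_deriv i \<phi> x)" for i
        using partial_deriv_cmult[OF d[OF p(1)]] by auto
      then have "c *\<^sub>R x = (L2_class (\<lambda>x. c * \<phi> x), \<chi> i. L2_class (partial_deriv i (\<lambda>x. c * \<phi> x)))"
        using p sq[OF p(1)] by (simp add: L2_class_scaleR Finite_Cartesian_Product.vec_eq_iff)
      then show ?thesis using test_functions_cmult[OF p(1)] by (auto simp: test_graph_def)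
    qed
  qed
qed

lemma subspace_H1_0: assumes S: "open S" shows "subspace (H1_0 S)"
proof -
  have G: "subspace (closure (test_graph S))" by (rule subspace_closure[OF subspace_test_graph])
  have H: "f \<in> H1 S" if "f \<in> H1_0 S" for f using that by (simp add: H1_0_def)
  show ?thesis
    unfolding subspace_def
  proof (intro conjI ballI allI)
    have "(0, 0) \<in> closure (test_graph S)" using subspace_0[OF G] by (simp add: zero_prod_def)
    then show "0 \<in> H1_0 S" using closure_test_graph[OF S] H1_0_iff[OF S] by metis
    show "x + y \<in> H1_0 S" if "x \<in> H1_0 S" "y \<in> H1_0 S" for x y
      using that subspace_add[OF G, of "(x, weak_grad S x)" "(y, weak_grad S y)"] weak_grad_linear(1)[OF S H H, of x y]
      by (simp add: H1_0_iff[OF S])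
    show "c *\<^sub>R x \<in> H1_0 S" if "x \<in> H1_0 S" for c x
      using that subspace_scale[OF G, of "(x, weak_grad S x)" c] weak_grad_linear(2)[OF S H H, of x x]
      by (simp add: H1_0_iff[OF S])
  qed
qed

section \<open>The function spaces as Hilbert spaces\<close>

text \<open>\<open>inj\<close> and \<open>surj\<close> say that \<open>E\<close> is the full product
  over \<open>I\<close>. The component maps \<open>\<pi>\<close> are kept abstract to cover both
  vectors indexed by \<open>'d\<close> and sequences truncated at \<open>n\<close>.\<close>

lemma hilbert_form_family:
  fixes D :: "'a::real_vector set" and E :: "'c::real_vector set" and \<pi> :: "'i \<Rightarrow> 'c \<Rightarrow> 'a"
  assumes "hilbert_form D b" and I: "finite I" and E: "subspace E"
    and \<pi>: "\<And>x i. x \<in> E \<Longrightarrow> i \<in> I \<Longrightarrow> \<pi> i x \<in> D"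
      "\<And>x y i. x \<in> E \<Longrightarrow> y \<in> E \<Longrightarrow> i \<in> I \<Longrightarrow> \<pi> i (x + y) = \<pi> i x + \<pi> i y"
      "\<And>x c i. x \<in> E \<Longrightarrow> i \<in> I \<Longrightarrow> \<pi> i (c *\<^sub>R x) = c *\<^sub>R \<pi> i x"
    and inj: "\<And>x. x \<in> E \<Longrightarrow> (\<And>i. i \<in> I \<Longrightarrow> \<pi> i x = 0) \<Longrightarrow> x = 0"
    and surj: "\<And>\<xi>. (\<And>i. i \<in> I \<Longrightarrow> \<xi> i \<in> D) \<Longrightarrow> \<exists>x\<in>E. \<forall>i\<in>I. \<pi> i x = \<xi> i"
  shows "hilbert_form E (\<lambda>x y. \<Sum>i\<in>I. b (\<pi> i x) (\<pi> i y))"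
proof -
  interpret D: hilbert_form D b by fact
  have \<pi>_diff: "\<pi> i (x - y) = \<pi> i x - \<pi> i y" if "x \<in> E" "y \<in> E" "i \<in> I" for x y i
    using \<pi>(2)[of x "(-1) *\<^sub>R y" i] \<pi>(3)[of y i "-1"] that subspace_scale[OF E, of y "-1"] by simp
  show ?thesis
  proof
    show "subspace E" by fact
    show "(\<Sum>i\<in>I. b (\<pi> i (x + y)) (\<pi> i z)) = (\<Sum>i\<in>I. b (\<pi> i x) (\<pi> i z)) + (\<Sum>i\<in>I. b (\<pi> i y) (\<pi> i z))"
      if "x \<in> E" "y \<in> E" "z \<in> E" for x y z
      unfolding sum.distrib[symmetric] using that by (intro sum.cong) (auto simp: \<pi> D.add_left)
    show "(\<Sum>i\<in>I. b (\<pi> i (c *\<^sub>R x)) (\<pi> i z)) = c * (\<Sum>i\<in>I. b (\<pi> i x) (\<pi> i z))"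
      if "x \<in> E" "z \<in> E" for x z c
      unfolding sum_distrib_left using that by (intro sum.cong) (auto simp: \<pi> D.scale_left)
    show "(\<Sum>i\<in>I. b (\<pi> i x) (\<pi> i y)) = (\<Sum>i\<in>I. b (\<pi> i y) (\<pi> i x))" if "x \<in> E" "y \<in> E" for x y
      using that by (intro sum.cong D.sym \<pi>) auto
    show "0 < (\<Sum>i\<in>I. b (\<pi> i x) (\<pi> i x))" if x: "x \<in> E" "x \<noteq> 0" for x
    proof -
      obtain j where j: "j \<in> I" "\<pi> j x \<noteq> 0" using inj[OF x(1)] x(2) by blast
      have "b (\<pi> j x) (\<pi> j x) > 0" using D.pos[OF \<pi>(1)[OF x(1) j(1)] j(2)] .
      also have "b (\<pi> j x) (\<pi> j x) \<le> (\<Sum>i\<in>I. b (\<pi> i x) (\<pi> i x))"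
        using I j x by (intro member_le_sum) (auto intro: D.nonneg \<pi>)
      finally show ?thesis .
    qed
    fix X :: "nat \<Rightarrow> 'c"
    assume X: "\<And>n. X n \<in> E" and C: "\<And>e. e > 0 \<Longrightarrow> \<exists>N. \<forall>m\<ge>N. \<forall>n\<ge>N.
        (\<Sum>i\<in>I. b (\<pi> i (X m - X n)) (\<pi> i (X m - X n))) < e"
    have "\<exists>\<xi>\<in>D. (\<lambda>n. b (\<pi> i (X n) - \<xi>) (\<pi> i (X n) - \<xi>)) \<longlonglongrightarrow> 0" if i: "i \<in> I" for i
    proof (rule D.complete)
      show "\<pi> i (X n) \<in> D" for n using \<pi>(1) X i by blast
      fix e :: real assume "e > 0"
      then obtain N where N: "\<And>m n. m \<ge> N \<Longrightarrow> n \<ge> N \<Longrightarrow> (\<Sum>i\<in>I. b (\<pi> i (X m - X n)) (\<pi> i (X m - X n))) < e"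
        using C by blast
      have "b (\<pi> i (X m) - \<pi> i (X n)) (\<pi> i (X m) - \<pi> i (X n)) < e" if "m \<ge> N" "n \<ge> N" for m n
      proof -
        have "b (\<pi> i (X m - X n)) (\<pi> i (X m - X n)) \<le> (\<Sum>i\<in>I. b (\<pi> i (X m - X n)) (\<pi> i (X m - X n)))"
          using I i X by (intro member_le_sum) (auto intro!: D.nonneg \<pi>(1) subspace_diff[OF E])
        then show ?thesis using N[OF that] \<pi>_diff[OF X X i] by simp
      qed
      then show "\<exists>N. \<forall>m\<ge>N. \<forall>n\<ge>N. b (\<pi> i (X m) - \<pi> i (X n)) (\<pi> i (X m) - \<pi> i (X n)) < e" by blast
    qed
    then have "\<forall>i\<in>I. \<exists>\<xi>. \<xi> \<in> D \<and> (\<lambda>n. b (\<pi> i (X n) - \<xi>) (\<pi> i (X n) - \<xi>)) \<longlonglongrightarrow> 0" by blast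
    then obtain \<xi> where \<xi>: "\<And>i. i \<in> I \<Longrightarrow> \<xi> i \<in> D"
      "\<And>i. i \<in> I \<Longrightarrow> (\<lambda>n. b (\<pi> i (X n) - \<xi> i) (\<pi> i (X n) - \<xi> i)) \<longlonglongrightarrow> 0" by (auto dest!: bchoice)
    obtain x where x: "x \<in> E" "\<And>i. i \<in> I \<Longrightarrow> \<pi> i x = \<xi> i" using surj[of \<xi>] \<xi>(1) by auto
    have "(\<lambda>n. \<Sum>i\<in>I. b (\<pi> i (X n - x)) (\<pi> i (X n - x))) \<longlonglongrightarrow> (\<Sum>i\<in>I. 0)"
    proof (rule tendsto_sum)
      fix i assume i: "i \<in> I"
      have "\<pi> i (X n - x) = \<pi> i (X n) - \<xi> i" for n using \<pi>_diff[OF X x(1) i] x(2)[OF i] by simp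
      then show "(\<lambda>n. b (\<pi> i (X n - x)) (\<pi> i (X n - x))) \<longlonglongrightarrow> 0" using \<xi>(2)[OF i] by simp
    qed
    then show "\<exists>x\<in>E. (\<lambda>n. \<Sum>i\<in>I. b (\<pi> i (X n - x)) (\<pi> i (X n - x))) \<longlonglongrightarrow> 0" using x(1) by auto
  qed
qed

lemma hilbert_form_Times:
  assumes "hilbert_form D b" "hilbert_form E e"
  shows "hilbert_form (D \<times> E) (\<lambda>(x, y) (x', y'). b x x' + e y y')"
proof -
  interpret D: hilbert_form D b by fact
  interpret E: hilbert_form E e by fact
  show ?thesis
  proof
    show "subspace (D \<times> E)" using D.subspace E.subspace by (rule subspace_Times)
    show "(\<lambda>(x, y) (x', y'). b x x' + e y y') (x + y) z =
        (\<lambda>(x, y) (x', y'). b x x' + e y y') x z + (\<lambda>(x, y) (x', y'). b x x' + e y y') y z"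
      if "x \<in> D \<times> E" "y \<in> D \<times> E" "z \<in> D \<times> E" for x y z
      using that by (auto simp: D.add_left E.add_left)
    show "(\<lambda>(x, y) (x', y'). b x x' + e y y') (c *\<^sub>R x) z = c * (\<lambda>(x, y) (x', y'). b x x' + e y y') x z"
      if "x \<in> D \<times> E" "z \<in> D \<times> E" for x z c
      using that by (auto simp: D.scale_left E.scale_left distrib_left)
    show "(\<lambda>(x, y) (x', y'). b x x' + e y y') x y = (\<lambda>(x, y) (x', y'). b x x' + e y y') y x"
      if "x \<in> D \<times> E" "y \<in> D \<times> E" for x y
      using that D.sym[of "fst x" "fst y"] E.sym[of "snd x" "snd y"] by (auto simp: mem_Times_iff case_prod_beta)
    show "0 < (\<lambda>(x, y) (x', y'). b x x' + e y y') x x" if x: "x \<in> D \<times> E" "x \<noteq> 0" for x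
    proof (cases "fst x = 0")
      case True
      then have "snd x \<noteq> 0" using x(2) by (auto simp: prod_eq_iff)
      then show ?thesis using x E.pos[of "snd x"] D.nonneg[of "fst x"]
        by (auto simp: case_prod_beta mem_Times_iff intro: add_nonneg_pos)
    next
      case False
      then show ?thesis using x D.pos[of "fst x"] E.nonneg[of "snd x"]
        by (auto simp: case_prod_beta mem_Times_iff intro: add_pos_nonneg)
    qed
    fix X :: "nat \<Rightarrow> 'a \<times> 'b"
    assume X: "\<And>n. X n \<in> D \<times> E" and C: "\<And>r. r > 0 \<Longrightarrow> \<exists>N. \<forall>m\<ge>N. \<forall>n\<ge>N.
        (\<lambda>(x, y) (x', y'). b x x' + e y y') (X m - X n) (X m - X n) < r"
    have X': "fst (X n) \<in> D" "snd (X n) \<in> E" for n using X[of n] by auto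
    have n: "0 \<le> b (fst (X m) - fst (X n)) (fst (X m) - fst (X n))" "0 \<le> e (snd (X m) - snd (X n)) (snd (X m) - snd (X n))" for m n
      by (intro D.nonneg E.nonneg D.D_diff E.D_diff X')+
    have *: "\<exists>N. \<forall>m\<ge>N. \<forall>n\<ge>N. b (fst (X m) - fst (X n)) (fst (X m) - fst (X n)) < r \<and>
        e (snd (X m) - snd (X n)) (snd (X m) - snd (X n)) < r" if r: "r > 0" for r
    proof -
      obtain N where N: "\<And>m n. m \<ge> N \<Longrightarrow> n \<ge> N \<Longrightarrow>
        b (fst (X m) - fst (X n)) (fst (X m) - fst (X n)) + e (snd (X m) - snd (X n)) (snd (X m) - snd (X n)) < r"
        using C[OF r] by (auto simp: case_prod_beta)
      have "b (fst (X m) - fst (X n)) (fst (X m) - fst (X n)) < r \<and>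
        e (snd (X m) - snd (X n)) (snd (X m) - snd (X n)) < r" if "m \<ge> N" "n \<ge> N" for m n
        using N[OF that] n[of m n] by linarith
      then show ?thesis by blast
    qed
    obtain x where x: "x \<in> D" "(\<lambda>n. b (fst (X n) - x) (fst (X n) - x)) \<longlonglongrightarrow> 0"
      using D.complete[of "\<lambda>n. fst (X n)"] X' * by meson
    obtain y where y: "y \<in> E" "(\<lambda>n. e (snd (X n) - y) (snd (X n) - y)) \<longlonglongrightarrow> 0"
      using E.complete[of "\<lambda>n. snd (X n)"] X' * by meson
    have "(\<lambda>n. (\<lambda>(x, y) (x', y'). b x x' + e y y') (X n - (x, y)) (X n - (x, y))) \<longlonglongrightarrow> 0"
      using tendsto_add[OF x(2) y(2)] by (simp add: case_prod_beta)
    then show "\<exists>z\<in>D \<times> E. (\<lambda>n. (\<lambda>(x, y) (x', y'). b x x' + e y y') (X n - z) (X n - z)) \<longlonglongrightarrow> 0"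
      using x(1) y(1) by (intro bexI[of _ "(x, y)"]) auto
  qed
qed

text \<open>The graph norm of a closed operator is complete; \<open>T\<close> will be the weak
  gradient and the weak divergence.\<close>

lemma hilbert_form_graph:
  fixes D :: "'a::{real_inner, complete_space} set" and T :: "'a \<Rightarrow> 'b::{real_inner, complete_space}"
  assumes D: "subspace D"
    and T: "\<And>x y. x \<in> D \<Longrightarrow> y \<in> D \<Longrightarrow> T (x + y) = T x + T y" "\<And>c x. x \<in> D \<Longrightarrow> T (c *\<^sub>R x) = c *\<^sub>R T x"
    and closed: "\<And>X x y. (\<And>n. X n \<in> D) \<Longrightarrow> X \<longlonglongrightarrow> x \<Longrightarrow> (\<lambda>n. T (X n)) \<longlonglongrightarrow> y \<Longrightarrow> x \<in> D \<and> T x = y"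
  shows "hilbert_form D (\<lambda>x y. inner x y + inner (T x) (T y))"
proof
  have T_diff: "T (x - y) = T x - T y" if "x \<in> D" "y \<in> D" for x y
    using T(1)[of x "(-1) *\<^sub>R y"] T(2)[of y "-1"] that subspace_scale[OF D, of y "-1"] by simp
  show "inner (x + y) z + inner (T (x + y)) (T z) = inner x z + inner (T x) (T z) + (inner y z + inner (T y) (T z))"
    if "x \<in> D" "y \<in> D" "z \<in> D" for x y z using that by (simp add: T inner_add_left)
  show "inner (c *\<^sub>R x) z + inner (T (c *\<^sub>R x)) (T z) = c * (inner x z + inner (T x) (T z))"
    if "x \<in> D" "z \<in> D" for x z c using that by (simp add: T distrib_left)
  show "inner x y + inner (T x) (T y) = inner y x + inner (T y) (T x)" for x y
    by (simp add: inner_commute)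
  show "0 < inner x x + inner (T x) (T x)" if "x \<noteq> 0" for x
    using that by (simp add: add_pos_nonneg)
  fix X :: "nat \<Rightarrow> 'a"
  assume X: "\<And>n. X n \<in> D" and C: "\<And>e. e > 0 \<Longrightarrow> \<exists>N. \<forall>m\<ge>N. \<forall>n\<ge>N.
      inner (X m - X n) (X m - X n) + inner (T (X m - X n)) (T (X m - X n)) < e"
  have *: "\<exists>N. \<forall>m\<ge>N. \<forall>n\<ge>N. norm (X m - X n) < e \<and> norm (T (X m) - T (X n)) < e" if e: "e > 0" for e
  proof -
    have "e\<^sup>2 > 0" using e by simp
    then obtain N where N: "\<And>m n. m \<ge> N \<Longrightarrow> n \<ge> N \<Longrightarrow>
      inner (X m - X n) (X m - X n) + inner (T (X m - X n)) (T (X m - X n)) < e\<^sup>2" using C by blast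
    have "norm (X m - X n) < e \<and> norm (T (X m) - T (X n)) < e" if "m \<ge> N" "n \<ge> N" for m n
    proof -
      have "(norm (X m - X n))\<^sup>2 + (norm (T (X m) - T (X n)))\<^sup>2 < e\<^sup>2"
        using N[OF that] by (simp add: power2_norm_eq_inner T_diff X)
      then have "(norm (X m - X n))\<^sup>2 < e\<^sup>2" "(norm (T (X m) - T (X n)))\<^sup>2 < e\<^sup>2"
        using zero_le_power2[of "norm (X m - X n)"] zero_le_power2[of "norm (T (X m) - T (X n))"] by linarith+
      then show ?thesis using e by (auto intro: power_less_imp_less_base)
    qed
    then show ?thesis by blast
  qed
  have "Cauchy X" "Cauchy (\<lambda>n. T (X n))"
    by (rule CauchyI; use * in meson)+
  then obtain x y where xy: "X \<longlonglongrightarrow> x" "(\<lambda>n. T (X n)) \<longlonglongrightarrow> y"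
    by (auto dest!: Cauchy_convergent simp: convergent_def)
  have x: "x \<in> D" "T x = y" using closed[OF X xy] by auto
  have "(\<lambda>n. inner (X n - x) (X n - x) + inner (T (X n) - y) (T (X n) - y))
      \<longlonglongrightarrow> inner (x - x) (x - x) + inner (y - y) (y - y)"
    by (intro tendsto_intros xy)
  then have "(\<lambda>n. inner (X n - x) (X n - x) + inner (T (X n - x)) (T (X n - x))) \<longlonglongrightarrow> 0"
    using x X by (simp add: T_diff)
  then show "\<exists>x\<in>D. (\<lambda>n. inner (X n - x) (X n - x) + inner (T (X n - x)) (T (X n - x))) \<longlonglongrightarrow> 0"
    using x(1) by blast
qed (rule D)

section \<open>Completeness of the scalar and vector H^1_0 spaces\<close>

lemma H1_0_H1: "f \<in> H1_0 S \<Longrightarrow> f \<in> H1 S" by (simp add: H1_0_def)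

lemma hilbert_form_H1_0:
  assumes S: "open S"
  shows "hilbert_form (H1_0 S) (\<lambda>f g. inner f g + inner (weak_grad S f) (weak_grad S g))"
proof (rule hilbert_form_graph)
  show "subspace (H1_0 S)" by (rule subspace_H1_0[OF S])
  show "weak_grad S (f + g) = weak_grad S f + weak_grad S g" if "f \<in> H1_0 S" "g \<in> H1_0 S" for f g
    using that by (intro weak_grad_linear S H1_0_H1)
  show "weak_grad S (c *\<^sub>R f) = c *\<^sub>R weak_grad S f" if "f \<in> H1_0 S" for f c
    using weak_grad_linear(2)[OF S H1_0_H1[OF that] H1_0_H1[OF that]] .
  fix X f g assume X: "\<And>n. X n \<in> H1_0 S" "X \<longlonglongrightarrow> f" "(\<lambda>n. weak_grad S (X n)) \<longlonglongrightarrow> g"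
  have "(\<lambda>n. (X n, weak_grad S (X n))) \<longlonglongrightarrow> (f, g)" by (intro tendsto_Pair X)
  then have c: "(f, g) \<in> closure (test_graph S)"
  proof (rule closed_sequentially[OF closed_closure, rotated])
    show "(X n, weak_grad S (X n)) \<in> closure (test_graph S)" for n using X(1) H1_0_iff[OF S] by simp
  qed
  then have "weak_grad S f = g" using closure_test_graph[OF S] by blast
  then show "f \<in> H1_0 S \<and> weak_grad S f = g" using c H1_0_iff[OF S] by simp
qed

lemma subspace_U_space: "open S \<Longrightarrow> subspace (U_space S)"
  using subspace_H1_0[of S] by (auto simp: subspace_def U_space_def)

definition U_inner :: "(real^'d::finite) set \<Rightarrow> 'd vfield \<Rightarrow> 'd vfield \<Rightarrow> real" where
  "U_inner S u w = (\<Sum>i\<in>UNIV. inner (u $ i) (w $ i) + inner (weak_grad S (u $ i)) (weak_grad S (w $ i)))"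

lemma hilbert_form_U_inner: "open S \<Longrightarrow> hilbert_form (U_space S) (U_inner S)"
  unfolding U_inner_def[abs_def]
proof (rule hilbert_form_family[OF hilbert_form_H1_0])
  assume S: "open S"
  show "open S" "subspace (U_space S)" using S by (auto intro: subspace_U_space)
  show "\<exists>x\<in>U_space S. \<forall>i\<in>UNIV. x $ i = \<xi> i" if "\<And>i. i \<in> UNIV \<Longrightarrow> \<xi> i \<in> H1_0 S" for \<xi>
    using that by (intro bexI[of _ "\<chi> i. \<xi> i"]) (auto simp: U_space_def)
qed (auto simp: U_space_def Finite_Cartesian_Product.vec_eq_iff)

lemma U_norm_eq: "U_norm S u = sqrt (U_inner S u u)"
  by (simp add: U_norm_def U_inner_def H1_norm_def power2_norm_eq_inner)

section \<open>The inequalities of Poincare and Korn\<close>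

text \<open>Formally one integrates by parts twice and exchanges second derivatives. After
  mollifying \<open>g\<close> the exchange is elementary, as one derivative can be moved onto the
  mollifier and the other kept on \<open>g\<close>; only first derivatives of \<open>g\<close> occur
  in the limit.\<close>

lemma integral_partial_swap:
  fixes f g :: "real^'d::finite \<Rightarrow> real"
  assumes f: "f \<in> tf" and g: "g \<in> tf"
  shows "(\<integral>x. partial_deriv j f x * partial_deriv i g x \<partial>lborel) = (\<integral>x. partial_deriv i f x * partial_deriv j g x \<partial>lborel)"
proof -
  obtain a :: "real^'d \<Rightarrow> real" where a: "a \<in> tf" "(\<integral>x. a x \<partial>lborel) = 1"
    by (rule nonneg_bump[of 1]) (simp, blast)
  define b where "b k = dil ((1/2) ^ k) a" for k
  have b: "b k \<in> tf" for k unfolding b_def by (rule dil_tf) (use a in auto)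
  note D = test_functions_partial_deriv
  have swap: "(\<integral>x. conv (b k) (partial_deriv i g) x * partial_deriv j f x \<partial>lborel) =
      (\<integral>x. conv (b k) (partial_deriv j g) x * partial_deriv i f x \<partial>lborel)" for k
  proof -
    have c: "conv (b k) h = conv h (b k)" for h by (rule conv_commute)
    have eq: "partial_deriv j (conv (b k) (partial_deriv i g)) = partial_deriv i (conv (b k) (partial_deriv j g))"
    proof -
      have "partial_deriv j (conv (b k) (partial_deriv i g)) = conv (partial_deriv j (b k)) (partial_deriv i g)"
        by (rule partial_deriv_conv_left[OF b tf_Cc[OF D[OF g]]])
      also have "\<dots> = partial_deriv i (conv (partial_deriv j (b k)) g)"
        by (rule partial_deriv_conv[OF Cc_integrable[OF tf_Cc[OF D[OF b]]] g, symmetric])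
      also have "conv (partial_deriv j (b k)) g = conv (b k) (partial_deriv j g)"
        unfolding partial_deriv_conv_left[OF b tf_Cc[OF g], symmetric]
        by (rule partial_deriv_conv[OF Cc_integrable[OF tf_Cc[OF b]] g])
      finally show ?thesis .
    qed
    have ci: "C_inf f" using f by (simp add: tf_iff)
    have "conv (b k) (partial_deriv i' g) \<in> tf" for i' by (intro tf_conv tf_Cc b D g)
    from integral_by_parts_tf[OF this ci, of j i] integral_by_parts_tf[OF this ci, of i j] eq
    show ?thesis by simp
  qed
  have lim: "(\<lambda>k. \<integral>x. conv (b k) (partial_deriv i' g) x * h x \<partial>lborel) \<longlonglongrightarrow> (\<integral>x. partial_deriv i' g x * h x \<partial>lborel)"
    if h: "h \<in> tf" for i' h
  proof (rule LIM_zero_cancel, rule Lim_null_comparison)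
    have Cg: "Cc (partial_deriv i' g)" and Ch: "Cc h" by (intro tf_Cc D g h)+
    have Ck: "Cc (conv (b k) (partial_deriv i' g))" for k by (intro Cc_conv tf_Cc[OF b] Cg)
    show "(\<lambda>k. n2 (\<lambda>x. conv (b k) (partial_deriv i' g) x - partial_deriv i' g x) * n2 h) \<longlonglongrightarrow> 0"
      unfolding b_def using approx_identity[OF tf_Cc[OF a(1)] a(2) Cg, of "1/2"] by (intro tendsto_mult_left_zero) auto
    have "\<bar>(\<integral>x. conv (b k) (partial_deriv i' g) x * h x \<partial>lborel) - (\<integral>x. partial_deriv i' g x * h x \<partial>lborel)\<bar>
        \<le> n2 (\<lambda>x. conv (b k) (partial_deriv i' g) x - partial_deriv i' g x) * n2 h" for k
      using n2_CS_Cc[OF Cc_diff[OF Ck Cg] Ch, of k] Cc_integrable[OF Cc_mult2[OF Ck Ch], of k] Cc_integrable[OF Cc_mult2[OF Cg Ch]]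
      by (simp add: left_diff_distrib)
    then show "\<forall>\<^sub>F k in sequentially. norm ((\<integral>x. conv (b k) (partial_deriv i' g) x * h x \<partial>lborel) -
        (\<integral>x. partial_deriv i' g x * h x \<partial>lborel)) \<le> n2 (\<lambda>x. conv (b k) (partial_deriv i' g) x - partial_deriv i' g x) * n2 h"
      by (simp add: real_norm_def)
  qed
  have "(\<integral>x. partial_deriv i g x * partial_deriv j f x \<partial>lborel) = (\<integral>x. partial_deriv j g x * partial_deriv i f x \<partial>lborel)"
    using LIMSEQ_unique[OF lim[OF D[OF f], of i j] lim[OF D[OF f], of j i, folded swap]] .
  then show ?thesis by (simp add: mult.commute)
qed

text \<open>Write 1 as the derivative of the coordinate x_k and integrate by parts against the
  square of \<open>\<phi>\<close>, whose derivative accounts for the factor 2.\<close>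

lemma Poincare_test:
  fixes \<phi> :: "real^'d::finite \<Rightarrow> real"
  assumes \<phi>: "\<phi> \<in> test_functions S" and R: "\<And>x. x \<in> S \<Longrightarrow> \<bar>x $ k\<bar> \<le> R" and R0: "0 \<le> R"
  shows "n2 \<phi> \<le> 2 * R * n2 (partial_deriv k \<phi>)"
proof -
  note C = test_functions_Cc
  let ?x\<phi> = "\<lambda>x. x $ k * \<phi> x"
  have d\<phi>: "partial_deriv k \<phi> \<in> test_functions S" by (rule test_functions_partial_deriv[OF \<phi>])
  have x\<phi>: "?x\<phi> \<in> test_functions S" by (rule test_functions_mult[OF \<phi> C_inf_component])
  have pd: "partial_deriv k ?x\<phi> x = x $ k * partial_deriv k \<phi> x + \<phi> x" for x
    using partial_deriv_mult[OF C_inf_differentiable[OF C_inf_component] tf_differentiable[OF test_functions_tf[OF \<phi>]], of k k x]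
    by (simp add: partial_deriv_component)
  have int: "integrable lborel (\<lambda>x. \<phi> x * \<phi> x)" "integrable lborel (\<lambda>x. ?x\<phi> x * partial_deriv k \<phi> x)"
    by (intro Cc_integrable Cc_mult2 C[OF \<phi>] C[OF x\<phi>] C[OF d\<phi>])+
  have "(\<integral>x. partial_deriv k ?x\<phi> x * \<phi> x \<partial>lborel) = - (\<integral>x. ?x\<phi> x * partial_deriv k \<phi> x \<partial>lborel)"
    using integral_by_parts_tf[of ?x\<phi> \<phi> k] \<phi> test_functions_tf[OF x\<phi>] by (simp add: test_functions_iff)
  moreover have "(\<lambda>x. partial_deriv k ?x\<phi> x * \<phi> x) = (\<lambda>x. \<phi> x * \<phi> x + ?x\<phi> x * partial_deriv k \<phi> x)"
    unfolding pd by (simp add: fun_eq_iff algebra_simps)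
  ultimately have "(n2 \<phi>)\<^sup>2 = - 2 * (\<integral>x. ?x\<phi> x * partial_deriv k \<phi> x \<partial>lborel)"
    using int by (simp add: n2_power2)
  also have "\<dots> \<le> 2 * (n2 ?x\<phi> * n2 (partial_deriv k \<phi>))"
    using n2_CS_Cc[OF C[OF x\<phi>] C[OF d\<phi>]] by linarith
  also have "n2 ?x\<phi> \<le> R * n2 \<phi>"
  proof -
    have "(n2 ?x\<phi>)\<^sup>2 \<le> R\<^sup>2 * (n2 \<phi>)\<^sup>2"
      unfolding n2_power2 integral_mult_right_zero[symmetric]
    proof (rule integral_mono)
      show "integrable lborel (\<lambda>x. ?x\<phi> x * ?x\<phi> x)" by (intro Cc_integrable Cc_mult2 C[OF x\<phi>])
      show "integrable lborel (\<lambda>x. R\<^sup>2 * (\<phi> x * \<phi> x))" using int by simp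
      show "?x\<phi> x * ?x\<phi> x \<le> R\<^sup>2 * (\<phi> x * \<phi> x)" for x
      proof (cases "\<phi> x = 0")
        case False
        then have "(x $ k)\<^sup>2 \<le> R\<^sup>2" using R[OF test_functions_nonzero[OF \<phi> False]] R0 by (metis abs_le_square_iff abs_of_nonneg)
        then have "(x $ k)\<^sup>2 * (\<phi> x * \<phi> x) \<le> R\<^sup>2 * (\<phi> x * \<phi> x)" by (rule mult_right_mono) simp
        then show ?thesis by (simp add: power2_eq_square mult_ac)
      qed simp
    qed
    then show ?thesis using R0 by (intro power2_le_imp_le[of "n2 ?x\<phi>"]) (auto simp: power_mult_distrib)
  qed
  finally have "n2 \<phi> * n2 \<phi> \<le> (2 * R * n2 (partial_deriv k \<phi>)) * n2 \<phi>"
    by (simp add: power2_eq_square mult_right_mono mult_ac)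
  then show ?thesis by (rule le_if_square_le) (use R0 in auto)
qed

lemma H1_0_test_sequence:
  assumes S: "open S" and f: "f \<in> H1_0 S"
  obtains \<phi> where "\<And>n::nat. \<phi> n \<in> test_functions S" "(\<lambda>n. L2_class (\<phi> n)) \<longlonglongrightarrow> f"
    "\<And>i. (\<lambda>n. L2_class (partial_deriv i (\<phi> n))) \<longlonglongrightarrow> weak_partial S i f"
proof -
  have "(f, weak_grad S f) \<in> closure (test_graph S)" using H1_0_iff[OF S] f by blast
  then obtain X where X: "\<And>n. X n \<in> test_graph S" "X \<longlonglongrightarrow> (f, weak_grad S f)" using closure_sequential by blast
  have "\<exists>\<phi>. \<phi> \<in> test_functions S \<and> X n = (L2_class \<phi>, \<chi> i. L2_class (partial_deriv i \<phi>))" for n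
    using X(1)[of n] unfolding test_graph_def by blast
  then have "\<forall>n. \<exists>\<phi>. \<phi> \<in> test_functions S \<and> X n = (L2_class \<phi>, \<chi> i. L2_class (partial_deriv i \<phi>))" by blast
  then obtain \<phi> where \<phi>: "\<And>n. \<phi> n \<in> test_functions S" "\<And>n. X n = (L2_class (\<phi> n), \<chi> i. L2_class (partial_deriv i (\<phi> n)))"
    by (auto dest!: choice)
  show ?thesis
  proof (rule that[of \<phi>])
    show "(\<lambda>n. L2_class (\<phi> n)) \<longlonglongrightarrow> f" using tendsto_fst[OF X(2)] by (simp add: \<phi>(2))
    show "(\<lambda>n. L2_class (partial_deriv i (\<phi> n))) \<longlonglongrightarrow> weak_partial S i f" for i
      using tendsto_vec_nth[OF tendsto_snd[OF X(2)], of i] by (simp add: \<phi>(2) weak_grad_def)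
  qed (rule \<phi>(1))
qed

locale bounded_open =
  fixes S :: "(real^'d::finite) set"
  assumes opn: "open S" and bdd: "bounded S"
begin

lemma weak_partial_swap:
  assumes "f \<in> H1_0 S" "g \<in> H1_0 S"
  shows "inner (weak_partial S j f) (weak_partial S i g) = inner (weak_partial S i f) (weak_partial S j g)"
proof -
  obtain \<phi> where \<phi>: "\<And>n::nat. \<phi> n \<in> test_functions S" "(\<lambda>n. L2_class (\<phi> n)) \<longlonglongrightarrow> f"
    "\<And>i. (\<lambda>n. L2_class (partial_deriv i (\<phi> n))) \<longlonglongrightarrow> weak_partial S i f"
    by (rule H1_0_test_sequence[OF opn assms(1)]) blast
  obtain \<psi> where \<psi>: "\<And>n::nat. \<psi> n \<in> test_functions S" "(\<lambda>n. L2_class (\<psi> n)) \<longlonglongrightarrow> g"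
    "\<And>i. (\<lambda>n. L2_class (partial_deriv i (\<psi> n))) \<longlonglongrightarrow> weak_partial S i g"
    by (rule H1_0_test_sequence[OF opn assms(2)]) blast
  note D = test_functions_partial_deriv
  have eq: "inner (L2_class (partial_deriv j (\<phi> n))) (L2_class (partial_deriv i (\<psi> n))) =
      inner (L2_class (partial_deriv i (\<phi> n))) (L2_class (partial_deriv j (\<psi> n)))" for n
    unfolding inner_test[OF D[OF \<phi>(1)] D[OF \<psi>(1)]]
    by (rule integral_partial_swap[OF test_functions_tf[OF \<phi>(1)] test_functions_tf[OF \<psi>(1)]])
  show ?thesis
    using LIMSEQ_unique[OF tendsto_inner[OF \<phi>(3)[of j] \<psi>(3)[of i]] tendsto_inner[OF \<phi>(3)[of i] \<psi>(3)[of j], folded eq]] .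
qed

lemma Poincare:
  obtains K where "0 \<le> K" "\<And>f i. f \<in> H1_0 S \<Longrightarrow> norm f \<le> K * norm (weak_partial S i f)"
proof -
  obtain R where R: "R > 0" "\<And>x. x \<in> S \<Longrightarrow> norm x \<le> R" using bdd bounded_pos[of S] by blast
  show ?thesis
  proof (rule that[of "2 * R"])
    fix f i assume "f \<in> H1_0 S"
    then obtain \<phi> where \<phi>: "\<And>n::nat. \<phi> n \<in> test_functions S" "(\<lambda>n. L2_class (\<phi> n)) \<longlonglongrightarrow> f"
      "\<And>i. (\<lambda>n. L2_class (partial_deriv i (\<phi> n))) \<longlonglongrightarrow> weak_partial S i f"
      by (rule H1_0_test_sequence[OF opn]) blast
    have "\<bar>x $ i\<bar> \<le> R" if "x \<in> S" for x using R(2)[OF that] component_le_norm_cart[of x i] by linarith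
    from Poincare_test[OF \<phi>(1) this] R(1)
    have le: "norm (L2_class (\<phi> n)) \<le> 2 * R * norm (L2_class (partial_deriv i (\<phi> n)))" for n
      by (simp add: norm_L2_class square_integrable_test[OF \<phi>(1)] square_integrable_test[OF test_functions_partial_deriv[OF \<phi>(1)]])
    show "norm f \<le> 2 * R * norm (weak_partial S i f)"
      by (rule LIMSEQ_le[OF tendsto_norm[OF \<phi>(2)] tendsto_mult_left[OF tendsto_norm[OF \<phi>(3)]]]) (use le in blast)
  qed (use R in simp)
qed

lemma U_H1: "u \<in> U_space S \<Longrightarrow> u $ i \<in> H1 S" and U_H1_0: "u \<in> U_space S \<Longrightarrow> u $ i \<in> H1_0 S"
  by (auto simp: U_space_def H1_0_def)

lemma has_weak_div_U: "u \<in> U_space S \<Longrightarrow> has_weak_div S u (\<Sum>i\<in>UNIV. weak_partial S i (u $ i))"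
  unfolding has_weak_div_def
proof (intro conjI ballI)
  assume u: "u \<in> U_space S"
  note w = H1_weak_partial[OF opn U_H1[OF u], unfolded has_weak_partial_def]
  show "(\<Sum>i\<in>UNIV. weak_partial S i (u $ i)) \<in> L2_on S"
    using w by (intro subspace_sum subspace_L2_on borel_open opn) auto
  fix \<phi> assume "\<phi> \<in> test_functions S"
  then show "inner u (\<chi> i. L2_class (partial_deriv i \<phi>)) = - inner (\<Sum>i\<in>UNIV. weak_partial S i (u $ i)) (L2_class \<phi>)"
    using w by (simp add: inner_vec_def inner_sum_left sum_negf)
qed

lemma weak_div_U: "u \<in> U_space S \<Longrightarrow> weak_div S u = (\<Sum>i\<in>UNIV. weak_partial S i (u $ i))"
  by (rule weak_div_eq[OF opn has_weak_div_U])

lemma weak_partial_linear: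
  assumes "f \<in> H1 S"
  shows "g \<in> H1 S \<Longrightarrow> weak_partial S i (f + g) = weak_partial S i f + weak_partial S i g"
    "weak_partial S i (c *\<^sub>R f) = c *\<^sub>R weak_partial S i f"
  using weak_grad_linear(1)[OF opn assms, of g] weak_grad_linear(2)[OF opn assms assms, of c]
  by (simp_all add: weak_grad_def Finite_Cartesian_Product.vec_eq_iff)

lemma sym_grad_add: "u \<in> U_space S \<Longrightarrow> w \<in> U_space S \<Longrightarrow> sym_grad S (u + w) = sym_grad S u + sym_grad S w"
  and sym_grad_scaleR: "u \<in> U_space S \<Longrightarrow> sym_grad S (c *\<^sub>R u) = c *\<^sub>R sym_grad S u"
  by (simp_all add: sym_grad_def Finite_Cartesian_Product.vec_eq_iff weak_partial_linear U_H1 scaleR_add_right)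

lemma div_U_add: "u \<in> U_space S \<Longrightarrow> w \<in> U_space S \<Longrightarrow> weak_div S (u + w) = weak_div S u + weak_div S w"
  and div_U_scaleR: "u \<in> U_space S \<Longrightarrow> weak_div S (c *\<^sub>R u) = c *\<^sub>R weak_div S u"
  using subspace_U_space[OF opn]
  by (simp_all add: weak_div_U subspace_add subspace_scale weak_partial_linear U_H1 sum.distrib scaleR_sum_right)

section \<open>The symmetric gradient compared with the full gradient\<close>

definition grad2 :: "'d vfield \<Rightarrow> real" where
  "grad2 u = (\<Sum>i\<in>UNIV. \<Sum>j\<in>UNIV. (norm (weak_partial S j (u $ i)))\<^sup>2)"

lemma norm_sym_grad:
  "(norm (sym_grad S u))\<^sup>2 = (\<Sum>i\<in>UNIV. \<Sum>j\<in>UNIV. (norm ((1/2) *\<^sub>R (weak_partial S j (u $ i) + weak_partial S i (u $ j))))\<^sup>2)"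
  by (simp only: power2_norm_eq_inner inner_vec_def sym_grad_def vec_lambda_beta)

lemma norm_sym_grad_expand:
  "(norm (sym_grad S u))\<^sup>2 = (1/2) * grad2 u + (1/2) * (\<Sum>i\<in>UNIV. \<Sum>j\<in>UNIV. inner (weak_partial S j (u $ i)) (weak_partial S i (u $ j)))"
proof -
  have e: "(norm ((1/2) *\<^sub>R (a + b)))\<^sup>2 = (1/4) * (norm a)\<^sup>2 + (1/4) * (norm b)\<^sup>2 + (1/2) * inner a b" for a b :: "(real^'d) L2"
    by (simp add: power2_norm_eq_inner inner_add_left inner_add_right inner_commute algebra_simps)
  show ?thesis
    unfolding norm_sym_grad e sum.distrib sum_distrib_left[symmetric] grad2_def
    by (subst (2) sum.swap) simp
qed

lemma Korn:
  assumes u: "u \<in> U_space S"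
  shows "grad2 u \<le> 2 * (norm (sym_grad S u))\<^sup>2"
proof -
  have "(\<Sum>i\<in>UNIV. \<Sum>j\<in>UNIV. inner (weak_partial S j (u $ i)) (weak_partial S i (u $ j))) = inner (weak_div S u) (weak_div S u)"
    unfolding weak_div_U[OF u] inner_sum_left inner_sum_right
  proof (intro sum.cong refl)
    fix i j
    show "inner (weak_partial S j (u $ i)) (weak_partial S i (u $ j)) = inner (weak_partial S j (u $ j)) (weak_partial S i (u $ i))"
      using weak_partial_swap[OF U_H1_0[OF u] U_H1_0[OF u], of j i i j] by (simp add: inner_commute)
  qed
  then show ?thesis unfolding norm_sym_grad_expand by simp
qed

lemma norm_sym_grad_le: "(norm (sym_grad S u))\<^sup>2 \<le> grad2 u"
proof -
  have "(norm ((1/2) *\<^sub>R (a + b)))\<^sup>2 \<le> (1/2) * (norm a)\<^sup>2 + (1/2) * (norm b)\<^sup>2" for a b :: "(real^'d) L2"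
    using inner_ge_zero[of "a - b"]
    by (simp add: power2_norm_eq_inner inner_add_left inner_add_right inner_diff_left inner_diff_right inner_commute algebra_simps)
  then have "(norm (sym_grad S u))\<^sup>2 \<le> (\<Sum>i\<in>UNIV. \<Sum>j\<in>UNIV. (1/2) * (norm (weak_partial S j (u $ i)))\<^sup>2 + (1/2) * (norm (weak_partial S i (u $ j)))\<^sup>2)"
    unfolding norm_sym_grad by (intro sum_mono)
  also have "\<dots> = grad2 u"
    unfolding sum.distrib sum_distrib_left[symmetric] grad2_def by (subst (2) sum.swap) simp
  finally show ?thesis .
qed

text \<open>The divergence is the trace of the symmetric gradient; the factor is Cauchy-Schwarz over
  the diagonal entries.\<close>

lemma norm_div_le: "u \<in> U_space S \<Longrightarrow> (norm (weak_div S u))\<^sup>2 \<le> real CARD('d) * (norm (sym_grad S u))\<^sup>2"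
proof -
  assume u: "u \<in> U_space S"
  have e: "(1/2) *\<^sub>R (a + a) = a" for a :: "(real^'d) L2" by (simp add: scaleR_2[symmetric])
  have "(norm (weak_div S u))\<^sup>2 \<le> (\<Sum>i\<in>UNIV. norm (weak_partial S i (u $ i)))\<^sup>2"
    unfolding weak_div_U[OF u] by (intro power_mono norm_sum) auto
  also have "\<dots> \<le> (\<Sum>i\<in>UNIV. (norm (weak_partial S i (u $ i)))\<^sup>2) * real CARD('d)"
    by (rule sum_squared_le_sum_of_squares) 
  also have "(\<Sum>i\<in>UNIV. (norm (weak_partial S i (u $ i)))\<^sup>2) \<le> (norm (sym_grad S u))\<^sup>2"
    unfolding norm_sym_grad
  proof (rule sum_mono)
    fix i :: 'd
    have "(norm ((1/2) *\<^sub>R (weak_partial S i (u $ i) + weak_partial S i (u $ i))))\<^sup>2 \<le>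
      (\<Sum>j\<in>UNIV. (norm ((1/2) *\<^sub>R (weak_partial S j (u $ i) + weak_partial S i (u $ j))))\<^sup>2)"
      by (rule member_le_sum[of i UNIV "\<lambda>j. (norm ((1/2) *\<^sub>R (weak_partial S j (u $ i) + weak_partial S i (u $ j))))\<^sup>2"]) auto
    then show "(norm (weak_partial S i (u $ i)))\<^sup>2 \<le>
      (\<Sum>j\<in>UNIV. (norm ((1/2) *\<^sub>R (weak_partial S j (u $ i) + weak_partial S i (u $ j))))\<^sup>2)" by (simp only: e)
  qed
  finally show ?thesis by (simp add: mult.commute)
qed

lemma U_inner_eq: "U_inner S u u = (\<Sum>i\<in>UNIV. (norm (u $ i))\<^sup>2) + grad2 u"
  by (simp add: U_inner_def weak_grad_def inner_vec_def grad2_def sum.distrib power2_norm_eq_inner)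

lemma U_inner_le:
  obtains K where "0 < K" "\<And>u. u \<in> U_space S \<Longrightarrow> U_inner S u u \<le> K * (norm (sym_grad S u))\<^sup>2"
proof -
  obtain K where K: "0 \<le> K" "\<And>f i. f \<in> H1_0 S \<Longrightarrow> norm f \<le> K * norm (weak_partial S i f)" by (rule Poincare) blast
  show ?thesis
  proof (rule that[of "2 * (K\<^sup>2 + 1)"])
    fix u assume u: "u \<in> U_space S"
    have "(norm (u $ i))\<^sup>2 \<le> K\<^sup>2 * (\<Sum>j\<in>UNIV. (norm (weak_partial S j (u $ i)))\<^sup>2)" for i
    proof -
      have "(norm (u $ i))\<^sup>2 \<le> K\<^sup>2 * (norm (weak_partial S i (u $ i)))\<^sup>2"
        using power_mono[OF K(2)[OF U_H1_0[OF u]] norm_ge_zero, where n=2] by (simp add: power_mult_distrib)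
      also have "\<dots> \<le> K\<^sup>2 * (\<Sum>j\<in>UNIV. (norm (weak_partial S j (u $ i)))\<^sup>2)"
        by (intro mult_left_mono member_le_sum) auto
      finally show ?thesis .
    qed
    then have "(\<Sum>i\<in>UNIV. (norm (u $ i))\<^sup>2) \<le> K\<^sup>2 * grad2 u"
      unfolding grad2_def sum_distrib_left[of "K\<^sup>2"] by (intro sum_mono) 
    then have "U_inner S u u \<le> (K\<^sup>2 + 1) * grad2 u" by (simp add: U_inner_eq algebra_simps)
    also have "\<dots> \<le> (K\<^sup>2 + 1) * (2 * (norm (sym_grad S u))\<^sup>2)" by (intro mult_left_mono Korn u) auto
    finally show "U_inner S u u \<le> 2 * (K\<^sup>2 + 1) * (norm (sym_grad S u))\<^sup>2" by (simp only: mult_ac)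
  qed (simp add: add_nonneg_pos)
qed

end

section \<open>Divergence and mean value\<close>

lemma scaleR_fun_apply [simp]: "(c *\<^sub>R f) x = c *\<^sub>R f x"
  by (simp add: scaleR_fun_def)

definition one_on :: "(real^'d::finite) set \<Rightarrow> 'd sfield" where
  "one_on S = L2_class (indicat_real S)"

definition Hdiv_inner :: "(real^'d::finite) set \<Rightarrow> 'd vfield \<Rightarrow> 'd vfield \<Rightarrow> real" where
  "Hdiv_inner S v z = inner v z + inner (weak_div S v) (weak_div S z)"

definition V_inner :: "(real^'d::finite) set \<Rightarrow> nat \<Rightarrow> (nat \<Rightarrow> 'd vfield) \<Rightarrow> (nat \<Rightarrow> 'd vfield) \<Rightarrow> real" where
  "V_inner S n v z = (\<Sum>i<n. Hdiv_inner S (v i) (z i))"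

definition P_inner :: "nat \<Rightarrow> (nat \<Rightarrow> 'b::real_inner) \<Rightarrow> (nat \<Rightarrow> 'b) \<Rightarrow> real" where
  "P_inner n p q = (\<Sum>i<n. inner (p i) (q i))"

lemma V_norm_eq: "V_norm S n v = sqrt (V_inner S n v v)"
  by (simp add: V_norm_def V_inner_def Hdiv_inner_def power2_norm_eq_inner)

lemma P_norm_eq: "P_norm n p = sqrt (P_inner n p p)"
  by (simp add: P_norm_def P_inner_def power2_norm_eq_inner)

context bounded_open
begin

lemma square_integrable_indicator: "square_integrable (indicat_real S)"
proof -
  have "integrable lborel (indicat_real S)"
    using opn bdd by (intro integrable_real_indicator) (use emeasure_bounded_finite in \<open>auto simp: less_top[symmetric]\<close>)
  moreover have "(\<lambda>x. (indicat_real S x)\<^sup>2) = indicat_real S" by (auto simp: indicator_def)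
  ultimately show ?thesis using opn by (auto simp: square_integrable_def)
qed

section \<open>Functions of mean zero\<close>

lemma L2_integral_eq: "L2_integral S f = inner f (one_on S)"
proof -
  have "L2_integral S f = (LINT x:S|lborel. rep_L2 f x)"
    using L2_integral.abs_eq[OF L2_rel_refl[OF square_integrable_rep_L2], of S f] opn by (simp add: L2_class_rep_L2)
  also have "\<dots> = (\<integral>x. rep_L2 f x * indicat_real S x \<partial>lborel)"
    by (simp add: set_lebesgue_integral_def mult.commute)
  also have "\<dots> = inner (L2_class (rep_L2 f)) (one_on S)"
    unfolding one_on_def by (rule inner_L2_class[OF square_integrable_rep_L2 square_integrable_indicator, symmetric])
  finally show ?thesis by (simp only: L2_class_rep_L2)
qed

lemma L2_mean_zero_eq: "L2_mean_zero S = L2_on S \<inter> {f. inner f (one_on S) = 0}"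
  by (auto simp: L2_mean_zero_def L2_integral_eq)

lemma subspace_L2_mean_zero: "subspace (L2_mean_zero S)"
  unfolding L2_mean_zero_eq using opn
  by (intro subspace_inter subspace_L2_on borel_open) (auto simp: subspace_def inner_add_left)

lemma hilbert_form_L2_mean_zero: "hilbert_form (L2_mean_zero S) inner"
proof (rule hilbert_form_inner[OF subspace_L2_mean_zero])
  show "closed (L2_mean_zero S)"
    unfolding L2_mean_zero_eq using opn
    by (intro closed_Int closed_L2_on borel_open closed_Collect_eq continuous_intros) auto
qed

lemma subspace_P_space: "subspace (P_space S n)"
  using subspace_L2_mean_zero by (auto simp: subspace_def P_space_def)

lemma hilbert_form_P: "hilbert_form (P_space S n) (P_inner n)"
  unfolding P_inner_def[abs_def]
proof (rule hilbert_form_family[OF hilbert_form_L2_mean_zero _ subspace_P_space])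
  show "\<exists>x\<in>P_space S n. \<forall>i\<in>{..<n}. x i = \<xi> i" if "\<And>i. i \<in> {..<n} \<Longrightarrow> \<xi> i \<in> L2_mean_zero S" for \<xi>
    using that by (intro bexI[of _ "\<lambda>i. if i < n then \<xi> i else 0"]) (auto simp: P_space_def)
qed (auto simp: P_space_def fun_eq_iff not_less[symmetric])

section \<open>Fields with square integrable divergence and zero normal trace\<close>

lemma Hdiv_weak_div: "v \<in> Hdiv S \<Longrightarrow> has_weak_div S v (weak_div S v)"
  using weak_div_eq[OF opn] by (auto simp: Hdiv_def)

lemma weak_div_linear:
  assumes "v \<in> Hdiv S"
  shows "z \<in> Hdiv S \<Longrightarrow> weak_div S (v + z) = weak_div S v + weak_div S z"
    "weak_div S (c *\<^sub>R v) = c *\<^sub>R weak_div S v"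
  by (intro weak_div_eq has_weak_div_add has_weak_div_scaleR Hdiv_weak_div opn assms; assumption)+

lemma subspace_Hdiv_0: "subspace (Hdiv_0 S)"
  unfolding subspace_def
proof (intro conjI ballI allI)
  have L: "subspace (L2_on S)" using opn by (intro subspace_L2_on) auto
  have z: "has_weak_div S 0 0" using subspace_0[OF L] by (simp add: has_weak_div_def)
  show "0 \<in> Hdiv_0 S"
    using z subspace_0[OF L] weak_div_eq[OF opn z] by (auto simp: Hdiv_0_def Hdiv_def normal_trace_def)
  show "x + y \<in> Hdiv_0 S" if x: "x \<in> Hdiv_0 S" and y: "y \<in> Hdiv_0 S" for x y
  proof -
    have H: "x \<in> Hdiv S" "y \<in> Hdiv S" using x y by (auto simp: Hdiv_0_def)
    have "x + y \<in> Hdiv S"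
      using H subspace_add[OF L] has_weak_div_add[OF opn Hdiv_weak_div[OF H(1)] Hdiv_weak_div[OF H(2)]]
      by (auto simp: Hdiv_def)
    then show ?thesis using x y by (auto simp: Hdiv_0_def normal_trace_def weak_div_linear H inner_add_left algebra_simps)
  qed
  show "c *\<^sub>R x \<in> Hdiv_0 S" if x: "x \<in> Hdiv_0 S" for c x
  proof -
    have H: "x \<in> Hdiv S" using x by (auto simp: Hdiv_0_def)
    have "c *\<^sub>R x \<in> Hdiv S"
      using H subspace_scale[OF L] has_weak_div_scaleR[OF opn Hdiv_weak_div[OF H], of c]
      by (auto simp: Hdiv_def)
    moreover have "c * inner x (weak_grad S q) + c * inner (weak_div S x) q = 0" if "q \<in> H1 S" for q
      using x that by (simp add: Hdiv_0_def normal_trace_def distrib_left[symmetric])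
    ultimately show ?thesis by (auto simp: Hdiv_0_def normal_trace_def weak_div_linear H)
  qed
qed

lemma Hdiv_0_Hdiv: "v \<in> Hdiv_0 S \<Longrightarrow> v \<in> Hdiv S"
  by (simp add: Hdiv_0_def)

lemma hilbert_form_Hdiv_0: "hilbert_form (Hdiv_0 S) (Hdiv_inner S)"
  unfolding Hdiv_inner_def[abs_def]
proof (rule hilbert_form_graph[OF subspace_Hdiv_0])
  fix X v g assume X: "\<And>n. X n \<in> Hdiv_0 S" "X \<longlonglongrightarrow> v" "(\<lambda>n. weak_div S (X n)) \<longlonglongrightarrow> g"
  have d: "has_weak_div S v g"
    by (rule has_weak_div_limit[OF opn Hdiv_weak_div[OF Hdiv_0_Hdiv[OF X(1)]] X(2,3)])
  have "v $ i \<in> L2_on S" for i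
    using X(1) opn by (intro closed_sequentially[OF closed_L2_on _ tendsto_vec_nth[OF X(2)]]) (auto simp: Hdiv_0_def Hdiv_def)
  moreover have "normal_trace S v q = 0" if q: "q \<in> H1 S" for q
  proof -
    have "(\<lambda>n. inner (X n) (weak_grad S q) + inner (weak_div S (X n)) q) \<longlonglongrightarrow> inner v (weak_grad S q) + inner g q"
      by (intro tendsto_intros X)
    moreover have "inner (X n) (weak_grad S q) + inner (weak_div S (X n)) q = 0" for n
      using X(1)[of n] q by (auto simp: Hdiv_0_def normal_trace_def)
    ultimately show ?thesis using weak_div_eq[OF opn d] by (simp add: normal_trace_def LIMSEQ_const_iff)
  qed
  ultimately show "v \<in> Hdiv_0 S \<and> weak_div S v = g"
    using d weak_div_eq[OF opn d] by (auto simp: Hdiv_0_def Hdiv_def)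
qed (simp_all add: weak_div_linear Hdiv_0_Hdiv)

lemma subspace_V_space: "subspace (V_space S n)"
  using subspace_Hdiv_0 by (auto simp: subspace_def V_space_def)

lemma hilbert_form_V: "hilbert_form (V_space S n) (V_inner S n)"
  unfolding V_inner_def[abs_def]
proof (rule hilbert_form_family[OF hilbert_form_Hdiv_0 _ subspace_V_space])
  show "\<exists>x\<in>V_space S n. \<forall>i\<in>{..<n}. x i = \<xi> i" if "\<And>i. i \<in> {..<n} \<Longrightarrow> \<xi> i \<in> Hdiv_0 S" for \<xi>
    using that by (intro bexI[of _ "\<lambda>i. if i < n then \<xi> i else 0"]) (auto simp: V_space_def)
qed (auto simp: V_space_def fun_eq_iff not_less[symmetric])

lemma inner_weak_partial_H1_0:
  assumes f: "f \<in> H1_0 S" and q: "q \<in> H1 S"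
  shows "inner f (weak_partial S i q) + inner (weak_partial S i f) q = 0"
proof -
  obtain \<phi> where \<phi>: "\<And>n::nat. \<phi> n \<in> test_functions S" "(\<lambda>n. L2_class (\<phi> n)) \<longlonglongrightarrow> f"
    "\<And>i. (\<lambda>n. L2_class (partial_deriv i (\<phi> n))) \<longlonglongrightarrow> weak_partial S i f"
    by (rule H1_0_test_sequence[OF opn f]) blast
  have "(\<lambda>n. inner (L2_class (\<phi> n)) (weak_partial S i q) + inner (L2_class (partial_deriv i (\<phi> n))) q)
      \<longlonglongrightarrow> inner f (weak_partial S i q) + inner (weak_partial S i f) q"
    by (intro tendsto_intros \<phi>)
  moreover have "inner (L2_class (\<phi> n)) (weak_partial S i q) + inner (L2_class (partial_deriv i (\<phi> n))) q = 0" for n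
    using H1_weak_partial[OF opn q, of i] \<phi>(1)[of n] by (simp add: has_weak_partial_def inner_commute)
  ultimately show ?thesis by (simp add: LIMSEQ_const_iff)
qed

text \<open>The vanishing normal trace is Green's formula, which passes from test functions to their
  H^1 closure against any fixed \<open>H1\<close> function.\<close>

lemma U_Hdiv_0: assumes u: "u \<in> U_space S" shows "u \<in> Hdiv_0 S"
proof -
  have "u $ i \<in> L2_on S" for i using U_H1[OF u, of i] by (simp add: H1_def)
  then have "u \<in> Hdiv S" using has_weak_div_U[OF u] by (auto simp: Hdiv_def)
  moreover have "normal_trace S u q = 0" if q: "q \<in> H1 S" for q
    unfolding normal_trace_def weak_div_U[OF u]
    by (simp add: inner_vec_def weak_grad_def inner_sum_left sum.distrib[symmetric] inner_weak_partial_H1_0[OF U_H1_0[OF u] q])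
  ultimately show ?thesis by (simp add: Hdiv_0_def)
qed

lemma has_weak_partial_one: "has_weak_partial S i (one_on S) 0"
  unfolding has_weak_partial_def
proof (intro conjI ballI)
  show "0 \<in> L2_on S" using opn by (intro subspace_0 subspace_L2_on) auto
  fix \<phi> assume \<phi>: "\<phi> \<in> test_functions S"
  note d = test_functions_partial_deriv[OF \<phi>, of i]
  have "inner (one_on S) (L2_class (partial_deriv i \<phi>)) = (\<integral>x. indicat_real S x * partial_deriv i \<phi> x \<partial>lborel)"
    unfolding one_on_def by (rule inner_L2_class[OF square_integrable_indicator square_integrable_test[OF d]])
  also have "\<dots> = (\<integral>x. partial_deriv i \<phi> x \<partial>lborel)"
    using test_functions_nonzero[OF d] by (intro Bochner_Integration.integral_cong) (auto simp: indicator_def)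
  also have "\<dots> = 0" by (rule integral_partial_deriv[OF test_functions_tf[OF \<phi>]])
  finally show "inner (one_on S) (L2_class (partial_deriv i \<phi>)) = - inner 0 (L2_class \<phi>)" by simp
qed

text \<open>The normal trace tested with the constant 1, whose weak gradient is 0.\<close>

lemma weak_div_mean_zero: assumes v: "v \<in> Hdiv_0 S" shows "weak_div S v \<in> L2_mean_zero S"
proof -
  have "one_on S \<in> L2_on S" unfolding one_on_def
    by (rule L2_class_in_L2_on[OF square_integrable_indicator]) (auto simp: indicator_def split: if_splits)
  then have "one_on S \<in> H1 S" using has_weak_partial_one by (auto simp: H1_def)
  moreover have "weak_grad S (one_on S) = 0"
    using weak_partial_eq[OF opn has_weak_partial_one] by (simp add: weak_grad_def Finite_Cartesian_Product.vec_eq_iff)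
  ultimately have "inner (weak_div S v) (one_on S) = 0" using v by (auto simp: Hdiv_0_def normal_trace_def)
  then show ?thesis
    using Hdiv_weak_div[OF Hdiv_0_Hdiv[OF v]] by (simp add: L2_mean_zero_eq has_weak_div_def)
qed

end

text \<open>The Necas inequality is the inf-sup condition of the divergence: a bound for the pairing
  with divergences on all of \<open>U_space S\<close> holds in particular on test fields, which is
  \<open>grad_bound\<close>. Then \<open>surj_if_inf_sup\<close> inverts the divergence.\<close>

lemma div_right_inverse:
  assumes "lipschitz_domain S"
  obtains C where "0 < C"
    "\<And>g. g \<in> L2_mean_zero S \<Longrightarrow> \<exists>w\<in>U_space S. weak_div S w = g \<and> U_inner S w w \<le> C * (norm g)\<^sup>2"
proof -
  interpret bounded_open S using assms by unfold_locales (auto simp: lipschitz_domain_def)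
  obtain C where C: "0 \<le> C" "\<And>p M. square_integrable p \<Longrightarrow> 0 \<le> M \<Longrightarrow> grad_bound S p M \<Longrightarrow>
    (\<integral>x. indicat_real S x * p x \<partial>lborel) = 0 \<Longrightarrow> set_n2 S p \<le> C * M" by (rule Necas_inequality[OF assms]) blast
  obtain K where K: "0 < K" "\<And>u. u \<in> U_space S \<Longrightarrow> U_inner S u u \<le> K * (norm (sym_grad S u))\<^sup>2" by (rule U_inner_le) blast
  have gU: "grad2 u \<le> U_inner S u u" for u by (simp add: U_inner_eq sum_nonneg)
  have main: "sqrt (inner p p) \<le> (C * sqrt K) * M" if p: "p \<in> L2_mean_zero S" and M: "0 \<le> M"
    and b: "\<And>w. w \<in> U_space S \<Longrightarrow> \<bar>inner p (weak_div S w)\<bar> \<le> M * sqrt (U_inner S w w)" for p M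
  proof -
    have sq: "square_integrable (rep_L2 p)" by (rule square_integrable_rep_L2)
    have "set_n2 S (rep_L2 p) \<le> C * (sqrt K * M)"
    proof (rule C(2)[OF sq])
      show "0 \<le> sqrt K * M" using M K by simp
      have "inner (L2_class (rep_L2 p)) (one_on S) = 0" using p by (simp add: L2_mean_zero_eq L2_class_rep_L2)
      then show "(\<integral>x. indicat_real S x * rep_L2 p x \<partial>lborel) = 0"
        unfolding one_on_def inner_L2_class[OF sq square_integrable_indicator] by (simp add: mult.commute)
      show "grad_bound S (rep_L2 p) (sqrt K * M)"
        unfolding grad_bound_def
      proof
        fix w assume w: "w \<in> test_fields S"
        then have wi: "w i \<in> test_functions S" for i by (simp add: test_fields_def)
        note dw = test_functions_partial_deriv[OF wi]
        let ?u = "\<chi> i. L2_class (w i)"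
        have "L2_class (w i) \<in> H1_0 S" for i
          unfolding H1_0_iff[OF opn] weak_grad_test[OF opn wi]
          by (rule subsetD[OF closure_subset]) (use wi in \<open>auto simp: test_graph_def\<close>)
        then have u: "?u \<in> U_space S" by (simp add: U_space_def)
        have wp: "weak_partial S j (L2_class (w i)) = L2_class (partial_deriv j (w i))" for i j
          by (rule weak_partial_eq[OF opn has_weak_partial_test[OF wi]])
        have fd: "square_integrable (fdiv w)" "weak_div S ?u = L2_class (fdiv w)"
          unfolding weak_div_U[OF u] fdiv_def[abs_def]
          using L2_class_sum[of UNIV "\<lambda>i. partial_deriv i (w i)"] square_integrable_test[OF test_functions_sum[OF dw]]
          by (simp_all add: wp square_integrable_test[OF dw])
        \<comment> \<open>Poincare and Korn reduce the full norm of a test field to the norm of its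
          gradient, in which \<open>grad_bound\<close> is stated.\<close>
        have "U_inner S ?u ?u \<le> K * (norm (sym_grad S ?u))\<^sup>2" by (rule K(2)[OF u])
        also have "\<dots> \<le> K * grad2 ?u" using K(1) norm_sym_grad_le by (intro mult_left_mono) auto
        also have "grad2 ?u = (grad_norm w)\<^sup>2"
          by (simp add: grad2_def grad_norm_def wp norm_L2_class square_integrable_test[OF dw] sum_nonneg)
        finally have "sqrt (U_inner S ?u ?u) \<le> sqrt K * grad_norm w"
          by (metis grad_norm_nonneg real_sqrt_le_mono real_sqrt_mult real_sqrt_abs abs_of_nonneg)
        then have "\<bar>inner p (weak_div S ?u)\<bar> \<le> M * (sqrt K * grad_norm w)"
          using b[OF u] mult_left_mono[OF _ M] by (meson order_trans)
        moreover have "inner p (weak_div S ?u) = (\<integral>x. rep_L2 p x * fdiv w x \<partial>lborel)"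
          unfolding fd(2) inner_L2_class[OF sq fd(1), symmetric] by (simp only: L2_class_rep_L2)
        ultimately show "\<bar>\<integral>x. rep_L2 p x * fdiv w x \<partial>lborel\<bar> \<le> sqrt K * M * grad_norm w" by (simp add: mult_ac)
      qed
    qed
    moreover have "set_n2 S (rep_L2 p) = n2 (rep_L2 p)"
    proof -
      have "AE x in lborel. indicat_real S x * rep_L2 p x = rep_L2 p x"
        using p[unfolded L2_mean_zero_eq Int_iff L2_on_iff_rep, THEN conjunct1] by eventually_elim (auto simp: indicator_def)
      then show ?thesis unfolding set_n2_def
        using square_integrable_indicator_mult(1)[OF sq, of S] opn sq by (intro n2_cong_AE) (auto simp: square_integrable_def)
    qed
    moreover have "n2 (rep_L2 p) = norm p" using norm_L2_class[OF sq] by (simp only: L2_class_rep_L2)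
    ultimately show ?thesis by (simp add: norm_eq_sqrt_inner mult_ac)
  qed
  show ?thesis
  \<comment> \<open>The summand 1 makes the constant strictly positive.\<close>
  proof (rule that[of "(C * sqrt K)\<^sup>2 + 1"])
    show "0 < (C * sqrt K)\<^sup>2 + 1" by (simp add: add_nonneg_pos)
    fix g assume g: "g \<in> L2_mean_zero S"
    obtain w where w: "w \<in> U_space S" "weak_div S w = g" "sqrt (U_inner S w w) \<le> (C * sqrt K) * sqrt (inner g g)"
    proof (rule surj_if_inf_sup[OF hilbert_form_U_inner[OF opn] hilbert_form_L2_mean_zero _ div_U_add div_U_scaleR _ _ _ g, where K="sqrt (real CARD('a))"])
      show "sqrt (inner (weak_div S w) (weak_div S w)) \<le> sqrt (real CARD('a)) * sqrt (U_inner S w w)" if w: "w \<in> U_space S" for w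
      proof -
        have "inner (weak_div S w) (weak_div S w) \<le> real CARD('a) * (norm (sym_grad S w))\<^sup>2"
          using norm_div_le[OF w] by (simp add: power2_norm_eq_inner)
        also have "\<dots> \<le> real CARD('a) * U_inner S w w"
          using norm_sym_grad_le[of w] gU[of w] by (intro mult_left_mono) linarith+
        finally show ?thesis unfolding real_sqrt_mult[symmetric] by (rule real_sqrt_le_mono)
      qed
    qed (auto intro: main weak_div_mean_zero U_Hdiv_0)
    have "0 \<le> U_inner S w w" using gU[of w] by (simp add: U_inner_eq grad2_def sum_nonneg)
    then have "U_inner S w w \<le> (C * sqrt K)\<^sup>2 * (norm g)\<^sup>2"
      using power_mono[OF w(3) real_sqrt_ge_zero, where n=2] by (simp add: power_mult_distrib power2_norm_eq_inner)
    also have "\<dots> \<le> ((C * sqrt K)\<^sup>2 + 1) * (norm g)\<^sup>2" by (intro mult_right_mono) auto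
    finally show "\<exists>w\<in>U_space S. weak_div S w = g \<and> U_inner S w w \<le> ((C * sqrt K)\<^sup>2 + 1) * (norm g)\<^sup>2"
      using w by blast
  qed
qed

section \<open>The parameter matrices\<close>

text \<open>Zero beyond \<open>n\<close>, so that tuples in \<open>P_space S n\<close> are mapped to
  such tuples.\<close>

definition mat_app :: "nat \<Rightarrow> real mat \<Rightarrow> (nat \<Rightarrow> 'b::real_vector) \<Rightarrow> nat \<Rightarrow> 'b" where
  "mat_app n M p i = (if i < n then \<Sum>j<n. (M $$ (i, j)) *\<^sub>R p j else 0)"

lemma mat_form_eq: "mat_form n M p q = P_inner n (mat_app n M p) q"
  by (simp add: mat_form_def P_inner_def mat_app_def)

lemma P_inner_linear:
  "P_inner n (p + p') q = P_inner n p q + P_inner n p' q"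
  "P_inner n (p - p') q = P_inner n p q - P_inner n p' q"
  "P_inner n (c *\<^sub>R p) q = c * P_inner n p q"
  "P_inner n q (p + p') = P_inner n q p + P_inner n q p'"
  "P_inner n q (p - p') = P_inner n q p - P_inner n q p'"
  "P_inner n q (c *\<^sub>R p) = c * P_inner n q p"
  by (simp_all add: P_inner_def inner_add_left inner_add_right inner_diff_left inner_diff_right
      sum.distrib sum_subtractf sum_distrib_left)

lemma P_inner_commute: "P_inner n p q = P_inner n q p"
  by (simp add: P_inner_def inner_commute)

lemma P_inner_nonneg: "0 \<le> P_inner n p p"
  by (simp add: P_inner_def sum_nonneg)

lemma P_inner_cong: "(\<And>i. i < n \<Longrightarrow> p i = p' i) \<Longrightarrow> P_inner n p q = P_inner n p' q"
  by (simp add: P_inner_def)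

lemma mat_app_linear:
  "mat_app n M (p + q) = mat_app n M p + mat_app n M q"
  "mat_app n M (p - q) = mat_app n M p - mat_app n M q"
  "mat_app n M (c *\<^sub>R p) = c *\<^sub>R mat_app n M p"
  by (auto simp: mat_app_def fun_eq_iff scaleR_add_right scaleR_diff_right sum.distrib sum_subtractf scaleR_sum_right mult_ac)

lemma mat_app_plus:
  "A \<in> carrier_mat n n \<Longrightarrow> B \<in> carrier_mat n n \<Longrightarrow> mat_app n (A + B) p = mat_app n A p + mat_app n B p"
  by (auto simp: mat_app_def fun_eq_iff scaleR_add_left sum.distrib)

lemma mat_app_mult:
  assumes "A \<in> carrier_mat n n" "B \<in> carrier_mat n n"
  shows "mat_app n A (mat_app n B p) = mat_app n (A * B) p"
proof
  fix i
  show "mat_app n A (mat_app n B p) i = mat_app n (A * B) p i"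
  proof (cases "i < n")
    case True
    have "(\<Sum>k<n. A $$ (i, k) *\<^sub>R (\<Sum>j<n. B $$ (k, j) *\<^sub>R p j)) = (\<Sum>j<n. (\<Sum>k<n. A $$ (i, k) * B $$ (k, j)) *\<^sub>R p j)"
      unfolding scaleR_sum_right scaleR_sum_left by (subst sum.swap) simp
    then show ?thesis using True assms by (simp add: mat_app_def scalar_prod_def atLeast0LessThan)
  qed (simp add: mat_app_def)
qed

lemma mat_app_one: "mat_app n (1\<^sub>m n) p = (\<lambda>i. if i < n then p i else 0)"
proof
  fix i
  have "(\<Sum>j<n. (if i = j then 1 else 0) *\<^sub>R p j) = (\<Sum>j<n. if i = j then p j else 0)"
    by (intro sum.cong) auto
  then show "mat_app n (1\<^sub>m n) p i = (if i < n then p i else 0)" by (simp add: mat_app_def)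
qed

lemma mat_app_symmetric:
  assumes "\<And>i j. i < n \<Longrightarrow> j < n \<Longrightarrow> A $$ (i, j) = A $$ (j, i)"
  shows "P_inner n (mat_app n A p) q = P_inner n p (mat_app n A q)"
proof -
  have "P_inner n (mat_app n A p) q = (\<Sum>i<n. \<Sum>j<n. A $$ (i, j) * inner (p j) (q i))"
    by (simp add: P_inner_def mat_app_def inner_sum_left)
  also have "\<dots> = (\<Sum>j<n. \<Sum>i<n. A $$ (j, i) * inner (p j) (q i))"
    by (subst sum.swap) (simp add: assms)
  also have "\<dots> = P_inner n p (mat_app n A q)"
    by (simp add: P_inner_def mat_app_def inner_sum_right)
  finally show ?thesis .
qed

text \<open>A positive matrix has trivial kernel. Nonzero vectors are recognised by
  \<open>0 < P_inner n x x\<close>, because entries of \<open>x\<close> beyond \<open>n\<close> do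
  not count.\<close>

lemma mat_inverse_if_positive:
  assumes A: "A \<in> carrier_mat n n"
    and pos: "\<And>x :: nat \<Rightarrow> real. 0 < P_inner n x x \<Longrightarrow> 0 < P_inner n (mat_app n A x) x"
  shows "A * the (mat_inverse A) = 1\<^sub>m n" "the (mat_inverse A) \<in> carrier_mat n n"
proof -
  have "det A \<noteq> 0"
  proof
    assume "det A = 0"
    then obtain v where v: "v \<in> carrier_vec n" "v \<noteq> 0\<^sub>v n" "A *\<^sub>v v = 0\<^sub>v n"
      using det_0_iff_vec_prod_zero[OF A] by blast
    define x where "x i = vec_index v i" for i
    obtain k where k: "k < n" "x k \<noteq> 0" using v(1,2) by (auto simp: x_def Matrix.vec_eq_iff)
    have "0 < (x k)\<^sup>2" using k by simp
    also have "(x k)\<^sup>2 \<le> (\<Sum>i<n. (x i)\<^sup>2)" using k by (intro member_le_sum) auto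
    finally have "0 < P_inner n x x" by (simp add: P_inner_def power2_eq_square)
    then have "0 < P_inner n (mat_app n A x) x" by (rule pos)
    moreover have "mat_app n A x i = 0" if "i < n" for i
    proof -
      have "vec_index (A *\<^sub>v v) i = 0" using v(3) that by simp
      then show ?thesis using that A v(1) by (simp add: mat_app_def x_def mult_mat_vec_def scalar_prod_def atLeast0LessThan)
    qed
    ultimately show False by (simp add: P_inner_def)
  qed
  then have "A \<in> Units (ring_mat TYPE(real) n ())" by (rule det_non_zero_imp_unit[OF A])
  then obtain B where "mat_inverse A = Some B" using mat_inverse(1)[OF A, of "()"] by (cases "mat_inverse A") auto
  then show "A * the (mat_inverse A) = 1\<^sub>m n" "the (mat_inverse A) \<in> carrier_mat n n"
    using mat_inverse(2)[OF A] by auto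
qed

lemma mat_app_bound:
  obtains K where "0 \<le> K" "\<And>p :: nat \<Rightarrow> 'b::real_inner. P_inner n (mat_app n A p) p \<le> K * P_inner n p p"
proof (rule that[of "\<Sum>i<n. \<Sum>j<n. \<bar>A $$ (i, j)\<bar>"])
  fix p :: "nat \<Rightarrow> 'b"
  have le: "norm (p i) \<le> sqrt (P_inner n p p)" if "i < n" for i
    unfolding P_inner_def norm_eq_sqrt_inner using that by (intro real_sqrt_le_mono member_le_sum) auto
  have "A $$ (i, j) * inner (p j) (p i) \<le> \<bar>A $$ (i, j)\<bar> * P_inner n p p" if "i < n" "j < n" for i j
  proof -
    have "A $$ (i, j) * inner (p j) (p i) \<le> \<bar>A $$ (i, j)\<bar> * \<bar>inner (p j) (p i)\<bar>"
      by (metis abs_ge_self abs_mult)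
    also have "\<bar>inner (p j) (p i)\<bar> \<le> sqrt (P_inner n p p) * sqrt (P_inner n p p)"
      using order_trans[OF Cauchy_Schwarz_ineq2 mult_mono[OF le[OF that(2)] le[OF that(1)]]] by (simp add: P_inner_nonneg)
    also have "\<dots> = P_inner n p p" by (simp add: P_inner_nonneg)
    finally show ?thesis by (simp add: mult_left_mono)
  qed
  then show "P_inner n (mat_app n A p) p \<le> (\<Sum>i<n. \<Sum>j<n. \<bar>A $$ (i, j)\<bar>) * P_inner n p p"
    unfolding P_inner_def[of n "mat_app n A p"] mat_app_def sum_distrib_right
    by (simp add: inner_sum_left) (intro sum_mono, simp)
qed (simp add: sum_nonneg)

section \<open>The network matrices\<close>

locale network =
  fixes n :: nat and l :: real and Rinv ap :: "nat \<Rightarrow> real" and \<tau> :: real and \<alpha> :: "nat \<Rightarrow> real"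
    and \<beta> a :: "nat \<Rightarrow> nat \<Rightarrow> real"
  assumes n: "1 \<le> n" and l: "0 < l" and Rinv: "\<And>i. i < n \<Longrightarrow> 0 < Rinv i" and ap: "\<And>i. i < n \<Longrightarrow> 0 \<le> ap i"
    and \<tau>: "0 < \<tau>" and \<alpha>: "\<And>i. i < n \<Longrightarrow> 0 < \<alpha> i"
    and \<beta>: "\<And>i j. i < n \<Longrightarrow> j < n \<Longrightarrow> i \<noteq> j \<Longrightarrow> 0 \<le> \<beta> i j \<and> \<beta> i j = \<beta> j i"
    and \<beta>_diag: "\<And>i. i < n \<Longrightarrow> \<beta> i i = (\<Sum>j\<in>{..<n} - {i}. \<beta> i j)"
    and a: "\<And>i j. i < n \<Longrightarrow> j < n \<Longrightarrow> a i j = \<tau> * \<beta> i j / (\<alpha> i * \<alpha> j)"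
begin

abbreviation "l0 \<equiv> max 1 l"
abbreviation "R \<equiv> R_const n Rinv"
abbreviation "L12 \<equiv> Lambda1 n a + Lambda2 n ap"
abbreviation "L \<equiv> Lambda n l Rinv ap a"
abbreviation "Li \<equiv> Lambda_inv n l Rinv ap a"

lemma R: "0 < R" "i < n \<Longrightarrow> Rinv i \<le> 1 / R"
proof -
  have "Rinv 0 \<in> Rinv ` {..<n}" using n by auto
  then have "Rinv ` {..<n} \<noteq> {}" by blast
  then have "Max (Rinv ` {..<n}) \<in> Rinv ` {..<n}" by (intro Max_in) auto
  then show "0 < R" using Rinv by (auto simp: R_const_def)
  show "Rinv i \<le> 1 / R" if "i < n" using that by (simp add: R_const_def)
qed

lemma carriers: "Lambda1 n a \<in> carrier_mat n n" "Lambda2 n ap \<in> carrier_mat n n" "Lambda3 n Rinv \<in> carrier_mat n n"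
  "Lambda4 n l \<in> carrier_mat n n" "L12 \<in> carrier_mat n n" "L \<in> carrier_mat n n"
  by (auto simp: Lambda1_def Lambda2_def Lambda3_def Lambda4_def Lambda_def)

lemma L12_symmetric: "P_inner n (mat_app n L12 p) q = P_inner n p (mat_app n L12 q)"
proof (rule mat_app_symmetric)
  fix i j assume "i < n" "j < n"
  then show "L12 $$ (i, j) = L12 $$ (j, i)"
    using \<beta>[of i j] by (auto simp: Lambda1_def Lambda2_def a mult.commute)
qed

lemma L_split:
  "P_inner n (mat_app n L p) q =
    P_inner n (mat_app n L12 p) q + R * P_inner n p q + (1 / l0) * inner (\<Sum>i<n. p i) (\<Sum>i<n. q i)"
proof -
  have 3: "P_inner n (mat_app n (Lambda3 n Rinv) p) q = R * P_inner n p q"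
  proof -
    have "mat_app n (Lambda3 n Rinv) p i = R *\<^sub>R p i" if "i < n" for i
    proof -
      have "(\<Sum>j<n. Lambda3 n Rinv $$ (i, j) *\<^sub>R p j) = (\<Sum>j<n. if i = j then R *\<^sub>R p j else 0)"
        using that by (intro sum.cong) (auto simp: Lambda3_def)
      then show ?thesis using that by (simp add: mat_app_def)
    qed
    then show ?thesis by (simp add: P_inner_def sum_distrib_left)
  qed
  have 4: "P_inner n (mat_app n (Lambda4 n l) p) q = (1 / l0) * inner (\<Sum>i<n. p i) (\<Sum>i<n. q i)"
    by (simp add: P_inner_def mat_app_def Lambda4_def scaleR_sum_right[symmetric] inner_sum_right sum_divide_distrib)
  show ?thesis
    unfolding Lambda_def by (simp only: mat_app_plus carriers add_carrier_mat P_inner_linear 3 4)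
qed

lemma L_symmetric: "P_inner n (mat_app n L p) q = P_inner n p (mat_app n L q)"
proof -
  have "P_inner n p (mat_app n L q) = P_inner n (mat_app n L q) p" by (rule P_inner_commute)
  also have "\<dots> = P_inner n (mat_app n L12 q) p + R * P_inner n q p + (1 / l0) * inner (\<Sum>i<n. q i) (\<Sum>i<n. p i)"
    by (rule L_split)
  also have "P_inner n (mat_app n L12 q) p = P_inner n (mat_app n L12 p) q"
    by (rule trans[OF L12_symmetric P_inner_commute])
  also have "P_inner n q p = P_inner n p q" by (rule P_inner_commute)
  also have "inner (\<Sum>i<n. q i) (\<Sum>i<n. p i) = inner (\<Sum>i<n. p i) (\<Sum>i<n. q i)" by (rule inner_commute)
  finally show ?thesis unfolding L_split by (rule sym)
qed

text \<open>In the variables p_i / \<alpha>_i, \<open>Lambda1\<close> is the Laplacian of the graph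
  with edge weights \<tau> \<beta>_ij: the diagonal balances the row sums, so the quadratic form is
  half the weighted sum of squared differences. \<open>Lambda2\<close> is diagonal and
  nonnegative.\<close>

lemma L12_nonneg: "0 \<le> P_inner n (mat_app n L12 p) p"
proof -
  define c where "c i j = (if i = j then 0 else \<tau> * \<beta> i j)" for i j
  define x where "x i = (1 / \<alpha> i) *\<^sub>R p i" for i
  have c: "0 \<le> c i j" "c i j = c j i" if "i < n" "j < n" for i j using \<beta>[OF that] \<tau> by (auto simp: c_def)
  have diag: "a i i = (\<Sum>j<n. c i j) / (\<alpha> i * \<alpha> i)" if i: "i < n" for i
  proof -
    have "(\<Sum>j<n. c i j) = (\<Sum>j\<in>{..<n} - {i}. \<tau> * \<beta> i j)"
      using i by (subst sum.remove[of _ i]) (auto simp: c_def intro!: sum.cong)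
    then show ?thesis using a[OF i i] \<beta>_diag[OF i] by (simp add: sum_distrib_left)
  qed
  have row: "(\<Sum>j<n. Lambda1 n a $$ (i, j) * inner (p j) (p i)) = (\<Sum>j<n. c i j * (inner (x i) (x i) - inner (x j) (x i)))"
    if i: "i < n" for i
  proof -
    have "(\<Sum>j<n. Lambda1 n a $$ (i, j) * inner (p j) (p i)) =
        (\<Sum>j<n. (if i = j then a i i * inner (p i) (p i) else 0) - c i j * inner (x j) (x i))"
      using i \<alpha> by (intro sum.cong) (auto simp: Lambda1_def a c_def x_def)
    also have "\<dots> = a i i * inner (p i) (p i) - (\<Sum>j<n. c i j * inner (x j) (x i))"
      using i by (simp add: sum_subtractf)
    also have "a i i * inner (p i) (p i) = (\<Sum>j<n. c i j * inner (x i) (x i))"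
      using i \<alpha>[OF i] by (simp add: diag x_def sum_distrib_right sum_divide_distrib)
    finally show ?thesis by (simp add: right_diff_distrib sum_subtractf)
  qed
  \<comment> \<open>\<open>g\<close> is antisymmetric, so it sums to 0; subtracting it turns each
    summand into half of \<open>c i j\<close> times the square of x_i - x_j.\<close>
  define g where "g i j = c i j * ((1/2) * (inner (x i) (x i) - inner (x j) (x j)))" for i j
  have "(\<Sum>i<n. \<Sum>j<n. g i j) = (\<Sum>i<n. \<Sum>j<n. g j i)" by (rule sum.swap)
  also have "\<dots> = (\<Sum>i<n. \<Sum>j<n. - g i j)"
    using c(2) by (intro sum.cong refl) (auto simp: g_def algebra_simps)
  finally have "0 = (\<Sum>i<n. \<Sum>j<n. g i j)" by (simp add: sum_negf)
  also have "\<dots> \<le> (\<Sum>i<n. \<Sum>j<n. Lambda1 n a $$ (i, j) * inner (p j) (p i))"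
  proof (rule sum_mono)
    fix i assume i: "i \<in> {..<n}"
    have "(1/2) * (inner (x i) (x i) - inner (x j) (x j)) \<le> inner (x i) (x i) - inner (x j) (x i)" for j
      using inner_ge_zero[of "x i - x j"] by (simp add: inner_diff_left inner_diff_right inner_commute field_simps)
    then have "(\<Sum>j<n. g i j) \<le> (\<Sum>j<n. c i j * (inner (x i) (x i) - inner (x j) (x i)))"
      unfolding g_def using i c(1) by (intro sum_mono mult_left_mono) auto
    then show "(\<Sum>j<n. g i j) \<le> (\<Sum>j<n. Lambda1 n a $$ (i, j) * inner (p j) (p i))" using row i by simp
  qed
  finally have 1: "0 \<le> P_inner n (mat_app n (Lambda1 n a) p) p"
    by (simp add: P_inner_def mat_app_def inner_sum_left)
  have "mat_app n (Lambda2 n ap) p i = ap i *\<^sub>R p i" if "i < n" for i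
  proof -
    have "(\<Sum>j<n. Lambda2 n ap $$ (i, j) *\<^sub>R p j) = (\<Sum>j<n. if i = j then ap i *\<^sub>R p j else 0)"
      using that by (intro sum.cong) (auto simp: Lambda2_def)
    then show ?thesis using that by (simp add: mat_app_def)
  qed
  then have "0 \<le> P_inner n (mat_app n (Lambda2 n ap) p) p" using ap by (auto simp: P_inner_def intro!: sum_nonneg)
  with 1 show ?thesis by (simp add: mat_app_plus carriers P_inner_linear)
qed

lemma L_ge:
  "R * P_inner n p p \<le> P_inner n (mat_app n L p) p"
  "(1 / l0) * inner (\<Sum>i<n. p i) (\<Sum>i<n. p i) \<le> P_inner n (mat_app n L p) p"
  using L_split[of p p] L12_nonneg[of p] R(1) P_inner_nonneg[of n p] l by simp_all

lemma L_inverse: "L * Li = 1\<^sub>m n" "Li \<in> carrier_mat n n"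
proof -
  have pos: "0 < P_inner n (mat_app n L x) x" if "0 < P_inner n x x" for x :: "nat \<Rightarrow> real"
    using L_ge(1)[of x] mult_pos_pos[OF R(1) that] by linarith
  show "L * Li = 1\<^sub>m n" "Li \<in> carrier_mat n n"
    unfolding Lambda_inv_def using mat_inverse_if_positive[OF carriers(6) pos] by blast+
qed

lemma L_Li: "mat_app n L (mat_app n Li r) = (\<lambda>i. if i < n then r i else 0)"
  by (simp add: mat_app_mult carriers L_inverse mat_app_one)

lemma P_inner_L_Li: "P_inner n (mat_app n L (mat_app n Li r)) q = P_inner n r q"
  by (auto simp: L_Li intro: P_inner_cong)

text \<open>The form of the inverse is the form of \<open>L\<close> at the preimages, so estimates
  for the inverse become estimates for \<open>L\<close>.\<close>

lemma Li_form: "P_inner n (mat_app n Li r) s = P_inner n (mat_app n L (mat_app n Li r)) (mat_app n Li s)"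
proof -
  have "P_inner n (mat_app n L (mat_app n Li r)) (mat_app n Li s) = P_inner n (mat_app n Li r) (mat_app n L (mat_app n Li s))"
    by (rule L_symmetric)
  also have "\<dots> = P_inner n (mat_app n L (mat_app n Li s)) (mat_app n Li r)" by (rule P_inner_commute)
  also have "\<dots> = P_inner n s (mat_app n Li r)" by (rule P_inner_L_Li)
  also have "\<dots> = P_inner n (mat_app n Li r) s" by (rule P_inner_commute)
  finally show ?thesis by simp
qed

text \<open>\<open>L\<close> dominates \<open>R\<close> times the identity. With s the preimage of
  \<open>r\<close>, expand the square of R s - r and absorb R |s|^2 into the pairing of s with
  \<open>r\<close>.\<close>

lemma Li_le: "P_inner n (mat_app n Li r) r \<le> (1 / R) * P_inner n r r"
proof -
  let ?s = "mat_app n Li r"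
  have "0 \<le> P_inner n (R *\<^sub>R ?s - r) (R *\<^sub>R ?s - r)" by (rule P_inner_nonneg)
  also have "\<dots> = R * (R * P_inner n ?s ?s) - R * P_inner n ?s r - (R * P_inner n r ?s - P_inner n r r)"
    by (simp only: P_inner_linear right_diff_distrib)
  also have "P_inner n r ?s = P_inner n ?s r" by (rule P_inner_commute)
  finally have "2 * (R * P_inner n ?s r) \<le> R * (R * P_inner n ?s ?s) + P_inner n r r" by linarith
  moreover have "R * P_inner n ?s ?s \<le> P_inner n ?s r" using L_ge(1)[of ?s] by (simp only: Li_form[symmetric])
  then have "R * (R * P_inner n ?s ?s) \<le> R * P_inner n ?s r" using R(1) by (intro mult_left_mono) auto
  ultimately have "R * P_inner n ?s r \<le> P_inner n r r" by linarith
  then show ?thesis using R(1) by (simp add: field_simps)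
qed

end

section \<open>The block-diagonal form\<close>

definition form_sum :: "('a \<Rightarrow> 'a \<Rightarrow> real) \<Rightarrow> ('b \<Rightarrow> 'b \<Rightarrow> real) \<Rightarrow> 'a \<times> 'b \<Rightarrow> 'a \<times> 'b \<Rightarrow> real" where
  "form_sum b e = (\<lambda>(x, y) (x', y'). b x x' + e y y')"

lemma form_sum_simps [simp]: "form_sum b e (x, y) (x', y') = b x x' + e y y'"
  by (simp add: form_sum_def)

text \<open>The constants may depend on the parameters: the equivalence serves completeness and the
  identification of dual spaces, not the final bounds.\<close>

definition form_equiv :: "'a set \<Rightarrow> ('a \<Rightarrow> 'a \<Rightarrow> real) \<Rightarrow> ('a \<Rightarrow> 'a \<Rightarrow> real) \<Rightarrow> bool" where
  "form_equiv D b e \<longleftrightarrow> (\<exists>c>0. \<exists>C. \<forall>x\<in>D. c * e x x \<le> b x x \<and> b x x \<le> C * e x x)"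

lemma form_equivI:
  "0 < c \<Longrightarrow> (\<And>x. x \<in> D \<Longrightarrow> c * e x x \<le> b x x) \<Longrightarrow> (\<And>x. x \<in> D \<Longrightarrow> b x x \<le> C * e x x) \<Longrightarrow> form_equiv D b e"
  unfolding form_equiv_def by blast

lemma hilbert_form_sum: "hilbert_form D b \<Longrightarrow> hilbert_form E e \<Longrightarrow> hilbert_form (D \<times> E) (form_sum b e)"
  unfolding form_sum_def by (rule hilbert_form_Times)

lemma form_equiv_sum:
  assumes D: "hilbert_form D e" and E: "hilbert_form E e'" and "form_equiv D b e" "form_equiv E b' e'"
  shows "form_equiv (D \<times> E) (form_sum b b') (form_sum e e')"
proof -
  obtain c C where c: "c > 0" "\<And>x. x \<in> D \<Longrightarrow> c * e x x \<le> b x x" "\<And>x. x \<in> D \<Longrightarrow> b x x \<le> C * e x x"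
    using assms(3) unfolding form_equiv_def by blast
  obtain c' C' where c': "c' > 0" "\<And>x. x \<in> E \<Longrightarrow> c' * e' x x \<le> b' x x" "\<And>x. x \<in> E \<Longrightarrow> b' x x \<le> C' * e' x x"
    using assms(4) unfolding form_equiv_def by blast
  show ?thesis
  proof (rule form_equivI)
    show "0 < min c c'" using c c' by simp
    fix z assume "z \<in> D \<times> E"
    then obtain x y where z: "z = (x, y)" "x \<in> D" "y \<in> E" by blast
    note nn = hilbert_form.nonneg[OF D z(2)] hilbert_form.nonneg[OF E z(3)]
    have "min c c' * e x x \<le> c * e x x" "min c c' * e' y y \<le> c' * e' y y"
      "C * e x x \<le> max C C' * e x x" "C' * e' y y \<le> max C C' * e' y y"
      using nn by (auto intro: mult_right_mono)
    then show "min c c' * form_sum e e' z z \<le> form_sum b b' z z" "form_sum b b' z z \<le> max C C' * form_sum e e' z z"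
      using c(2,3)[OF z(2)] c'(2,3)[OF z(3)] by (auto simp: z(1) distrib_left)
  qed
qed

text \<open>Equivalent forms have the same bounded functionals, so Riesz for \<open>b\<close> maps
  onto the dual taken with the fixed norm of \<open>e\<close>.\<close>

lemma dual_bij:
  assumes "hilbert_form D b" and e_form: "hilbert_form D e" and e: "form_equiv D b e"
  shows "bij_betw (\<lambda>x. \<lambda>y\<in>D. b x y) D (dual_space D (\<lambda>x. sqrt (e x x)))"
proof -
  interpret hilbert_form D b by fact
  obtain c C where c: "c > 0" "\<And>x. x \<in> D \<Longrightarrow> c * e x x \<le> b x x" "\<And>x. x \<in> D \<Longrightarrow> b x x \<le> C * e x x"
    using e unfolding form_equiv_def by blast
  have le: "sqrt (b y y) \<le> sqrt C * sqrt (e y y)" if "y \<in> D" for y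
    unfolding real_sqrt_mult[symmetric] by (intro real_sqrt_le_mono c that)
  have ge: "sqrt (e y y) \<le> (1 / sqrt c) * sqrt (b y y)" if "y \<in> D" for y
  proof -
    have "sqrt (c * e y y) \<le> sqrt (b y y)" by (intro real_sqrt_le_mono c that)
    then show ?thesis using c(1) by (simp add: real_sqrt_mult field_simps)
  qed
  show ?thesis
    unfolding bij_betw_def
  proof
    show "inj_on (\<lambda>x. \<lambda>y\<in>D. b x y) D"
    proof (rule inj_onI, rule eq_if_eq_left)
      fix x x' z assume "restrict (b x) D = restrict (b x') D" "z \<in> D"
      then show "b x z = b x' z" by (metis restrict_apply')
    qed
    show "(\<lambda>x. \<lambda>y\<in>D. b x y) ` D = dual_space D (\<lambda>x. sqrt (e x x))"
    proof (intro equalityI subsetI)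
      fix F assume "F \<in> (\<lambda>x. \<lambda>y\<in>D. b x y) ` D"
      then obtain x where x: "x \<in> D" "F = (\<lambda>y\<in>D. b x y)" by blast
      have "\<bar>F y\<bar> \<le> (sqrt (b x x) * sqrt C) * sqrt (e y y)" if y: "y \<in> D" for y
      proof -
        have "\<bar>b x y\<bar> \<le> sqrt (b x x) * sqrt (b y y)" by (rule Cauchy_Schwarz[OF x(1) y])
        also have "\<dots> \<le> sqrt (b x x) * (sqrt C * sqrt (e y y))" by (intro mult_left_mono le y) (simp add: nonneg x)
        finally show ?thesis using x y by (simp add: mult_ac)
      qed
      then show "F \<in> dual_space D (\<lambda>x. sqrt (e x x))"
        using x by (auto simp: dual_space_def add_right scale_right D_add D_scale)
    next
      fix F assume F: "F \<in> dual_space D (\<lambda>x. sqrt (e x x))"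
      then obtain K where K: "\<And>x. x \<in> D \<Longrightarrow> \<bar>F x\<bar> \<le> K * sqrt (e x x)" unfolding dual_space_def by blast
      have bound: "\<bar>F x\<bar> \<le> (\<bar>K\<bar> * (1 / sqrt c)) * sqrt (b x x)" if "x \<in> D" for x
      proof -
        have s: "0 \<le> sqrt (e x x)" using hilbert_form.nonneg[OF e_form that] by simp
        have "\<bar>F x\<bar> \<le> \<bar>K\<bar> * sqrt (e x x)" using K[OF that] mult_right_mono[OF abs_ge_self s, of K] by linarith
        also have "\<dots> \<le> \<bar>K\<bar> * ((1 / sqrt c) * sqrt (b x x))" by (intro mult_left_mono ge that) auto
        finally show ?thesis by (simp add: mult_ac)
      qed
      obtain x where x: "x \<in> D" "\<And>y. y \<in> D \<Longrightarrow> F y = b x y"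
        by (rule Riesz[of F, OF _ _ bound]) (use F in \<open>auto simp: dual_space_def\<close>)
      then have "F = (\<lambda>y\<in>D. b x y)" using F by (auto simp: dual_space_def fun_eq_iff extensional_def)
      then show "F \<in> (\<lambda>x. \<lambda>y\<in>D. b x y) ` D" using x by blast
    qed
  qed
qed

lemma op_norm_le:
  assumes "\<And>x. x \<in> D \<Longrightarrow> 0 \<le> N x" "\<And>x. x \<in> D \<Longrightarrow> N (T x) \<le> C * N x" "0 \<le> C"
  shows "op_norm D N T \<le> ennreal C"
  unfolding op_norm_def
proof (rule SUP_least, rule ennreal_leI)
  fix x assume "x \<in> D"
  \<comment> \<open>Where \<open>N x = 0\<close> the quotient is 0, the value of a division by
    zero.\<close>
  then show "N (T x) / N x \<le> C" using assms(1,2)[of x] assms(3) by (cases "N x = 0") (auto simp: divide_le_eq)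
qed

section \<open>The diagonal blocks as Hilbert forms\<close>

locale problem = bounded_open S + network n l Rinv ap \<tau> \<alpha> \<beta> a
  for S :: "(real^'d::finite) set" and n l Rinv ap \<tau> \<alpha> \<beta> a
begin

abbreviation "P \<equiv> P_inner n"
abbreviation "Div v \<equiv> (\<lambda>i. weak_div S (v i))"

definition bu :: "'d vfield \<Rightarrow> 'd vfield \<Rightarrow> real" where
  "bu u w = inner (sym_grad S u) (sym_grad S w) + l * inner (weak_div S u) (weak_div S w)"

definition br :: "(nat \<Rightarrow> 'd vfield) \<Rightarrow> (nat \<Rightarrow> 'd vfield) \<Rightarrow> real" where
  "br v z = (\<Sum>i<n. Rinv i * inner (v i) (z i))"

definition bv :: "(nat \<Rightarrow> 'd vfield) \<Rightarrow> (nat \<Rightarrow> 'd vfield) \<Rightarrow> real" where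
  "bv v z = br v z + P (mat_app n Li (Div v)) (Div z)"

definition bp :: "(nat \<Rightarrow> 'd sfield) \<Rightarrow> (nat \<Rightarrow> 'd sfield) \<Rightarrow> real" where
  "bp p q = P (mat_app n L p) q"

abbreviation "bx \<equiv> form_sum bu (form_sum bv bp)"
abbreviation "ex \<equiv> form_sum (U_inner S) (form_sum (V_inner S n) (P_inner n))"

lemma bu_ge: "(norm (sym_grad S u))\<^sup>2 \<le> bu u u" "l * (norm (weak_div S u))\<^sup>2 \<le> bu u u"
  using l by (auto simp: bu_def power2_norm_eq_inner)

lemma U_equiv: "hilbert_form (U_space S) bu" "form_equiv (U_space S) bu (U_inner S)"
proof -
  interpret U: hilbert_form "U_space S" "U_inner S" by (rule hilbert_form_U_inner[OF opn])
  obtain K where K: "0 < K" "\<And>u. u \<in> U_space S \<Longrightarrow> U_inner S u u \<le> K * (norm (sym_grad S u))\<^sup>2" by (rule U_inner_le) blast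
  have lo: "(1 / K) * U_inner S u u \<le> bu u u" if "u \<in> U_space S" for u
  proof -
    have "(1 / K) * U_inner S u u \<le> (norm (sym_grad S u))\<^sup>2" using K(1) K(2)[OF that] by (simp add: field_simps)
    then show ?thesis using bu_ge(1)[of u] by linarith
  qed
  have up: "bu u u \<le> (1 + l * real CARD('d)) * U_inner S u u" if u: "u \<in> U_space S" for u
  proof -
    have g: "(norm (sym_grad S u))\<^sup>2 \<le> U_inner S u u"
      using norm_sym_grad_le[of u] by (simp add: U_inner_eq) (meson add_increasing sum_nonneg zero_le_power2 order_trans)
    have "bu u u \<le> (norm (sym_grad S u))\<^sup>2 + l * (real CARD('d) * (norm (sym_grad S u))\<^sup>2)"
      using norm_div_le[OF u] l by (simp add: bu_def power2_norm_eq_inner)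
    also have "\<dots> = (1 + l * real CARD('d)) * (norm (sym_grad S u))\<^sup>2" by (simp add: algebra_simps)
    also have "\<dots> \<le> (1 + l * real CARD('d)) * U_inner S u u" using g l by (intro mult_left_mono) auto
    finally show ?thesis .
  qed
  show "form_equiv (U_space S) bu (U_inner S)"
    by (rule form_equivI[OF _ lo up]) (use K in auto)
  show "hilbert_form (U_space S) bu"
  proof (rule U.equivalent_form[where b'=bu, OF _ _ _ _ lo up])
    show "0 < 1 / K" using K by simp
    show "bu u w = bu w u" for u w by (simp add: bu_def inner_commute)
  qed (simp_all add: bu_def sym_grad_add sym_grad_scaleR div_U_add div_U_scaleR inner_add_left distrib_left)
qed

lemma P_equiv: "hilbert_form (P_space S n) bp" "form_equiv (P_space S n) bp (P_inner n)"
proof -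
  interpret P: hilbert_form "P_space S n" "P_inner n" by (rule hilbert_form_P)
  obtain K where K: "0 \<le> K" "\<And>p :: nat \<Rightarrow> 'd sfield. P (mat_app n L p) p \<le> K * P p p" by (rule mat_app_bound) blast
  show "form_equiv (P_space S n) bp (P_inner n)"
    unfolding bp_def by (rule form_equivI[OF R(1) L_ge(1) K(2)])
  show "hilbert_form (P_space S n) bp"
  proof (rule P.equivalent_form[where c=R and C=K])
    show "bp p q = bp q p" for p q unfolding bp_def by (rule trans[OF L_symmetric P_inner_commute])
  qed (simp_all only: bp_def mat_app_linear P_inner_linear R(1) L_ge(1) K(2))
qed

lemma V_Hdiv_0: "v \<in> V_space S n \<Longrightarrow> v i \<in> Hdiv_0 S"
  using subspace_0[OF subspace_Hdiv_0] by (cases "i < n") (auto simp: V_space_def)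

lemma Div_linear:
  assumes "v \<in> V_space S n"
  shows "z \<in> V_space S n \<Longrightarrow> Div (v + z) = Div v + Div z" "Div (c *\<^sub>R v) = c *\<^sub>R Div v"
  using weak_div_linear[OF Hdiv_0_Hdiv[OF V_Hdiv_0[OF assms]]] Hdiv_0_Hdiv[OF V_Hdiv_0[of z]] by (auto simp: fun_eq_iff)

lemma Div_P: assumes "v \<in> V_space S n" shows "Div v \<in> P_space S n"
proof -
  have "weak_div S 0 = 0" using weak_div_linear(2)[OF Hdiv_0_Hdiv[OF subspace_0[OF subspace_Hdiv_0]], of 0] by simp
  then show ?thesis using assms weak_div_mean_zero by (auto simp: P_space_def V_space_def)
qed

lemma mat_app_P: "p \<in> P_space S n \<Longrightarrow> mat_app n M p \<in> P_space S n"
  using subspace_L2_mean_zero by (auto simp: P_space_def mat_app_def intro!: subspace_sum subspace_scale)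

lemma Li_bp: "P (mat_app n Li r) s = bp (mat_app n Li r) (mat_app n Li s)"
  unfolding bp_def by (rule Li_form)

lemma V_equiv: "hilbert_form (V_space S n) bv" "form_equiv (V_space S n) bv (V_inner S n)"
proof -
  interpret V: hilbert_form "V_space S n" "V_inner S n" by (rule hilbert_form_V)
  obtain K where K: "0 \<le> K" "\<And>p :: nat \<Rightarrow> 'd sfield. P (mat_app n L p) p \<le> K * P p p" by (rule mat_app_bound) blast
  define k where "k = K + 1"
  have k: "k > 0" "P (mat_app n L p) p \<le> k * P p p" for p :: "nat \<Rightarrow> 'd sfield"
    using K(1) K(2)[of p] P_inner_nonneg[of n p] by (auto simp: k_def distrib_right)
  \<comment> \<open>An upper bound \<open>k\<close> for \<open>L\<close> gives the lower bound 1/k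
    for its inverse: with s the preimage of \<open>r\<close>, expand the nonnegative form of
    \<open>L\<close> at k s - r.\<close>
  have Li_ge: "P r r \<le> k * P (mat_app n Li r) r" for r :: "nat \<Rightarrow> 'd sfield"
  proof -
    let ?s = "mat_app n Li r"
    have "0 \<le> R * P (k *\<^sub>R ?s - r) (k *\<^sub>R ?s - r)" using R(1) P_inner_nonneg by (intro mult_nonneg_nonneg) auto
    also have "\<dots> \<le> P (mat_app n L (k *\<^sub>R ?s - r)) (k *\<^sub>R ?s - r)" by (rule L_ge(1))
    also have "\<dots> = k * (k * P (mat_app n L ?s) ?s) - k * P (mat_app n L r) ?s - (k * P (mat_app n L ?s) r - P (mat_app n L r) r)"
      by (simp only: mat_app_linear P_inner_linear right_diff_distrib)
    also have "P (mat_app n L r) ?s = P (mat_app n L ?s) r" by (rule trans[OF L_symmetric P_inner_commute])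
    finally have "2 * (k * P r r) \<le> k * (k * P ?s r) + P (mat_app n L r) r"
      using trans[OF P_inner_L_Li[of r ?s] P_inner_commute[of n r ?s]] by (simp only: P_inner_L_Li)
    then have "k * P r r \<le> k * (k * P ?s r)" using k(2)[of r] by linarith
    then show ?thesis using k(1) by simp
  qed
  define r where "r = Min (Rinv ` {..<n})"
  have "Rinv 0 \<in> Rinv ` {..<n}" using n by auto
  then have "r \<in> Rinv ` {..<n}" unfolding r_def by (intro Min_in) auto
  then have r: "r > 0" using Rinv by auto
  have r_le: "r \<le> Rinv i" if "i < n" for i using that by (simp add: r_def)
  have Vi: "V_inner S n v v = (\<Sum>i<n. inner (v i) (v i)) + P (Div v) (Div v)" for v
    by (simp add: V_inner_def Hdiv_inner_def P_inner_def sum.distrib)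
  have lo: "min r (1 / k) * V_inner S n v v \<le> bv v v" for v
  proof -
    have "min r (1 / k) * (\<Sum>i<n. inner (v i) (v i)) \<le> br v v"
      unfolding br_def sum_distrib_left using r_le by (intro sum_mono mult_right_mono) (auto simp: min_le_iff_disj)
    moreover have "min r (1 / k) * P (Div v) (Div v) \<le> (1 / k) * P (Div v) (Div v)"
      using P_inner_nonneg by (intro mult_right_mono) auto
    moreover have "(1 / k) * P (Div v) (Div v) \<le> P (mat_app n Li (Div v)) (Div v)"
      using Li_ge[of "Div v"] k(1) by (simp add: field_simps)
    ultimately show ?thesis by (simp only: Vi bv_def distrib_left)
  qed
  have up: "bv v v \<le> (1 / R) * V_inner S n v v" for v
  proof -
    have "br v v \<le> (1 / R) * (\<Sum>i<n. inner (v i) (v i))"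
      unfolding br_def sum_distrib_left using R(2) by (intro sum_mono mult_right_mono) auto
    then show ?thesis using Li_le[of "Div v"] by (simp only: Vi bv_def distrib_left)
  qed
  have c: "0 < min r (1 / k)" using r k by simp
  show "form_equiv (V_space S n) bv (V_inner S n)"
    by (rule form_equivI[OF c lo up])
  show "hilbert_form (V_space S n) bv"
  proof (rule V.equivalent_form[where b'=bv, OF _ _ _ c lo up])
    show "bv v z = bv z v" for v z
    proof -
      have "P (mat_app n Li (Div v)) (Div z) = P (mat_app n Li (Div z)) (Div v)"
        unfolding Li_bp bp_def by (rule trans[OF L_symmetric P_inner_commute])
      then show ?thesis by (simp add: bv_def br_def inner_commute)
    qed
    show "bv (v + z) y = bv v y + bv z y" if "v \<in> V_space S n" "z \<in> V_space S n" for v z y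
      using that by (simp only: bv_def Div_linear mat_app_linear P_inner_linear)
        (simp add: br_def inner_add_left distrib_left sum.distrib)
    show "bv (c *\<^sub>R v) y = c * bv v y" if "v \<in> V_space S n" for c v y
      using that by (simp only: bv_def Div_linear mat_app_linear P_inner_linear distrib_left)
        (simp add: br_def sum_distrib_left mult_ac)
  qed
qed

lemma X_norm_eq: "X_norm S n x = sqrt (ex x x)"
proof -
  have nn: "0 \<le> U_inner S u u" "0 \<le> V_inner S n v v" for u v
    by (simp_all add: U_inner_def V_inner_def Hdiv_inner_def sum_nonneg)
  show ?thesis
    by (cases x) (simp add: X_norm_def U_norm_eq V_norm_eq P_norm_eq P_inner_nonneg nn add.assoc)
qed

lemma X_equiv: "hilbert_form (X_space S n) bx" "hilbert_form (X_space S n) ex" "form_equiv (X_space S n) bx ex"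
  unfolding X_space_def
  by (intro form_equiv_sum hilbert_form_sum U_equiv V_equiv P_equiv hilbert_form_U_inner hilbert_form_V hilbert_form_P opn)+

lemma B_bij:
  "bij_betw (B_u S l) (U_space S) (U_dual S)"
  "bij_betw (B_v S n l Rinv ap a) (V_space S n) (V_dual S n)"
  "bij_betw (B_p S n l Rinv ap a) (P_space S n) (P_dual S n)"
  using dual_bij[OF U_equiv(1) hilbert_form_U_inner[OF opn] U_equiv(2)] dual_bij[OF V_equiv(1) hilbert_form_V V_equiv(2)]
    dual_bij[OF P_equiv(1) hilbert_form_P P_equiv(2)]
  unfolding B_u_def[abs_def] B_v_def[abs_def] B_p_def[abs_def] bu_def[symmetric] mat_form_eq
    bv_def[unfolded br_def, symmetric] bp_def[symmetric] U_norm_eq[symmetric] V_norm_eq[symmetric] P_norm_eq[symmetric] .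

end

section \<open>Boundedness and stability\<close>

lemma (in hilbert_form) sum_le: "x \<in> D \<Longrightarrow> y \<in> D \<Longrightarrow> b (x + y) (x + y) \<le> 2 * b x x + 2 * b y y"
  using nonneg[OF D_diff[of x y]] sym[of y x]
  by (simp add: add_left add_right diff_left diff_right D_add D_diff)

text \<open>The abstract situation of a symmetric indefinite form: an upper bound on its diagonal,
  and for each \<open>x\<close> a test element realising the inf-sup condition.\<close>

locale symmetric_inf_sup = hilbert_form D b for D :: "'a::real_vector set" and b +
  fixes A :: "'a \<Rightarrow> 'a \<Rightarrow> real" and K M :: real
  assumes A_add: "\<And>x y z. x \<in> D \<Longrightarrow> y \<in> D \<Longrightarrow> z \<in> D \<Longrightarrow> A (x + y) z = A x z + A y z"
    and A_scale: "\<And>c x z. x \<in> D \<Longrightarrow> z \<in> D \<Longrightarrow> A (c *\<^sub>R x) z = c * A x z"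
    and A_sym: "\<And>x y. x \<in> D \<Longrightarrow> y \<in> D \<Longrightarrow> A x y = A y x"
    and A_diag: "\<And>x. x \<in> D \<Longrightarrow> \<bar>A x x\<bar> \<le> K * b x x" and K: "0 \<le> K"
    and inf_sup: "\<And>x. x \<in> D \<Longrightarrow> \<exists>y\<in>D. b y y \<le> M * b x x \<and> (1/2) * b x x \<le> A x y" and M: "0 \<le> M"
begin

lemma A_add_right: "x \<in> D \<Longrightarrow> y \<in> D \<Longrightarrow> z \<in> D \<Longrightarrow> A z (x + y) = A z x + A z y"
  by (simp add: A_sym[of z] A_add D_add)

lemma A_scale_right: "x \<in> D \<Longrightarrow> z \<in> D \<Longrightarrow> A z (c *\<^sub>R x) = c * A z x"
  by (simp add: A_sym[of z] A_scale D_scale)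

text \<open>Polarisation loses nothing: for normalised arguments the parallelogram law gives the
  constant \<open>K\<close> of the diagonal.\<close>

lemma A_bound: assumes x: "x \<in> D" and y: "y \<in> D" shows "\<bar>A x y\<bar> \<le> K * sqrt (b x x) * sqrt (b y y)"
proof (cases "x = 0 \<or> y = 0")
  case True
  then have "A x y = 0"
    using A_scale[OF D_zero y, of 0] A_scale_right[OF D_zero x, of 0] by auto
  then show ?thesis using K nonneg x y by simp
next
  case False
  then have p: "sqrt (b x x) > 0" "sqrt (b y y) > 0" using pos x y by auto
  have polar: "2 * \<bar>A x y\<bar> \<le> K * (b x x + b y y)" if x: "x \<in> D" and y: "y \<in> D" for x y
  proof -
    have my: "(-1) *\<^sub>R y \<in> D" by (rule D_scale[OF y])
    have "4 * A x y = A (x + y) (x + y) - A (x + (-1) *\<^sub>R y) (x + (-1) *\<^sub>R y)"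
      using x y my A_sym[OF x y] by (simp only: A_add A_add_right D_add A_scale A_scale_right) (simp add: algebra_simps)
    moreover have "b (x + y) (x + y) + b (x + (-1) *\<^sub>R y) (x + (-1) *\<^sub>R y) = 2 * (b x x + b y y)"
      using x y my by (simp only: add_left add_right D_add scale_left scale_right) (simp add: algebra_simps)
    then have "K * b (x + y) (x + y) + K * b (x + (-1) *\<^sub>R y) (x + (-1) *\<^sub>R y) = 2 * (K * (b x x + b y y))"
      by (simp only: distrib_left[symmetric] mult.left_commute)
    ultimately show ?thesis
      using A_diag[OF D_add[OF x y]] A_diag[OF D_add[OF x my]] by linarith
  qed
  let ?x = "(1 / sqrt (b x x)) *\<^sub>R x" and ?y = "(1 / sqrt (b y y)) *\<^sub>R y"
  have "b ?x ?x = 1" "b ?y ?y = 1"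
    using p x y by (simp_all add: scale_left scale_right D_scale real_sqrt_mult_self)
  then have "\<bar>A ?x ?y\<bar> \<le> K" using polar[OF D_scale[OF x] D_scale[OF y], of "1 / sqrt (b x x)" "1 / sqrt (b y y)"] by simp
  moreover have "A ?x ?y = A x y / (sqrt (b x x) * sqrt (b y y))"
    using x y by (simp add: A_scale A_scale_right D_scale)
  ultimately have "\<bar>A x y\<bar> / (sqrt (b x x) * sqrt (b y y)) \<le> K" using p by (simp add: abs_mult)
  then show ?thesis using p by (simp add: divide_le_eq mult_ac)
qed

text \<open>The upper bound tests with \<open>T x\<close>, the lower bound with the inf-sup element;
  surjectivity follows from the symmetry of \<open>A\<close> through
  \<open>symmetric_surj\<close>.\<close>

lemma operator_bounds:
  assumes T: "\<And>x. x \<in> D \<Longrightarrow> T x \<in> D" "\<And>x y. x \<in> D \<Longrightarrow> y \<in> D \<Longrightarrow> b (T x) y = A x y"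
  shows "bij_betw T D D"
    "x \<in> D \<Longrightarrow> sqrt (b (T x) (T x)) \<le> K * sqrt (b x x)"
    "x \<in> D \<Longrightarrow> sqrt (b x x) \<le> (2 * sqrt M) * sqrt (b (T x) (T x))"
proof -
  have up: "sqrt (b (T x) (T x)) \<le> K * sqrt (b x x)" if x: "x \<in> D" for x
  proof -
    have n: "0 \<le> b (T x) (T x)" by (intro nonneg T x)
    have "sqrt (b (T x) (T x)) * sqrt (b (T x) (T x)) = A x (T x)" using n T(2)[OF x T(1)[OF x]] by simp
    also have "\<dots> \<le> (K * sqrt (b x x)) * sqrt (b (T x) (T x))" using A_bound[OF x T(1)[OF x]] by linarith
    finally show ?thesis by (rule le_if_square_le) (use n nonneg[OF x] K in auto)
  qed
  have lo: "sqrt (b x x) \<le> (2 * sqrt M) * sqrt (b (T x) (T x))" if x: "x \<in> D" for x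
  proof -
    have n: "0 \<le> b (T x) (T x)" "0 \<le> b x x" by (intro nonneg T x)+
    obtain y where y: "y \<in> D" "b y y \<le> M * b x x" "(1/2) * b x x \<le> A x y" using inf_sup[OF x] by blast
    have "(1/2) * (sqrt (b x x) * sqrt (b x x)) \<le> b (T x) y" using y(3) T(2)[OF x y(1)] n by simp
    also have "\<dots> \<le> sqrt (b (T x) (T x)) * sqrt (b y y)" using Cauchy_Schwarz[OF T(1)[OF x] y(1)] by linarith
    also have "\<dots> \<le> sqrt (b (T x) (T x)) * (sqrt M * sqrt (b x x))"
      unfolding real_sqrt_mult[symmetric] using y(2) n by (intro mult_left_mono real_sqrt_le_mono) auto
    finally have "sqrt (b x x) * sqrt (b x x) \<le> ((2 * sqrt M) * sqrt (b (T x) (T x))) * sqrt (b x x)" by (simp add: mult_ac)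
    then show ?thesis by (rule le_if_square_le) (use n M in auto)
  qed
  show "bij_betw T D D"
    unfolding bij_betw_def
  proof
    show "inj_on T D"
    proof (rule inj_onI, rule ccontr)
      fix x y assume xy: "x \<in> D" "y \<in> D" "T x = T y" "x \<noteq> y"
      have d: "x + (-1) *\<^sub>R y \<in> D" using xy by (intro D_add D_scale)
      have A0: "A (x + (-1) *\<^sub>R y) z = 0" if z: "z \<in> D" for z
        unfolding A_add[OF xy(1) D_scale[OF xy(2)] z] A_scale[OF xy(2) z]
        using T(2)[OF xy(1) z] T(2)[OF xy(2) z] xy(3) by simp
      obtain z where z: "z \<in> D" "(1/2) * b (x + (-1) *\<^sub>R y) (x + (-1) *\<^sub>R y) \<le> A (x + (-1) *\<^sub>R y) z"
        using inf_sup[OF d] by blast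
      moreover have "0 < b (x + (-1) *\<^sub>R y) (x + (-1) *\<^sub>R y)" using xy by (intro pos d) auto
      ultimately show False using A0[OF z(1)] by linarith
    qed
    have "\<exists>x\<in>D. T x = y" if y: "y \<in> D" for y
    proof (cases "M = 0")
      \<comment> \<open>With \<open>M = 0\<close> the space is trivial; otherwise
        \<open>1 / (4 * M)\<close> is the lower constant for \<open>symmetric_surj\<close>.\<close>
      case True
      have "b y y = 0" using lo[OF y] nonneg[OF y] True by simp
      then have "y = 0" using pos[OF y] by fastforce
      moreover have "T 0 = 0" using up[OF D_zero] zero_left[OF D_zero] nonneg[OF T(1)[OF D_zero]] pos[OF T(1)[OF D_zero]] by force
      ultimately show ?thesis using D_zero by blast
    next
      case False
      then have M': "M > 0" using M by simp
      have sq_up: "b (T x) (T x) \<le> K\<^sup>2 * b x x" if x: "x \<in> D" for x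
        using power_mono[OF up[OF x] real_sqrt_ge_zero, where n=2] nonneg[OF x] nonneg[OF T(1)[OF x]] by (simp add: power_mult_distrib)
      have "b x x \<le> (4 * M) * b (T x) (T x)" if x: "x \<in> D" for x
        using power_mono[OF lo[OF x] real_sqrt_ge_zero, where n=2] nonneg[OF x] nonneg[OF T(1)[OF x]] M by (simp add: power_mult_distrib)
      then have sq_lo: "(1 / (4 * M)) * b x x \<le> b (T x) (T x)" if x: "x \<in> D" for x
        using that M' by (simp add: field_simps)
      have s: "b (T x) y = b x (T y)" if "x \<in> D" "y \<in> D" for x y
        using T[OF that(1)] T[OF that(2)] that A_sym[OF that] sym[OF that(1) T(1)[OF that(2)]] by simp
      obtain x where "x \<in> D" "T x = y"
      proof (rule symmetric_surj[where T=T and c="1 / (4 * M)" and C="K\<^sup>2" and y=y])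
        show "0 < 1 / (4 * M)" using M' by simp
      qed (use T(1) s sq_lo sq_up y in blast)+
      then show ?thesis by blast
    qed
    then show "T ` D = D" using T(1) by blast
  qed
  show "x \<in> D \<Longrightarrow> sqrt (b (T x) (T x)) \<le> K * sqrt (b x x)" "x \<in> D \<Longrightarrow> sqrt (b x x) \<le> (2 * sqrt M) * sqrt (b (T x) (T x))"
    using up lo by auto
qed

end

lemma P_inner_minus: "P_inner n (- p) q = - P_inner n p q" "P_inner n q (- p) = - P_inner n q p"
  by (simp_all add: P_inner_def sum_negf)

lemma mat_app_minus: "mat_app n M (- p) = - mat_app n M p"
  by (simp add: mat_app_def fun_eq_iff sum_negf)

context problem
begin

section \<open>The saddle point form\<close>

abbreviation "A \<equiv> A_form S n l Rinv ap a"

lemma A_eq: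
  "A (u, v, p) (w, z, q) = bu u w - inner (\<Sum>i<n. p i) (weak_div S w) + br v z - P p (Div z)
    - inner (weak_div S u) (\<Sum>i<n. q i) - P (Div v) q - P (mat_app n L12 p) q"
  by (simp add: A_form_def bu_def br_def P_inner_def mat_form_eq)

lemma A_symmetric: "A x y = A y x"
proof -
  obtain u v p w z q where e: "x = (u, v, p)" "y = (w, z, q)" by (metis prod.exhaust)
  have "bu u w = bu w u" "br v z = br z v" by (simp_all add: bu_def br_def inner_commute)
  moreover have "P (mat_app n L12 p) q = P (mat_app n L12 q) p" by (rule trans[OF L12_symmetric P_inner_commute])
  ultimately show ?thesis
    unfolding e A_eq P_inner_commute[of n p "Div z"] P_inner_commute[of n "Div v" q] inner_commute[of "weak_div S u"]
      inner_commute[of "\<Sum>i<n. p i"] by simp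
qed

lemma br_linear: "br (v + v') z = br v z + br v' z" "br (c *\<^sub>R v) z = c * br v z"
  by (simp_all add: br_def inner_add_left distrib_left sum.distrib sum_distrib_left mult_ac)

lemma A_linear:
  assumes "x \<in> X_space S n"
  shows "y \<in> X_space S n \<Longrightarrow> A (x + y) t = A x t + A y t" "A (c *\<^sub>R x) t = c * A x t"
proof -
  obtain u v p where x: "x = (u, v, p)" "u \<in> U_space S" "v \<in> V_space S n" using assms by (auto simp: X_space_def)
  obtain w z q where t: "t = (w, z, q)" by (cases t)
  show "A (c *\<^sub>R x) t = c * A x t"
    unfolding x t scaleR_Pair A_eq div_U_scaleR[OF x(2)] Div_linear[OF x(3)] mat_app_linear P_inner_linear br_linear bu_def sym_grad_scaleR[OF x(2)]
    by (simp add: algebra_simps scaleR_sum_right[symmetric])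
  show "A (x + y) t = A x t + A y t" if "y \<in> X_space S n"
  proof -
    obtain u' v' p' where y: "y = (u', v', p')" "u' \<in> U_space S" "v' \<in> V_space S n" using \<open>y \<in> X_space S n\<close> by (auto simp: X_space_def)
    show ?thesis
      unfolding x y t add_Pair A_eq div_U_add[OF x(2) y(2)] Div_linear(1)[OF x(3) y(3)] mat_app_linear P_inner_linear br_linear bu_def sym_grad_add[OF x(2) y(2)]
      by (simp add: algebra_simps sum.distrib inner_add_left inner_add_right)
  qed
qed

lemma br_nonneg: "0 \<le> br v v"
  unfolding br_def using Rinv by (intro sum_nonneg mult_nonneg_nonneg) (auto intro: less_imp_le)

lemma bp_nonneg: "0 \<le> bp p p"
  using L_ge(1)[of p] R(1) P_inner_nonneg[of n p] unfolding bp_def by (meson less_imp_le mult_nonneg_nonneg order_trans)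

text \<open>\<open>l0\<close> is 1 or \<open>l\<close>: the first case uses the symmetric gradient,
  the second the divergence term of \<open>bu\<close>. Together with the \<open>Lambda4\<close> part
  of \<open>bp\<close> this bounds the coupling of \<open>u\<close> and \<open>p\<close> uniformly
  in \<open>l\<close>.\<close>

lemma div_le_bu: "u \<in> U_space S \<Longrightarrow> l0 * (norm (weak_div S u))\<^sup>2 \<le> real CARD('d) * bu u u"
proof -
  assume u: "u \<in> U_space S"
  have b: "0 \<le> bu u u" using bu_ge(1)[of u] zero_le_power2 by (rule order_trans[rotated])
  have "(norm (weak_div S u))\<^sup>2 \<le> real CARD('d) * bu u u"
    using norm_div_le[OF u] bu_ge(1)[of u] by (meson mult_left_mono of_nat_0_le_iff order_trans)
  moreover have "l * (norm (weak_div S u))\<^sup>2 \<le> real CARD('d) * bu u u"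
  proof -
    have "1 * bu u u \<le> real CARD('d) * bu u u" using b by (intro mult_right_mono) (simp_all add: Suc_leI)
    then show ?thesis using bu_ge(2)[of u] by linarith
  qed
  ultimately show ?thesis by (simp add: max_def)
qed


text \<open>The hypothesis is the expanded square of 2k x - y in a semidefinite form, with A, B, C
  its values at (x, x), (x, y), (y, y).\<close>

lemma Young_real: "0 \<le> 4 * k\<^sup>2 * A - 4 * k * B + C \<Longrightarrow> 0 < k \<Longrightarrow> B \<le> k * A + C / (4 * k)" for A B C k :: real
  by (simp add: field_simps power2_eq_square)

lemma inner_Young: "0 < k \<Longrightarrow> inner x y \<le> k * (norm x)\<^sup>2 + (norm y)\<^sup>2 / (4 * k)" for x y :: "'b::real_inner"
  using inner_ge_zero[of "(2 * k) *\<^sub>R x - y"]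
  by (intro Young_real) (simp_all only: power2_norm_eq_inner, simp add: inner_diff_left inner_diff_right inner_commute power2_eq_square algebra_simps)

lemma br_Young: "0 < k \<Longrightarrow> br v z \<le> k * br v v + br z z / (4 * k)"
proof -
  assume k: "0 < k"
  have "Rinv i * inner (v i) (z i) \<le> k * (Rinv i * inner (v i) (v i)) + Rinv i * inner (z i) (z i) / (4 * k)" if "i < n" for i
    using mult_left_mono[OF inner_Young[OF k, of "v i" "z i"] less_imp_le[OF Rinv[OF that]]]
    by (simp add: power2_norm_eq_inner distrib_left mult_ac)
  then have "br v z \<le> (\<Sum>i<n. k * (Rinv i * inner (v i) (v i)) + Rinv i * inner (z i) (z i) / (4 * k))"
    unfolding br_def by (intro sum_mono) auto
  then show ?thesis by (simp add: br_def sum.distrib sum_distrib_left sum_divide_distrib)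
qed

lemma L12_Young: "0 < k \<Longrightarrow> P (mat_app n L12 p) q \<le> k * P (mat_app n L12 p) p + P (mat_app n L12 q) q / (4 * k)"
proof (rule Young_real)
  have "0 \<le> P (mat_app n L12 ((2 * k) *\<^sub>R p - q)) ((2 * k) *\<^sub>R p - q)" by (rule L12_nonneg)
  also have "\<dots> = (2 * k) * ((2 * k) * P (mat_app n L12 p) p) - (2 * k) * P (mat_app n L12 q) p
      - ((2 * k) * P (mat_app n L12 p) q - P (mat_app n L12 q) q)"
    by (simp only: mat_app_linear P_inner_linear right_diff_distrib)
  also have "P (mat_app n L12 q) p = P (mat_app n L12 p) q" by (rule trans[OF L12_symmetric P_inner_commute])
  finally show "0 \<le> 4 * k\<^sup>2 * P (mat_app n L12 p) p - 4 * k * P (mat_app n L12 p) q + P (mat_app n L12 q) q"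
    by (simp add: power2_eq_square)
qed

lemma bp_Young: "0 < k \<Longrightarrow> bp p q \<le> k * bp p p + bp q q / (4 * k)"
proof (rule Young_real)
  have "0 \<le> bp ((2 * k) *\<^sub>R p - q) ((2 * k) *\<^sub>R p - q)" by (rule bp_nonneg)
  also have "\<dots> = (2 * k) * ((2 * k) * bp p p) - (2 * k) * bp q p - ((2 * k) * bp p q - bp q q)"
    by (simp only: bp_def mat_app_linear P_inner_linear right_diff_distrib)
  also have "bp q p = bp p q" unfolding bp_def by (rule trans[OF L_symmetric P_inner_commute])
  finally show "0 \<le> 4 * k\<^sup>2 * bp p p - 4 * k * bp p q + bp q q" by (simp add: power2_eq_square)
qed

lemma bp_split: "bp p p = P (mat_app n L12 p) p + R * P p p + (1 / l0) * (norm (\<Sum>i<n. p i))\<^sup>2"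
  unfolding bp_def L_split power2_norm_eq_inner ..

lemma P_Div: "P p (Div z) = bp (mat_app n Li (Div z)) p"
  unfolding bp_def P_inner_L_Li by (rule P_inner_commute)

lemma bv_split: "bv v v = br v v + bp (mat_app n Li (Div v)) (mat_app n Li (Div v))"
  unfolding bv_def Li_bp ..

lemma sum_le_bp: "(1 / l0) * (norm (\<Sum>i<n. p i))\<^sup>2 \<le> bp p p"
  unfolding bp_def power2_norm_eq_inner by (rule L_ge(2))

text \<open>The coupling of \<open>u\<close> and \<open>p\<close> costs d times \<open>bu\<close>
  plus one \<open>bp\<close>, that of \<open>v\<close> and \<open>p\<close> two \<open>bp\<close>
  and half of the divergence part of \<open>bv\<close>, and the \<open>L12\<close> term at most one
  more \<open>bp\<close>. The coefficients are thus at most d + 1 on \<open>bu\<close>, 4 on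
  \<open>bp\<close> and 1 on \<open>bv\<close>.\<close>

lemma A_diagonal:
  assumes "x \<in> X_space S n"
  shows "\<bar>A x x\<bar> \<le> (real CARD('d) + 4) * bx x x"
proof -
  obtain u v p where x: "x = (u, v, p)" "u \<in> U_space S" using assms by (auto simp: X_space_def)
  let ?s = "mat_app n Li (Div v)" and ?d = "real CARD('d)"
  have l0: "0 < l0" by simp
  have bu: "0 \<le> bu u u" using bu_ge(1)[of u] zero_le_power2 by (rule order_trans[rotated])
  have 1: "\<bar>2 * inner (\<Sum>i<n. p i) (weak_div S u)\<bar> \<le> ?d * bu u u + bp p p"
  proof -
    \<comment> \<open>After doubling, the Young weights are l0 and 1/l0, as in
      \<open>div_le_bu\<close> and \<open>sum_le_bp\<close>.\<close>
    have k: "0 < l0 / 2" using l0 by simp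
    have "\<bar>inner (weak_div S u) (\<Sum>i<n. p i)\<bar> \<le> (l0 / 2) * (norm (weak_div S u))\<^sup>2 + (norm (\<Sum>i<n. p i))\<^sup>2 / (4 * (l0 / 2))"
      using inner_Young[OF k, of "weak_div S u" "\<Sum>i<n. p i"] inner_Young[OF k, of "- weak_div S u" "\<Sum>i<n. p i"] by auto
    then show ?thesis using div_le_bu[OF x(2)] sum_le_bp[of p] by (simp add: inner_commute)
  qed
  have 2: "\<bar>2 * P p (Div v)\<bar> \<le> 2 * bp p p + bp ?s ?s / 2"
  proof -
    have "bp (- p) ?s = - bp p ?s" "bp (- p) (- p) = bp p p" 
      by (simp_all add: bp_def mat_app_minus P_inner_minus)
    moreover have "bp ?s p = bp p ?s" unfolding bp_def by (rule trans[OF L_symmetric P_inner_commute])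
    ultimately show ?thesis
      using bp_Young[of 1 p ?s] bp_Young[of 1 "- p" ?s] unfolding P_Div abs_le_iff by simp
  qed
  have 3: "0 \<le> P (mat_app n L12 p) p" "P (mat_app n L12 p) p \<le> bp p p"
    using L12_nonneg[of p] bp_split[of p] R(1) P_inner_nonneg[of n p] l0 by auto
  have "A x x = bu u u - 2 * inner (\<Sum>i<n. p i) (weak_div S u) + br v v - 2 * P p (Div v) - P (mat_app n L12 p) p"
    unfolding x A_eq inner_commute[of "weak_div S u"] P_inner_commute[of n "Div v"] by simp
  moreover have "0 \<le> ?d * bu u u" "0 \<le> ?d * bv v v" "0 \<le> ?d * bp p p" "br v v \<le> bv v v" "bp ?s ?s \<le> bv v v"
    using bu bv_split[of v] br_nonneg[of v] bp_nonneg[of ?s] bp_nonneg[of p] by simp_all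
  ultimately have "\<bar>A x x\<bar> \<le> (?d * bu u u + 4 * bu u u) + (?d * bv v v + 4 * bv v v) + (?d * bp p p + 4 * bp p p)"
    using 1 2 3 bu br_nonneg[of v] bp_nonneg[of ?s] bp_nonneg[of p] unfolding abs_le_iff
    by - (elim conjE, intro conjI; linarith)
  also have "\<dots> = (?d + 4) * bx x x" by (simp add: x algebra_simps)
  finally show ?thesis .
qed

text \<open>\<open>\<delta>\<close> exceeds by 1 what the cross terms take from
  \<open>bu u u\<close>, namely Cd + 1 through \<open>w0\<close> and d through \<open>q0\<close>; it
  covers the losses of \<open>br v v\<close> and of the \<open>L12\<close> part as well. Of the
  squares gained by the corrections, 3/4 of \<open>N4\<close> and of \<open>N3\<close> and 1/2 of
  \<open>bp q0 q0\<close> survive, whence the factor 1/2.\<close>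

lemma inf_sup_condition:
  assumes Cd: "0 < Cd" "\<And>g. g \<in> L2_mean_zero S \<Longrightarrow> \<exists>w\<in>U_space S. weak_div S w = g \<and> U_inner S w w \<le> Cd * (norm g)\<^sup>2"
    and x: "x \<in> X_space S n"
  defines "\<delta> \<equiv> Cd + real CARD('d) + 2"
  shows "\<exists>y\<in>X_space S n. bx y y \<le> (2 * \<delta>\<^sup>2 + 2 * (Cd + 1)) * bx x x \<and> (1/2) * bx x x \<le> A x y"
proof -
  interpret X: hilbert_form "X_space S n" bx by (rule X_equiv)
  interpret U: hilbert_form "U_space S" bu by (rule U_equiv)
  obtain u v p where xe: "x = (u, v, p)" and u: "u \<in> U_space S" and v: "v \<in> V_space S n" and p: "p \<in> P_space S n"
    using x by (auto simp: X_space_def)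
  let ?d = "real CARD('d)" and ?sp = "\<Sum>i<n. p i"
  have l0: "0 < l0" "1 \<le> l0" "l \<le> l0" by auto
  have Z: "subspace (L2_mean_zero S)" by (rule subspace_L2_mean_zero)
  have pi: "p i \<in> L2_mean_zero S" for i using p subspace_0[OF Z] by (cases "i < n") (auto simp: P_space_def)
  have U_ge: "(norm w)\<^sup>2 \<le> U_inner S w w" "(norm (sym_grad S w))\<^sup>2 \<le> U_inner S w w" for w :: "'d vfield"
  proof -
    have "(norm w)\<^sup>2 = (\<Sum>i\<in>UNIV. (norm (w $ i))\<^sup>2)" by (simp only: power2_norm_eq_inner inner_vec_def)
    moreover have "0 \<le> (\<Sum>i\<in>UNIV. (norm (w $ i))\<^sup>2)" "0 \<le> grad2 w" by (simp_all add: sum_nonneg grad2_def)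
    ultimately show "(norm w)\<^sup>2 \<le> U_inner S w w" "(norm (sym_grad S w))\<^sup>2 \<le> U_inner S w w"
      using norm_sym_grad_le[of w] by (simp_all add: U_inner_eq)
  qed
  define q0 where "q0 = mat_app n Li (Div v)"
  define N3 where "N3 = R * P p p"
  define N4 where "N4 = (1 / l0) * (norm ?sp)\<^sup>2"
  define N12 where "N12 = P (mat_app n L12 p) p"
  have nn: "0 \<le> bu u u" "0 \<le> br v v" "0 \<le> bp q0 q0" "0 \<le> N3" "0 \<le> N4" "0 \<le> N12"
    using U.nonneg[OF u] br_nonneg bp_nonneg R(1) P_inner_nonneg[of n p] l0(1) L12_nonneg
    by (simp_all add: N3_def N4_def N12_def)
  have bxx: "bx x x = bu u u + (br v v + bp q0 q0) + (N12 + N3 + N4)"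
    unfolding xe form_sum_simps bv_split bp_split N12_def N3_def N4_def q0_def by simp

  \<comment> \<open>\<open>w0\<close>, \<open>z0\<close> and \<open>q0\<close> produce the squares that $A(x, (u, v, -p))$ lacks: those of \<open>\<Lambda>\<^sub>4\<close>, \<open>\<Lambda>\<^sub>3\<close> and $\Lambda^{-1}$\<close>
  have "(1 / l0) *\<^sub>R ?sp \<in> L2_mean_zero S" by (intro subspace_scale[OF Z] subspace_sum[OF Z] pi)
  then obtain w0 where w0: "w0 \<in> U_space S" "weak_div S w0 = (1 / l0) *\<^sub>R ?sp"
    "U_inner S w0 w0 \<le> Cd * (norm ((1 / l0) *\<^sub>R ?sp))\<^sup>2" using Cd(2) by blast
  \<comment> \<open>Both 1/l0 and l/l0 are at most 1, so the energy of \<open>w0\<close> is bounded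
    independently of \<open>l\<close>.\<close>
  have bw0: "bu w0 w0 \<le> (Cd + 1) * N4"
  proof -
    have g: "(norm ((1 / l0) *\<^sub>R ?sp))\<^sup>2 = (1 / l0) * N4"
      by (simp add: N4_def power_mult_distrib power2_eq_square)
    have "bu w0 w0 = (norm (sym_grad S w0))\<^sup>2 + l * (norm (weak_div S w0))\<^sup>2"
      by (simp add: bu_def power2_norm_eq_inner)
    also have "\<dots> \<le> Cd * ((1 / l0) * N4) + l * ((1 / l0) * N4)"
      using w0(3) U_ge(2)[of w0] unfolding w0(2) g by linarith
    also have "\<dots> \<le> Cd * N4 + 1 * N4"
    proof (intro add_mono)
      have "(1 / l0) * N4 \<le> 1 * N4" using l0 nn by (intro mult_right_mono) auto
      then show "Cd * ((1 / l0) * N4) \<le> Cd * N4" using Cd(1) by (intro mult_left_mono) auto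
      have "(l / l0) * N4 \<le> 1 * N4" using l0 nn by (intro mult_right_mono) auto
      then show "l * ((1 / l0) * N4) \<le> 1 * N4" by simp
    qed
    finally show ?thesis by (simp add: distrib_right)
  qed

  have "\<exists>z. z \<in> U_space S \<and> weak_div S z = R *\<^sub>R p i \<and> U_inner S z z \<le> Cd * (norm (R *\<^sub>R p i))\<^sup>2" for i
    using Cd(2)[OF subspace_scale[OF Z pi]] by blast
  then have "\<forall>i. \<exists>z. z \<in> U_space S \<and> weak_div S z = R *\<^sub>R p i \<and> U_inner S z z \<le> Cd * (norm (R *\<^sub>R p i))\<^sup>2" by blast
  then obtain \<zeta> where \<zeta>: "\<And>i. \<zeta> i \<in> U_space S" "\<And>i. weak_div S (\<zeta> i) = R *\<^sub>R p i"
    "\<And>i. U_inner S (\<zeta> i) (\<zeta> i) \<le> Cd * (norm (R *\<^sub>R p i))\<^sup>2" by (auto dest!: choice)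
  define z0 where "z0 = (\<lambda>i. if i < n then \<zeta> i else 0)"
  have z0: "z0 \<in> V_space S n" using U_Hdiv_0[OF \<zeta>(1)] by (auto simp: V_space_def z0_def)
  have Dz0: "Div z0 = R *\<^sub>R p"
    using Div_P[OF z0] p \<zeta>(2) by (auto simp: fun_eq_iff P_space_def z0_def)
  \<comment> \<open>\<open>Rinv i \<le> 1 / R\<close> cancels one of the two factors
    \<open>R\<close> in the squared norm of \<open>R *\<^sub>R p i\<close>, which leaves
    \<open>N3\<close>.\<close>
  have brz0: "br z0 z0 \<le> Cd * N3"
  proof -
    have "Rinv i * inner (z0 i) (z0 i) \<le> (Cd * R) * inner (p i) (p i)" if i: "i < n" for i
    proof -
      have "inner (z0 i) (z0 i) \<le> Cd * (R\<^sup>2 * inner (p i) (p i))"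
      proof -
        have "(norm (R *\<^sub>R p i))\<^sup>2 = R\<^sup>2 * inner (p i) (p i)"
          by (simp only: norm_scaleR power_mult_distrib power2_abs power2_norm_eq_inner)
        then show ?thesis using U_ge(1)[of "\<zeta> i"] \<zeta>(3)[of i] i by (simp add: z0_def power2_norm_eq_inner)
      qed
      then have "Rinv i * inner (z0 i) (z0 i) \<le> (1 / R) * (Cd * (R\<^sup>2 * inner (p i) (p i)))"
        using R(2)[OF i] R(1) by (intro mult_mono) auto
      then show ?thesis using R(1) by (simp add: power2_eq_square)
    qed
    then have "br z0 z0 \<le> (\<Sum>i<n. (Cd * R) * inner (p i) (p i))" unfolding br_def by (intro sum_mono) auto
    then show ?thesis by (simp add: N3_def P_inner_def sum_distrib_left mult_ac)
  qed
  have bvz0: "bv z0 z0 \<le> (Cd + 1) * N3"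
  proof -
    have "P (mat_app n Li (R *\<^sub>R p)) (R *\<^sub>R p) \<le> (1 / R) * P (R *\<^sub>R p) (R *\<^sub>R p)" by (rule Li_le)
    also have "\<dots> = N3" using R(1) by (simp only: P_inner_linear N3_def) simp
    finally show ?thesis using brz0 by (simp only: bv_def Dz0 distrib_right)
  qed

  define y where "y = (\<delta> *\<^sub>R u + (-1) *\<^sub>R w0, \<delta> *\<^sub>R v + (-1) *\<^sub>R z0, \<delta> *\<^sub>R (- p) + (-1) *\<^sub>R q0)"
  let ?x' = "(u, v, - p)" and ?y0 = "(w0, z0, q0)"
  have q0: "q0 \<in> P_space S n" unfolding q0_def by (intro mat_app_P Div_P v)
  have x': "?x' \<in> X_space S n" and y0: "?y0 \<in> X_space S n"
    using u v p w0 z0 q0 subspace_scale[OF subspace_P_space p, of "-1"] by (auto simp: X_space_def)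
  have ye: "y = \<delta> *\<^sub>R ?x' + (-1) *\<^sub>R ?y0" by (simp add: y_def)
  have "y \<in> X_space S n" unfolding ye by (intro X.D_add X.D_scale x' y0)
  moreover have "bx y y \<le> (2 * \<delta>\<^sup>2 + 2 * (Cd + 1)) * bx x x"
  proof -
    have "bx y y \<le> 2 * bx (\<delta> *\<^sub>R ?x') (\<delta> *\<^sub>R ?x') + 2 * bx ((-1) *\<^sub>R ?y0) ((-1) *\<^sub>R ?y0)"
      unfolding ye by (intro X.sum_le X.D_scale x' y0)
    also have "bx (\<delta> *\<^sub>R ?x') (\<delta> *\<^sub>R ?x') = \<delta>\<^sup>2 * bx ?x' ?x'"
      by (simp only: X.scale_left[OF x' X.D_scale[OF x']] X.scale_right[OF x' x'] power2_eq_square mult.assoc)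
    \<comment> \<open>Flipping the sign of \<open>p\<close> is an isometry of a block-diagonal
      form.\<close>
    also have "bx ?x' ?x' = bx x x" by (simp add: xe bp_def mat_app_minus P_inner_minus)
    also have "bx ((-1) *\<^sub>R ?y0) ((-1) *\<^sub>R ?y0) = bx ?y0 ?y0"
      by (simp only: X.scale_left[OF y0 X.D_scale[OF y0]] X.scale_right[OF y0 y0])
    also have "bx ?y0 ?y0 \<le> (Cd + 1) * bx x x"
    proof -
      have "bp q0 q0 \<le> (Cd + 1) * bp q0 q0" using Cd nn mult_right_mono[of 1 "Cd + 1" "bp q0 q0"] by simp
      then have "bx ?y0 ?y0 \<le> (Cd + 1) * (N4 + N3 + bp q0 q0)" using bw0 bvz0 by (simp add: distrib_left)
      also have "\<dots> \<le> (Cd + 1) * bx x x" using nn Cd by (intro mult_left_mono) (simp_all add: bxx)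
      finally show ?thesis .
    qed
    finally show ?thesis by (simp add: distrib_right mult_ac)
  qed
  moreover have "(1/2) * bx x x \<le> A x y"
  proof -
    \<comment> \<open>Young with the weight \<open>Cd + 1\<close> reduces the energies of
      \<open>w0\<close> and \<open>z0\<close> to a quarter of \<open>N4\<close> and
      \<open>N3\<close>.\<close>
    have k: "0 < Cd + 1" using Cd by simp
    have 1: "bu u w0 \<le> (Cd + 1) * bu u u + N4 / 4"
    proof -
      have "0 \<le> bu ((2 * (Cd + 1)) *\<^sub>R u - w0) ((2 * (Cd + 1)) *\<^sub>R u - w0)" by (intro U.nonneg U.D_diff U.D_scale u w0)
      also have "\<dots> = 4 * (Cd + 1)\<^sup>2 * bu u u - 4 * (Cd + 1) * bu u w0 + bu w0 w0"
        by (simp only: U.diff_left[OF U.D_scale[OF u] w0(1)] U.diff_right[OF U.D_scale[OF u] w0(1)] U.scale_left[OF u]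
            U.scale_right[OF u] U.D_diff U.D_scale u w0(1) U.sym[OF w0(1) u])
          (simp add: power2_eq_square algebra_simps)
      finally have "bu u w0 \<le> (Cd + 1) * bu u u + bu w0 w0 / (4 * (Cd + 1))" by (rule Young_real[OF _ k])
      moreover have "bu w0 w0 / (4 * (Cd + 1)) \<le> N4 / 4" using bw0 k by (simp add: field_simps)
      ultimately show ?thesis by linarith
    qed
    have 2: "br v z0 \<le> (Cd + 1) * br v v + N3 / 4"
    proof -
      have "br z0 z0 / (4 * (Cd + 1)) \<le> N3 / 4" using brz0 nn(4) k by (simp add: field_simps)
      then show ?thesis using br_Young[OF k, of v z0] by linarith
    qed
    have 3: "- inner (weak_div S u) (\<Sum>i<n. q0 i) \<le> ?d * bu u u + bp q0 q0 / 4"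
      using inner_Young[OF l0(1), of "- weak_div S u" "\<Sum>i<n. q0 i"] div_le_bu[OF u] sum_le_bp[of q0] by simp
    have 4: "- P (mat_app n L12 p) q0 \<le> N12 + bp q0 q0 / 4"
    proof -
      have "P (mat_app n L12 q0) q0 \<le> bp q0 q0"
        using bp_split[of q0] R(1) P_inner_nonneg[of n q0] l0(1) by simp
      then show ?thesis using L12_Young[of 1 "- p" q0] by (simp add: N12_def mat_app_minus P_inner_minus)
    qed
    have "A x y = bu u (\<delta> *\<^sub>R u + (-1) *\<^sub>R w0) - inner ?sp (weak_div S (\<delta> *\<^sub>R u + (-1) *\<^sub>R w0))
        + br v (\<delta> *\<^sub>R v + (-1) *\<^sub>R z0) - P p (Div (\<delta> *\<^sub>R v + (-1) *\<^sub>R z0))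
        - inner (weak_div S u) (\<Sum>i<n. (\<delta> *\<^sub>R (- p) + (-1) *\<^sub>R q0) i) - P (Div v) (\<delta> *\<^sub>R (- p) + (-1) *\<^sub>R q0)
        - P (mat_app n L12 p) (\<delta> *\<^sub>R (- p) + (-1) *\<^sub>R q0)"
      unfolding xe y_def by (rule A_eq)
    also have "bu u (\<delta> *\<^sub>R u + (-1) *\<^sub>R w0) = \<delta> * bu u u - bu u w0"
      by (simp only: U.add_right U.scale_right U.D_scale u w0)
    also have "inner ?sp (weak_div S (\<delta> *\<^sub>R u + (-1) *\<^sub>R w0)) = \<delta> * inner ?sp (weak_div S u) - N4"
      by (simp only: div_U_add div_U_scaleR U.D_scale u w0 inner_add_right inner_scaleR_right N4_def power2_norm_eq_inner; simp)
    also have "inner ?sp (weak_div S u) = inner (weak_div S u) ?sp" by (rule inner_commute)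
    also have "br v (\<delta> *\<^sub>R v + (-1) *\<^sub>R z0) = \<delta> * br v v - br v z0"
      by (simp add: br_def inner_add_right distrib_left right_diff_distrib sum_subtractf sum.distrib sum_distrib_left inner_diff_right mult_ac)
    also have "P p (Div (\<delta> *\<^sub>R v + (-1) *\<^sub>R z0)) = \<delta> * P (Div v) p - N3"
      using subspace_scale[OF subspace_V_space v] subspace_scale[OF subspace_V_space z0]
      by (simp only: Div_linear v z0 Dz0 P_inner_linear N3_def P_inner_commute[of n p "Div v"]; simp)
    also have "inner (weak_div S u) (\<Sum>i<n. (\<delta> *\<^sub>R (- p) + (-1) *\<^sub>R q0) i) = - \<delta> * inner (weak_div S u) ?sp - inner (weak_div S u) (\<Sum>i<n. q0 i)"
      by (simp add: sum_subtractf sum_negf scaleR_sum_right[symmetric] inner_diff_right)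
    also have "P (Div v) (\<delta> *\<^sub>R (- p) + (-1) *\<^sub>R q0) = - \<delta> * P (Div v) p - bp q0 q0"
      unfolding bp_def q0_def P_inner_L_Li by (simp only: P_inner_linear P_inner_minus; simp)
    also have "P (mat_app n L12 p) (\<delta> *\<^sub>R (- p) + (-1) *\<^sub>R q0) = - \<delta> * N12 - P (mat_app n L12 p) q0"
      by (simp only: P_inner_linear P_inner_minus N12_def; simp)
    finally have A: "A x y = \<delta> * bu u u + \<delta> * br v v + \<delta> * N12 + N4 + N3 + bp q0 q0
        - bu u w0 - br v z0 + inner (weak_div S u) (\<Sum>i<n. q0 i) + P (mat_app n L12 p) q0" by (simp add: algebra_simps)
    have e: "\<delta> * bu u u = Cd * bu u u + ?d * bu u u + 2 * bu u u" "\<delta> * br v v = Cd * br v v + ?d * br v v + 2 * br v v"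
      "\<delta> * N12 = Cd * N12 + ?d * N12 + 2 * N12" by (simp_all add: \<delta>_def algebra_simps)
    have f: "(Cd + 1) * bu u u = Cd * bu u u + bu u u" "(Cd + 1) * br v v = Cd * br v v + br v v" by (simp_all add: algebra_simps)
    have "0 \<le> ?d * br v v" "0 \<le> Cd * N12" "0 \<le> ?d * N12" using nn Cd by simp_all
    then have "bx x x \<le> A x y + A x y" unfolding bxx A e using 1 2 3 4 nn unfolding f by linarith
    then show ?thesis by simp
  qed
  ultimately show ?thesis by blast
qed

end

section \<open>The preconditioned operator\<close>

context problem
begin

lemma X_dual_bij: "bij_betw (\<lambda>x. \<lambda>y\<in>X_space S n. bx x y) (X_space S n) (X_dual S n)"
  using dual_bij[OF X_equiv] by (simp only: X_norm_eq[symmetric])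

text \<open>Restricted to one factor, the functional of a block-diagonal form is that of the block,
  since the other blocks see 0. So \<open>B_op\<close> undoes the Riesz map of
  \<open>bx\<close>.\<close>

lemma B_op_Riesz:
  assumes t: "t \<in> X_space S n"
  shows "B_op S n l Rinv ap a (\<lambda>y\<in>X_space S n. bx t y) = t"
proof -
  interpret U: hilbert_form "U_space S" bu by (rule U_equiv)
  interpret V: hilbert_form "V_space S n" bv by (rule V_equiv)
  interpret P: hilbert_form "P_space S n" bp by (rule P_equiv)
  obtain u v p where e: "t = (u, v, p)" "u \<in> U_space S" "v \<in> V_space S n" "p \<in> P_space S n"
    using t by (auto simp: X_space_def)
  have z: "bu u 0 = 0" "bv v 0 = 0" "bp p 0 = 0"
    using U.sym[OF e(2) U.D_zero] U.zero_left[OF e(2)] V.sym[OF e(3) V.D_zero] V.zero_left[OF e(3)]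
      P.sym[OF e(4) P.D_zero] P.zero_left[OF e(4)] by simp_all
  have "(\<lambda>w\<in>U_space S. (\<lambda>y\<in>X_space S n. bx t y) (w, 0, 0)) = B_u S l u"
    by (auto simp: B_u_def fun_eq_iff e z X_space_def V.D_zero P.D_zero bu_def)
  moreover have "(\<lambda>w\<in>V_space S n. (\<lambda>y\<in>X_space S n. bx t y) (0, w, 0)) = B_v S n l Rinv ap a v"
    by (auto simp: B_v_def fun_eq_iff e z X_space_def U.D_zero P.D_zero bv_def br_def mat_form_eq)
  moreover have "(\<lambda>w\<in>P_space S n. (\<lambda>y\<in>X_space S n. bx t y) (0, 0, w)) = B_p S n l Rinv ap a p"
    by (auto simp: B_p_def fun_eq_iff e z X_space_def U.D_zero V.D_zero bp_def mat_form_eq)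
  ultimately show ?thesis
    unfolding B_op_def using B_bij[THEN bij_betw_imp_inj_on] e by (simp add: inv_into_f_f)
qed

text \<open>\<open>B_op\<close> is injective on the dual, so \<open>inv_into\<close> can only return
  the functional exhibited by \<open>B_op_Riesz\<close>.\<close>

lemma B_norm_eq:
  assumes x: "x \<in> X_space S n"
  shows "B_norm S n l Rinv ap a x = sqrt (bx x x)"
proof -
  let ?F = "\<lambda>x. \<lambda>y\<in>X_space S n. bx x y"
  have F: "?F x \<in> X_dual S n" using X_dual_bij x by (auto simp: bij_betw_def)
  have "inj_on (B_op S n l Rinv ap a) (X_dual S n)"
  proof (rule inj_onI)
    fix G H assume G: "G \<in> X_dual S n" and H: "H \<in> X_dual S n" and eq: "B_op S n l Rinv ap a G = B_op S n l Rinv ap a H"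
    obtain g h where "g \<in> X_space S n" "G = ?F g" "h \<in> X_space S n" "H = ?F h"
      using G H X_dual_bij unfolding bij_betw_def by blast
    then show "G = H" using eq by (simp add: B_op_Riesz)
  qed
  then have "inv_into (X_dual S n) (B_op S n l Rinv ap a) x = ?F x"
    using inv_into_f_f[OF _ F] B_op_Riesz[OF x] by metis
  then show ?thesis using x by (simp add: B_norm_def)
qed

text \<open>\<open>BA_op\<close> represents \<open>A\<close> in the inner product \<open>bx\<close>,
  so the abstract operator bounds apply, with constants made of \<open>Cd\<close> and the
  dimension.\<close>

theorem preconditioner:
  assumes Cd: "0 < Cd" "\<forall>g\<in>L2_mean_zero S. \<exists>w\<in>U_space S. weak_div S w = g \<and> U_inner S w w \<le> Cd * (norm g)\<^sup>2"
  defines "K \<equiv> real CARD('d) + 4"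
    and "M \<equiv> 2 * (Cd + real CARD('d) + 2)\<^sup>2 + 2 * (Cd + 1)"
  shows "A_op S n l Rinv ap a \<in> X_space S n \<rightarrow> X_dual S n"
    and "bij_betw (BA_op S n l Rinv ap a) (X_space S n) (X_space S n)"
    and "op_norm (X_space S n) (B_norm S n l Rinv ap a) (BA_op S n l Rinv ap a) \<le> ennreal K"
    and "op_norm (X_space S n) (B_norm S n l Rinv ap a) (inv_into (X_space S n) (BA_op S n l Rinv ap a)) \<le> ennreal (2 * sqrt M)"
proof -
  let ?X = "X_space S n" and ?T = "BA_op S n l Rinv ap a" and ?N = "B_norm S n l Rinv ap a"
  have K: "0 \<le> K" and M: "0 \<le> M" using Cd by (simp_all add: K_def M_def)
  interpret X: hilbert_form ?X bx by (rule X_equiv)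
  interpret X: symmetric_inf_sup ?X bx A K M
  proof
    show "\<bar>A x x\<bar> \<le> K * bx x x" if "x \<in> ?X" for x using A_diagonal[OF that] by (simp add: K_def)
    show "\<exists>y\<in>?X. bx y y \<le> M * bx x x \<and> (1/2) * bx x x \<le> A x y" if "x \<in> ?X" for x
      using inf_sup_condition[OF Cd(1) bspec[OF Cd(2)] that] by (simp add: M_def)
  qed (use K M A_linear A_symmetric in auto)
  have ex: "\<exists>t\<in>?X. A_op S n l Rinv ap a x = (\<lambda>y\<in>?X. bx t y)" if x: "x \<in> ?X" for x
  proof -
    obtain t where t: "t \<in> ?X" "\<And>y. y \<in> ?X \<Longrightarrow> A x y = bx t y"
      by (rule X.Riesz[of "A x", OF _ _ X.A_bound[OF x]]) (use X.A_add_right X.A_scale_right x in auto)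
    have "A_op S n l Rinv ap a x = (\<lambda>y\<in>?X. bx t y)"
      unfolding A_op_def using t(2) by (intro restrict_ext) auto
    then show ?thesis using t(1) by blast
  qed
  show "A_op S n l Rinv ap a \<in> ?X \<rightarrow> X_dual S n"
    using ex X_dual_bij unfolding bij_betw_def by blast
  have T: "?T x \<in> ?X" "y \<in> ?X \<Longrightarrow> bx (?T x) y = A x y" if x: "x \<in> ?X" for x y
  proof -
    obtain t where t: "t \<in> ?X" "A_op S n l Rinv ap a x = (\<lambda>y\<in>?X. bx t y)" using ex[OF x] by blast
    have "?T x = t" unfolding BA_op_def t(2) by (rule B_op_Riesz[OF t(1)])
    moreover have "A x y = bx t y" if "y \<in> ?X" using fun_cong[OF t(2), of y] that by (simp add: A_op_def)
    ultimately show "?T x \<in> ?X" "y \<in> ?X \<Longrightarrow> bx (?T x) y = A x y" using t(1) by auto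
  qed
  show bij: "bij_betw ?T ?X ?X" by (rule X.operator_bounds(1)[of ?T, OF T(1) T(2)])
  have up: "sqrt (bx (?T x) (?T x)) \<le> K * sqrt (bx x x)" if x: "x \<in> ?X" for x
    by (rule X.operator_bounds(2)[of ?T, OF T(1) T(2) x])
  have lo: "sqrt (bx x x) \<le> (2 * sqrt M) * sqrt (bx (?T x) (?T x))" if x: "x \<in> ?X" for x
    by (rule X.operator_bounds(3)[of ?T, OF T(1) T(2) x])
  have N: "?N x = sqrt (bx x x)" "0 \<le> ?N x" if "x \<in> ?X" for x using B_norm_eq[OF that] X.nonneg[OF that] by auto
  show "op_norm ?X ?N ?T \<le> ennreal K"
  proof (rule op_norm_le)
    fix x assume x: "x \<in> ?X"
    show "?N (?T x) \<le> K * ?N x" using up[OF x] by (simp add: N x T(1))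
  qed (use N K in auto)
  have inv: "inv_into ?X ?T x \<in> ?X" "?T (inv_into ?X ?T x) = x" if "x \<in> ?X" for x
    using bij that by (auto simp: bij_betw_def inv_into_into f_inv_into_f)
  show "op_norm ?X ?N (inv_into ?X ?T) \<le> ennreal (2 * sqrt M)"
  proof (rule op_norm_le)
    fix x assume x: "x \<in> ?X"
    show "?N (inv_into ?X ?T x) \<le> (2 * sqrt M) * ?N x"
      using lo[OF inv(1)[OF x]] inv[OF x] N(1)[OF x] N(1)[OF inv(1)[OF x]] by simp
  qed (use N M in auto)
qed

end

text \<open>Finiteness of both norms and bijectivity accompany the bound because in
  \<open>ennreal\<close> a factor 0 would hide an infinite one, and \<open>inv_into\<close> is an
  inverse only of a bijection.\<close>

theorem mainTheorem7:
  fixes \<Omega> :: "(real^'d::finite) set"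
  assumes "CARD('d) = 2 \<or> CARD('d) = 3"
    and "lipschitz_domain \<Omega>"
  shows "\<exists>C::real. \<forall>(n::nat) (l::real) (Rinv::nat \<Rightarrow> real) (ap::nat \<Rightarrow> real)
      (\<tau>::real) (\<alpha>::nat \<Rightarrow> real) (\<beta>::nat \<Rightarrow> nat \<Rightarrow> real) (a::nat \<Rightarrow> nat \<Rightarrow> real).
    1 \<le> n \<and> 0 < l \<and> (\<forall>i<n. 0 < Rinv i) \<and> (\<forall>i<n. 0 \<le> ap i) \<and> 0 < \<tau> \<and> (\<forall>i<n. 0 < \<alpha> i) \<and>
    (\<forall>i<n. \<forall>j<n. i \<noteq> j \<longrightarrow> 0 \<le> \<beta> i j \<and> \<beta> i j = \<beta> j i) \<and>
    (\<forall>i<n. \<beta> i i = (\<Sum>j\<in>{..<n} - {i}. \<beta> i j)) \<and>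
    (\<forall>i<n. \<forall>j<n. a i j = \<tau> * \<beta> i j / (\<alpha> i * \<alpha> j)) \<longrightarrow>
      A_op \<Omega> n l Rinv ap a \<in> X_space \<Omega> n \<rightarrow> X_dual \<Omega> n \<and>
      bij_betw (B_u \<Omega> l) (U_space \<Omega>) (U_dual \<Omega>) \<and>
      bij_betw (B_v \<Omega> n l Rinv ap a) (V_space \<Omega> n) (V_dual \<Omega> n) \<and>
      bij_betw (B_p \<Omega> n l Rinv ap a) (P_space \<Omega> n) (P_dual \<Omega> n) \<and>
      bij_betw (BA_op \<Omega> n l Rinv ap a) (X_space \<Omega> n) (X_space \<Omega> n) \<and>
      op_norm (X_space \<Omega> n) (B_norm \<Omega> n l Rinv ap a) (BA_op \<Omega> n l Rinv ap a) < \<infinity> \<and>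
      op_norm (X_space \<Omega> n) (B_norm \<Omega> n l Rinv ap a)
        (inv_into (X_space \<Omega> n) (BA_op \<Omega> n l Rinv ap a)) < \<infinity> \<and>
      condition_number (X_space \<Omega> n) (B_norm \<Omega> n l Rinv ap a) (BA_op \<Omega> n l Rinv ap a)
        \<le> ennreal C"
proof -
  obtain Cd where Cd: "0 < Cd"
    "\<forall>g\<in>L2_mean_zero \<Omega>. \<exists>w\<in>U_space \<Omega>. weak_div \<Omega> w = g \<and> U_inner \<Omega> w w \<le> Cd * (norm g)\<^sup>2"
    by (rule div_right_inverse[OF assms(2)]) blast
  define K where "K = real CARD('d) + 4"
  define M where "M = 2 * sqrt (2 * (Cd + real CARD('d) + 2)\<^sup>2 + 2 * (Cd + 1))"
  have dom: "open \<Omega>" "bounded \<Omega>" using assms(2) by (auto simp: lipschitz_domain_def)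
  show ?thesis
  \<comment> \<open>\<open>K\<close> and \<open>M\<close> are fixed before the parameters are
    introduced; \<open>Cd\<close> belongs to the domain alone.\<close>
  proof (intro exI[of _ "K * M"] allI impI)
    fix n :: nat and l \<tau> :: real and Rinv ap \<alpha> :: "nat \<Rightarrow> real" and \<beta> a :: "nat \<Rightarrow> nat \<Rightarrow> real"
    assume h: "1 \<le> n \<and> 0 < l \<and> (\<forall>i<n. 0 < Rinv i) \<and> (\<forall>i<n. 0 \<le> ap i) \<and> 0 < \<tau> \<and> (\<forall>i<n. 0 < \<alpha> i) \<and>
      (\<forall>i<n. \<forall>j<n. i \<noteq> j \<longrightarrow> 0 \<le> \<beta> i j \<and> \<beta> i j = \<beta> j i) \<and>
      (\<forall>i<n. \<beta> i i = (\<Sum>j\<in>{..<n} - {i}. \<beta> i j)) \<and>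
      (\<forall>i<n. \<forall>j<n. a i j = \<tau> * \<beta> i j / (\<alpha> i * \<alpha> j))"
    interpret problem \<Omega> n l Rinv ap \<tau> \<alpha> \<beta> a
      by unfold_locales (use h dom in auto)
    note p = preconditioner[OF Cd, folded K_def M_def]
    have "condition_number (X_space \<Omega> n) (B_norm \<Omega> n l Rinv ap a) (BA_op \<Omega> n l Rinv ap a) \<le> ennreal K * ennreal M"
      unfolding condition_number_def by (intro mult_mono p) auto
    also have "\<dots> = ennreal (K * M)" using Cd by (intro ennreal_mult[symmetric]) (simp_all add: K_def M_def)
    finally have "condition_number (X_space \<Omega> n) (B_norm \<Omega> n l Rinv ap a) (BA_op \<Omega> n l Rinv ap a) \<le> ennreal (K * M)" .
    moreover have "op_norm (X_space \<Omega> n) (B_norm \<Omega> n l Rinv ap a) (BA_op \<Omega> n l Rinv ap a) < \<infinity>"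
      using p(3) by (rule le_less_trans) (rule ennreal_less_top[folded infinity_ennreal_def])
    moreover have "op_norm (X_space \<Omega> n) (B_norm \<Omega> n l Rinv ap a) (inv_into (X_space \<Omega> n) (BA_op \<Omega> n l Rinv ap a)) < \<infinity>"
      using p(4) by (rule le_less_trans) (rule ennreal_less_top[folded infinity_ennreal_def])
    ultimately show "A_op \<Omega> n l Rinv ap a \<in> X_space \<Omega> n \<rightarrow> X_dual \<Omega> n \<and>
      bij_betw (B_u \<Omega> l) (U_space \<Omega>) (U_dual \<Omega>) \<and>
      bij_betw (B_v \<Omega> n l Rinv ap a) (V_space \<Omega> n) (V_dual \<Omega> n) \<and>
      bij_betw (B_p \<Omega> n l Rinv ap a) (P_space \<Omega> n) (P_dual \<Omega> n) \<and>
      bij_betw (BA_op \<Omega> n l Rinv ap a) (X_space \<Omega> n) (X_space \<Omega> n) \<and>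
      op_norm (X_space \<Omega> n) (B_norm \<Omega> n l Rinv ap a) (BA_op \<Omega> n l Rinv ap a) < \<infinity> \<and>
      op_norm (X_space \<Omega> n) (B_norm \<Omega> n l Rinv ap a)
        (inv_into (X_space \<Omega> n) (BA_op \<Omega> n l Rinv ap a)) < \<infinity> \<and>
      condition_number (X_space \<Omega> n) (B_norm \<Omega> n l Rinv ap a) (BA_op \<Omega> n l Rinv ap a)
        \<le> ennreal (K * M)"
      using p(1,2) B_bij by blast
  qed
qed

end
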